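(* Let $\mathcal T_n$ be a conditioned Galton--Watson tree of order $n$ with offspring distribution $\xi$, where $\mathbb E\xi=1$ and $0<\sigma^2:=\operatorname{Var}\xi<\infty$, and let $\mathcal T$ be the corresponding unconditioned Galton--Watson tree. Suppose that $f:\mathfrak T\to\mathbb R$ is a functional of rooted trees such that $\mathbb E|f(\mathcal T)|<\infty$, and let $\mu:=\mathbb E f(\mathcal T)$. (i) If $\mathbb E f(\mathcal T_n)\to0$ as $n\to\infty$, then $$\mathbb E F(\mathcal T_n)=n\mu+o(\sqrt n).$$ (ii) If $\mathbb E\bigl(f(\mathcal T_n)^2\bigr)\to0$ as $n\to\infty$, and $$\sum_{n=1}^\infty\frac{\sqrt{\mathbb E(f(\mathcal T_n)^2)}}{n}<\infty,$$ then $$\operatorname{Var}F(\mathcal T_n)=n\gamma^2+o(n),$$ where $$\gamma^2:=2\,\mathbb E\Bigl(f(\mathcal T)\bigl(F(\mathcal T)-|\mathcal T|\mu\bigr)\Bigr)-\operatorname{Var}f(\mathcal T)-\mu^2/\sigma^2$$ is finite; moreover, $$\frac{F(\mathcal T_n)-n\mu}{\sqrt n}\overset{d}{\longrightarrow}N(0,\gamma^2).$$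
   Context: All trees are finite, rooted and ordered (plane). $\mathfrak T$ is the countable set of all such trees (up to isomorphism preserving the root and the orderings of children), and $|T|$ is the number of nodes of $T$. For a node $v$ of $T$, $T_v$ denotes the fringe subtree of $T$ consisting of $v$ and all its descendants. For a functional $f:\mathfrak T\to\mathbb R$, define $F(T):=\sum_{v\in T}f(T_v)$. Given a nonnegative integer-valued random variable $\xi$, the Galton--Watson tree $\mathcal T$ with offspring distribution $\xi$ is the random tree obtained by starting with a root and giving each node a number of children that is an independent copy of $\xi$ (with $\mathbb E\xi=1$ and $\operatorname{Var}\xi>0$ it is a.s. finite). The conditioned Galton--Watson tree $\mathcal T_n$ is $\mathcal T$ conditioned on $|\mathcal T|=n$; only $n$ with $\mathbb P(|\mathcal T|=n)>0$ are considered, so all statements involving $\mathcal T_n$ (limits as $n\to\infty$, sums over $n$) are restricted to such $n$. $N(0,\gamma^2)$ with $\gamma^2=0$ is the point mass at $0$; $\overset{d}{\longrightarrow}$ is convergence in distribution. *)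

theory Defs
  imports "HOL-Probability.Probability" "HOL-Library.Landau_Symbols"
begin

datatype plane_tree = Node (children: "plane_tree list")

instance plane_tree :: countable
  by countable_datatype

text \<open>Nodes are addressed by Ulam--Harris words: \<open>[]\<close> is the root and
  \<open>i # v\<close> is the node \<open>v\<close> of the subtree rooted at the \<open>i\<close>-th child of the root
  (children are counted from 0).\<close>

primrec is_node :: "nat list \<Rightarrow> plane_tree \<Rightarrow> bool" where
  "is_node [] t \<longleftrightarrow> True"
| "is_node (i # v) t \<longleftrightarrow> i < length (children t) \<and> is_node v (children t ! i)"

definition nodes :: "plane_tree \<Rightarrow> nat list set" where
  "nodes t = {v. is_node v t}"

text \<open>The fringe subtree \<open>T\<^sub>v\<close>; only meaningful for \<open>v \<in> nodes t\<close>.\<close>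

primrec fringe :: "plane_tree \<Rightarrow> nat list \<Rightarrow> plane_tree" where
  "fringe t [] = t"
| "fringe t (i # v) = fringe (children t ! i) v"

definition num_nodes :: "plane_tree \<Rightarrow> nat" where
  "num_nodes t = card (nodes t)"

definition additive_functional :: "(plane_tree \<Rightarrow> real) \<Rightarrow> plane_tree \<Rightarrow> real" where
  "additive_functional f t = (\<Sum>v\<in>nodes t. f (fringe t v))"

lemma nodes_Node:
  "nodes (Node ts) = insert [] (\<Union>i<length ts. (#) i ` nodes (ts ! i))"
proof (intro set_eqI)
  fix v
  show "v \<in> nodes (Node ts) \<longleftrightarrow> v \<in> insert [] (\<Union>i<length ts. (#) i ` nodes (ts ! i))"
    by (cases v) (auto simp: nodes_def)
qed

lemma finite_nodes: "finite (nodes t)"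
proof (induction t)
  case (Node ts)
  then show ?case by (auto simp: nodes_Node)
qed

text \<open>A Galton--Watson tree is grown from i.i.d. offspring numbers \<open>\<omega> v\<close> attached to all
  words \<open>v\<close>: it is the tree in which every node \<open>v\<close> has exactly \<open>\<omega> v\<close> children.\<close>

definition grown_from :: "(nat list \<Rightarrow> nat) \<Rightarrow> plane_tree \<Rightarrow> bool" where
  "grown_from \<omega> t \<longleftrightarrow> (\<forall>v\<in>nodes t. length (children (fringe t v)) = \<omega> v)"

lemma grown_from_Node:
  "grown_from \<omega> (Node ts) \<longleftrightarrow>
     length ts = \<omega> [] \<and> (\<forall>i<length ts. grown_from (\<lambda>v. \<omega> (i # v)) (ts ! i))"
  by (auto simp: grown_from_def nodes_Node)

lemma grown_from_unique: "grown_from \<omega> t \<Longrightarrow> grown_from \<omega> t' \<Longrightarrow> t = t'"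
proof (induction t arbitrary: \<omega> t')
  case (Node ts)
  obtain ts' where t': "t' = Node ts'" by (cases t')
  have "ts = ts'"
  proof (rule nth_equalityI)
    show len: "length ts = length ts'"
      using Node.prems by (simp add: t' grown_from_Node)
    fix i assume i: "i < length ts"
    then show "ts ! i = ts' ! i"
      using Node.IH[OF nth_mem[OF i], of "\<lambda>v. \<omega> (i # v)"] Node.prems len
      by (simp add: t' grown_from_Node)
  qed
  then show ?case by (simp add: t')
qed

text \<open>If the growth never stops, no finite tree is grown from \<open>\<omega>\<close> and a dummy value is
  returned. For critical offspring distributions with positive variance this has
  probability 0.\<close>

definition grow :: "(nat list \<Rightarrow> nat) \<Rightarrow> plane_tree" where
  "grow \<omega> = (if \<exists>t. grown_from \<omega> t then THE t. grown_from \<omega> t else Node [])"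

definition galton_watson :: "nat pmf \<Rightarrow> plane_tree measure" where
  "galton_watson p =
     distr (\<Pi>\<^sub>M v\<in>(UNIV :: nat list set). measure_pmf p) (count_space UNIV) grow"

lemma grow_eq: "grown_from \<omega> t \<Longrightarrow> grow \<omega> = t"
  unfolding grow_def using grown_from_unique by (metis the_equality)

lemma measurable_grow [measurable]:
  "grow \<in> (\<Pi>\<^sub>M v\<in>(UNIV :: nat list set). measure_pmf p) \<rightarrow>\<^sub>M count_space UNIV"
    (is "_ \<in> ?M \<rightarrow>\<^sub>M _")
proof -
  have ev: "{\<omega> \<in> space ?M. grown_from \<omega> t} \<in> sets ?M" for t
  proof -
    have "Measurable.pred ?M (\<lambda>\<omega>. length (children (fringe t v)) = \<omega> v)" for v
    proof -
      have "(\<lambda>\<omega>. \<omega> v) \<in> ?M \<rightarrow>\<^sub>M measure_pmf p"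
        by (rule measurable_component_singleton) simp
      then have *: "(\<lambda>\<omega>. \<omega> v) \<in> ?M \<rightarrow>\<^sub>M count_space UNIV"
        by (simp cong: measurable_cong_sets)
      show ?thesis
        using measurable_compose[OF *, of "\<lambda>k. length (children (fringe t v)) = k"
          "count_space UNIV"] by (simp add: pred_def)
    qed
    then have "Measurable.pred ?M (\<lambda>\<omega>. \<forall>v\<in>nodes t. length (children (fringe t v)) = \<omega> v)"
      by (intro pred_intros_finite finite_nodes)
    then show ?thesis by (simp add: grown_from_def pred_def)
  qed
  have "grow -` {t} \<inter> space ?M =
      (if t = Node [] then space ?M - (\<Union>s\<in>-{t}. {\<omega> \<in> space ?M. grown_from \<omega> s})
       else {\<omega> \<in> space ?M. grown_from \<omega> t})" for t
  proof (cases "t = Node []")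
    case True
    have "grow \<omega> = t \<longleftrightarrow> (\<forall>s. s \<noteq> t \<longrightarrow> \<not> grown_from \<omega> s)" for \<omega>
      using grow_eq True by (metis grow_def)
    with True show ?thesis by auto
  next
    case False
    then have "grow \<omega> = t \<longleftrightarrow> grown_from \<omega> t" for \<omega>
      using grow_eq by (metis grow_def)
    with False show ?thesis by auto
  qed
  then have "grow -` {t} \<inter> space ?M \<in> sets ?M" for t
    using ev by (auto intro!: sets.Diff sets.countable_UN'' simp del: space_PiM)
  then show ?thesis
    by (subst measurable_count_space_eq2_countable) auto
qed

lemma prob_space_galton_watson: "prob_space (galton_watson p)"
proof -
  interpret product_prob_space "\<lambda>_ :: nat list. measure_pmf p" UNIV
    by unfold_locales
  show ?thesis
    unfolding galton_watson_def by (rule prob_space_distr) (rule measurable_grow)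
qed

definition conditioned_galton_watson :: "nat pmf \<Rightarrow> nat \<Rightarrow> plane_tree measure" where
  "conditioned_galton_watson p n = uniform_measure (galton_watson p) {t. num_nodes t = n}"

definition admissible_sizes :: "nat pmf \<Rightarrow> nat set" where
  "admissible_sizes p = {n. 0 < measure (galton_watson p) {t. num_nodes t = n}}"

text \<open>The filter \<open>n \<rightarrow> \<infinity>\<close> restricted to admissible \<open>n\<close>.\<close>

definition admissible_at_top :: "nat pmf \<Rightarrow> nat filter" where
  "admissible_at_top p = inf sequentially (principal (admissible_sizes p))"

text \<open>Convergence in distribution along an arbitrary filter; the library notion
  \<open>weak_conv_m\<close> only covers full sequences.\<close>

definition converges_in_distribution ::
    "(nat \<Rightarrow> real measure) \<Rightarrow> real measure \<Rightarrow> nat filter \<Rightarrow> bool" where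
  "converges_in_distribution L N \<F> \<longleftrightarrow>
     (\<forall>x. isCont (cdf N) x \<longrightarrow> ((\<lambda>n. cdf (L n) x) \<longlongrightarrow> cdf N x) \<F>)"

lemma converges_in_distribution_sequentially:
  "converges_in_distribution L N sequentially \<longleftrightarrow> weak_conv_m L N"
  by (simp add: converges_in_distribution_def weak_conv_m_def weak_conv_def)

text \<open>The second argument is the variance, assumed nonnegative.\<close>

definition normal_distribution :: "real \<Rightarrow> real \<Rightarrow> real measure" where
  "normal_distribution m s2 =
     (if s2 = 0 then return borel m else density lborel (normal_density m (sqrt s2)))"

end

theory Submission
  imports Defs "HOL-Library.Sublist" "HOL-Real_Asymp.Real_Asymp"
begin

text \<open>By the cycle lemma, the trees of size \<open>n\<close>, weighted by their probabilities, correspond to the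
  i.i.d. degree words of length \<open>n\<close> whose walk ends at \<open>-1\<close>, taken up to rotation, and \<open>F\<close>
  becomes a cyclic sum over the word. Hence the first two moments of \<open>F\<close> on trees of size \<open>n\<close> are sums over
  small trees with coefficients expressed by the law of the walk. Fourier inversion gives local
  limit estimates for this law and for its first and mixed second differences. They yield part (i), the limit of the
  variance when \<open>f\<close> vanishes on large trees, and a bound of the standard deviation of
  \<open>F / \<surd>n\<close> by a multiple of \<open>sup\<^sub>k \<parallel>f\<parallel>\<^sub>k + \<Sum>\<^sub>k \<parallel>f\<parallel>\<^sub>k / k\<close>, where
  \<open>\<parallel>f\<parallel>\<^sub>k\<close> is the \<open>L\<^sup>2\<close> norm on trees of size \<open>k\<close>. The bound reduces
  part (ii) to functionals that vanish on large trees. For these, \<open>F\<close> is up to a small \<open>L\<^sup>1\<close> error a sum of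
  independent functionals of blocks that cover a proportion \<open>1 - 1/r\<close> of the word.
  Conditioning the walk to end at \<open>-1\<close> turns the characteristic function of the block sum into a Fourier
  integral, whose Gaussian limit follows by dominated convergence because the uncovered
  steps provide the decay; finally \<open>r\<close> tends to infinity.\<close>

section \<open>Plane trees and degree words\<close>

text \<open>The obstacle is cancellation in the variance. Pairs of disjoint fringe trees of sizes
  \<open>k\<close> and \<open>m\<close> enter the second moment with a weight of order
  \<open>n\<^sup>2\<close>, the squared mean is equally large, and only a difference of order
  \<open>n\<close> may survive. First differences of the walk law alone do not give this: the
  coefficient has to be written as a mixed second difference plus a product of two first
  differences, each of relative order \<open>1 / n\<close>. The limit of the mixed difference, a
  second Gaussian moment, produces the term \<open>- \<mu>\<^sup>2 / \<sigma>2\<close>. The Fourier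
  bounds behind this need a fixed fraction of free letters and so only reach trees of at most
  \<open>n / 4\<close> nodes. Larger trees are rare enough for a bound without cancellation. For the
  smaller ones, the deviation at \<open>n\<close> is bounded through the deviations at sizes up to
  \<open>n / 4\<close>; their constant enters under a square root, so that an induction on
  \<open>n\<close> closes. The offspring law may live on a lattice: limits run along admissible
  sizes, and frequencies fill one period of the dual lattice.\<close>

primrec degree_seq :: "plane_tree \<Rightarrow> nat list" where
  "degree_seq (Node ts) = length ts # concat (map degree_seq ts)"

lemma degree_seq_nonempty [simp]: "degree_seq t \<noteq> []"
  by (cases t) simp

lemma length_degree_seq: "length (degree_seq t) = num_nodes t"
proof (induction t)
  case (Node ts)
  have "num_nodes (Node ts) = Suc (card (\<Union>i<length ts. (#) i ` nodes (ts ! i)))"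
    unfolding num_nodes_def nodes_Node
    by (subst card_insert_disjoint) (auto intro!: finite_imageI finite_nodes)
  also have "card (\<Union>i<length ts. (#) i ` nodes (ts ! i)) = (\<Sum>i<length ts. card ((#) i ` nodes (ts ! i)))"
    by (rule card_UN_disjoint) (auto intro: finite_nodes)
  also have "\<dots> = (\<Sum>i<length ts. num_nodes (ts ! i))"
    by (simp add: card_image num_nodes_def)
  also have "\<dots> = (\<Sum>i<length ts. length (degree_seq (ts ! i)))"
    using Node.IH by simp
  finally show ?case
    by (simp add: length_concat sum_list_sum_nth comp_def atLeast0LessThan)
qed

lemma num_nodes_pos: "0 < num_nodes t"
  using degree_seq_nonempty[of t] by (metis length_degree_seq length_greater_0_conv)

lemma additive_functional_Node:
  "additive_functional f (Node ts) = f (Node ts) + sum_list (map (additive_functional f) ts)"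
proof -
  have "additive_functional f (Node ts) =
     f (Node ts) + (\<Sum>v\<in>(\<Union>i<length ts. (#) i ` nodes (ts ! i)). f (fringe (Node ts) v))"
    unfolding additive_functional_def nodes_Node
    by (subst sum.insert) (auto intro!: finite_imageI finite_nodes)
  also have "(\<Sum>v\<in>(\<Union>i<length ts. (#) i ` nodes (ts ! i)). f (fringe (Node ts) v))
     = (\<Sum>i<length ts. \<Sum>v\<in>(#) i ` nodes (ts ! i). f (fringe (Node ts) v))"
    by (rule sum.UNION_disjoint) (auto intro: finite_nodes)
  also have "\<dots> = (\<Sum>i<length ts. additive_functional f (ts ! i))"
    by (simp add: sum.reindex additive_functional_def)
  finally show ?thesis by (simp add: sum_list_sum_nth atLeast0LessThan)
qed

text \<open>Degree words form a prefix code: the first letter fixes the number of children, and each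
  child is then read off in a forced way. Hence at most one tree is a prefix of a given word. The
  inner claim \<open>forest\<close> passes the hypothesis for single children on to lists of
  children.\<close>

lemma degree_seq_append_eq:
  "degree_seq t @ xs = degree_seq s @ ys \<Longrightarrow> t = s \<and> xs = ys"
proof (induction t arbitrary: s xs ys)
  case (Node ts)
  obtain ss where s: "s = Node ss" by (cases s)
  have forest: "length ts' = length ss \<Longrightarrow> set ts' \<subseteq> set ts \<Longrightarrow>
      concat (map degree_seq ts') @ xs = concat (map degree_seq ss) @ ys \<Longrightarrow> ts' = ss \<and> xs = ys"
    for ts' ss xs ys
  proof (induction ts' ss arbitrary: xs ys rule: list_induct2)
    case (Cons t ts'' u us)
    have "degree_seq t @ (concat (map degree_seq ts'') @ xs)
        = degree_seq u @ (concat (map degree_seq us) @ ys)"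
      using Cons.prems by simp
    then have "t = u \<and> concat (map degree_seq ts'') @ xs = concat (map degree_seq us) @ ys"
      using Node.IH[of t] Cons.prems(1) by auto
    then show ?case using Cons.IH[of xs ys] Cons.prems(1) by auto
  qed simp
  have "length ts = length ss" "concat (map degree_seq ts) @ xs = concat (map degree_seq ss) @ ys"
    using Node.prems by (auto simp: s)
  then show ?case using forest[of ts ss xs ys] by (auto simp: s)
qed

lemma inj_degree_seq: "inj degree_seq"
  using degree_seq_append_eq[of _ "[]" _ "[]"] by (auto intro!: injI)

lemma prefix_degree_seq_unique:
  "prefix (degree_seq t) xs \<Longrightarrow> prefix (degree_seq s) xs \<Longrightarrow> t = s"
  using degree_seq_append_eq by (auto simp: prefix_def)

text \<open>Every node except the root is counted exactly once, as a child of its parent.\<close>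

lemma sum_list_degree_seq: "Suc (sum_list (degree_seq t)) = num_nodes t"
proof (induction t)
  case (Node ts)
  have "sum_list (concat (map degree_seq us)) + length us = length (concat (map degree_seq us))"
    if "set us \<subseteq> set ts" for us
    using that
  proof (induction us)
    case (Cons u us)
    have "Suc (sum_list (degree_seq u)) = length (degree_seq u)"
      using Node.IH[of u] Cons.prems by (simp add: length_degree_seq)
    then show ?case using Cons by simp
  qed simp
  from this[of ts] show ?case
    using length_degree_seq[of "Node ts"] by simp
qed

text \<open>Endpoint of the Lukasiewicz walk, whose step at a letter \<open>x\<close> is
  \<open>x - 1\<close>. While a tree is read in depth-first order, the current position plus one is
  the number of subtrees still to be read.\<close>

definition walk :: "nat list \<Rightarrow> int" where
  "walk xs = int (sum_list xs) - int (length xs)"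

lemma walk_simps [simp]:
  "walk [] = 0" "walk (x # xs) = int x - 1 + walk xs" "walk (xs @ ys) = walk xs + walk ys"
  by (auto simp: walk_def)

lemma walk_rotate [simp]: "walk (rotate j xs) = walk xs"
proof -
  have "walk (rotate j xs) = walk (take (j mod length xs) xs @ drop (j mod length xs) xs)"
    by (simp add: rotate_drop_take del: append_take_drop_id)
  then show ?thesis by simp
qed

lemma walk_degree_seq: "walk (degree_seq t) = -1"
  using sum_list_degree_seq[of t] by (simp add: walk_def length_degree_seq)

text \<open>The count \<open>r\<close> of trees is what makes the induction on the word work.
  Reading a letter \<open>x\<close> leaves \<open>x + r'\<close> trees to be read, where
  \<open>r = Suc r'\<close>, and lowers the bound on the rest of the walk accordingly; the first
  \<open>x\<close> of these trees then become the children of the new root.\<close>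

lemma forest_prefix_exists:
  "walk xs \<le> - int r \<Longrightarrow> \<exists>ts. length ts = r \<and> prefix (concat (map degree_seq ts)) xs"
proof (induction xs arbitrary: r)
  case Nil
  then show ?case by (intro exI[of _ "[]"]) auto
next
  case (Cons x xs)
  show ?case
  proof (cases r)
    case 0
    then show ?thesis by auto
  next
    case (Suc r')
    have "walk xs \<le> - int (x + r')" using Cons.prems Suc by simp
    then obtain ts where ts: "length ts = x + r'" "prefix (concat (map degree_seq ts)) xs"
      using Cons.IH by blast
    have "concat (map degree_seq (Node (take x ts) # drop x ts)) = x # concat (map degree_seq ts)"
      using ts(1) by (simp flip: concat_append map_append)
    then show ?thesis using ts Suc
      by (intro exI[of _ "Node (take x ts) # drop x ts"]) auto
  qed
qed

lemma tree_prefix_exists: "walk xs < 0 \<Longrightarrow> \<exists>t. prefix (degree_seq t) xs"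
  using forest_prefix_exists[of xs 1] by (auto simp: length_Suc_conv)

text \<open>A negative position before the end would produce the word of a tree inside a proper
  prefix, against the prefix-code property.\<close>

lemma walk_take_degree_seq:
  assumes "i < num_nodes t" shows "0 \<le> walk (take i (degree_seq t))"
proof (rule ccontr)
  assume "\<not> ?thesis"
  then obtain s where s: "prefix (degree_seq s) (take i (degree_seq t))"
    using tree_prefix_exists by (meson not_le)
  then have "prefix (degree_seq s) (degree_seq t)"
    using take_is_prefix prefix_order.trans by blast
  then have "s = t" using prefix_degree_seq_unique[of s "degree_seq t" t] by auto
  then show False using prefix_length_le[OF s] assms by (simp add: length_degree_seq)
qed

text \<open>For the converse, a walk ending at \<open>-1\<close> starts with the word of some tree;
  there the walk is at \<open>-1\<close>, so nonnegativity before the end forces that word to be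
  everything.\<close>

lemma is_degree_seq_iff:
  assumes "walk xs = -1"
  shows "xs \<in> range degree_seq \<longleftrightarrow> (\<forall>i<length xs. 0 \<le> walk (take i xs))"
proof
  assume "xs \<in> range degree_seq"
  then show "\<forall>i<length xs. 0 \<le> walk (take i xs)"
    using walk_take_degree_seq by (auto simp: length_degree_seq)
next
  assume *: "\<forall>i<length xs. 0 \<le> walk (take i xs)"
  obtain t ys where t: "xs = degree_seq t @ ys"
    using tree_prefix_exists[of xs] assms by (auto simp: prefix_def)
  have "ys = []"
  proof (rule ccontr)
    assume "ys \<noteq> []"
    then have "length (degree_seq t) < length xs" by (simp add: t)
    with * have "0 \<le> walk (take (length (degree_seq t)) xs)" by blast
    then show False by (simp add: t walk_degree_seq)
  qed
  then show "xs \<in> range degree_seq" by (auto simp: t)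
qed

text \<open>The good rotation starts at the first minimum of the walk.\<close>

lemma cycle_lemma:
  assumes "walk xs = -1"
  shows "\<exists>!j. j < length xs \<and> rotate j xs \<in> range degree_seq"
proof -
  define n where "n = length xs"
  define P where "P i = walk (take i xs)" for i
  have n: "n > 0" using assms by (cases xs) (auto simp: n_def)
  have walk_rot: "walk (rotate j xs) = -1" for j
    using assms by simp
  have take_rot: "walk (take i (rotate j xs)) =
      (if j + i < n then P (j + i) - P j else P (j + i - n) - 1 - P j)"
    if "j < n" "i < n" for i j
  proof -
    have rot: "rotate j xs = drop j xs @ take j xs"
      using that by (simp add: rotate_drop_take n_def)
    have spl: "walk (take (j + i) xs) = P j + walk (take i (drop j xs))" for i
      unfolding P_def by (simp add: take_add)
    show ?thesis
    proof (cases "j + i < n")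
      case True
      then have "take i (rotate j xs) = take i (drop j xs)" by (simp add: rot n_def)
      then show ?thesis using True spl[of i] by (simp add: P_def)
    next
      case False
      then have "take i (rotate j xs) = drop j xs @ take (j + i - n) xs"
        using that by (simp add: rot n_def min_def add.commute)
      moreover have "P j + walk (drop j xs) = -1"
        using assms by (metis P_def append_take_drop_id walk_simps(3))
      ultimately show ?thesis using False by (simp add: P_def)
    qed
  qed
  \<comment> \<open>A rotated prefix that passes the end of the word has absorbed the total drop of
    \<open>1\<close>. Hence the inequality is strict for the positions before \<open>j\<close>, and
    this strictness is what makes \<open>j\<close> unique.\<close>
  have char: "rotate j xs \<in> range degree_seq \<longleftrightarrow>
      (\<forall>m<n. j \<le> m \<longrightarrow> P j \<le> P m) \<and> (\<forall>m<j. P j < P m)" if j: "j < n" for j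
  proof -
    have "rotate j xs \<in> range degree_seq \<longleftrightarrow> (\<forall>i<n. 0 \<le> walk (take i (rotate j xs)))"
      using is_degree_seq_iff[OF walk_rot] by (simp add: n_def)
    also have "\<dots> \<longleftrightarrow> (\<forall>m<n. j \<le> m \<longrightarrow> P j \<le> P m) \<and> (\<forall>m<j. P j < P m)"
    proof (intro iffI conjI allI impI)
      fix m assume *: "\<forall>i<n. 0 \<le> walk (take i (rotate j xs))" "m < n" "j \<le> m"
      then have "0 \<le> walk (take (m - j) (rotate j xs))" by simp
      then show "P j \<le> P m" using take_rot[OF j, of "m - j"] * by simp
    next
      fix m assume *: "\<forall>i<n. 0 \<le> walk (take i (rotate j xs))" "m < j"
      have lt: "n - j + m < n" using * j by linarith
      then have "0 \<le> walk (take (n - j + m) (rotate j xs))" using * by blast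
      moreover have "\<not> j + (n - j + m) < n" "j + (n - j + m) - n = m" using j by auto
      ultimately show "P j < P m" using take_rot[OF j lt] by simp
    next
      fix i assume *: "(\<forall>m<n. j \<le> m \<longrightarrow> P j \<le> P m) \<and> (\<forall>m<j. P j < P m)" "i < n"
      show "0 \<le> walk (take i (rotate j xs))"
      proof (cases "j + i < n")
        case True
        then show ?thesis using take_rot[OF j *(2)] * by simp
      next
        case False
        then have "P j < P (j + i - n)" using * j by simp
        then show ?thesis using take_rot[OF j *(2)] False by simp
      qed
    qed
    finally show ?thesis .
  qed
  define mn where "mn = Min (P ` {..<n})"
  have "mn \<in> P ` {..<n}" unfolding mn_def using n by (intro Min_in) auto
  then have ex: "\<exists>j. j < n \<and> P j = mn" by auto
  define j0 where "j0 = (LEAST j. j < n \<and> P j = mn)"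
  have j0: "j0 < n" "P j0 = mn" using LeastI_ex[OF ex] by (auto simp: j0_def)
  have le: "mn \<le> P m" if "m < n" for m using that by (auto simp: mn_def)
  have "P m \<noteq> mn" if "m < j0" for m
    using not_less_Least[of m "\<lambda>j. j < n \<and> P j = mn"] that j0 by (auto simp: j0_def)
  then have rot0: "rotate j0 xs \<in> range degree_seq"
    unfolding char[OF j0(1)] using j0 le by (metis order.strict_iff_order less_trans)
  have less: "\<not> j < j'" if "j < n" "j' < n" "rotate j xs \<in> range degree_seq"
    "rotate j' xs \<in> range degree_seq" for j j'
  proof
    assume "j < j'"
    then have "P j \<le> P j'" "P j' < P j" using that char[of j] char[of j'] by auto
    then show False by simp
  qed
  show ?thesis
  proof (rule ex1I)
    show "j0 < length xs \<and> rotate j0 xs \<in> range degree_seq"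
      using j0 rot0 by (simp add: n_def)
    fix j assume "j < length xs \<and> rotate j xs \<in> range degree_seq"
    then show "j = j0"
      using less[of j j0] less[of j0 j] j0 rot0 by (simp add: n_def)
  qed
qed

section \<open>Trees starting at the positions of a word, and sums over them\<close>

definition first_tree :: "(plane_tree \<Rightarrow> real) \<Rightarrow> nat list \<Rightarrow> real" where
  "first_tree f xs = (if \<exists>t. prefix (degree_seq t) xs then f (THE t. prefix (degree_seq t) xs) else 0)"

lemma first_tree_eq: "prefix (degree_seq t) xs \<Longrightarrow> first_tree f xs = f t"
  unfolding first_tree_def using prefix_degree_seq_unique
  by (metis (mono_tags, lifting) the_equality)

lemma first_tree_append [simp]: "first_tree f (degree_seq t @ xs) = f t"
  by (rule first_tree_eq) simp

lemma first_tree_none: "\<nexists>t. prefix (degree_seq t) xs \<Longrightarrow> first_tree f xs = 0"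
  by (simp add: first_tree_def)

lemma first_tree_Nil [simp]: "first_tree f [] = 0"
  by (simp add: first_tree_def)

definition window_sum :: "(plane_tree \<Rightarrow> real) \<Rightarrow> nat list \<Rightarrow> real" where
  "window_sum f xs = (\<Sum>i<length xs. first_tree f (drop i xs))"

lemma window_sum_Nil [simp]: "window_sum f [] = 0"
  by (simp add: window_sum_def)

lemma window_sum_Cons: "window_sum f (x # xs) = first_tree f (x # xs) + window_sum f xs"
  by (simp add: window_sum_def sum.lessThan_Suc_shift del: sum.lessThan_Suc)

text \<open>A position inside the leading tree starts a fringe subtree whose word is complete before
  \<open>xs\<close> begins, so \<open>xs\<close> does not influence what is read there.\<close>

lemma window_sum_append:
  "window_sum f (degree_seq t @ xs) = additive_functional f t + window_sum f xs"
proof (induction t arbitrary: xs)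
  case (Node ts)
  have "window_sum f (concat (map degree_seq us) @ xs)
      = sum_list (map (additive_functional f) us) + window_sum f xs" if "set us \<subseteq> set ts" for us
    using that Node.IH by (induction us) (auto simp: algebra_simps)
  from this[of ts] show ?case
    using first_tree_append[of f "Node ts" xs]
    by (simp add: window_sum_Cons additive_functional_Node algebra_simps)
qed

lemma window_sum_degree_seq [simp]: "window_sum f (degree_seq t) = additive_functional f t"
  using window_sum_append[of f t "[]"] by simp

definition cyclic_sum :: "(plane_tree \<Rightarrow> real) \<Rightarrow> nat list \<Rightarrow> real" where
  "cyclic_sum f xs = (\<Sum>j<length xs. first_tree f (rotate j xs))"

lemma sum_rotations_shift:
  fixes g :: "nat list \<Rightarrow> real"
  shows "(\<Sum>j<length xs. g (rotate (j + i) xs)) = (\<Sum>j<length xs. g (rotate j xs))"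
proof (induction i)
  case (Suc i)
  have "(\<Sum>j<Suc (length xs). g (rotate (j + i) xs))
      = g (rotate i xs) + (\<Sum>j<length xs. g (rotate (j + Suc i) xs))"
    by (subst sum.lessThan_Suc_shift) simp
  moreover have "rotate (length xs + i) xs = rotate i xs"
    by (metis mod_add_self1 rotate_conv_mod)
  ultimately show ?case using Suc by simp
qed simp

lemma cyclic_sum_rotate: "cyclic_sum f (rotate i xs) = cyclic_sum f xs"
  using sum_rotations_shift[of "first_tree f" i xs]
  by (simp add: cyclic_sum_def rotate_rotate)

text \<open>In the word of a tree no window wraps around: from each position to the end the walk is
  negative, because it ends at \<open>-1\<close> and is nonnegative before, so the tree starting
  there is complete in time.\<close>

lemma cyclic_sum_degree_seq: "cyclic_sum f (degree_seq t) = additive_functional f t"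
proof -
  have "first_tree f (rotate j (degree_seq t)) = first_tree f (drop j (degree_seq t))"
    if j: "j < length (degree_seq t)" for j
  proof -
    have "walk (take j (degree_seq t)) + walk (drop j (degree_seq t)) = -1"
      using walk_degree_seq[of t] by (metis append_take_drop_id walk_simps(3))
    then have "walk (drop j (degree_seq t)) < 0"
      using walk_take_degree_seq[of j t] j by (simp add: length_degree_seq)
    then obtain s where s: "prefix (degree_seq s) (drop j (degree_seq t))"
      using tree_prefix_exists by blast
    then have "prefix (degree_seq s) (rotate j (degree_seq t))"
      using j by (simp add: rotate_drop_take prefix_prefix)
    then show ?thesis using s by (simp add: first_tree_eq)
  qed
  then show ?thesis
    using window_sum_degree_seq[of f t] by (simp add: cyclic_sum_def window_sum_def)
qed

section \<open>Trees of a given size and their probabilities\<close>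

definition trees :: "nat \<Rightarrow> plane_tree set" where
  "trees n = {t. num_nodes t = n}"

lemma trees_0 [simp]: "trees 0 = {}"
  using num_nodes_pos by (auto simp: trees_def)

lemma finite_lists_sum: "finite {xs :: nat list. length xs = n \<and> sum_list xs \<le> m}"
proof (rule finite_subset)
  show "{xs. length xs = n \<and> sum_list xs \<le> m} \<subseteq> {xs. set xs \<subseteq> {..m} \<and> length xs = n}"
    by (auto dest!: member_le_sum_list)
  show "finite {xs. set xs \<subseteq> {..m} \<and> length xs = n}"
    by (rule finite_lists_length_eq) simp
qed

lemma degree_seq_image_trees_subset:
  "degree_seq ` trees n \<subseteq> {xs. length xs = n \<and> sum_list xs = n - 1}"
proof
  fix xs assume "xs \<in> degree_seq ` trees n"
  then obtain t where t: "xs = degree_seq t" "num_nodes t = n" by (auto simp: trees_def)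
  then show "xs \<in> {xs. length xs = n \<and> sum_list xs = n - 1}"
    using sum_list_degree_seq[of t] length_degree_seq[of t] by simp
qed

lemma finite_trees [simp]: "finite (trees n)"
proof -
  have "finite {xs :: nat list. length xs = n \<and> sum_list xs = n - 1}"
    by (rule finite_subset[OF _ finite_lists_sum[of n "n - 1"]]) auto
  then have "finite (degree_seq ` trees n)"
    using degree_seq_image_trees_subset by (rule finite_subset[rotated])
  then show ?thesis
    by (rule finite_imageD) (use inj_degree_seq in \<open>auto intro: inj_on_subset\<close>)
qed

definition tree_weight :: "nat pmf \<Rightarrow> plane_tree \<Rightarrow> real" where
  "tree_weight p t = prod_list (map (pmf p) (degree_seq t))"

lemma prod_list_nonneg_real: "(\<And>x. x \<in> set xs \<Longrightarrow> 0 \<le> x) \<Longrightarrow> 0 \<le> prod_list (xs :: real list)"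
  by (induction xs) auto

lemma tree_weight_nonneg [simp]: "0 \<le> tree_weight p t"
  unfolding tree_weight_def by (rule prod_list_nonneg_real) auto

lemma prod_list_concat: "prod_list (concat xss) = prod_list (map prod_list xss)"
  by (induction xss) auto

lemma tree_weight_Node:
  "tree_weight p (Node ts) = pmf p (length ts) * prod_list (map (tree_weight p) ts)"
  by (simp add: tree_weight_def[abs_def] map_concat prod_list_concat comp_def)

lemma prod_nodes_eq_tree_weight:
  "(\<Prod>v\<in>nodes t. pmf p (length (children (fringe t v)))) = tree_weight p t"
proof (induction t)
  case (Node ts)
  let ?g = "\<lambda>t v. pmf p (length (children (fringe t v)))"
  have "(\<Prod>v\<in>nodes (Node ts). ?g (Node ts) v) =
     pmf p (length ts) * (\<Prod>v\<in>(\<Union>i<length ts. (#) i ` nodes (ts ! i)). ?g (Node ts) v)"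
    unfolding nodes_Node
    by (subst prod.insert) (auto intro!: finite_imageI finite_nodes)
  also have "(\<Prod>v\<in>(\<Union>i<length ts. (#) i ` nodes (ts ! i)). ?g (Node ts) v)
     = (\<Prod>i<length ts. \<Prod>v\<in>(#) i ` nodes (ts ! i). ?g (Node ts) v)"
    by (rule prod.UNION_disjoint) (auto intro: finite_nodes)
  also have "\<dots> = (\<Prod>i<length ts. tree_weight p (ts ! i))"
    by (simp add: prod.reindex Node.IH)
  finally show ?case by (simp add: tree_weight_Node prod.list_conv_set_nth atLeast0LessThan)
qed

lemma emeasure_grown_from:
  "emeasure (\<Pi>\<^sub>M v\<in>(UNIV :: nat list set). measure_pmf p) {\<omega>. grown_from \<omega> t} = ennreal (tree_weight p t)"
proof -
  interpret product_prob_space "\<lambda>_ :: nat list. measure_pmf p" UNIV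
    by unfold_locales
  have "{\<omega>. grown_from \<omega> t} = {\<omega> \<in> space (\<Pi>\<^sub>M v\<in>(UNIV :: nat list set). measure_pmf p).
      \<forall>v\<in>nodes t. \<omega> v \<in> {length (children (fringe t v))}}"
    by (auto simp: grown_from_def space_PiM)
  also have "emeasure (\<Pi>\<^sub>M v\<in>(UNIV :: nat list set). measure_pmf p) \<dots>
      = (\<Prod>v\<in>nodes t. emeasure (measure_pmf p) {length (children (fringe t v))})"
    by (subst emeasure_PiM_Collect) (auto simp: finite_nodes)
  also have "\<dots> = ennreal (\<Prod>v\<in>nodes t. pmf p (length (children (fringe t v))))"
    by (simp add: emeasure_pmf_single prod_ennreal)
  finally show ?thesis by (simp add: prod_nodes_eq_tree_weight)
qed

lemma sets_grown_from:
  "{\<omega>. grown_from \<omega> t} \<in> sets (\<Pi>\<^sub>M v\<in>(UNIV :: nat list set). measure_pmf p)"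
proof -
  have "Measurable.pred (\<Pi>\<^sub>M v\<in>(UNIV :: nat list set). measure_pmf p)
      (\<lambda>\<omega>. \<forall>v\<in>nodes t. length (children (fringe t v)) = \<omega> v)"
  proof (intro pred_intros_finite finite_nodes)
    fix v
    have "(\<lambda>\<omega>. \<omega> v) \<in> (\<Pi>\<^sub>M v\<in>(UNIV :: nat list set). measure_pmf p) \<rightarrow>\<^sub>M measure_pmf p"
      by (rule measurable_component_singleton) simp
    then have "(\<lambda>\<omega>. \<omega> v) \<in> (\<Pi>\<^sub>M v\<in>(UNIV :: nat list set). measure_pmf p) \<rightarrow>\<^sub>M count_space UNIV"
      by (simp cong: measurable_cong_sets)
    from measurable_compose[OF this, of "\<lambda>k. length (children (fringe t v)) = k" "count_space UNIV"]
    show "Measurable.pred (\<Pi>\<^sub>M v\<in>(UNIV :: nat list set). measure_pmf p)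
        (\<lambda>\<omega>. length (children (fringe t v)) = \<omega> v)" by (simp add: pred_def)
  qed
  then show ?thesis by (simp add: grown_from_def pred_def space_PiM)
qed

lemma nn_integral_lists_prod:
  fixes w :: "'a::countable \<Rightarrow> ennreal"
  shows "(\<integral>\<^sup>+xs. prod_list (map w xs) \<partial>count_space {xs. length xs = k})
       = (\<integral>\<^sup>+x. w x \<partial>count_space UNIV) ^ k"
proof (induction k)
  case 0
  have "{xs :: 'a list. length xs = 0} = {[]}" by auto
  then show ?case by (simp add: nn_integral_count_space_finite)
next
  case (Suc k)
  let ?L = "{xs :: 'a list. length xs = k}"
  have bij: "bij_betw (\<lambda>(x, xs). x # xs) (UNIV \<times> ?L) {xs. length xs = Suc k}"
    by (auto simp: bij_betw_def inj_on_def length_Suc_conv image_def)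
  have "(\<integral>\<^sup>+xs. prod_list (map w xs) \<partial>count_space {xs. length xs = Suc k})
      = (\<integral>\<^sup>+y. prod_list (map w (case y of (x, xs) \<Rightarrow> x # xs)) \<partial>count_space (UNIV \<times> ?L))"
    by (rule nn_integral_bij_count_space[OF bij, symmetric])
  also have "\<dots> = (\<integral>\<^sup>+y. w (fst y) * prod_list (map w (snd y)) \<partial>(count_space UNIV \<Otimes>\<^sub>M count_space ?L))"
    by (subst pair_measure_countable)
       (auto intro!: nn_integral_cong simp: case_prod_unfold intro: countable_subset[OF subset_UNIV])
  also have "\<dots> = (\<integral>\<^sup>+x. \<integral>\<^sup>+xs. w x * prod_list (map w xs) \<partial>count_space ?L \<partial>count_space UNIV)"
    by (subst sigma_finite_measure.nn_integral_fst[symmetric])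
       (auto intro!: sigma_finite_measure_count_space_countable simp: pair_measure_countable
             intro: countable_subset[OF subset_UNIV])
  also have "\<dots> = (\<integral>\<^sup>+x. w x \<partial>count_space UNIV) * (\<integral>\<^sup>+x. w x \<partial>count_space UNIV) ^ k"
    by (simp add: nn_integral_cmult nn_integral_multc Suc.IH)
  finally show ?case by simp
qed

text \<open>This is the extinction equation of the branching process, obtained by splitting a tree
  into the degree of the root and the list of its subtrees.\<close>

lemma nn_integral_tree_weight_fixpoint:
  fixes p
  defines "\<rho> \<equiv> \<integral>\<^sup>+t. ennreal (tree_weight p t) \<partial>count_space UNIV"
  shows "\<rho> = (\<integral>\<^sup>+k. ennreal (pmf p k) * \<rho> ^ k \<partial>count_space UNIV)"
proof -
  have bij: "bij_betw (\<lambda>(k :: nat, ts). Node ts) (SIGMA k : UNIV. {ts. length ts = k}) UNIV"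
  proof (rule bij_betw_imageI)
    show "inj_on (\<lambda>(k :: nat, ts). Node ts) (SIGMA k : UNIV. {ts. length ts = k})"
      by (auto simp: inj_on_def)
    show "(\<lambda>(k :: nat, ts). Node ts) ` (SIGMA k : UNIV. {ts. length ts = k}) = UNIV"
      by (auto simp: image_def) (metis plane_tree.exhaust)
  qed
  have prod: "ennreal (prod_list (map (tree_weight p) ts)) = prod_list (map (\<lambda>t. ennreal (tree_weight p t)) ts)" for ts
  proof (induction ts)
    case (Cons a ts)
    have "0 \<le> prod_list (map (tree_weight p) ts)" by (rule prod_list_nonneg_real) auto
    then show ?case using Cons by (simp add: ennreal_mult)
  qed simp
  have "\<rho> = (\<integral>\<^sup>+y. ennreal (tree_weight p (case y of (k :: nat, ts) \<Rightarrow> Node ts))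
      \<partial>count_space (SIGMA k : UNIV. {ts. length ts = k}))"
    unfolding \<rho>_def by (rule nn_integral_bij_count_space[OF bij, symmetric])
  also have "\<dots> = (\<integral>\<^sup>+y. ennreal (pmf p (fst y)) * prod_list (map (\<lambda>t. ennreal (tree_weight p t)) (snd y))
      \<partial>count_space (SIGMA k : UNIV. {ts. length ts = k}))"
    by (intro nn_integral_cong)
       (auto simp: tree_weight_Node simp flip: prod intro!: ennreal_mult prod_list_nonneg_real)
  also have "\<dots> = (\<integral>\<^sup>+k. \<integral>\<^sup>+ts. ennreal (pmf p k) * prod_list (map (\<lambda>t. ennreal (tree_weight p t)) ts)
      * indicator {ts. length ts = k} ts \<partial>count_space UNIV \<partial>count_space UNIV)"
    using nn_integral_fst_count_space[of "\<lambda>y. ennreal (pmf p (fst y)) *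
        prod_list (map (\<lambda>t. ennreal (tree_weight p t)) (snd y)) * indicator {ts. length ts = fst y} (snd y)"]
    by (auto simp: nn_integral_count_space_indicator indicator_def intro!: nn_integral_cong)
  also have "\<dots> = (\<integral>\<^sup>+k. ennreal (pmf p k) * \<rho> ^ k \<partial>count_space UNIV)"
    by (intro nn_integral_cong)
       (simp add: nn_integral_lists_prod[symmetric] \<rho>_def nn_integral_cmult[symmetric]
          nn_integral_count_space_indicator mult.assoc)
  finally show ?thesis .
qed

text \<open>By uniqueness of the grown tree the weights are probabilities of disjoint
  events.\<close>

lemma nn_integral_tree_weight_le_1:
  "(\<integral>\<^sup>+t. ennreal (tree_weight p t) \<partial>count_space UNIV) \<le> 1"
proof -
  let ?M = "\<Pi>\<^sub>M v\<in>(UNIV :: nat list set). measure_pmf p"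
  interpret product_prob_space "\<lambda>_ :: nat list. measure_pmf p" UNIV
    by unfold_locales
  have "(\<integral>\<^sup>+t. ennreal (tree_weight p t) \<partial>count_space UNIV)
      = (\<integral>\<^sup>+t. emeasure ?M {\<omega>. grown_from \<omega> t} \<partial>count_space UNIV)"
    by (simp add: emeasure_grown_from)
  also have "\<dots> = emeasure ?M (\<Union>t. {\<omega>. grown_from \<omega> t})"
    by (rule emeasure_UN_countable[symmetric])
       (auto simp: sets_grown_from disjoint_family_on_def intro: grown_from_unique)
  also have "\<dots> \<le> 1" by (rule emeasure_le_1)
  finally show ?thesis .
qed

section \<open>Galton--Watson trees\<close>

locale critical_offspring =
  fixes p :: "nat pmf"
  assumes mean_offspring: "measure_pmf.expectation p real = 1"
    and finite_variance: "integrable (measure_pmf p) (\<lambda>k. (real k)\<^sup>2)"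
    and variance_pos: "0 < measure_pmf.variance p real"
begin

lemma integrable_offspring: "integrable (measure_pmf p) real"
  using mean_offspring not_integrable_integral_eq by fastforce

text \<open>Otherwise \<open>1 - real k\<close> would be nonnegative with mean 0, hence almost
  surely 0, and the variance would vanish.\<close>

lemma exists_offspring_ge_2: "\<exists>k\<ge>2. 0 < pmf p k"
proof (rule ccontr)
  assume "\<not> ?thesis"
  then have small: "k \<le> 1" if "k \<in> set_pmf p" for k
    using that by (metis not_less_eq_eq numeral_2_eq_2 One_nat_def pmf_positive)
  have "(\<integral>k. 1 - real k \<partial>measure_pmf p) = 0"
    using integrable_offspring mean_offspring by simp
  moreover have "AE k in measure_pmf p. 0 \<le> 1 - real k"
    using small by (auto simp: AE_measure_pmf_iff)
  ultimately have "AE k in measure_pmf p. 1 - real k = 0"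
    using integrable_offspring by (subst (asm) integral_nonneg_eq_0_iff_AE) auto
  then have "measure_pmf.variance p real = 0"
    by (intro integral_eq_zero_AE) (auto simp: mean_offspring elim!: eventually_mono)
  then show False using variance_pos by simp
qed

text \<open>Otherwise \<open>real k - 1\<close> would be nonnegative with mean 0, which excludes
  offspring numbers above 1. That 0 is a possible offspring number also ties the gcd of the support
  to the lattice of the walk.\<close>

lemma offspring_0_pos: "0 < pmf p 0"
proof (rule ccontr)
  assume "\<not> ?thesis"
  then have pos: "1 \<le> k" if "k \<in> set_pmf p" for k
    using that by (metis less_one not_le pmf_positive)
  have "(\<integral>k. real k - 1 \<partial>measure_pmf p) = 0"
    using integrable_offspring mean_offspring by simp
  moreover have "AE k in measure_pmf p. 0 \<le> real k - 1"
    using pos by (auto simp: AE_measure_pmf_iff)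
  ultimately have *: "AE k in measure_pmf p. real k - 1 = 0"
    using integrable_offspring by (subst (asm) integral_nonneg_eq_0_iff_AE) auto
  obtain k where "k \<ge> 2" "0 < pmf p k" using exists_offspring_ge_2 by blast
  moreover from this have "real k - 1 = 0" using * by (simp add: AE_measure_pmf_iff set_pmf_iff)
  ultimately show False by simp
qed

text \<open>Almost sure extinction at criticality. The generating function has slope 1 at the point
  1 and, by Bernoulli's inequality, lies above its tangent there. At a fixed point
  \<open>\<rho>\<close> the gap to the tangent has mean 0, so it vanishes at every possible
  offspring number; one that is at least 2 forces \<open>\<rho> = 1\<close>.\<close>

lemma nn_integral_tree_weight: "(\<integral>\<^sup>+t. ennreal (tree_weight p t) \<partial>count_space UNIV) = 1"
proof -
  define \<rho> where "\<rho> = enn2real (\<integral>\<^sup>+t. ennreal (tree_weight p t) \<partial>count_space UNIV)"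
  have le1: "(\<integral>\<^sup>+t. ennreal (tree_weight p t) \<partial>count_space UNIV) \<le> 1"
    by (rule nn_integral_tree_weight_le_1)
  then have \<rho>: "(\<integral>\<^sup>+t. ennreal (tree_weight p t) \<partial>count_space UNIV) = ennreal \<rho>"
    unfolding \<rho>_def by (subst ennreal_enn2real) (auto intro: le_less_trans[OF le1])
  have \<rho>01: "0 \<le> \<rho>" "\<rho> \<le> 1" using le1[unfolded \<rho>] by (simp_all add: \<rho>_def)
  have "ennreal \<rho> = (\<integral>\<^sup>+k. ennreal (pmf p k) * ennreal \<rho> ^ k \<partial>count_space UNIV)"
    using nn_integral_tree_weight_fixpoint[of p] by (simp add: \<rho>)
  also have "\<dots> = (\<integral>\<^sup>+k. ennreal (\<rho> ^ k) \<partial>measure_pmf p)"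
    by (simp add: nn_integral_measure_pmf ennreal_power \<rho>01)
  also have "\<dots> = ennreal (\<integral>k. \<rho> ^ k \<partial>measure_pmf p)"
    by (intro nn_integral_eq_integral measure_pmf.integrable_const_bound[of _ 1])
       (auto simp: power_le_one \<rho>01)
  finally have fix_eq: "\<rho> = (\<integral>k. \<rho> ^ k \<partial>measure_pmf p)"
    using \<rho>01 by (subst (asm) ennreal_inj) (auto intro!: integral_nonneg_AE)
  have int: "integrable (measure_pmf p) (\<lambda>k. \<rho> ^ k)"
    by (intro measure_pmf.integrable_const_bound[of _ 1]) (auto simp: power_le_one \<rho>01)
  have "(\<integral>k. \<rho> ^ k - (1 + real k * (\<rho> - 1)) \<partial>measure_pmf p) = 0"
    using int integrable_offspring mean_offspring fix_eq by simp
  moreover have bern: "0 \<le> \<rho> ^ k - (1 + real k * (\<rho> - 1))" for k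
    using Bernoulli_inequality[of "\<rho> - 1" k] \<rho>01 by simp
  ultimately have *: "AE k in measure_pmf p. \<rho> ^ k - (1 + real k * (\<rho> - 1)) = 0"
    using int integrable_offspring by (subst (asm) integral_nonneg_eq_0_iff_AE) auto
  obtain k where k: "k \<ge> 2" "0 < pmf p k" using exists_offspring_ge_2 by blast
  then have eq: "\<rho> ^ k = 1 + real k * (\<rho> - 1)"
    using * by (auto simp: AE_measure_pmf_iff set_pmf_iff)
  have "\<rho> = 1"
  proof (rule ccontr)
    assume "\<rho> \<noteq> 1"
    then have lt: "\<rho> < 1" using \<rho>01 by simp
    obtain m where m: "k = Suc m" "m \<ge> 1" using k by (cases k) auto
    \<comment> \<open>Bernoulli for \<open>m = k - 1\<close>, multiplied by \<open>\<rho>\<close>,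
      exceeds the tangent value for \<open>k\<close> by
      \<open>real m * (\<rho> - 1)\<^sup>2\<close>. This excess is strict when
      \<open>\<rho> < 1\<close>.\<close>
    have "1 + real m * (\<rho> - 1) \<le> \<rho> ^ m"
      using Bernoulli_inequality[of "\<rho> - 1" m] \<rho>01 by simp
    then have "\<rho> * (1 + real m * (\<rho> - 1)) \<le> \<rho> ^ k"
      using \<rho>01 by (simp add: m mult_left_mono)
    moreover have "\<rho> * (1 + real m * (\<rho> - 1)) = 1 + real k * (\<rho> - 1) + real m * (\<rho> - 1)\<^sup>2"
      by (simp add: m algebra_simps power2_eq_square)
    moreover have "real m * (\<rho> - 1)\<^sup>2 > 0" using m lt by simp
    ultimately show False using eq by simp
  qed
  then show ?thesis by (simp add: \<rho>)
qed

definition gw :: "plane_tree pmf" where "gw = embed_pmf (tree_weight p)"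

lemma pmf_gw [simp]: "pmf gw t = tree_weight p t"
  unfolding gw_def by (rule pmf_embed_pmf) (auto simp: nn_integral_tree_weight)

text \<open>Since the weights sum to 1, some finite tree is grown almost surely, and the dummy value
  of \<open>grow\<close> is taken only on a null set besides the honest one-node trees.\<close>

lemma galton_watson_eq_gw: "galton_watson p = measure_pmf gw"
proof -
  let ?M = "\<Pi>\<^sub>M v\<in>(UNIV :: nat list set). measure_pmf p"
  interpret product_prob_space "\<lambda>_ :: nat list. measure_pmf p" UNIV
    by unfold_locales
  have "emeasure ?M (\<Union>t. {\<omega>. grown_from \<omega> t}) = (\<integral>\<^sup>+t. emeasure ?M {\<omega>. grown_from \<omega> t} \<partial>count_space UNIV)"
    by (rule emeasure_UN_countable)
       (auto simp: sets_grown_from disjoint_family_on_def intro: grown_from_unique)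
  then have one: "emeasure ?M (\<Union>t. {\<omega>. grown_from \<omega> t}) = 1"
    by (simp add: emeasure_grown_from nn_integral_tree_weight)
  have "AE \<omega> in ?M. \<omega> \<in> (\<Union>t. {\<omega>. grown_from \<omega> t})"
    by (rule AE_prob_1) (simp add: measure_def one)
  then have AE: "AE \<omega> in ?M. grow \<omega> = t \<longleftrightarrow> grown_from \<omega> t" for t
    by eventually_elim (use grow_eq in auto)
  have grow_sets: "grow -` {t} \<inter> space ?M \<in> sets ?M" for t
    by (rule measurable_sets[OF measurable_grow]) simp
  show ?thesis
  proof (rule measure_eqI_countable[where A = UNIV])
    fix t
    have "emeasure (galton_watson p) {t} = emeasure ?M (grow -` {t} \<inter> space ?M)"
      unfolding galton_watson_def by (subst emeasure_distr) (auto simp: measurable_grow)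
    also have "\<dots> = emeasure ?M {\<omega>. grown_from \<omega> t}"
      by (rule emeasure_eq_AE) (use AE[of t] grow_sets sets_grown_from in \<open>auto simp: space_PiM elim!: eventually_mono\<close>)
    finally show "emeasure (galton_watson p) {t} = emeasure (measure_pmf gw) {t}"
      by (simp add: emeasure_grown_from emeasure_pmf_single)
  qed (auto simp: galton_watson_def)
qed

text \<open>The expectation over the event of size \<open>n\<close>, not divided by the probability
  of that event. In this form it makes sense at inadmissible sizes and adds up over sizes.\<close>

definition tree_sum :: "nat \<Rightarrow> (plane_tree \<Rightarrow> real) \<Rightarrow> real" where
  "tree_sum n h = (\<Sum>t\<in>trees n. tree_weight p t * h t)"

definition size_prob :: "nat \<Rightarrow> real" where
  "size_prob n = tree_sum n (\<lambda>_. 1)"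

lemma size_prob_nonneg [simp]: "0 \<le> size_prob n"
  unfolding size_prob_def tree_sum_def by (intro sum_nonneg) auto

lemma size_prob_0 [simp]: "size_prob 0 = 0"
  by (simp add: size_prob_def tree_sum_def)

lemma prob_trees: "measure (measure_pmf gw) (trees n) = size_prob n"
  by (simp add: measure_measure_pmf_finite size_prob_def tree_sum_def)

lemma admissible_sizes_eq: "admissible_sizes p = {n. 0 < size_prob n}"
  by (simp add: admissible_sizes_def galton_watson_eq_gw prob_trees flip: trees_def)

lemma conditioned_eq_cond_pmf:
  assumes "0 < size_prob n"
  shows "conditioned_galton_watson p n = measure_pmf (cond_pmf gw (trees n))"
    and "set_pmf (cond_pmf gw (trees n)) \<subseteq> trees n"
    and "t \<in> trees n \<Longrightarrow> pmf (cond_pmf gw (trees n)) t = tree_weight p t / size_prob n"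
proof -
  have ne: "set_pmf gw \<inter> trees n \<noteq> {}"
    using assms by (metis prob_trees measure_measure_pmf_not_zero measure_pmf_zero_iff less_irrefl)
  show "conditioned_galton_watson p n = measure_pmf (cond_pmf gw (trees n))"
    by (simp add: conditioned_galton_watson_def galton_watson_eq_gw cond_pmf.rep_eq[OF ne] flip: trees_def)
  show "set_pmf (cond_pmf gw (trees n)) \<subseteq> trees n" by (simp add: set_cond_pmf[OF ne])
  show "t \<in> trees n \<Longrightarrow> pmf (cond_pmf gw (trees n)) t = tree_weight p t / size_prob n"
    by (simp add: pmf_cond[OF ne] prob_trees)
qed

lemma expectation_conditioned:
  assumes "0 < size_prob n"
  shows "integral\<^sup>L (conditioned_galton_watson p n) h = tree_sum n h / size_prob n"
proof -
  note q = conditioned_eq_cond_pmf[OF assms]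
  have "integral\<^sup>L (conditioned_galton_watson p n) h = (\<Sum>t\<in>trees n. h t * pmf (cond_pmf gw (trees n)) t)"
    unfolding q(1) by (rule integral_measure_pmf_real) (use q(2) in auto)
  also have "\<dots> = tree_sum n h / size_prob n"
    by (simp add: q(3) tree_sum_def sum_divide_distrib mult.commute)
  finally show ?thesis .
qed

lemma nn_integral_gw: "(\<integral>\<^sup>+t. ennreal \<bar>h t\<bar> \<partial>gw) = (\<Sum>n. ennreal (tree_sum n (\<lambda>t. \<bar>h t\<bar>)))"
proof -
  have "(\<integral>\<^sup>+t. ennreal \<bar>h t\<bar> \<partial>gw) = (\<integral>\<^sup>+t. (\<Sum>n. ennreal \<bar>h t\<bar> * indicator (trees n) t) \<partial>gw)"
  proof (intro nn_integral_cong)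
    fix t
    have "(\<lambda>n. ennreal \<bar>h t\<bar> * indicator (trees n) t) = (\<lambda>n. if n = num_nodes t then ennreal \<bar>h t\<bar> else 0)"
      by (auto simp: trees_def)
    then have "(\<lambda>n. ennreal \<bar>h t\<bar> * indicator (trees n) t) sums ennreal \<bar>h t\<bar>"
      using sums_single[of "num_nodes t" "\<lambda>_. ennreal \<bar>h t\<bar>"] by simp
    then show "ennreal \<bar>h t\<bar> = (\<Sum>n. ennreal \<bar>h t\<bar> * indicator (trees n) t)"
      by (simp add: sums_iff)
  qed
  also have "\<dots> = (\<Sum>n. \<integral>\<^sup>+t. ennreal \<bar>h t\<bar> * indicator (trees n) t \<partial>gw)"
    by (rule nn_integral_suminf) auto
  also have "(\<lambda>n. \<integral>\<^sup>+t. ennreal \<bar>h t\<bar> * indicator (trees n) t \<partial>gw) = (\<lambda>n. ennreal (tree_sum n (\<lambda>t. \<bar>h t\<bar>)))"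
  proof
    fix n
    have "(\<integral>\<^sup>+t. ennreal \<bar>h t\<bar> * indicator (trees n) t \<partial>gw)
       = (\<integral>\<^sup>+t. ennreal (tree_weight p t * \<bar>h t\<bar>) \<partial>count_space (trees n))"
      by (simp add: nn_integral_measure_pmf nn_integral_count_space_indicator ennreal_mult mult.assoc)
    also have "\<dots> = ennreal (tree_sum n (\<lambda>t. \<bar>h t\<bar>))"
      by (simp add: nn_integral_count_space_finite tree_sum_def sum_ennreal)
    finally show "(\<integral>\<^sup>+t. ennreal \<bar>h t\<bar> * indicator (trees n) t \<partial>gw) = ennreal (tree_sum n (\<lambda>t. \<bar>h t\<bar>))" .
  qed
  finally show ?thesis .
qed

lemma tree_sum_nonneg: "(\<And>t. t \<in> trees n \<Longrightarrow> 0 \<le> h t) \<Longrightarrow> 0 \<le> tree_sum n h"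
  unfolding tree_sum_def by (intro sum_nonneg mult_nonneg_nonneg) auto

lemma integrable_gw_iff: "integrable gw h \<longleftrightarrow> summable (\<lambda>n. tree_sum n (\<lambda>t. \<bar>h t\<bar>))"
proof
  assume "integrable gw h"
  then have "(\<Sum>n. ennreal (tree_sum n (\<lambda>t. \<bar>h t\<bar>))) < \<infinity>"
    by (simp add: integrable_iff_bounded nn_integral_gw)
  then have "(\<Sum>n. ennreal (tree_sum n (\<lambda>t. \<bar>h t\<bar>))) \<noteq> \<top>" by (metis infinity_ennreal_def less_irrefl)
  then show "summable (\<lambda>n. tree_sum n (\<lambda>t. \<bar>h t\<bar>))"
    by (rule summable_suminf_not_top[rotated]) (rule tree_sum_nonneg, simp)
next
  assume "summable (\<lambda>n. tree_sum n (\<lambda>t. \<bar>h t\<bar>))"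
  then have "(\<Sum>n. ennreal (tree_sum n (\<lambda>t. \<bar>h t\<bar>))) \<noteq> \<top>"
    by (rule ennreal_suminf_neq_top) (rule tree_sum_nonneg, simp)
  then show "integrable gw h"
    unfolding integrable_iff_bounded real_norm_def nn_integral_gw infinity_ennreal_def
    by (auto simp only: less_top[symmetric] measurable_measure_pmf) simp
qed

lemma sums_expectation_gw:
  assumes "integrable gw h" shows "(\<lambda>n. tree_sum n h) sums integral\<^sup>L gw h"
proof -
  have int: "integrable gw (\<lambda>t. indicator (trees n) t * h t)" for n
    using assms by (simp add: integrable_real_mult_indicator mult.commute)
  have eq: "(\<integral>t. indicator (trees n) t * g t \<partial>gw) = tree_sum n g" for n g
    by (subst integral_measure_pmf_real[of "trees n"]) (auto simp: tree_sum_def mult.commute indicator_def)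
  have single: "(\<lambda>n. indicator (trees n) t * g t) sums g t" for t and g :: "plane_tree \<Rightarrow> real"
  proof -
    have "(\<lambda>n. indicator (trees n) t * g t) = (\<lambda>n. if n = num_nodes t then g t else 0)"
      by (auto simp: trees_def)
    then show ?thesis using sums_single[of "num_nodes t" "\<lambda>_. g t"] by simp
  qed
  have "(\<lambda>n. \<integral>t. indicator (trees n) t * h t \<partial>gw) sums (\<integral>t. (\<Sum>n. indicator (trees n) t * h t) \<partial>gw)"
  proof (rule sums_integral)
    show "AE t in gw. summable (\<lambda>n. norm (indicator (trees n) t * h t))"
      using single[of _ "\<lambda>t. \<bar>h t\<bar>"] by (auto simp: abs_mult sums_iff)
    show "summable (\<lambda>n. \<integral>t. norm (indicator (trees n) t * h t) \<partial>gw)"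
      using assms by (simp add: abs_mult eq integrable_gw_iff)
  qed (rule int)
  moreover have "(\<Sum>n. indicator (trees n) t * h t) = h t" for t
    using single[of t h] by (simp add: sums_iff)
  ultimately show ?thesis by (simp add: eq)
qed

end

section \<open>Random degree words\<close>

lemma measure_pair_pmf:
  fixes A :: "'a::countable pmf" and B :: "'b::countable pmf"
  shows "measure_pmf (pair_pmf A B) = measure_pmf A \<Otimes>\<^sub>M measure_pmf B"
proof (rule measure_eqI_countable[where A = UNIV])
  have "sets (measure_pmf A \<Otimes>\<^sub>M measure_pmf B)
      = sets (count_space (UNIV :: 'a set) \<Otimes>\<^sub>M count_space (UNIV :: 'b set))"
    by (rule sets_pair_measure_cong) auto
  also have "count_space (UNIV :: 'a set) \<Otimes>\<^sub>M count_space (UNIV :: 'b set) = count_space (UNIV \<times> UNIV)"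
    by (rule pair_measure_countable) auto
  finally show "sets (measure_pmf A \<Otimes>\<^sub>M measure_pmf B) = Pow UNIV" by simp
  fix y :: "'a \<times> 'b"
  have "emeasure (measure_pmf A \<Otimes>\<^sub>M measure_pmf B) ({fst y} \<times> {snd y})
      = emeasure (measure_pmf A) {fst y} * emeasure (measure_pmf B) {snd y}"
    by (rule measure_pmf.emeasure_pair_measure_Times) auto
  then show "emeasure (measure_pmf (pair_pmf A B)) {y} = emeasure (measure_pmf A \<Otimes>\<^sub>M measure_pmf B) {y}"
    by (cases y) (simp add: emeasure_pmf_single pmf_pair ennreal_mult)
qed auto

lemma integral_pair_pmf:
  fixes h :: "'a::countable \<times> 'b::countable \<Rightarrow> 'c::{banach, second_countable_topology}"
  assumes "integrable (measure_pmf (pair_pmf A B)) h"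
  shows "measure_pmf.expectation (pair_pmf A B) h
       = measure_pmf.expectation A (\<lambda>a. measure_pmf.expectation B (\<lambda>b. h (a, b)))"
proof -
  interpret pair_sigma_finite "measure_pmf A" "measure_pmf B" ..
  show ?thesis
    using assms integral_fst'[of h] by (simp add: measure_pair_pmf)
qed

lemma integrable_pair_pmf_mult:
  fixes g h :: "_ \<Rightarrow> real" and A :: "'a::countable pmf" and B :: "'b::countable pmf"
  assumes "integrable (measure_pmf A) g" "integrable (measure_pmf B) h"
  shows "integrable (measure_pmf (pair_pmf A B)) (\<lambda>y. g (fst y) * h (snd y))"
proof -
  interpret pair_sigma_finite "measure_pmf A" "measure_pmf B" ..
  have "g \<circ> fst \<in> borel_measurable (measure_pmf A \<Otimes>\<^sub>M measure_pmf B)"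
       "h \<circ> snd \<in> borel_measurable (measure_pmf A \<Otimes>\<^sub>M measure_pmf B)"
    by (intro measurable_comp[OF measurable_fst] measurable_comp[OF measurable_snd]; simp)+
  then have "(\<lambda>y. g (fst y) * h (snd y)) \<in> borel_measurable (measure_pmf A \<Otimes>\<^sub>M measure_pmf B)"
    by (auto simp: comp_def)
  then show ?thesis
    unfolding measure_pair_pmf
    by (intro Fubini_integrable) (use assms in \<open>auto simp: abs_mult\<close>)
qed

lemma integrable_finite_support:
  fixes g :: "'a \<Rightarrow> 'b::{banach, second_countable_topology}"
  assumes "finite A" "\<And>x. x \<in> set_pmf M \<Longrightarrow> x \<notin> A \<Longrightarrow> g x = 0"
  shows "integrable (measure_pmf M) g"
proof (rule measure_pmf.integrable_const_bound)
  show "AE x in measure_pmf M. norm (g x) \<le> (\<Sum>a\<in>A. norm (g a))"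
  proof (rule AE_pmfI)
    fix x assume "x \<in> set_pmf M"
    then show "norm (g x) \<le> (\<Sum>a\<in>A. norm (g a))"
      using assms by (cases "x \<in> A") (auto intro!: member_le_sum sum_nonneg)
  qed
qed simp

lemma integrable_pmf_bounded:
  fixes g :: "'a \<Rightarrow> 'b::{banach, second_countable_topology}"
  assumes "\<And>x. x \<in> set_pmf M \<Longrightarrow> norm (g x) \<le> B"
  shows "integrable (measure_pmf M) g"
  by (rule measure_pmf.integrable_const_bound[of _ B]) (auto simp: AE_measure_pmf_iff assms)

lemma expectation_pmf_cong:
  "(\<And>x. x \<in> set_pmf M \<Longrightarrow> g x = h x) \<Longrightarrow> measure_pmf.expectation M g = measure_pmf.expectation M h"
  by (rule integral_cong_AE) (auto simp: AE_measure_pmf_iff)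

lemma replicate_pmf_append:
  "replicate_pmf (m + n) q = map_pmf (\<lambda>(a, b). a @ b) (pair_pmf (replicate_pmf m q) (replicate_pmf n q))"
  by (simp add: replicate_pmf_distrib pair_pmf_def map_bind_pmf map_return_pmf bind_assoc_pmf bind_return_pmf)

lemma replicate_pmf_Suc_pair:
  "replicate_pmf (Suc n) q = map_pmf (\<lambda>(x, xs). x # xs) (pair_pmf q (replicate_pmf n q))"
  by (simp add: pair_pmf_def map_bind_pmf map_return_pmf bind_assoc_pmf bind_return_pmf)

lemma pmf_replicate:
  "length xs = n \<Longrightarrow> pmf (replicate_pmf n q) xs = prod_list (map (pmf q) xs)"
proof (induction n arbitrary: xs)
  case (Suc n)
  then obtain y ys where xs: "xs = y # ys" "length ys = n" by (auto simp: length_Suc_conv)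
  have "inj (\<lambda>(x :: 'a, xs). x # xs)" by (auto simp: inj_def)
  then have "pmf (map_pmf (\<lambda>(x, xs). x # xs) (pair_pmf q (replicate_pmf n q))) ((\<lambda>(x, xs). x # xs) (y, ys))
      = pmf (pair_pmf q (replicate_pmf n q)) (y, ys)"
    by (rule pmf_map_inj')
  then show ?case using Suc.IH[OF xs(2)] by (simp add: xs(1) replicate_pmf_Suc_pair pmf_pair del: replicate_pmf.simps)
qed simp

lemma length_replicate_pmf: "xs \<in> set_pmf (replicate_pmf n q) \<Longrightarrow> length xs = n"
  by (simp add: set_replicate_pmf)

lemma map_rotate_replicate_pmf: "map_pmf (rotate j) (replicate_pmf n q) = replicate_pmf n q"
proof (cases "n = 0")
  case False
  define i where "i = j mod n"
  have i: "i \<le> n" using False by (simp add: i_def less_imp_le)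
  have "map_pmf (rotate j) (replicate_pmf n q) = map_pmf (rotate i) (replicate_pmf n q)"
    unfolding i_def by (intro map_pmf_cong refl) (metis length_replicate_pmf rotate_conv_mod)
  also have "\<dots> = map_pmf (rotate i) (map_pmf (\<lambda>(a, b). a @ b) (pair_pmf (replicate_pmf i q) (replicate_pmf (n - i) q)))"
    using replicate_pmf_append[of i "n - i" q] i by simp
  also have "\<dots> = map_pmf (\<lambda>(a, b). b @ a) (pair_pmf (replicate_pmf i q) (replicate_pmf (n - i) q))"
    by (auto simp: map_pmf_comp rotate_append intro!: map_pmf_cong dest!: length_replicate_pmf)
  also have "\<dots> = map_pmf (\<lambda>(a, b). a @ b) (pair_pmf (replicate_pmf (n - i) q) (replicate_pmf i q))"
    by (subst pair_commute_pmf) (simp add: map_pmf_comp case_prod_unfold)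
  also have "\<dots> = replicate_pmf n q"
    using replicate_pmf_append[of "n - i" i q] i by simp
  finally show ?thesis .
qed simp

context critical_offspring
begin

abbreviation word_mean :: "nat \<Rightarrow> (nat list \<Rightarrow> 'b) \<Rightarrow> 'b::{banach, second_countable_topology}" where
  "word_mean n h \<equiv> measure_pmf.expectation (replicate_pmf n p) h"

lemma word_mean_append:
  fixes h :: "nat list \<Rightarrow> 'b::{banach, second_countable_topology}"
  assumes "integrable (measure_pmf (replicate_pmf (m + n) p)) h"
  shows "word_mean (m + n) h = word_mean m (\<lambda>a. word_mean n (\<lambda>b. h (a @ b)))"
proof -
  have "integrable (measure_pmf (pair_pmf (replicate_pmf m p) (replicate_pmf n p))) (\<lambda>y. h (case y of (a, b) \<Rightarrow> a @ b))"
    using assms by (simp add: replicate_pmf_append)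
  from integral_pair_pmf[OF this] show ?thesis by (simp add: replicate_pmf_append)
qed

lemma word_mean_rotate: "word_mean n (\<lambda>xs. h (rotate j xs)) = word_mean n h"
proof -
  have "word_mean n (\<lambda>xs. h (rotate j xs)) = measure_pmf.expectation (map_pmf (rotate j) (replicate_pmf n p)) h"
    by simp
  then show ?thesis by (simp only: map_rotate_replicate_pmf)
qed

lemma integrable_word_take_drop:
  fixes g h :: "nat list \<Rightarrow> real"
  assumes "integrable (replicate_pmf m p) g" "integrable (replicate_pmf n p) h"
  shows "integrable (replicate_pmf (m + n) p) (\<lambda>xs. g (take m xs) * h (drop m xs))"
proof -
  have eq: "map_pmf (\<lambda>y. (\<lambda>(a, b). a @ b) y) (pair_pmf (replicate_pmf m p) (replicate_pmf n p)) = replicate_pmf (m + n) p"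
    by (simp add: replicate_pmf_append)
  have "integrable (pair_pmf (replicate_pmf m p) (replicate_pmf n p)) (\<lambda>y. g (fst y) * h (snd y))"
    using assms by (rule integrable_pair_pmf_mult)
  then have "integrable (pair_pmf (replicate_pmf m p) (replicate_pmf n p))
      (\<lambda>y. g (take m (case y of (a, b) \<Rightarrow> a @ b)) * h (drop m (case y of (a, b) \<Rightarrow> a @ b)))"
    by (subst integrable_cong_AE[where g = "\<lambda>y. g (fst y) * h (snd y)"])
       (auto simp: AE_measure_pmf_iff dest!: length_replicate_pmf)
  then show ?thesis by (simp add: replicate_pmf_append)
qed

lemma word_mean_take_drop:
  fixes g h :: "nat list \<Rightarrow> real"
  assumes "integrable (replicate_pmf m p) g" "integrable (replicate_pmf n p) h"
  shows "word_mean (m + n) (\<lambda>xs. g (take m xs) * h (drop m xs)) = word_mean m g * word_mean n h"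
proof -
  have "word_mean (m + n) (\<lambda>xs. g (take m xs) * h (drop m xs))
      = word_mean m (\<lambda>a. word_mean n (\<lambda>b. g (take m (a @ b)) * h (drop m (a @ b))))"
    using assms by (intro word_mean_append integrable_word_take_drop)
  also have "\<dots> = word_mean m (\<lambda>a. word_mean n (\<lambda>b. g a * h b))"
    by (intro expectation_pmf_cong) (auto dest!: length_replicate_pmf)
  finally show ?thesis by simp
qed

lemma word_mean_take:
  fixes g :: "nat list \<Rightarrow> 'b::{banach, second_countable_topology}"
  shows "word_mean (m + n) (\<lambda>xs. g (take m xs)) = word_mean m g"
proof -
  have "map_pmf (take m) (replicate_pmf (m + n) p) = replicate_pmf m p"
  proof -
    have "map_pmf (take m) (replicate_pmf (m + n) p) = map_pmf fst (pair_pmf (replicate_pmf m p) (replicate_pmf n p))"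
      unfolding replicate_pmf_append map_pmf_comp
      by (intro map_pmf_cong refl) (auto dest!: length_replicate_pmf)
    then show ?thesis by (simp add: map_fst_pair_pmf)
  qed
  then have "word_mean m g = measure_pmf.expectation (map_pmf (take m) (replicate_pmf (m + n) p)) g" by simp
  then show ?thesis by simp
qed

lemma map_drop_replicate_pmf: "map_pmf (drop m) (replicate_pmf (m + n) p) = replicate_pmf n p"
proof -
  have "map_pmf (drop m) (replicate_pmf (m + n) p) = map_pmf snd (pair_pmf (replicate_pmf m p) (replicate_pmf n p))"
    unfolding replicate_pmf_append map_pmf_comp
    by (intro map_pmf_cong refl) (auto dest!: length_replicate_pmf)
  then show ?thesis by (simp add: map_snd_pair_pmf)
qed

lemma word_mean_drop:
  fixes g :: "nat list \<Rightarrow> 'b::{banach, second_countable_topology}"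
  shows "word_mean (m + n) (\<lambda>xs. g (drop m xs)) = word_mean n g"
proof -
  have "word_mean n g = measure_pmf.expectation (map_pmf (drop m) (replicate_pmf (m + n) p)) g"
    by (simp only: map_drop_replicate_pmf)
  then show ?thesis by simp
qed

lemma word_mean_tl: "word_mean (Suc n) (\<lambda>xs. g (tl xs)) = word_mean n g"
  using word_mean_drop[of 1 n g] by (simp add: drop_Suc)

lemma integrable_word_tl:
  fixes g :: "nat list \<Rightarrow> 'b::{banach, second_countable_topology}"
  shows "integrable (replicate_pmf (Suc n) p) (\<lambda>xs. g (tl xs)) \<longleftrightarrow> integrable (replicate_pmf n p) g"
proof -
  have "integrable (replicate_pmf n p) g \<longleftrightarrow> integrable (map_pmf (drop 1) (replicate_pmf (1 + n) p)) g"
    by (simp only: map_drop_replicate_pmf)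
  then show ?thesis by (simp add: drop_Suc integrable_map_pmf_eq del: replicate_pmf.simps)
qed

section \<open>The law of the walk, and the cycle lemma in expectation\<close>

definition walk_prob :: "nat \<Rightarrow> int \<Rightarrow> real" where
  "walk_prob n i = word_mean n (\<lambda>xs. of_bool (walk xs = i))"

lemma integrable_of_bool [simp]: "integrable (measure_pmf M) (\<lambda>x. of_bool (P x) :: real)"
  by (rule integrable_pmf_bounded[of _ _ 1]) simp

lemma walk_prob_nonneg [simp]: "0 \<le> walk_prob n i"
  unfolding walk_prob_def by (rule integral_nonneg_AE) simp

lemma walk_prob_le_1: "walk_prob n i \<le> 1"
  unfolding walk_prob_def by (rule measure_pmf.integral_le_const) auto

lemma finite_words_walk: "finite {xs. length xs = n \<and> walk xs = i}"
  by (rule finite_subset[OF _ finite_lists_sum[of n "nat (i + int n)"]]) (auto simp: walk_def)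

lemma integrable_word_walk:
  fixes h :: "nat list \<Rightarrow> real"
  shows "integrable (replicate_pmf n p) (\<lambda>xs. of_bool (walk xs = i) * h xs)"
  by (rule integrable_finite_support[OF finite_words_walk[of n i]])
     (auto dest: length_replicate_pmf)

text \<open>The cycle lemma as an identity between weighted sums.\<close>

lemma tree_sum_eq_word_mean:
  assumes rot: "\<And>j xs. h (rotate j xs) = h xs"
  shows "real n * tree_sum n (\<lambda>t. h (degree_seq t)) = word_mean n (\<lambda>xs. of_bool (walk xs = -1) * h xs)"
proof -
  let ?R = "\<lambda>xs. of_bool (xs \<in> range degree_seq) * h xs :: real"
  have int: "integrable (replicate_pmf n p) ?R"
    by (rule integrable_finite_support[OF finite_words_walk[of n "-1"]])
       (auto dest: length_replicate_pmf simp: walk_degree_seq)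
  have int_rot: "integrable (replicate_pmf n p) (\<lambda>xs. ?R (rotate j xs))" for j
  proof -
    have "integrable (map_pmf (rotate j) (replicate_pmf n p)) ?R"
      using int by (simp only: map_rotate_replicate_pmf)
    then show ?thesis by simp
  qed
  have "word_mean n (\<lambda>xs. of_bool (walk xs = -1) * h xs) = word_mean n (\<lambda>xs. \<Sum>j<n. ?R (rotate j xs))"
  proof (rule expectation_pmf_cong)
    fix xs assume "xs \<in> set_pmf (replicate_pmf n p)"
    then have len: "length xs = n" by (rule length_replicate_pmf)
    have "(\<Sum>j<n. ?R (rotate j xs)) = (\<Sum>j<n. of_bool (rotate j xs \<in> range degree_seq)) * h xs"
      by (simp only: rot sum_distrib_right)
    also have "(\<Sum>j<n. of_bool (rotate j xs \<in> range degree_seq)) = (of_bool (walk xs = -1) :: real)"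
    proof (cases "walk xs = -1")
      case True
      then obtain j0 where j0: "\<And>j. j < n \<and> rotate j xs \<in> range degree_seq \<longleftrightarrow> j = j0"
        using cycle_lemma[of xs] len by (metis (no_types, lifting))
      have "(\<Sum>j<n. of_bool (rotate j xs \<in> range degree_seq)) = (\<Sum>j<n. if j = j0 then 1 else 0 :: real)"
        by (intro sum.cong refl) (use j0 in auto)
      then show ?thesis using True j0[of j0] by simp
    next
      case False
      then have "rotate j xs \<notin> range degree_seq" for j
        by (metis rangeE walk_degree_seq walk_rotate)
      then show ?thesis using False by simp
    qed
    finally show "of_bool (walk xs = -1) * h xs = (\<Sum>j<n. ?R (rotate j xs))" by simp
  qed
  also have "\<dots> = (\<Sum>j<n. word_mean n (\<lambda>xs. ?R (rotate j xs)))"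
    by (rule Bochner_Integration.integral_sum) (rule int_rot)
  also have "\<dots> = real n * word_mean n ?R"
  proof -
    have "word_mean n (\<lambda>xs. ?R (rotate j xs)) = word_mean n ?R" for j by (rule word_mean_rotate)
    then show ?thesis by simp
  qed
  also have "word_mean n ?R = (\<Sum>xs\<in>degree_seq ` trees n. ?R xs * pmf (replicate_pmf n p) xs)"
    by (rule integral_measure_pmf_real, simp)
       (auto dest!: length_replicate_pmf simp: trees_def length_degree_seq split: if_splits)
  also have "\<dots> = tree_sum n (\<lambda>t. h (degree_seq t))"
    unfolding tree_sum_def
    by (subst sum.reindex) (auto intro: inj_on_subset[OF inj_degree_seq]
         intro!: sum.cong simp: pmf_replicate length_degree_seq trees_def tree_weight_def)
  finally show ?thesis ..
qed

text \<open>The Otter-Dwass formula: the cycle lemma applied to a constant functional.\<close>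

lemma size_prob_eq_walk_prob: "real n * size_prob n = walk_prob n (-1)"
  using tree_sum_eq_word_mean[of "\<lambda>_. 1" n] by (simp add: size_prob_def walk_prob_def)

lemma first_tree_eq_sum:
  assumes "length xs \<le> N"
  shows "first_tree f xs = (\<Sum>k\<le>N. \<Sum>t\<in>trees k. of_bool (prefix (degree_seq t) xs) * f t)"
proof (cases "\<exists>t. prefix (degree_seq t) xs")
  case False
  then show ?thesis by (simp add: first_tree_none)
next
  case True
  then obtain s where s: "prefix (degree_seq s) xs" by blast
  have eq: "prefix (degree_seq t) xs \<longleftrightarrow> t = s" for t
    using s prefix_degree_seq_unique by blast
  have "num_nodes s \<le> N"
    using prefix_length_le[OF s] assms by (simp add: length_degree_seq)
  have "(\<Sum>t\<in>trees k. of_bool (prefix (degree_seq t) xs) * f t) = (if k = num_nodes s then f s else 0)" for k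
  proof -
    have "(\<Sum>t\<in>trees k. of_bool (prefix (degree_seq t) xs) * f t) = (\<Sum>t\<in>trees k. if t = s then f t else 0)"
      by (intro sum.cong refl) (auto simp: eq)
    moreover have "s \<in> trees k \<longleftrightarrow> k = num_nodes s" by (auto simp: trees_def)
    ultimately show ?thesis by simp
  qed
  then show ?thesis using s \<open>num_nodes s \<le> N\<close> by (simp add: first_tree_eq)
qed

lemma abs_first_tree_le:
  assumes "length xs \<le> N"
  shows "\<bar>first_tree f xs\<bar> \<le> (\<Sum>k\<le>N. \<Sum>t\<in>trees k. \<bar>f t\<bar>)"
  unfolding first_tree_eq_sum[OF assms]
  by (intro order.trans[OF sum_abs] sum_mono) (auto simp: of_bool_def)

lemma word_mean_prefix:
  fixes h :: "nat list \<Rightarrow> real"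
  assumes "integrable (replicate_pmf N p) h" "num_nodes t \<le> N"
  shows "word_mean N (\<lambda>xs. of_bool (prefix (degree_seq t) xs) * h xs)
       = tree_weight p t * word_mean (N - num_nodes t) (\<lambda>zs. h (degree_seq t @ zs))"
proof -
  let ?k = "num_nodes t"
  have N: "N = ?k + (N - ?k)" using assms by simp
  have "integrable (replicate_pmf N p) (\<lambda>xs. of_bool (prefix (degree_seq t) xs) * h xs)"
    by (rule Bochner_Integration.integrable_bound[OF assms(1)]) auto
  then have "word_mean N (\<lambda>xs. of_bool (prefix (degree_seq t) xs) * h xs)
      = word_mean ?k (\<lambda>a. word_mean (N - ?k) (\<lambda>b. of_bool (prefix (degree_seq t) (a @ b)) * h (a @ b)))"
    using word_mean_append[of ?k "N - ?k"] N by simp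
  also have "\<dots> = word_mean ?k (\<lambda>a. of_bool (a = degree_seq t) * word_mean (N - ?k) (\<lambda>b. h (degree_seq t @ b)))"
  proof (intro expectation_pmf_cong)
    fix a assume "a \<in> set_pmf (replicate_pmf ?k p)"
    then have "length a = length (degree_seq t)" by (simp add: length_replicate_pmf length_degree_seq)
    then have "prefix (degree_seq t) (a @ b) \<longleftrightarrow> a = degree_seq t" for b
      by (auto simp: prefix_def)
    then show "word_mean (N - ?k) (\<lambda>b. of_bool (prefix (degree_seq t) (a @ b)) * h (a @ b))
        = of_bool (a = degree_seq t) * word_mean (N - ?k) (\<lambda>b. h (degree_seq t @ b))" by simp
  qed
  also have "\<dots> = word_mean ?k (\<lambda>a. of_bool (a = degree_seq t)) * word_mean (N - ?k) (\<lambda>b. h (degree_seq t @ b))"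
    by simp
  also have "word_mean ?k (\<lambda>a. of_bool (a = degree_seq t)) = pmf (replicate_pmf ?k p) (degree_seq t)"
    by (subst integral_measure_pmf_real[of "{degree_seq t}"]) auto
  also have "\<dots> = tree_weight p t"
    by (simp add: pmf_replicate length_degree_seq tree_weight_def)
  finally show ?thesis .
qed

text \<open>A renewal decomposition: once the leading tree is known, the remaining letters are again
  i.i.d. It is the basic tool for all moment formulas of window sums and cyclic sums below.\<close>

lemma word_mean_first_tree:
  fixes h :: "nat list \<Rightarrow> real"
  assumes "integrable (replicate_pmf N p) h"
  shows "word_mean N (\<lambda>xs. first_tree f xs * h xs)
       = (\<Sum>k\<le>N. tree_sum k (\<lambda>t. f t * word_mean (N - k) (\<lambda>zs. h (degree_seq t @ zs))))"
proof -
  have int: "integrable (replicate_pmf N p) (\<lambda>xs. of_bool (prefix (degree_seq t) xs) * h xs)" for t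
    by (rule Bochner_Integration.integrable_bound[OF assms]) auto
  have "word_mean N (\<lambda>xs. first_tree f xs * h xs)
      = word_mean N (\<lambda>xs. \<Sum>k\<le>N. \<Sum>t\<in>trees k. f t * (of_bool (prefix (degree_seq t) xs) * h xs))"
  proof (intro expectation_pmf_cong)
    fix xs assume "xs \<in> set_pmf (replicate_pmf N p)"
    then have "length xs \<le> N" by (simp add: length_replicate_pmf)
    then show "first_tree f xs * h xs = (\<Sum>k\<le>N. \<Sum>t\<in>trees k. f t * (of_bool (prefix (degree_seq t) xs) * h xs))"
      unfolding first_tree_eq_sum[OF \<open>length xs \<le> N\<close>] sum_distrib_right
      by (intro sum.cong refl) (simp only: mult_ac)
  qed
  also have "\<dots> = (\<Sum>k\<le>N. \<Sum>t\<in>trees k. f t * word_mean N (\<lambda>xs. of_bool (prefix (degree_seq t) xs) * h xs))"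
    using int by (simp add: Bochner_Integration.integral_sum)
  also have "\<dots> = (\<Sum>k\<le>N. tree_sum k (\<lambda>t. f t * word_mean (N - k) (\<lambda>zs. h (degree_seq t @ zs))))"
    unfolding tree_sum_def
    by (intro sum.cong refl) (auto simp: word_mean_prefix[OF assms] trees_def)
  finally show ?thesis .
qed

lemma integrable_first_tree:
  fixes h :: "nat list \<Rightarrow> real"
  assumes "integrable (replicate_pmf N p) h"
  shows "integrable (replicate_pmf N p) (\<lambda>xs. first_tree f xs * h xs)"
proof (rule Bochner_Integration.integrable_bound)
  let ?B = "\<Sum>k\<le>N. \<Sum>t\<in>trees k. \<bar>f t\<bar>"
  show "integrable (replicate_pmf N p) (\<lambda>xs. ?B * h xs)" using assms by simp
  have B: "0 \<le> ?B" by (intro sum_nonneg) auto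
  show "AE xs in replicate_pmf N p. norm (first_tree f xs * h xs) \<le> norm (?B * h xs)"
    using abs_first_tree_le[of _ N f] B
    by (auto simp: AE_measure_pmf_iff abs_mult dest!: length_replicate_pmf intro!: mult_right_mono)
qed simp

text \<open>After rotation every position contributes as much as the first, which cancels the factor
  \<open>n\<close> of the cycle lemma. A leading tree of size \<open>k\<close> already brings the
  walk to \<open>-1\<close>, so the other \<open>n - k\<close> letters must sum to 0.\<close>

lemma tree_sum_additive_functional:
  "tree_sum n (additive_functional f) = (\<Sum>k\<le>n. walk_prob (n - k) 0 * tree_sum k f)"
proof (cases "n = 0")
  case False
  let ?b = "\<lambda>xs. of_bool (walk xs = -1) :: real"
  have "real n * tree_sum n (additive_functional f) = word_mean n (\<lambda>xs. ?b xs * cyclic_sum f xs)"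
    using tree_sum_eq_word_mean[of "cyclic_sum f" n] by (simp add: cyclic_sum_rotate cyclic_sum_degree_seq)
  also have "\<dots> = word_mean n (\<lambda>xs. \<Sum>j<n. ?b (rotate j xs) * first_tree f (rotate j xs))"
    by (intro expectation_pmf_cong)
       (auto dest!: length_replicate_pmf simp: cyclic_sum_def sum_distrib_left)
  also have "\<dots> = (\<Sum>j<n. word_mean n (\<lambda>xs. ?b (rotate j xs) * first_tree f (rotate j xs)))"
    by (rule Bochner_Integration.integral_sum) (simp add: integrable_word_walk)
  also have "\<dots> = (\<Sum>j<n. word_mean n (\<lambda>xs. first_tree f xs * ?b xs))"
    by (simp only: word_mean_rotate[of n "\<lambda>xs. ?b xs * first_tree f xs"] mult.commute[of "first_tree f _"])
  also have "\<dots> = real n * (\<Sum>k\<le>n. tree_sum k (\<lambda>t. f t * walk_prob (n - k) 0))"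
    by (simp add: word_mean_first_tree walk_degree_seq walk_prob_def)
  finally have "tree_sum n (additive_functional f) = (\<Sum>k\<le>n. tree_sum k (\<lambda>t. f t * walk_prob (n - k) 0))"
    using False by simp
  then show ?thesis by (simp add: tree_sum_def sum_distrib_left mult_ac)
qed (simp add: tree_sum_def)

section \<open>Moments of window sums of unconditioned words\<close>

definition cut_mean :: "(plane_tree \<Rightarrow> real) \<Rightarrow> nat \<Rightarrow> real" where
  "cut_mean f N = (\<Sum>k\<le>N. tree_sum k f)"

lemma abs_window_sum_le:
  assumes "length xs \<le> N"
  shows "\<bar>window_sum f xs\<bar> \<le> real N * (\<Sum>k\<le>N. \<Sum>t\<in>trees k. \<bar>f t\<bar>)"
proof -
  have "\<bar>window_sum f xs\<bar> \<le> (\<Sum>i<length xs. \<bar>first_tree f (drop i xs)\<bar>)"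
    unfolding window_sum_def by (rule sum_abs)
  also have "\<dots> \<le> (\<Sum>i<length xs. \<Sum>k\<le>N. \<Sum>t\<in>trees k. \<bar>f t\<bar>)"
    by (intro sum_mono abs_first_tree_le) (use assms in simp)
  also have "\<dots> \<le> real N * (\<Sum>k\<le>N. \<Sum>t\<in>trees k. \<bar>f t\<bar>)"
    using assms by (simp add: mult_right_mono sum_nonneg)
  finally show ?thesis .
qed

lemma integrable_window_sum_power: "integrable (replicate_pmf N p) (\<lambda>xs. window_sum f xs ^ j)"
  by (rule integrable_pmf_bounded[where B = "(real N * (\<Sum>k\<le>N. \<Sum>t\<in>trees k. \<bar>f t\<bar>)) ^ j"])
     (auto dest!: length_replicate_pmf simp: power_abs intro!: power_mono abs_window_sum_le)

lemma integrable_window_sum: "integrable (replicate_pmf N p) (window_sum f)"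
  using integrable_window_sum_power[of N f 1] by simp

definition window_mean :: "(plane_tree \<Rightarrow> real) \<Rightarrow> nat \<Rightarrow> real" where
  "window_mean f N = word_mean N (window_sum f)"

definition window_var :: "(plane_tree \<Rightarrow> real) \<Rightarrow> nat \<Rightarrow> real" where
  "window_var f N = word_mean N (\<lambda>xs. (window_sum f xs - window_mean f N)\<^sup>2)"

lemma window_var_eq: "window_var f N = word_mean N (\<lambda>xs. (window_sum f xs)\<^sup>2) - (window_mean f N)\<^sup>2"
proof -
  have "window_var f N = word_mean N (\<lambda>xs. (window_sum f xs)\<^sup>2 - 2 * window_mean f N * window_sum f xs + (window_mean f N)\<^sup>2)"
    unfolding window_var_def by (simp add: power2_eq_square algebra_simps)
  also have "\<dots> = word_mean N (\<lambda>xs. (window_sum f xs)\<^sup>2) - 2 * window_mean f N * window_mean f N + (window_mean f N)\<^sup>2"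
    using integrable_window_sum_power[of N f 2] integrable_window_sum[of N f] by (simp add: window_mean_def)
  finally show ?thesis by (simp add: power2_eq_square)
qed

lemma window_sum_tl: "xs \<noteq> [] \<Longrightarrow> window_sum f xs = first_tree f xs + window_sum f (tl xs)"
  by (cases xs) (auto simp: window_sum_Cons)

lemma window_mean_0 [simp]: "window_mean f 0 = 0"
  by (simp add: window_mean_def)

lemma window_var_0 [simp]: "window_var f 0 = 0"
  by (simp add: window_var_def)

lemma word_mean_first_tree_1: "word_mean N (first_tree f) = cut_mean f N"
  using word_mean_first_tree[of N "\<lambda>_. 1" f] by (simp add: cut_mean_def)

lemma window_mean_Suc: "window_mean f (Suc N) = window_mean f N + cut_mean f (Suc N)"
proof -
  have "window_mean f (Suc N) = word_mean (Suc N) (\<lambda>xs. first_tree f xs + window_sum f (tl xs))"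
    unfolding window_mean_def
    by (intro expectation_pmf_cong) (auto dest!: length_replicate_pmf intro!: window_sum_tl simp del: replicate_pmf.simps)
  also have "\<dots> = cut_mean f (Suc N) + window_mean f N"
    using integrable_first_tree[of "Suc N" "\<lambda>_. 1" f] integrable_window_sum[of N f]
    by (subst Bochner_Integration.integral_add)
       (simp_all add: integrable_word_tl word_mean_tl word_mean_first_tree_1 window_mean_def del: replicate_pmf.simps)
  finally show ?thesis by simp
qed

text \<open>A new first letter adds only the tree \<open>X\<close> at the front: the square of the
  window sum \<open>W\<close> grows by \<open>X * (2 * W - X)\<close>. Given that this tree is
  \<open>t\<close>, of size \<open>k\<close>, \<open>W\<close> is
  \<open>additive_functional f t\<close> plus the window sum of the remaining independent letters,
  whose mean appears in the last term.\<close>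

lemma window_var_Suc:
  "window_var f (Suc N) = window_var f N + (cut_mean f (Suc N))\<^sup>2
     + (\<Sum>k\<le>Suc N. tree_sum k (\<lambda>t. f t * (2 * additive_functional f t - f t
         - 2 * (window_mean f (Suc N) - window_mean f (Suc N - k)))))"
proof -
  let ?N = "Suc N"
  have int: "integrable (replicate_pmf ?N p) (\<lambda>xs. 2 * window_sum f xs - first_tree f xs)"
    using integrable_first_tree[of ?N "\<lambda>_. 1" f] integrable_window_sum[of ?N f]
    by (simp del: replicate_pmf.simps)
  have "word_mean ?N (\<lambda>xs. (window_sum f xs)\<^sup>2)
      = word_mean ?N (\<lambda>xs. (window_sum f (tl xs))\<^sup>2 + first_tree f xs * (2 * window_sum f xs - first_tree f xs))"
  proof (intro expectation_pmf_cong)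
    fix xs assume "xs \<in> set_pmf (replicate_pmf ?N p)"
    then have "xs \<noteq> []" by (auto dest!: length_replicate_pmf simp del: replicate_pmf.simps)
    then show "(window_sum f xs)\<^sup>2 = (window_sum f (tl xs))\<^sup>2 + first_tree f xs * (2 * window_sum f xs - first_tree f xs)"
      by (simp add: window_sum_tl power2_eq_square algebra_simps)
  qed
  also have "\<dots> = word_mean N (\<lambda>xs. (window_sum f xs)\<^sup>2) +
      word_mean ?N (\<lambda>xs. first_tree f xs * (2 * window_sum f xs - first_tree f xs))"
    using integrable_window_sum_power[of N f 2] integrable_first_tree[OF int]
    by (subst Bochner_Integration.integral_add)
       (simp_all add: word_mean_tl[of N "\<lambda>xs. (window_sum f xs)\<^sup>2"]
          integrable_word_tl[of N "\<lambda>xs. (window_sum f xs)\<^sup>2"] del: replicate_pmf.simps)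
  also have "word_mean ?N (\<lambda>xs. first_tree f xs * (2 * window_sum f xs - first_tree f xs))
      = (\<Sum>k\<le>?N. tree_sum k (\<lambda>t. f t * (2 * additive_functional f t - f t + 2 * window_mean f (?N - k))))"
    unfolding word_mean_first_tree[OF int]
  proof (intro sum.cong refl)
    fix k
    have "word_mean (?N - k) (\<lambda>zs. 2 * window_sum f (degree_seq t @ zs) - first_tree f (degree_seq t @ zs))
        = 2 * additive_functional f t - f t + 2 * window_mean f (?N - k)" for t
      using integrable_window_sum[of "?N - k" f]
      by (simp add: window_sum_append window_mean_def)
    then show "tree_sum k (\<lambda>t. f t * word_mean (?N - k) (\<lambda>zs. 2 * window_sum f (degree_seq t @ zs) - first_tree f (degree_seq t @ zs)))
       = tree_sum k (\<lambda>t. f t * (2 * additive_functional f t - f t + 2 * window_mean f (?N - k)))" by simp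
  qed
  finally have *: "word_mean ?N (\<lambda>xs. (window_sum f xs)\<^sup>2) = word_mean N (\<lambda>xs. (window_sum f xs)\<^sup>2)
     + (\<Sum>k\<le>?N. tree_sum k (\<lambda>t. f t * (2 * additive_functional f t - f t + 2 * window_mean f (?N - k))))" .
  have "(\<Sum>k\<le>?N. tree_sum k (\<lambda>t. f t * (2 * additive_functional f t - f t
         - 2 * (window_mean f ?N - window_mean f (?N - k)))))
      = (\<Sum>k\<le>?N. tree_sum k (\<lambda>t. f t * (2 * additive_functional f t - f t + 2 * window_mean f (?N - k)))
          - 2 * window_mean f ?N * tree_sum k f)"
    unfolding tree_sum_def by (intro sum.cong refl) (simp add: algebra_simps sum_subtractf sum_distrib_left sum.distrib)
  also have "\<dots> = (\<Sum>k\<le>?N. tree_sum k (\<lambda>t. f t * (2 * additive_functional f t - f t + 2 * window_mean f (?N - k))))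
          - 2 * window_mean f ?N * cut_mean f ?N"
    by (simp add: sum_subtractf sum_distrib_left cut_mean_def del: sum.atMost_Suc)
  finally show ?thesis
    using * unfolding window_var_eq by (simp add: window_mean_Suc power2_eq_square algebra_simps del: sum.atMost_Suc)
qed

definition offspring_var :: real where "offspring_var = measure_pmf.variance p real"

lemma offspring_var_pos: "0 < offspring_var"
  using variance_pos by (simp add: offspring_var_def)

text \<open>The four claims share one induction: the cross term in the second moment of the longer
  walk vanishes by integrability and centering of the shorter one.\<close>

lemma integrable_walk: "integrable (replicate_pmf n p) (\<lambda>xs. real_of_int (walk xs))"
  and word_mean_walk: "word_mean n (\<lambda>xs. real_of_int (walk xs)) = 0"
  and integrable_walk_sq: "integrable (replicate_pmf n p) (\<lambda>xs. (real_of_int (walk xs))\<^sup>2)"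
  and word_mean_walk_sq: "word_mean n (\<lambda>xs. (real_of_int (walk xs))\<^sup>2) = real n * offspring_var"
proof -
  have int1: "integrable (measure_pmf p) (\<lambda>x. real x - 1)" and
    int2: "integrable (measure_pmf p) (\<lambda>x. (real x - 1)\<^sup>2)"
    using integrable_offspring finite_variance by (simp_all add: power2_diff)
  have mean1: "(\<integral>x. real x - 1 \<partial>p) = 0" using integrable_offspring mean_offspring by simp
  have mean2: "(\<integral>x. (real x - 1)\<^sup>2 \<partial>p) = offspring_var" by (simp add: offspring_var_def mean_offspring)
  have walk: "real_of_int (walk (x # xs)) = (real x - 1) + real_of_int (walk xs)" for x xs by simp
  have "integrable (replicate_pmf n p) (\<lambda>xs. real_of_int (walk xs)) \<and> word_mean n (\<lambda>xs. real_of_int (walk xs)) = 0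
     \<and> integrable (replicate_pmf n p) (\<lambda>xs. (real_of_int (walk xs))\<^sup>2)
     \<and> word_mean n (\<lambda>xs. (real_of_int (walk xs))\<^sup>2) = real n * offspring_var"
  proof (induction n)
    case (Suc n)
    let ?P = "pair_pmf p (replicate_pmf n p)"
    let ?w = "\<lambda>xs. real_of_int (walk xs)"
    have P: "integrable ?P (\<lambda>y. (real (fst y) - 1) * 1)" "integrable ?P (\<lambda>y. (real (fst y) - 1)\<^sup>2 * 1)"
      "integrable ?P (\<lambda>y. 1 * ?w (snd y))" "integrable ?P (\<lambda>y. 1 * (?w (snd y))\<^sup>2)"
      "integrable ?P (\<lambda>y. (real (fst y) - 1) * ?w (snd y))"
      using int1 int2 Suc
      by (intro integrable_pair_pmf_mult[where g = "\<lambda>x. real x - 1" and h = "\<lambda>_. 1"]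
        integrable_pair_pmf_mult[where g = "\<lambda>x. (real x - 1)\<^sup>2" and h = "\<lambda>_. 1"]
        integrable_pair_pmf_mult[where g = "\<lambda>_. 1" and h = ?w]
        integrable_pair_pmf_mult[where g = "\<lambda>_. 1" and h = "\<lambda>x. (?w x)\<^sup>2"]
        integrable_pair_pmf_mult[where g = "\<lambda>x. real x - 1" and h = ?w]; simp)+
    have E: "(\<integral>y. (real (fst y) - 1) \<partial>?P) = 0" "(\<integral>y. (real (fst y) - 1)\<^sup>2 \<partial>?P) = offspring_var"
      "(\<integral>y. ?w (snd y) \<partial>?P) = 0" "(\<integral>y. (?w (snd y))\<^sup>2 \<partial>?P) = real n * offspring_var"
      using Suc mean1 mean2 by (simp_all add: expectation_pair_pmf_fst[where f = "\<lambda>x. real x - 1"]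
         expectation_pair_pmf_fst[where f = "\<lambda>x. (real x - 1)\<^sup>2"]
         expectation_pair_pmf_snd[where f = ?w] expectation_pair_pmf_snd[where f = "\<lambda>x. (?w x)\<^sup>2"]
        del: expectation_pair_pmf_fst expectation_pair_pmf_snd)
    have X: "(\<integral>y. (real (fst y) - 1) * ?w (snd y) \<partial>?P) = 0"
      using integral_pair_pmf[OF P(5)] Suc by simp
    have w: "?w (case y of (x, xs) \<Rightarrow> x # xs) = (real (fst y) - 1) + ?w (snd y)" for y
      by (cases y) simp
    have w2: "(?w (case y of (x, xs) \<Rightarrow> x # xs))\<^sup>2
       = (real (fst y) - 1)\<^sup>2 + (?w (snd y))\<^sup>2 + 2 * ((real (fst y) - 1) * ?w (snd y))" for y
      unfolding w by (simp add: power2_sum)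
    define g where "g y = real (fst y) - 1" for y :: "nat \<times> nat list"
    show ?case
      unfolding replicate_pmf_Suc_pair integrable_map_pmf_eq integral_map_pmf w2
      unfolding w
      using P E X by (simp add: distrib_right flip: g_def)
  qed (auto intro!: integrable_measure_pmf_finite)
  then show "integrable (replicate_pmf n p) (\<lambda>xs. real_of_int (walk xs))"
    "word_mean n (\<lambda>xs. real_of_int (walk xs)) = 0"
    "integrable (replicate_pmf n p) (\<lambda>xs. (real_of_int (walk xs))\<^sup>2)"
    "word_mean n (\<lambda>xs. (real_of_int (walk xs))\<^sup>2) = real n * offspring_var" by auto
qed

lemma integrable_window_sum_walk: "integrable (replicate_pmf N p) (\<lambda>xs. window_sum f xs * real_of_int (walk xs))"
proof (rule Bochner_Integration.integrable_bound)
  define B where "B = real N * (\<Sum>k\<le>N. \<Sum>t\<in>trees k. \<bar>f t\<bar>)"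
  show "integrable (replicate_pmf N p) (\<lambda>xs. B * real_of_int (walk xs))" using integrable_walk by simp
  have B: "0 \<le> B" unfolding B_def by (intro mult_nonneg_nonneg sum_nonneg) auto
  have W: "\<bar>window_sum f xs\<bar> \<le> B" if "length xs = N" for xs
    using abs_window_sum_le[of xs N f] that by (simp add: B_def)
  show "AE xs in replicate_pmf N p. norm (window_sum f xs * real_of_int (walk xs)) \<le> norm (B * real_of_int (walk xs))"
    using W B by (auto simp: AE_measure_pmf_iff abs_mult dest!: length_replicate_pmf intro!: mult_right_mono)
qed simp

text \<open>A tree at the front forces the walk down by 1 and the later steps are centered, so it
  contributes \<open>- cut_mean\<close>; the first letter is independent of the windows behind it.
  This covariance with the walk is what conditioning on the endpoint turns into the correction
  \<open>- \<mu>\<^sup>2 / \<sigma>2\<close>.\<close>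

lemma word_mean_window_sum_walk:
  "word_mean N (\<lambda>xs. window_sum f xs * real_of_int (walk xs)) = - window_mean f N"
proof (induction N)
  case (Suc N)
  let ?w = "\<lambda>xs. real_of_int (walk xs)"
  have hd: "integrable (replicate_pmf (1 + N) p) (\<lambda>xs. ?w (take 1 xs) * window_sum f (drop 1 xs))"
    and hd0: "word_mean (1 + N) (\<lambda>xs. ?w (take 1 xs) * window_sum f (drop 1 xs)) = 0"
    using integrable_word_take_drop[OF integrable_walk[of 1] integrable_window_sum[of N f]]
      word_mean_take_drop[OF integrable_walk[of 1] integrable_window_sum[of N f]] word_mean_walk[of 1]
    by (simp_all only: mult_zero_left)
  have "word_mean (Suc N) (\<lambda>xs. window_sum f xs * ?w xs) =
    word_mean (Suc N) (\<lambda>xs. first_tree f xs * ?w xs + (?w (take 1 xs) * window_sum f (drop 1 xs)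
        + window_sum f (tl xs) * ?w (tl xs)))"
  proof (intro expectation_pmf_cong)
    fix xs assume "xs \<in> set_pmf (replicate_pmf (Suc N) p)"
    then obtain y ys where "xs = y # ys"
      by (auto dest!: length_replicate_pmf simp: length_Suc_conv simp del: replicate_pmf.simps)
    then show "window_sum f xs * ?w xs = first_tree f xs * ?w xs + (?w (take 1 xs) * window_sum f (drop 1 xs)
        + window_sum f (tl xs) * ?w (tl xs))"
      by (simp add: window_sum_Cons algebra_simps)
  qed
  also have "\<dots> = word_mean (Suc N) (\<lambda>xs. first_tree f xs * ?w xs) + (0 + word_mean N (\<lambda>xs. window_sum f xs * ?w xs))"
    using integrable_first_tree[OF integrable_walk, of "Suc N" f] hd hd0 integrable_window_sum_walk[of N f]
    by (simp add: word_mean_tl[of N "\<lambda>xs. window_sum f xs * ?w xs"]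
          integrable_word_tl[of N "\<lambda>xs. window_sum f xs * ?w xs"] del: replicate_pmf.simps)
  also have "word_mean (Suc N) (\<lambda>xs. first_tree f xs * ?w xs) = - cut_mean f (Suc N)"
  proof -
    have "word_mean m (\<lambda>zs. ?w (degree_seq t @ zs)) = -1" for m t
      using integrable_walk[of m] word_mean_walk[of m] by (simp add: walk_degree_seq)
    then show ?thesis
      unfolding word_mean_first_tree[OF integrable_walk]
      by (simp add: cut_mean_def tree_sum_def sum_negf del: sum.atMost_Suc)
  qed
  finally show ?case using Suc by (simp add: window_mean_Suc)
qed simp

end

section \<open>Local limit estimates\<close>

lemma cmod_cis_diff_1_le: "cmod (cis y - 1) \<le> \<bar>y\<bar>"
  using iexp_approx1[of y 0] by (simp add: cis_conv_exp)

lemma cmod_cis_diff_le: "cmod (cis x - cis y) \<le> \<bar>x - y\<bar>"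
proof -
  have "cis x - cis y = cis y * (cis (x - y) - 1)" by (simp add: algebra_simps cis_mult)
  then show ?thesis using cmod_cis_diff_1_le[of "x - y"] by (simp add: norm_mult)
qed

lemma cmod_cis_approx1: "cmod (cis y - 1 - \<i> * y) \<le> y\<^sup>2 / 2"
  using iexp_approx1[of y 1] by (simp add: cis_conv_exp fact_numeral algebra_simps power2_eq_square)

lemma cmod_cis_approx2: "cmod (cis y - 1 - \<i> * y + complex_of_real (y\<^sup>2 / 2)) \<le> \<bar>y\<bar> ^ 3 / 6"
  using iexp_approx1[of y 2]
  by (simp add: cis_conv_exp fact_numeral numeral_2_eq_2 numeral_3_eq_3 algebra_simps power2_eq_square)

lemma borel_measurable_cis [measurable]: "cis \<in> borel_measurable borel"
  by (intro borel_measurable_continuous_onI) (auto intro!: continuous_intros)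

lemma integrable_pmf_square:
  fixes h :: "'a \<Rightarrow> real"
  assumes "integrable (measure_pmf M) (\<lambda>x. (h x)\<^sup>2)"
  shows "integrable (measure_pmf M) h"
proof (rule Bochner_Integration.integrable_bound)
  show "integrable (measure_pmf M) (\<lambda>x. 1 + (h x)\<^sup>2)" using assms by simp
  have "\<bar>y\<bar> \<le> 1 + y\<^sup>2" for y :: real
  proof -
    have "2 * \<bar>y\<bar> \<le> 1 + \<bar>y\<bar>\<^sup>2" using zero_le_power2[of "\<bar>y\<bar> - 1"] by (simp only: power2_diff) simp
    then show ?thesis by simp
  qed
  then show "AE x in measure_pmf M. norm (h x) \<le> norm (1 + (h x)\<^sup>2)" by simp
qed simp

lemma norm_expectation_le:
  fixes f :: "'a \<Rightarrow> 'b::{banach, second_countable_topology}"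
  assumes "integrable (measure_pmf M) g" "\<And>x. x \<in> set_pmf M \<Longrightarrow> norm (f x) \<le> g x"
  shows "norm (measure_pmf.expectation M f) \<le> measure_pmf.expectation M g"
proof -
  have "integrable (measure_pmf M) (\<lambda>x. norm (f x))"
    by (rule Bochner_Integration.integrable_bound[OF assms(1)])
       (use assms(2) in \<open>force simp: AE_measure_pmf_iff\<close>)+
  then have "measure_pmf.expectation M (\<lambda>x. norm (f x)) \<le> measure_pmf.expectation M g"
    using assms by (intro integral_mono_AE) (auto simp: AE_measure_pmf_iff)
  then show ?thesis using integral_norm_bound[of "measure_pmf M" f] by linarith
qed

lemma integrable_cis [simp]: "integrable (measure_pmf M) (\<lambda>x. cis (h x))"
  by (rule integrable_pmf_bounded[of _ _ 1]) simp

lemma expectation_abs_le_sqrt: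
  fixes h :: "'a \<Rightarrow> real"
  assumes "integrable (measure_pmf M) (\<lambda>x. (h x)\<^sup>2)"
  shows "measure_pmf.expectation M (\<lambda>x. \<bar>h x\<bar>) \<le> sqrt (measure_pmf.expectation M (\<lambda>x. (h x)\<^sup>2))"
proof -
  have "0 \<le> measure_pmf.variance M (\<lambda>x. \<bar>h x\<bar>)" by (intro integral_nonneg_AE) simp
  also have "\<dots> = measure_pmf.expectation M (\<lambda>x. \<bar>h x\<bar>\<^sup>2) - (measure_pmf.expectation M (\<lambda>x. \<bar>h x\<bar>))\<^sup>2"
    using assms integrable_pmf_square[OF assms] by (subst measure_pmf.variance_eq) auto
  finally show ?thesis by (intro real_le_rsqrt) simp
qed

text \<open>With only a second moment at hand, the two Taylor bounds share the work: the cubic one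
  gives convergence for each fixed \<open>x\<close>, the quadratic one gives the dominating
  function. The limit at 0 over real \<open>c\<close> serves both the decay of the characteristic
  function near 0 and its scaling limit.\<close>

lemma char_quadratic_at_0:
  fixes h :: "'a \<Rightarrow> real"
  assumes sq: "integrable (measure_pmf M) (\<lambda>x. (h x)\<^sup>2)" and mean: "measure_pmf.expectation M h = 0"
  shows "((\<lambda>c. (measure_pmf.expectation M (\<lambda>x. cis (c * h x)) - 1) / complex_of_real (c\<^sup>2))
     \<longlongrightarrow> complex_of_real (- measure_pmf.expectation M (\<lambda>x. (h x)\<^sup>2) / 2)) (at 0)"
  unfolding tendsto_at_iff_sequentially comp_def
proof safe
  fix X :: "nat \<Rightarrow> real"
  assume X0: "\<forall>i. X i \<in> UNIV - {0}" and X: "X \<longlonglongrightarrow> 0"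
  note int = integrable_pmf_square[OF sq]
  have nz: "X n \<noteq> 0" for n using X0 by simp
  let ?g = "\<lambda>n x. (cis (X n * h x) - 1 - \<i> * complex_of_real (X n * h x)) / complex_of_real ((X n)\<^sup>2)"
  have "(\<lambda>n. measure_pmf.expectation M (?g n)) \<longlonglongrightarrow> measure_pmf.expectation M (\<lambda>x. complex_of_real (- (h x)\<^sup>2 / 2))"
  proof (rule integral_dominated_convergence[where w = "\<lambda>x. (h x)\<^sup>2 / 2"])
    show "AE x in M. (\<lambda>n. ?g n x) \<longlonglongrightarrow> complex_of_real (- (h x)\<^sup>2 / 2)"
    proof (rule AE_pmfI)
      fix x
      have "(\<lambda>n. ?g n x - complex_of_real (- (h x)\<^sup>2 / 2)) \<longlonglongrightarrow> 0"
      proof (rule Lim_null_comparison)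
        show "\<forall>\<^sub>F n in sequentially. norm (?g n x - complex_of_real (- (h x)\<^sup>2 / 2)) \<le> \<bar>X n\<bar> * (\<bar>h x\<bar> ^ 3 / 6)"
        proof (rule always_eventually, rule allI)
          fix n
          let ?y = "X n * h x"
          have "?g n x - complex_of_real (- (h x)\<^sup>2 / 2)
              = (cis ?y - 1 - \<i> * complex_of_real ?y + complex_of_real (?y\<^sup>2 / 2)) / complex_of_real ((X n)\<^sup>2)"
            using nz[of n] by (simp add: field_simps power_mult_distrib)
          then have "norm (?g n x - complex_of_real (- (h x)\<^sup>2 / 2)) \<le> (\<bar>?y\<bar> ^ 3 / 6) / (X n)\<^sup>2"
            using cmod_cis_approx2[of ?y] by (simp only: norm_divide norm_of_real abs_power2) (intro divide_right_mono, auto)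
          also have "\<dots> = \<bar>X n\<bar> * (\<bar>h x\<bar> ^ 3 / 6)"
          proof -
            have "\<bar>?y\<bar> ^ 3 = \<bar>X n\<bar>\<^sup>2 * (\<bar>X n\<bar> * \<bar>h x\<bar> ^ 3)"
              by (simp only: abs_mult power_mult_distrib numeral_3_eq_3 power2_eq_square power_Suc power_0) (simp only: mult_ac)
            then show ?thesis using nz[of n] by simp
          qed
          finally show "norm (?g n x - complex_of_real (- (h x)\<^sup>2 / 2)) \<le> \<bar>X n\<bar> * (\<bar>h x\<bar> ^ 3 / 6)" .
        qed
        show "(\<lambda>n. \<bar>X n\<bar> * (\<bar>h x\<bar> ^ 3 / 6)) \<longlonglongrightarrow> 0"
          using X by (intro tendsto_mult_left_zero tendsto_rabs_zero)
      qed
      then show "(\<lambda>n. ?g n x) \<longlonglongrightarrow> complex_of_real (- (h x)\<^sup>2 / 2)" by (simp only: LIM_zero_iff)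
    qed
    show "AE x in M. norm (?g n x) \<le> (h x)\<^sup>2 / 2" for n
    proof (rule AE_pmfI)
      fix x
      have "norm (?g n x) \<le> ((X n * h x)\<^sup>2 / 2) / (X n)\<^sup>2"
        using cmod_cis_approx1[of "X n * h x"]
        by (simp only: norm_divide norm_of_real abs_power2) (intro divide_right_mono, auto)
      then show "norm (?g n x) \<le> (h x)\<^sup>2 / 2" using nz[of n] by (simp add: power_mult_distrib)
    qed
  qed (use sq in auto)
  moreover have "measure_pmf.expectation M (?g n)
     = (measure_pmf.expectation M (\<lambda>x. cis (X n * h x)) - 1) / complex_of_real ((X n)\<^sup>2)" for n
  proof -
    have "(\<integral>x. complex_of_real (X n * h x) \<partial>M) = complex_of_real (X n * measure_pmf.expectation M h)"
      by (subst integral_complex_of_real) simp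
    moreover have "integrable M (\<lambda>x. complex_of_real (X n * h x))"
      using int by (intro integrable_of_real) auto
    ultimately show ?thesis using mean by (simp del: of_real_mult)
  qed
  moreover have "measure_pmf.expectation M (\<lambda>x. complex_of_real (- (h x)\<^sup>2 / 2))
      = complex_of_real (- measure_pmf.expectation M (\<lambda>x. (h x)\<^sup>2) / 2)"
    by (subst integral_complex_of_real) simp
  ultimately show "(\<lambda>n. (measure_pmf.expectation M (\<lambda>x. cis (X n * h x)) - 1) / complex_of_real ((X n)\<^sup>2))
     \<longlonglongrightarrow> complex_of_real (- measure_pmf.expectation M (\<lambda>x. (h x)\<^sup>2) / 2)" by (simp only:)
qed

lemma char_quadratic:
  fixes h :: "'a \<Rightarrow> real"
  assumes "integrable (measure_pmf M) (\<lambda>x. (h x)\<^sup>2)" "measure_pmf.expectation M h = 0"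
  shows "(\<lambda>n. of_nat n * (measure_pmf.expectation M (\<lambda>x. cis (h x / sqrt (real n))) - 1))
     \<longlonglongrightarrow> complex_of_real (- measure_pmf.expectation M (\<lambda>x. (h x)\<^sup>2) / 2)"
proof -
  have "filterlim (\<lambda>n. 1 / sqrt (real n)) (at 0) sequentially"
    by (rule filterlim_atI) (real_asymp, auto intro!: eventually_sequentiallyI[of 1])
  from filterlim_compose[OF char_quadratic_at_0[OF assms] this]
  show ?thesis
    by (rule Lim_transform_eventually)
       (auto intro!: eventually_sequentiallyI[of 1] simp: power_divide field_simps)
qed

text \<open>In the unit disc two \<open>N\<close>-th powers differ by at most \<open>N\<close> times
  the difference of the bases. The comparison is with \<open>exp (z / n)\<close>, which stays in the
  disc because \<open>z \<le> 0\<close>; no complex logarithm is involved.\<close>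

lemma power_limit_exp:
  fixes w :: "nat \<Rightarrow> complex"
  assumes w: "\<And>n. norm (w n) \<le> 1" and lim: "(\<lambda>n. of_nat n * (w n - 1)) \<longlonglongrightarrow> complex_of_real z" and z: "z \<le> 0"
    and N: "(\<lambda>n. real (N n) / real n) \<longlonglongrightarrow> \<alpha>"
  shows "(\<lambda>n. w n ^ N n) \<longlonglongrightarrow> complex_of_real (exp (\<alpha> * z))"
proof -
  let ?e = "\<lambda>n. complex_of_real (exp (z / real n))"
  have "(\<lambda>n. real n * (exp (z / real n) - 1)) \<longlonglongrightarrow> z"
    by real_asymp
  then have "(\<lambda>n. complex_of_real (real n * (exp (z / real n) - 1))) \<longlonglongrightarrow> complex_of_real z"
    by (rule tendsto_of_real)
  then have "(\<lambda>n. of_nat n * (w n - 1) - complex_of_real (real n * (exp (z / real n) - 1))) \<longlonglongrightarrow> complex_of_real z - complex_of_real z"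
    by (intro tendsto_diff lim)
  then have "(\<lambda>n. real (N n) / real n * norm (of_nat n * (w n - 1) - complex_of_real (real n * (exp (z / real n) - 1)))) \<longlonglongrightarrow> \<alpha> * norm (0 :: complex)"
    by (intro tendsto_mult N tendsto_norm) simp
  then have bound: "(\<lambda>n. real (N n) / real n * norm (of_nat n * (w n - 1) - complex_of_real (real n * (exp (z / real n) - 1)))) \<longlonglongrightarrow> 0"
    by simp
  have "(\<lambda>n. w n ^ N n - ?e n ^ N n) \<longlonglongrightarrow> 0"
  proof (rule Lim_null_comparison[OF _ bound])
    show "\<forall>\<^sub>F n in sequentially. norm (w n ^ N n - ?e n ^ N n) \<le>
       real (N n) / real n * norm (of_nat n * (w n - 1) - complex_of_real (real n * (exp (z / real n) - 1)))"
      using eventually_gt_at_top[of 0]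
    proof eventually_elim
      case (elim n)
      have "norm (w n ^ N n - ?e n ^ N n) \<le> real (N n) * norm (w n - ?e n)"
        by (rule norm_power_diff) (use w z in \<open>auto simp: divide_nonpos_nonneg\<close>)
      also have "\<dots> = real (N n) / real n * norm (of_nat n * (w n - ?e n))"
        using elim by (simp add: norm_mult)
      also have "of_nat n * (w n - ?e n) = of_nat n * (w n - 1) - complex_of_real (real n * (exp (z / real n) - 1))"
        by (simp add: algebra_simps)
      finally show ?case .
    qed
  qed
  moreover have "(\<lambda>n. ?e n ^ N n) \<longlonglongrightarrow> complex_of_real (exp (\<alpha> * z))"
  proof -
    have "?e n ^ N n = complex_of_real (exp (real (N n) * (z / real n)))" for n
      by (simp only: exp_of_nat_mult of_real_power)
    moreover have "(\<lambda>n. complex_of_real (exp (real (N n) / real n * z))) \<longlonglongrightarrow> complex_of_real (exp (\<alpha> * z))"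
      by (intro tendsto_intros N)
    ultimately show ?thesis by (simp add: mult.commute)
  qed
  ultimately show ?thesis using tendsto_add by fastforce
qed

lemma char_power_limit:
  fixes h :: "'a \<Rightarrow> real"
  assumes "integrable (measure_pmf M) (\<lambda>x. (h x)\<^sup>2)" "measure_pmf.expectation M h = 0"
    and "(\<lambda>n. real (N n) / real n) \<longlonglongrightarrow> \<alpha>"
  shows "(\<lambda>n. measure_pmf.expectation M (\<lambda>x. cis (h x / sqrt (real n))) ^ N n)
     \<longlonglongrightarrow> complex_of_real (exp (- \<alpha> * measure_pmf.expectation M (\<lambda>x. (h x)\<^sup>2) / 2))"
proof -
  have "norm (measure_pmf.expectation M (\<lambda>x. cis (h x / sqrt (real n)))) \<le> 1" for n
  proof -
    have "norm (measure_pmf.expectation M (\<lambda>x. cis (h x / sqrt (real n)))) \<le> measure_pmf.expectation M (\<lambda>x. norm (cis (h x / sqrt (real n))))"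
      by (rule integral_norm_bound)
    then show ?thesis by simp
  qed
  from power_limit_exp[OF this char_quadratic[OF assms(1,2)] _ assms(3)] show ?thesis
    by (simp add: divide_nonpos_nonneg)
qed

text \<open>Orthogonality of the characters of a lattice of span \<open>d\<close> over one period of
  the dual group.\<close>

lemma integral_cis_period:
  fixes d :: nat and i :: int
  assumes d: "d > 0" "int d dvd i"
  shows "(LINT t:{-pi/d..pi/d}|lborel. cis (t * of_int i)) = (if i = 0 then 2 * pi / d else 0)"
proof (cases "i = 0")
  case False
  obtain j where j: "i = int d * j" using d by (auto elim: dvdE)
  let ?F = "\<lambda>t. cis (t * of_int i) / (\<i> * of_int i)"
  have "(LINT t:{-pi/d..pi/d}|lborel. cis (t * of_int i)) = ?F (pi/d) - ?F (-pi/d)"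
    unfolding set_lebesgue_integral_def
  proof (rule integral_FTC_atLeastAtMost)
    show "-pi/d \<le> pi/d" using d by (simp add: field_simps)
    show "continuous_on {-pi/d..pi/d} (\<lambda>t. cis (t * of_int i))" by (intro continuous_intros)
    fix t
    have "((iexp \<circ> (\<lambda>t. t * of_int i)) has_vector_derivative (real_of_int i *\<^sub>R (\<i> * iexp (t * of_int i)))) (at t within {-pi/d..pi/d})"
      by (rule vector_diff_chain_within) (auto intro!: derivative_eq_intros has_vector_derivative_iexp)
    then have "((\<lambda>t. iexp (t * of_int i)) has_vector_derivative (of_int i * (\<i> * iexp (t * of_int i)))) (at t within {-pi/d..pi/d})"
      by (simp add: comp_def scaleR_conv_of_real)
    then show "(?F has_vector_derivative cis (t * of_int i)) (at t within {-pi/d..pi/d})"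
      using False unfolding cis_conv_exp by (auto dest: has_vector_derivative_divide[of _ _ _ "\<i> * of_int i"] simp: mult_ac)
  qed
  also have "\<dots> = 0"
  proof -
    have "cis (pi/d * of_int i) = cis (-pi/d * of_int i)"
    proof -
      have "pi/d * of_int i = pi * of_int j" "-pi/d * of_int i = - (pi * of_int j)"
        using d by (simp_all add: j field_simps)
      then show ?thesis by (simp only:) (simp add: complex_eq_iff mult.commute)
    qed
    then show ?thesis by simp
  qed
  finally show ?thesis using False by simp
qed (use d in \<open>simp add: set_lebesgue_integral_def scaleR_conv_of_real field_simps\<close>)

context critical_offspring
begin

text \<open>The offspring law may be periodic. As 0 is a possible offspring number, the gcd of the
  support is the lattice span of the law, and a walk of \<open>n\<close> steps lives on the residue
  class of \<open>- n\<close> modulo it.\<close>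

definition span :: nat where "span = Gcd (set_pmf p)"

lemma span_pos: "0 < span"
proof -
  obtain k where "k \<ge> 2" "0 < pmf p k" using exists_offspring_ge_2 by blast
  then have "span dvd k" "0 < k" by (auto simp: span_def set_pmf_iff intro!: Gcd_dvd)
  then show ?thesis by (metis dvd_pos_nat)
qed

definition freq_scale :: real where "freq_scale = span / (2 * pi)"

lemma freq_scale_pos: "0 < freq_scale"
  using span_pos by (simp add: freq_scale_def)

lemma span_dvd_walk:
  assumes "xs \<in> set_pmf (replicate_pmf n p)" shows "int span dvd walk xs + int n"
proof -
  have "set xs \<subseteq> set_pmf p" "length xs = n" using assms by (auto simp: set_replicate_pmf)
  moreover have "set ys \<subseteq> set_pmf p \<Longrightarrow> span dvd sum_list ys" for ys
    by (induction ys) (auto simp: span_def)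
  ultimately show ?thesis by (simp add: walk_def)
qed

lemma walk_prob_eq_0: "\<not> int span dvd i + int n \<Longrightarrow> walk_prob n i = 0"
  unfolding walk_prob_def using span_dvd_walk
  by (intro integral_eq_zero_AE) (auto simp: AE_measure_pmf_iff)

lemma span_dvd_of_size_prob: "0 < size_prob n \<Longrightarrow> int span dvd int n - 1"
proof (rule ccontr)
  assume *: "0 < size_prob n" "\<not> int span dvd int n - 1"
  then have "walk_prob n (-1) = 0" by (intro walk_prob_eq_0) simp
  then show False using * size_prob_eq_walk_prob[of n] by (cases "n = 0") auto
qed

section \<open>The characteristic function of a step, and Fourier inversion\<close>

definition step_cf :: "real \<Rightarrow> complex" where
  "step_cf t = measure_pmf.expectation p (\<lambda>k. cis (t * (real k - 1)))"

lemma word_mean_mult_bounded: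
  fixes g h :: "nat list \<Rightarrow> complex"
  assumes "\<And>xs. norm (g xs) \<le> 1" "\<And>xs. norm (h xs) \<le> 1"
  shows "word_mean (m + n) (\<lambda>xs. g (take m xs) * h (drop m xs)) = word_mean m g * word_mean n h"
proof -
  have "integrable (replicate_pmf (m + n) p) (\<lambda>xs. g (take m xs) * h (drop m xs))"
    using assms by (intro integrable_pmf_bounded[of _ _ 1]) (auto simp: norm_mult intro!: mult_le_one)
  then have "word_mean (m + n) (\<lambda>xs. g (take m xs) * h (drop m xs))
      = word_mean m (\<lambda>a. word_mean n (\<lambda>b. g (take m (a @ b)) * h (drop m (a @ b))))"
    by (rule word_mean_append)
  also have "\<dots> = word_mean m (\<lambda>a. word_mean n (\<lambda>b. g a * h b))"
    by (intro expectation_pmf_cong) (auto dest!: length_replicate_pmf)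
  finally show ?thesis by simp
qed

lemma word_mean_cis_walk: "word_mean n (\<lambda>xs. cis (t * real_of_int (walk xs))) = step_cf t ^ n"
proof (induction n)
  case (Suc n)
  let ?c = "\<lambda>xs. cis (t * real_of_int (walk xs))"
  have "?c xs = ?c (take 1 xs) * ?c (drop 1 xs)" for xs
    using walk_simps(3)[of "take 1 xs" "drop 1 xs"]
    by (simp only: append_take_drop_id) (simp add: cis_mult distrib_left)
  then have "word_mean (1 + n) ?c = word_mean (1 + n) (\<lambda>xs. ?c (take 1 xs) * ?c (drop 1 xs))"
    by (intro expectation_pmf_cong)
  also have "\<dots> = word_mean 1 ?c * word_mean n ?c"
    by (rule word_mean_mult_bounded) auto
  also have "word_mean 1 ?c = step_cf t"
    by (simp add: step_cf_def replicate_pmf_1 map_pmf_def[symmetric])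
  finally show ?case using Suc by simp
qed simp

lemma integrable_step: "integrable (measure_pmf p) (\<lambda>k. real k - 1)"
  and mean_step: "(\<integral>k. real k - 1 \<partial>p) = 0"
  and integrable_step_sq: "integrable (measure_pmf p) (\<lambda>k. (real k - 1)\<^sup>2)"
  and mean_step_sq: "(\<integral>k. (real k - 1)\<^sup>2 \<partial>p) = offspring_var"
  using integrable_offspring mean_offspring finite_variance
  by (auto simp: power2_diff offspring_var_def)

lemma cmod_step_cf_le_1: "cmod (step_cf t) \<le> 1"
proof -
  have "cmod (step_cf t) \<le> (\<integral>k. cmod (cis (t * (real k - 1))) \<partial>p)"
    unfolding step_cf_def by (rule integral_norm_bound)
  then show ?thesis by simp
qed

lemma step_cf_0 [simp]: "step_cf 0 = 1" by (simp add: step_cf_def)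

lemma continuous_on_step_cf: "continuous_on A step_cf"
proof -
  let ?L = "\<integral>k. \<bar>real k - 1\<bar> \<partial>p"
  have "?L-lipschitz_on UNIV step_cf"
  proof (rule lipschitz_onI)
    fix s t
    have "step_cf s - step_cf t = (\<integral>k. cis (s * (real k - 1)) - cis (t * (real k - 1)) \<partial>p)"
      by (simp add: step_cf_def)
    also have "cmod \<dots> \<le> (\<integral>k. \<bar>s - t\<bar> * \<bar>real k - 1\<bar> \<partial>p)"
    proof (rule norm_expectation_le)
      show "cmod (cis (s * (real k - 1)) - cis (t * (real k - 1))) \<le> \<bar>s - t\<bar> * \<bar>real k - 1\<bar>" for k
        using cmod_cis_diff_le[of "s * (real k - 1)" "t * (real k - 1)"]
        by (simp only: abs_mult left_diff_distrib[symmetric])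
    qed (use integrable_step in auto)
    finally show "dist (step_cf s) (step_cf t) \<le> ?L * dist s t"
      by (simp add: dist_norm mult.commute)
  qed (auto intro!: integral_nonneg_AE)
  then show ?thesis using lipschitz_on_continuous_on continuous_on_subset by blast
qed

lemma measurable_step_cf [measurable]: "step_cf \<in> borel_measurable borel"
  using continuous_on_step_cf by (rule borel_measurable_continuous_onI)

lemma cmod_1_minus_step_cf_le: "cmod (1 - step_cf t) \<le> offspring_var / 2 * t\<^sup>2"
proof -
  have "step_cf t - 1 = (\<integral>k. cis (t * (real k - 1)) - 1 - \<i> * complex_of_real (t * (real k - 1)) \<partial>p)"
  proof -
    have "(\<integral>k. cis (t * (real k - 1)) - 1 - \<i> * complex_of_real (t * (real k - 1)) \<partial>p)
      = step_cf t - 1 - \<i> * (\<integral>k. complex_of_real (t * (real k - 1)) \<partial>p)"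
      using integrable_step by (simp add: step_cf_def del: of_real_mult of_real_diff)
    also have "(\<integral>k. complex_of_real (t * (real k - 1)) \<partial>p) = 0"
      using mean_step by (subst integral_complex_of_real) simp
    finally show ?thesis by simp
  qed
  also have "cmod \<dots> \<le> (\<integral>k. (t * (real k - 1))\<^sup>2 / 2 \<partial>p)"
    using integrable_step_sq by (intro norm_expectation_le cmod_cis_approx1) (simp add: power_mult_distrib)
  also have "\<dots> = offspring_var / 2 * t\<^sup>2"
    using mean_step_sq by (simp add: power_mult_distrib mult.commute)
  finally show ?thesis by (simp add: norm_minus_commute)
qed

text \<open>On possible words \<open>walk xs - i\<close> is a multiple of \<open>span\<close>, so
  integrating over one period isolates the event that it is 0. The factor \<open>h\<close> allows
  the same identity to be used for the law of the walk and for characteristic functions of sums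
  conditioned on the endpoint.\<close>

lemma fourier_inversion:
  fixes h :: "nat list \<Rightarrow> complex"
  assumes h: "\<And>xs. norm (h xs) \<le> 1" and i: "int span dvd i + int n"
  shows "word_mean n (\<lambda>xs. of_bool (walk xs = i) * h xs)
    = complex_of_real freq_scale * (LINT t:{-pi/span..pi/span}|lborel. word_mean n (\<lambda>xs. h xs * cis (t * of_int (walk xs - i))))"
proof -
  let ?I = "{-pi/span..pi/span}"
  let ?P = "measure_pmf (replicate_pmf n p)"
  let ?f = "\<lambda>t xs. indicator ?I t *\<^sub>R (h xs * cis (t * of_int (walk xs - i)))"
  interpret pair_sigma_finite lborel ?P ..
  have meas: "case_prod ?f \<in> borel_measurable (lborel \<Otimes>\<^sub>M ?P)"
  proof -
    have "case_prod ?f \<in> borel_measurable (lborel \<Otimes>\<^sub>M count_space UNIV)"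
      by (subst measurable_pair_swap_iff) (rule measurable_pair_measure_countable1, auto)
    then show ?thesis by (simp cong: measurable_cong_sets sets_pair_measure_cong)
  qed
  have int: "integrable (lborel \<Otimes>\<^sub>M ?P) (case_prod ?f)"
  proof (rule Fubini_integrable[OF meas])
    have "(\<integral>xs. norm (?f t xs) \<partial>?P) = (\<integral>xs. norm (h xs) \<partial>?P) * indicator ?I t" for t
      by (simp add: norm_mult indicator_def)
    then show "integrable lborel (\<lambda>x. \<integral>y. norm (case (x, y) of (x, y) \<Rightarrow> ?f x y) \<partial>?P)"
      by (simp only: prod.case) (simp add: integrable_real_indicator)
    show "AE x in lborel. integrable ?P (\<lambda>y. case (x, y) of (x, y) \<Rightarrow> ?f x y)"
      using h by (intro always_eventually allI integrable_pmf_bounded[of _ _ 1]) (auto simp: norm_mult indicator_def)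
  qed
  have "(LINT t:?I|lborel. word_mean n (\<lambda>xs. h xs * cis (t * of_int (walk xs - i)))) = (\<integral>t. \<integral>xs. ?f t xs \<partial>?P \<partial>lborel)"
    by (simp add: set_lebesgue_integral_def)
  also have "\<dots> = (\<integral>xs. \<integral>t. ?f t xs \<partial>lborel \<partial>?P)"
    using Fubini_integral[OF int] by simp
  also have "\<dots> = (\<integral>xs. complex_of_real (2 * pi / span) * (of_bool (walk xs = i) * h xs) \<partial>?P)"
  proof (rule expectation_pmf_cong)
    fix xs assume "xs \<in> set_pmf (replicate_pmf n p)"
    then have "int span dvd (walk xs + int n) - (i + int n)" using i span_dvd_walk by (intro dvd_diff) auto
    then have "int span dvd walk xs - i" by simp
    from integral_cis_period[OF span_pos this]
    have "(LINT t:?I|lborel. cis (t * of_int (walk xs - i))) = complex_of_real (2 * pi / span) * of_bool (walk xs = i)" by auto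
    moreover have "?f t xs = h xs * (indicator ?I t *\<^sub>R cis (t * of_int (walk xs - i)))" for t
      by simp
    then have "(\<integral>t. ?f t xs \<partial>lborel) = h xs * (LINT t:?I|lborel. cis (t * of_int (walk xs - i)))"
      unfolding set_lebesgue_integral_def by (simp only: integral_mult_right_zero)
    ultimately show "(\<integral>t. ?f t xs \<partial>lborel) = complex_of_real (2 * pi / span) * (of_bool (walk xs = i) * h xs)"
      by (simp only: mult_ac)
  qed
  finally have *: "(LINT t:?I|lborel. word_mean n (\<lambda>xs. h xs * cis (t * of_int (walk xs - i))))
      = complex_of_real (2 * pi / span) * word_mean n (\<lambda>xs. of_bool (walk xs = i) * h xs)"
    by (simp only: integral_mult_right_zero)
  have "complex_of_real freq_scale * complex_of_real (2 * pi / span) = 1"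
    using span_pos by (simp add: freq_scale_def flip: of_real_mult)
  then show ?thesis by (simp only: * mult.assoc[symmetric] mult_1_left)
qed

lemma walk_prob_fourier:
  assumes "int span dvd i + int n"
  shows "complex_of_real (walk_prob n i) = complex_of_real freq_scale * (LINT t:{-pi/span..pi/span}|lborel. step_cf t ^ n * cis (- t * of_int i))"
proof -
  have "complex_of_real (walk_prob n i) = word_mean n (\<lambda>xs. of_bool (walk xs = i) * 1)"
    unfolding walk_prob_def integral_complex_of_real[symmetric] by (intro expectation_pmf_cong) simp
  also have "\<dots> = complex_of_real freq_scale * (LINT t:{-pi/span..pi/span}|lborel. word_mean n (\<lambda>xs. 1 * cis (t * of_int (walk xs - i))))"
    using assms by (intro fourier_inversion) auto
  also have "(\<lambda>t. word_mean n (\<lambda>xs. 1 * cis (t * of_int (walk xs - i)))) = (\<lambda>t. step_cf t ^ n * cis (- t * of_int i))"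
  proof
    fix t
    have "1 * cis (t * of_int (walk xs - i)) = cis (t * of_int (walk xs)) * cis (- t * of_int i)" for xs
      by (simp add: cis_mult algebra_simps)
    then have "word_mean n (\<lambda>xs. 1 * cis (t * of_int (walk xs - i))) = word_mean n (\<lambda>xs. cis (t * of_int (walk xs))) * cis (- t * of_int i)"
      by (simp only: integral_mult_left_zero)
    then show "word_mean n (\<lambda>xs. 1 * cis (t * of_int (walk xs - i))) = step_cf t ^ n * cis (- t * of_int i)"
      by (simp only: word_mean_cis_walk)
  qed
  finally show ?thesis .
qed

end

lemma set_integral_norm_le:
  fixes G :: "real \<Rightarrow> complex"
  assumes "integrable lborel B" "\<And>t. 0 \<le> B t" "\<And>t. t \<in> A \<Longrightarrow> norm (G t) \<le> B t"
  shows "norm (LINT t:A|lborel. G t) \<le> (\<integral>t. B t \<partial>lborel)"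
proof -
  have "norm (LINT t:A|lborel. G t) \<le> (\<integral>t. norm (indicator A t *\<^sub>R G t) \<partial>lborel)"
    unfolding set_lebesgue_integral_def by (rule integral_norm_bound)
  also have "\<dots> \<le> (\<integral>t. B t \<partial>lborel)"
    using assms by (intro Bochner_Integration.integral_mono') (auto simp: indicator_def)
  finally show ?thesis .
qed

definition gauss_moment :: "nat \<Rightarrow> real" where
  "gauss_moment j = (\<integral>x. \<bar>x\<bar> ^ j * exp (- x\<^sup>2) \<partial>lborel)"

lemma integrable_gauss_moment: "integrable lborel (\<lambda>x :: real. \<bar>x\<bar> ^ j * exp (- x\<^sup>2))"
proof -
  have "integrable lborel (\<lambda>x. sqrt pi * (normal_density 0 (sqrt (1/2)) x * \<bar>x - 0\<bar> ^ j))"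
    by (intro integrable_mult_right integrable_normal_moment_abs) simp
  then show ?thesis by (simp add: normal_density_def mult_ac)
qed

text \<open>Rescaling by \<open>sqrt s\<close>. With \<open>s\<close> proportional to
  \<open>n\<close>, each additional factor \<open>\<bar>t\<bar>\<close> in an integrand is worth a
  factor of order \<open>1 / sqrt n\<close>; all rates below are read off in this way.\<close>

lemma has_integral_gauss:
  assumes "s > 0"
  shows "has_bochner_integral lborel (\<lambda>t. \<bar>t\<bar> ^ j * exp (- s * t\<^sup>2)) (gauss_moment j / sqrt s ^ Suc j)"
proof -
  have s: "sqrt s > 0" using assms by simp
  have "has_bochner_integral lborel (\<lambda>x :: real. \<bar>x\<bar> ^ j * exp (- x\<^sup>2)) (gauss_moment j)"
    unfolding gauss_moment_def by (rule has_bochner_integral_integrable[OF integrable_gauss_moment])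
  then have "has_bochner_integral lborel (\<lambda>x. \<bar>0 + sqrt s * x\<bar> ^ j * exp (- (0 + sqrt s * x)\<^sup>2)) (gauss_moment j /\<^sub>R \<bar>sqrt s\<bar>)"
    by (subst (asm) lborel_has_bochner_integral_real_affine_iff[of "sqrt s" _ _ 0]) (use s in auto)
  then have "has_bochner_integral lborel (\<lambda>x. (1 / sqrt s ^ j) * (\<bar>0 + sqrt s * x\<bar> ^ j * exp (- (0 + sqrt s * x)\<^sup>2)))
     ((1 / sqrt s ^ j) * (gauss_moment j /\<^sub>R \<bar>sqrt s\<bar>))"
    by (rule has_bochner_integral_mult_right)
  moreover have "(1 / sqrt s ^ j) * (\<bar>0 + sqrt s * x\<bar> ^ j * exp (- (0 + sqrt s * x)\<^sup>2)) = \<bar>x\<bar> ^ j * exp (- s * x\<^sup>2)" for x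
    using assms by (simp add: abs_mult power_mult_distrib)
  moreover have "(1 / sqrt s ^ j) * (gauss_moment j /\<^sub>R \<bar>sqrt s\<bar>) = gauss_moment j / sqrt s ^ Suc j"
    using s by (simp add: field_simps)
  ultimately show ?thesis by (simp only:)
qed

lemma gauss_moment_nonneg: "0 \<le> gauss_moment j"
  unfolding gauss_moment_def by (intro integral_nonneg_AE) simp

lemma integrable_gauss: "s > 0 \<Longrightarrow> integrable lborel (\<lambda>t :: real. \<bar>t\<bar> ^ j * exp (- s * t\<^sup>2))"
  using has_integral_gauss by (rule integrable.intros)

lemma integral_gauss: "s > 0 \<Longrightarrow> (\<integral>t. \<bar>t\<bar> ^ j * exp (- s * t\<^sup>2) \<partial>lborel) = gauss_moment j / sqrt s ^ Suc j"
  using has_integral_gauss by (rule has_bochner_integral_integral_eq)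

text \<open>The substitution \<open>t = x / sqrt n\<close> turns the fixed interval into intervals
  that exhaust the line, while the integrand converges for each \<open>x\<close>.\<close>

lemma scaled_dominated_convergence:
  fixes G :: "nat \<Rightarrow> real \<Rightarrow> complex"
  assumes a: "a > 0" and meas: "\<And>n. G n \<in> borel_measurable borel" "g \<in> borel_measurable borel"
    and lim: "\<And>x. (\<lambda>n. G n (x / sqrt (real n))) \<longlonglongrightarrow> g x"
    and bound: "\<And>n x. n \<ge> n0 \<Longrightarrow> n > 0 \<Longrightarrow> \<bar>x / sqrt (real n)\<bar> \<le> a \<Longrightarrow> norm (G n (x / sqrt (real n))) \<le> D x"
    and D: "integrable lborel D" "\<And>x. 0 \<le> D x"
  shows "(\<lambda>n. complex_of_real (sqrt (real n)) * (LINT t:{-a..a}|lborel. G n t)) \<longlonglongrightarrow> (\<integral>x. g x \<partial>lborel)"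
proof (rule LIMSEQ_offset)
  \<comment> \<open>The shift makes \<open>n \<ge> n0\<close> and \<open>n > 0\<close> hold at every
    index, since dominated convergence needs the bound for all members of the sequence.\<close>
  let ?k = "Suc n0"
  let ?f = "\<lambda>n x. indicator {-a..a} (x / sqrt (real (n + ?k))) *\<^sub>R G (n + ?k) (x / sqrt (real (n + ?k)))"
  have "(\<lambda>n. \<integral>x. ?f n x \<partial>lborel) \<longlonglongrightarrow> (\<integral>x. g x \<partial>lborel)"
  proof (rule integral_dominated_convergence[where w = D])
    show "AE x in lborel. (\<lambda>n. ?f n x) \<longlonglongrightarrow> g x"
    proof (rule AE_I2)
      fix x
      have "(\<lambda>n. x / sqrt (real n)) \<longlonglongrightarrow> 0" by real_asymp
      then have "\<forall>\<^sub>F n in sequentially. \<bar>x / sqrt (real n)\<bar> < a"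
        using a by (auto simp: tendsto_iff dist_real_def)
      then have "\<forall>\<^sub>F n in sequentially. x / sqrt (real n) \<in> {-a..a}"
        by eventually_elim (simp only: abs_less_iff atLeastAtMost_iff, linarith)
      then have "(\<lambda>n. indicator {-a..a} (x / sqrt (real n)) *\<^sub>R G n (x / sqrt (real n))) \<longlonglongrightarrow> g x"
        by (intro Lim_transform_eventually[OF lim]) (auto elim!: eventually_mono simp: indicator_def)
      from LIMSEQ_ignore_initial_segment[OF this, of ?k] show "(\<lambda>n. ?f n x) \<longlonglongrightarrow> g x" .
    qed
    show "AE x in lborel. norm (?f n x) \<le> D x" for n
      using bound[of "n + ?k"] D(2) by (auto simp: indicator_def abs_le_iff)
    show "?f n \<in> borel_measurable lborel" for n
      using meas(1)[of "n + ?k"] by measurable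
  qed (use meas(2) D in auto)
  moreover have "(\<integral>x. ?f n x \<partial>lborel) = complex_of_real (sqrt (real (n + ?k))) * (LINT t:{-a..a}|lborel. G (n + ?k) t)" for n
  proof -
    have "(LINT t:{-a..a}|lborel. G (n + ?k) t)
        = \<bar>1 / sqrt (real (n + ?k))\<bar> *\<^sub>R (\<integral>x. indicator {-a..a} (0 + 1 / sqrt (real (n + ?k)) * x) *\<^sub>R G (n + ?k) (0 + 1 / sqrt (real (n + ?k)) * x) \<partial>lborel)"
      unfolding set_lebesgue_integral_def by (rule lborel_integral_real_affine) simp
    then have "(LINT t:{-a..a}|lborel. G (n + ?k) t) = complex_of_real (1 / sqrt (real (n + ?k))) * (\<integral>x. ?f n x \<partial>lborel)"
      by (simp add: scaleR_conv_of_real)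
    moreover have "complex_of_real (sqrt (real (n + ?k))) * complex_of_real (1 / sqrt (real (n + ?k))) = 1"
      by (simp flip: of_real_mult)
    ultimately show ?thesis by (simp only: mult.assoc[symmetric] mult_1_left)
  qed
  ultimately show "(\<lambda>n. complex_of_real (sqrt (real (n + ?k))) * (LINT t:{-a..a}|lborel. G (n + ?k) t)) \<longlonglongrightarrow> (\<integral>x. g x \<partial>lborel)"
    by (simp only:)
qed

context critical_offspring
begin

text \<open>Modulus 1 forces \<open>cis (t * (k - 1))\<close> to be constant on the support.
  Comparison with the possible value \<open>k = 0\<close> gives \<open>cis (t * k) = 1\<close> on
  the support, hence \<open>cis (t * span) = 1\<close>, which fails for nonzero \<open>t\<close>
  within half a period of 0.\<close>

lemma cmod_step_cf_less_1:
  assumes t: "\<bar>t\<bar> \<le> pi / span" "t \<noteq> 0"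
  shows "cmod (step_cf t) < 1"
proof (rule ccontr)
  assume "\<not> ?thesis"
  then have one: "cmod (step_cf t) = 1" using cmod_step_cf_le_1[of t] by simp
  let ?w = "step_cf t"
  have w: "cnj ?w * ?w = 1" using one by (simp add: complex_norm_square[symmetric] mult.commute)
  have "(\<integral>k. 1 - Re (cnj ?w * cis (t * (real k - 1))) \<partial>p) = 1 - Re (\<integral>k. cnj ?w * cis (t * (real k - 1)) \<partial>p)"
  proof -
    define z where "z k = cnj ?w * cis (t * (real k - 1))" for k
    have z: "integrable p z" unfolding z_def by (intro integrable_mult_right) simp
    then have "(\<integral>k. 1 - Re (z k) \<partial>p) = 1 - Re (\<integral>k. z k \<partial>p)" by simp
    then show ?thesis by (simp only: z_def)
  qed
  also have "(\<integral>k. cnj ?w * cis (t * (real k - 1)) \<partial>p) = 1"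
    using w by (simp add: step_cf_def)
  finally have "(\<integral>k. 1 - Re (cnj ?w * cis (t * (real k - 1))) \<partial>p) = 0" by simp
  moreover have nn: "0 \<le> 1 - Re (cnj ?w * cis (t * (real k - 1)))" for k
    using complex_Re_le_cmod[of "cnj ?w * cis (t * (real k - 1))"] one by (simp add: norm_mult)
  moreover have "integrable (measure_pmf p) (\<lambda>k. 1 - Re (cnj ?w * cis (t * (real k - 1))))"
    by (intro Bochner_Integration.integrable_diff integrable_const integrable_Re integrable_mult_right) auto
  ultimately have "AE k in measure_pmf p. 1 - Re (cnj ?w * cis (t * (real k - 1))) = 0"
    by (subst (asm) integral_nonneg_eq_0_iff_AE) auto
  then have eq: "cis (t * (real k - 1)) = ?w" if "k \<in> set_pmf p" for k
  proof -
    let ?z = "cnj ?w * cis (t * (real k - 1))"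
    have re: "Re ?z = 1" using \<open>AE k in _. _\<close> that by (auto simp: AE_measure_pmf_iff)
    have "(cmod ?z)\<^sup>2 = 1" using one by (simp add: norm_mult)
    then have "Im ?z = 0" using re unfolding cmod_power2 by simp
    then have "?z = 1" using re by (simp add: complex_eq_iff)
    then have "?w * ?z = ?w" by simp
    then show ?thesis using w by (simp add: mult.assoc[symmetric] mult.commute[of ?w])
  qed
  define S where "S = {k :: nat. cis (t * real k) = 1}"
  have sub: "set_pmf p \<subseteq> S"
  proof
    fix k assume k: "k \<in> set_pmf p"
    have "cis (t * (real k - 1)) = cis (t * (real 0 - 1))"
      using eq[OF k] eq[of 0] offspring_0_pos by (simp add: set_pmf_iff)
    then have "cis (t * (real k - 1)) * cis t = cis (t * (real 0 - 1)) * cis t" by simp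
    then show "k \<in> S" by (simp add: cis_mult S_def algebra_simps)
  qed
  have ex: "\<exists>g. 0 < g \<and> g \<in> S"
  proof -
    obtain k where "k \<ge> 2" "0 < pmf p k" using exists_offspring_ge_2 by blast
    then show ?thesis using sub by (intro exI[of _ k]) (auto simp: set_pmf_iff)
  qed
  \<comment> \<open>Division with remainder shows that the least positive element of
    \<open>S\<close> divides all of \<open>S\<close>. So it divides \<open>span\<close>, and
    \<open>span\<close> inherits the relation that defines \<open>S\<close>.\<close>
  define g where "g = (LEAST g. 0 < g \<and> g \<in> S)"
  have g: "0 < g" "g \<in> S" using LeastI_ex[OF ex] by (auto simp: g_def)
  have mult: "cis (t * real (g * m)) = 1" for m
  proof -
    have "cis (t * real (g * m)) = cis (t * real g) ^ m" by (simp add: Complex.DeMoivre mult_ac)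
    then show ?thesis using g(2) by (simp add: S_def)
  qed
  have "g dvd k" if "k \<in> S" for k
  proof -
    have "t * real k = t * real (g * (k div g)) + t * real (k mod g)"
      by (simp only: mult_div_mod_eq flip: distrib_left of_nat_add)
    then have "cis (t * real k) = cis (t * real (g * (k div g))) * cis (t * real (k mod g))"
      by (simp only: cis_mult)
    then have "k mod g \<in> S" using that unfolding mult by (simp add: S_def)
    then have "\<not> 0 < k mod g" using not_less_Least[of "k mod g" "\<lambda>g. 0 < g \<and> g \<in> S"] g(1) by (auto simp: g_def[symmetric])
    then show ?thesis by (simp add: mod_eq_0_iff_dvd)
  qed
  then have "g dvd span" unfolding span_def using sub by (intro Gcd_greatest) auto
  then obtain m where "span = g * m" by auto
  then have "cis (t * real span) = 1" using mult[of m] by simp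
  then have c1: "cos (t * real span) = 1" by (simp add: complex_eq_iff)
  have "t * real span = 0"
  proof (rule ccontr)
    assume *: "t * real span \<noteq> 0"
    have "\<bar>t * real span\<bar> \<le> pi" using t(1) span_pos by (simp add: abs_mult field_simps)
    then have "cos \<bar>t * real span\<bar> < cos 0" using * by (intro cos_monotone_0_pi) auto
    then show False using c1 by simp
  qed
  then show False using t(2) span_pos by simp
qed

text \<open>Near 0 the quadratic expansion gives a Gaussian bound; on the compact rest of the period
  the modulus stays below some \<open>\<rho> < 1\<close> by continuity and strictness. The constant
  is taken to fit both regions.\<close>

lemma exists_decay: "\<exists>c>0. \<forall>t. \<bar>t\<bar> \<le> pi / span \<longrightarrow> cmod (step_cf t) \<le> exp (- c * t\<^sup>2)"
proof -
  let ?s = "offspring_var"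
  have "((\<lambda>c. (step_cf c - 1) / complex_of_real (c\<^sup>2)) \<longlongrightarrow> complex_of_real (- ?s / 2)) (at 0)"
    using char_quadratic_at_0[OF integrable_step_sq mean_step] by (simp add: step_cf_def mean_step_sq)
  then have "\<forall>\<^sub>F c in at 0. dist ((step_cf c - 1) / complex_of_real (c\<^sup>2)) (complex_of_real (- ?s / 2)) < ?s / 4"
    by (rule tendstoD) (use offspring_var_pos in simp)
  then obtain \<delta> where \<delta>: "\<delta> > 0" "\<And>c. c \<noteq> 0 \<Longrightarrow> \<bar>c\<bar> < \<delta> \<Longrightarrow> dist ((step_cf c - 1) / complex_of_real (c\<^sup>2)) (complex_of_real (- ?s / 2)) < ?s / 4"
    by (auto simp: eventually_at dist_real_def)
  \<comment> \<open>The cut-off \<open>1 / sqrt ?s\<close> keeps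
    \<open>1 - ?s / 2 * t\<^sup>2\<close> nonnegative, so that it equals its modulus.\<close>
  define \<epsilon> where "\<epsilon> = min \<delta> (1 / sqrt ?s)"
  have \<epsilon>: "\<epsilon> > 0" using \<delta> offspring_var_pos by (simp add: \<epsilon>_def)
  have near: "cmod (step_cf t) \<le> 1 - ?s / 4 * t\<^sup>2" if t: "\<bar>t\<bar> < \<epsilon>" for t
  proof (cases "t = 0")
    case False
    have "\<bar>t\<bar>\<^sup>2 \<le> (1 / sqrt ?s)\<^sup>2" using t by (intro power_mono) (auto simp: \<epsilon>_def)
    then have st: "?s * t\<^sup>2 \<le> 1" using offspring_var_pos by (simp add: power_divide field_simps)
    have "cmod ((step_cf t - 1) / complex_of_real (t\<^sup>2) - complex_of_real (- ?s / 2)) < ?s / 4"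
      using \<delta>(2)[OF False] t by (simp add: \<epsilon>_def dist_norm)
    moreover have "(step_cf t - 1) / complex_of_real (t\<^sup>2) - complex_of_real (- ?s / 2)
       = (step_cf t - complex_of_real (1 - ?s / 2 * t\<^sup>2)) / complex_of_real (t\<^sup>2)"
      using False by (simp add: field_simps)
    ultimately have "cmod (step_cf t - complex_of_real (1 - ?s / 2 * t\<^sup>2)) < ?s / 4 * t\<^sup>2"
      using False by (simp only: norm_divide norm_of_real) (simp add: field_simps)
    moreover have "cmod (complex_of_real (1 - ?s / 2 * t\<^sup>2)) = 1 - ?s / 2 * t\<^sup>2"
      using st by (simp only: norm_of_real)
    ultimately have "cmod (step_cf t) \<le> (1 - ?s / 2 * t\<^sup>2) + ?s / 4 * t\<^sup>2"
      using norm_triangle_sub[of "step_cf t" "complex_of_real (1 - ?s / 2 * t\<^sup>2)"] by linarith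
    then show ?thesis by (simp add: algebra_simps)
  qed simp
  define C where "C = {t. \<bar>t\<bar> \<le> pi / span} - {t. \<bar>t\<bar> < \<epsilon>}"
  have "\<exists>\<rho><1. \<forall>t\<in>C. cmod (step_cf t) \<le> \<rho>"
  proof (cases "C = {}")
    case True then show ?thesis by (intro exI[of _ 0]) auto
  next
    case False
    have "C = {-pi/span..pi/span} - {-\<epsilon><..<\<epsilon>}" by (auto simp: C_def abs_le_iff abs_less_iff)
    then have "compact C" by (auto intro!: compact_diff)
    then obtain t0 where "t0 \<in> C" "\<And>t. t \<in> C \<Longrightarrow> cmod (step_cf t) \<le> cmod (step_cf t0)"
      using continuous_attains_sup[of C "\<lambda>t. cmod (step_cf t)"] False
      by (auto intro!: continuous_on_norm continuous_on_step_cf)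
    then show ?thesis using cmod_step_cf_less_1[of t0] \<epsilon> by (intro exI[of _ "cmod (step_cf t0)"]) (auto simp: C_def)
  qed
  then obtain \<rho> where \<rho>: "\<rho> < 1" "\<And>t. t \<in> C \<Longrightarrow> cmod (step_cf t) \<le> \<rho>" by blast
  \<comment> \<open>The second entry makes \<open>c * t\<^sup>2 \<le> 1 - \<rho>\<close> for all
    \<open>t\<close> up to \<open>pi / span\<close>.\<close>
  define c where "c = min (?s / 4) ((1 - \<rho>) * (span / pi)\<^sup>2)"
  have "c > 0" using offspring_var_pos \<rho>(1) span_pos by (simp add: c_def)
  moreover have "cmod (step_cf t) \<le> exp (- c * t\<^sup>2)" if t: "\<bar>t\<bar> \<le> pi / span" for t
  proof -
    have "cmod (step_cf t) \<le> 1 - c * t\<^sup>2"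
    proof (cases "\<bar>t\<bar> < \<epsilon>")
      case True
      have "c * t\<^sup>2 \<le> ?s / 4 * t\<^sup>2" by (intro mult_right_mono) (auto simp: c_def)
      then show ?thesis using near[OF True] by simp
    next
      case False
      then have "cmod (step_cf t) \<le> \<rho>" using t by (intro \<rho>) (auto simp: C_def)
      moreover have "c * t\<^sup>2 \<le> (1 - \<rho>) * (span / pi)\<^sup>2 * (pi / span)\<^sup>2"
        using t \<open>c > 0\<close> by (intro mult_mono power2_le_iff_abs_le[THEN iffD2]) (auto simp: c_def)
      moreover have "(1 - \<rho>) * (span / pi)\<^sup>2 * (pi / span)\<^sup>2 = 1 - \<rho>" using span_pos by (simp add: power_divide)
      ultimately show ?thesis by simp
    qed
    also have "\<dots> \<le> exp (- c * t\<^sup>2)" using exp_ge_add_one_self[of "- c * t\<^sup>2"] by simp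
    finally show ?thesis .
  qed
  ultimately show ?thesis by blast
qed

definition decay :: real where
  "decay = (SOME c. c > 0 \<and> (\<forall>t. \<bar>t\<bar> \<le> pi / span \<longrightarrow> cmod (step_cf t) \<le> exp (- c * t\<^sup>2)))"

lemma decay_pos: "0 < decay"
  and cmod_step_cf_le: "\<bar>t\<bar> \<le> pi / span \<Longrightarrow> cmod (step_cf t) \<le> exp (- decay * t\<^sup>2)"
  using someI_ex[OF exists_decay[unfolded Bex_def]] by (auto simp: decay_def)

lemma cmod_step_cf_power_le:
  assumes "\<bar>t\<bar> \<le> pi / span" "r \<le> real m"
  shows "cmod (step_cf t ^ m) \<le> exp (- (decay * r) * t\<^sup>2)"
proof -
  have "cmod (step_cf t ^ m) \<le> exp (- decay * t\<^sup>2) ^ m"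
    unfolding norm_power using assms by (intro power_mono cmod_step_cf_le) auto
  also have "\<dots> = exp (real m * (- decay * t\<^sup>2))" by (rule exp_of_nat_mult[symmetric])
  also have "\<dots> \<le> exp (- (decay * r) * t\<^sup>2)"
    using mult_right_mono[OF assms(2), of "decay * t\<^sup>2"] decay_pos by (simp add: mult_ac)
  finally show ?thesis .
qed

abbreviation freq_range :: "real set" where "freq_range \<equiv> {-pi/span..pi/span}"

lemma freq_range_iff: "t \<in> freq_range \<longleftrightarrow> \<bar>t\<bar> \<le> pi / span"
  by (auto simp: abs_le_iff)

lemma pi_div_span_pos: "0 < pi / span" using span_pos by simp

lemma set_integrable_freq:
  fixes G :: "real \<Rightarrow> complex"
  assumes [measurable]: "G \<in> borel_measurable borel" and "\<And>t. norm (G t) \<le> B"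
  shows "set_integrable lborel freq_range G"
  unfolding set_integrable_def
proof (rule Bochner_Integration.integrable_bound)
  show "integrable lborel (\<lambda>t. B * indicator freq_range t :: real)" by simp
  show "AE x in lborel. norm (indicator freq_range x *\<^sub>R G x) \<le> norm (B * indicator freq_range x :: real)"
  proof (rule AE_I2)
    fix t
    have "norm (G t) \<le> \<bar>B\<bar>" using assms(2)[of t] by linarith
    then show "norm (indicator freq_range t *\<^sub>R G t) \<le> norm (B * indicator freq_range t :: real)"
      by (simp add: indicator_def)
  qed
qed simp

lemma set_integrable_step_cf: "set_integrable lborel freq_range (\<lambda>t. step_cf t ^ n * cis (- t * of_int i))"
  by (rule set_integrable_freq[of _ 1]) (auto simp: norm_mult norm_power cmod_step_cf_le_1 power_le_one)

section \<open>Uniform bounds for the law of the walk and for its differences\<close>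

lemma exists_walk_prob_upper: "\<exists>K. \<forall>n i. walk_prob n i \<le> K / sqrt (real n + 1)"
proof -
  define A where "A = freq_scale * (gauss_moment 0 / sqrt decay)"
  have A: "A \<ge> 0" using gauss_moment_nonneg[of 0] decay_pos freq_scale_pos by (auto simp: A_def)
  \<comment> \<open>The shift \<open>real n + 1\<close> and the summand 1 cover
    \<open>n = 0\<close>; the factor 2 pays for \<open>n + 1 \<le> 4 * n\<close> otherwise.\<close>
  have "walk_prob n i \<le> (2 * A + 1) / sqrt (real n + 1)" for n i
  proof (cases "n = 0 \<or> \<not> int span dvd i + int n")
    case True
    then show ?thesis using A walk_prob_le_1[of n i] walk_prob_eq_0[of i n] by auto
  next
    case False
    then have n: "n > 0" and dv: "int span dvd i + int n" by auto
    have "walk_prob n i = norm (complex_of_real (walk_prob n i))" by simp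
    also have "\<dots> = freq_scale * norm (LINT t:freq_range|lborel. step_cf t ^ n * cis (- t * of_int i))"
      unfolding walk_prob_fourier[OF dv] using freq_scale_pos by (simp only: norm_mult norm_of_real abs_of_pos)
    also have "\<dots> \<le> freq_scale * (\<integral>t. \<bar>t\<bar> ^ 0 * exp (- (decay * real n) * t\<^sup>2) \<partial>lborel)"
    proof (rule mult_left_mono[OF set_integral_norm_le])
      show "integrable lborel (\<lambda>t. \<bar>t\<bar> ^ 0 * exp (- (decay * real n) * t\<^sup>2))"
        using n decay_pos by (intro integrable_gauss) simp
      show "norm (step_cf t ^ n * cis (- t * of_int i)) \<le> \<bar>t\<bar> ^ 0 * exp (- (decay * real n) * t\<^sup>2)" if "t \<in> freq_range" for t
        using cmod_step_cf_power_le[of t "real n" n] that unfolding freq_range_iff by (simp add: norm_mult)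
    qed (use freq_scale_pos in auto)
    also have "(\<integral>t. \<bar>t\<bar> ^ 0 * exp (- (decay * real n) * t\<^sup>2) \<partial>lborel) = gauss_moment 0 / sqrt (decay * real n) ^ Suc 0"
      using n decay_pos by (intro integral_gauss) simp
    also have "freq_scale * (gauss_moment 0 / sqrt (decay * real n) ^ Suc 0) = A / sqrt (real n)"
      by (simp add: A_def real_sqrt_mult)
    also have "\<dots> \<le> 2 * A / sqrt (real n + 1)"
    proof -
      have "sqrt (real n + 1) \<le> sqrt (4 * real n)" using n by (intro real_sqrt_le_mono) simp
      then have "sqrt (real n + 1) \<le> 2 * sqrt (real n)" by (simp add: real_sqrt_mult)
      then have "A * sqrt (real n + 1) \<le> A * (2 * sqrt (real n))" using A by (intro mult_left_mono)
      then show ?thesis using n by (simp add: field_simps)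
    qed
    also have "\<dots> \<le> (2 * A + 1) / sqrt (real n + 1)" by (intro divide_right_mono) auto
    finally show ?thesis .
  qed
  then show ?thesis by blast
qed

text \<open>\<open>step_cf t ^ k * cis t\<close> is the characteristic function of \<open>k\<close>
  random steps counted from the endpoint \<open>-1\<close> of a tree. Exchanging \<open>k\<close>
  random letters for the word of a tree of size \<open>k\<close> therefore changes a Fourier
  integrand by this defect, which vanishes at \<open>t = 0\<close>.\<close>

definition cf_defect :: "nat \<Rightarrow> real \<Rightarrow> complex" where
  "cf_defect k t = 1 - step_cf t ^ k * cis t"

lemma measurable_cf_defect [measurable]: "cf_defect k \<in> borel_measurable borel"
  unfolding cf_defect_def[abs_def] by measurable

lemma cmod_1_minus_power_le: "cmod (1 - step_cf t ^ k) \<le> real k * (offspring_var / 2 * t\<^sup>2)"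
proof -
  have "cmod (1 ^ k - step_cf t ^ k) \<le> real k * cmod (1 - step_cf t)"
    by (rule norm_power_diff) (auto simp: cmod_step_cf_le_1)
  also have "\<dots> \<le> real k * (offspring_var / 2 * t\<^sup>2)" by (intro mult_left_mono cmod_1_minus_step_cf_le) auto
  finally show ?thesis by simp
qed

lemma cmod_cf_defect_le: "cmod (cf_defect k t) \<le> \<bar>t\<bar> + offspring_var / 2 * real k * \<bar>t\<bar>\<^sup>2"
proof -
  have "cf_defect k t = (1 - step_cf t ^ k) * cis t - (cis t - 1)" by (simp add: cf_defect_def algebra_simps)
  then have "cmod (cf_defect k t) \<le> cmod (1 - step_cf t ^ k) + cmod (cis t - 1)"
    by (metis norm_triangle_ineq4 norm_mult norm_cis mult.right_neutral)
  then show ?thesis using cmod_1_minus_power_le[of t k] cmod_cis_diff_1_le[of t] by (simp add: algebra_simps)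
qed

lemma walk_prob_diff_fourier:
  assumes "int span dvd int n - 1" "int span dvd int k - 1" "k \<le> n"
  shows "complex_of_real (walk_prob (n - k) 0 - walk_prob n (-1))
    = complex_of_real freq_scale * (LINT t:freq_range|lborel. step_cf t ^ (n - k) * cf_defect k t)"
proof -
  have "(int n - 1) - (int k - 1) = 0 + int (n - k)" "int n - 1 = -1 + int n" using assms by (simp_all add: of_nat_diff)
  with dvd_diff[OF assms(1,2)] assms(1) have d: "int span dvd 0 + int (n - k)" "int span dvd -1 + int n" by metis+
  let ?e = "\<lambda>n i t. step_cf t ^ n * cis (- t * of_int i)"
  have "(LINT t:freq_range|lborel. step_cf t ^ (n - k) * cf_defect k t)
    = (LINT t:freq_range|lborel. ?e (n - k) 0 t - ?e n (-1) t)"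
    using assms(3) by (simp add: cf_defect_def algebra_simps flip: power_add)
  also have "\<dots> = (LINT t:freq_range|lborel. ?e (n - k) 0 t) - (LINT t:freq_range|lborel. ?e n (-1) t)"
    by (rule set_integral_diff(2)) (rule set_integrable_step_cf)+
  finally show ?thesis
    by (simp only: of_real_diff walk_prob_fourier[OF d(1)] walk_prob_fourier[OF d(2)] right_diff_distrib)
qed

text \<open>The terms correspond to two, one or no trees cut out of the word; each tree removed
  raises the endpoint asked of the rest by 1. On the Fourier side the combination factors into two
  defects, which gives it the order \<open>1 / sqrt n ^ 3\<close>.\<close>

definition walk_prob_mixed :: "nat \<Rightarrow> nat \<Rightarrow> nat \<Rightarrow> real" where
  "walk_prob_mixed n k m = walk_prob (n - k - m) 1 - walk_prob (n - k) 0 - walk_prob (n - m) 0 + walk_prob n (-1)"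

lemma walk_prob_mixed_fourier:
  assumes "int span dvd int n - 1" "int span dvd int k - 1" "int span dvd int m - 1" "k + m \<le> n"
  shows "complex_of_real (walk_prob_mixed n k m)
    = complex_of_real freq_scale * (LINT t:freq_range|lborel. step_cf t ^ (n - k - m) * cis (-t) * (cf_defect k t * cf_defect m t))"
proof -
  note 1 = dvd_diff[OF assms(1,2)] and 2 = dvd_diff[OF assms(1,3)]
  have 3: "int span dvd (int n - 1) - (int k - 1) - (int m - 1)" using 1 assms(3) by (rule dvd_diff)
  have "(int n - 1) - (int k - 1) = 0 + int (n - k)" "(int n - 1) - (int m - 1) = 0 + int (n - m)"
    "(int n - 1) - (int k - 1) - (int m - 1) = 1 + int (n - k - m)" "int n - 1 = -1 + int n"
    using assms(4) by (simp_all add: of_nat_diff)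
  with 1 2 3 assms(1) have d: "int span dvd 0 + int (n - k)" "int span dvd 0 + int (n - m)" "int span dvd -1 + int n" "int span dvd 1 + int (n - k - m)"
    by metis+
  let ?e = "\<lambda>n i t. step_cf t ^ n * cis (- t * of_int i)"
  have pw: "step_cf t ^ (n - k - m) * step_cf t ^ k = step_cf t ^ (n - m)" "step_cf t ^ (n - k - m) * step_cf t ^ m = step_cf t ^ (n - k)"
    "step_cf t ^ (n - m) * step_cf t ^ m = step_cf t ^ n" for t
    using assms(4) by (simp_all flip: power_add)
  have eq: "step_cf t ^ (n - k - m) * cis (-t) * (cf_defect k t * cf_defect m t)
     = ?e (n - k - m) 1 t - ?e (n - k) 0 t - ?e (n - m) 0 t + ?e n (-1) t" for t
  proof -
    let ?a = "step_cf t ^ (n - k - m)" and ?b = "step_cf t ^ k" and ?c = "step_cf t ^ m"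
    have "?a * cis (-t) * (cf_defect k t * cf_defect m t) = ?a * cis (-t) - ?a * ?b * (cis (-t) * cis t)
       - ?a * ?c * (cis (-t) * cis t) + ?a * ?b * ?c * (cis (-t) * cis t) * cis t"
      by (simp only: cf_defect_def) (simp add: algebra_simps)
    also have "cis (-t) * cis t = 1" by (simp only: cis_mult) simp
    finally show ?thesis unfolding pw by simp
  qed
  note si = set_integrable_step_cf
  have "(LINT t:freq_range|lborel. step_cf t ^ (n - k - m) * cis (-t) * (cf_defect k t * cf_defect m t))
    = (LINT t:freq_range|lborel. ?e (n - k - m) 1 t) - (LINT t:freq_range|lborel. ?e (n - k) 0 t)
     - (LINT t:freq_range|lborel. ?e (n - m) 0 t) + (LINT t:freq_range|lborel. ?e n (-1) t)"
    unfolding eq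
    by (subst set_integral_add(2); (intro set_integral_diff(1) si)?) (simp only: set_integral_diff(2) set_integral_diff(1) si)
  then show ?thesis
    by (simp only: walk_prob_mixed_def of_real_diff of_real_add walk_prob_fourier[OF d(1)] walk_prob_fourier[OF d(2)]
       walk_prob_fourier[OF d(3)] walk_prob_fourier[OF d(4)] right_diff_distrib distrib_left)
qed

text \<open>The defect is at most \<open>\<bar>t\<bar> + v * k * \<bar>t\<bar>\<^sup>2\<close>, and
  the two terms integrate to the orders \<open>1 / n\<close> and \<open>k / (n * sqrt n)\<close>.
  The condition \<open>2 * k \<le> n\<close> leaves half of the steps for the Gaussian
  decay.\<close>

lemma exists_walk_prob_diff_bound:
  "\<exists>K. \<forall>n k. 0 < size_prob n \<longrightarrow> 0 < size_prob k \<longrightarrow> 2 * k \<le> n \<longrightarrow>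
     \<bar>walk_prob (n - k) 0 - walk_prob n (-1)\<bar> \<le> K / real n * (1 + real k / sqrt n)"
proof -
  define s where "s = decay / 2"
  have s: "s > 0" using decay_pos by (simp add: s_def)
  define A where "A j = gauss_moment j / sqrt s ^ Suc j" for j
  have A: "0 \<le> A j" for j using s gauss_moment_nonneg by (simp add: A_def)
  define v where "v = offspring_var / 2"
  have v: "0 < v" using offspring_var_pos by (simp add: v_def)
  define K where "K = freq_scale * (A 1 + v * A 2)"
  have "\<bar>walk_prob (n - k) 0 - walk_prob n (-1)\<bar> \<le> K / real n * (1 + real k / sqrt n)"
    if n: "0 < size_prob n" "0 < size_prob k" "2 * k \<le> n" for n k
  proof -
    have n0: "n > 0" using n by (cases n) auto
    let ?B = "\<lambda>t. \<bar>t\<bar> ^ 1 * exp (- (s * real n) * t\<^sup>2) + v * real k * (\<bar>t\<bar> ^ 2 * exp (- (s * real n) * t\<^sup>2))"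
    have sn: "s * real n > 0" using s n0 by simp
    have "\<bar>walk_prob (n - k) 0 - walk_prob n (-1)\<bar> = norm (complex_of_real (walk_prob (n - k) 0 - walk_prob n (-1)))"
      by (simp only: norm_of_real)
    also have "\<dots> = freq_scale * norm (LINT t:freq_range|lborel. step_cf t ^ (n - k) * cf_defect k t)"
      using n span_dvd_of_size_prob by (subst walk_prob_diff_fourier) (use freq_scale_pos in \<open>auto simp: norm_mult abs_of_pos\<close>)
    also have "\<dots> \<le> freq_scale * (\<integral>t. ?B t \<partial>lborel)"
    proof (rule mult_left_mono[OF set_integral_norm_le])
      show "integrable lborel ?B" using integrable_gauss[OF sn] by (intro Bochner_Integration.integrable_add integrable_mult_right)
      show "0 \<le> ?B t" for t using v by simp
      fix t assume "t \<in> freq_range"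
      then have "cmod (step_cf t ^ (n - k)) \<le> exp (- (decay * (real n / 2)) * t\<^sup>2)"
        unfolding freq_range_iff using n(3) by (intro cmod_step_cf_power_le) auto
      then have "cmod (step_cf t ^ (n - k) * cf_defect k t) \<le> exp (- (s * real n) * t\<^sup>2) * (\<bar>t\<bar> + v * real k * \<bar>t\<bar>\<^sup>2)"
        unfolding norm_mult using cmod_cf_defect_le[of k t] by (intro mult_mono) (auto simp: s_def v_def)
      then show "cmod (step_cf t ^ (n - k) * cf_defect k t) \<le> ?B t" by (simp add: algebra_simps)
    qed (use freq_scale_pos in auto)
    also have "(\<integral>t. ?B t \<partial>lborel) = gauss_moment 1 / sqrt (s * real n) ^ Suc 1 + v * real k * (gauss_moment 2 / sqrt (s * real n) ^ Suc 2)"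
      by (intro has_bochner_integral_integral_eq has_bochner_integral_add has_bochner_integral_mult_right has_integral_gauss sn)
    also have "\<dots> = A 1 / real n + v * A 2 * real k / (real n * sqrt (real n))"
    proof -
      have "sqrt (s * real n) ^ Suc 1 = sqrt s ^ Suc 1 * real n" "sqrt (s * real n) ^ Suc 2 = sqrt s ^ Suc 2 * (real n * sqrt (real n))"
        by (simp_all only: real_sqrt_mult power_mult_distrib) (simp_all add: eval_nat_numeral)
      then show ?thesis by (simp add: A_def del: power_Suc)
    qed
    also have "\<dots> \<le> (A 1 + v * A 2) / real n * (1 + real k / sqrt n)"
    proof -
      have "(A 1 + v * A 2) / real n * (1 + real k / sqrt n)
        = A 1 / real n + v * A 2 * real k / (real n * sqrt (real n)) + (v * A 2 / real n + A 1 * real k / (real n * sqrt n))"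
        by (simp add: add_divide_distrib distrib_left distrib_right)
      moreover have "0 \<le> v * A 2 / real n + A 1 * real k / (real n * sqrt n)" using A v by simp
      ultimately show ?thesis by linarith
    qed
    finally show ?thesis using freq_scale_pos by (simp add: K_def mult_left_mono mult.assoc)
  qed
  then show ?thesis by blast
qed

text \<open>As for the first difference, with a product of two defects in the integrand; two trees
  of at most \<open>n / 4\<close> nodes again leave half of the steps for the decay.\<close>

lemma exists_walk_prob_mixed_bound:
  "\<exists>K. \<forall>n k m. 0 < size_prob n \<longrightarrow> 0 < size_prob k \<longrightarrow> 0 < size_prob m \<longrightarrow> 4 * k \<le> n \<longrightarrow> 4 * m \<le> n \<longrightarrow>
     \<bar>walk_prob_mixed n k m\<bar> \<le> K / sqrt n ^ 3 * ((1 + real k / sqrt n) * (1 + real m / sqrt n))"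
proof -
  define s where "s = decay / 2"
  have s: "s > 0" using decay_pos by (simp add: s_def)
  define A where "A j = gauss_moment j / sqrt s ^ Suc j" for j
  have A: "0 \<le> A j" for j using s gauss_moment_nonneg by (simp add: A_def)
  define v where "v = offspring_var / 2"
  have v: "0 < v" using offspring_var_pos by (simp add: v_def)
  define C where "C = A 2 + v * A 3 + v\<^sup>2 * A 4"
  have C: "A 2 \<le> C" "v * A 3 \<le> C" "v\<^sup>2 * A 4 \<le> C" using A v by (auto simp: C_def)
  have "\<bar>walk_prob_mixed n k m\<bar> \<le> (freq_scale * C) / sqrt n ^ 3 * ((1 + real k / sqrt n) * (1 + real m / sqrt n))"
    if n: "0 < size_prob n" "0 < size_prob k" "0 < size_prob m" "4 * k \<le> n" "4 * m \<le> n" for n k m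
  proof -
    have n0: "n > 0" using n by (cases n) auto
    let ?g = "\<lambda>j t. \<bar>t\<bar> ^ j * exp (- (s * real n) * t\<^sup>2)"
    let ?B = "\<lambda>t. ?g 2 t + v * (real k + real m) * ?g 3 t + v\<^sup>2 * (real k * real m) * ?g 4 t"
    have sn: "s * real n > 0" using s n0 by simp
    let ?f = "\<lambda>t. step_cf t ^ (n - k - m) * cis (-t) * (cf_defect k t * cf_defect m t)"
    have "\<bar>walk_prob_mixed n k m\<bar> = norm (complex_of_real (walk_prob_mixed n k m))"
      by (simp only: norm_of_real)
    also have "\<dots> = freq_scale * norm (LINT t:freq_range|lborel. ?f t)"
      using n span_dvd_of_size_prob by (subst walk_prob_mixed_fourier) (use freq_scale_pos in \<open>auto simp: norm_mult abs_of_pos\<close>)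
    also have "\<dots> \<le> freq_scale * (\<integral>t. ?B t \<partial>lborel)"
    proof (rule mult_left_mono[OF set_integral_norm_le])
      show "integrable lborel ?B"
        using integrable_gauss[OF sn] by (intro Bochner_Integration.integrable_add integrable_mult_right)
      show "0 \<le> ?B t" for t using v by simp
      fix t assume "t \<in> freq_range"
      then have "cmod (step_cf t ^ (n - k - m)) \<le> exp (- (decay * (real n / 2)) * t\<^sup>2)"
        unfolding freq_range_iff using n(4,5) by (intro cmod_step_cf_power_le) auto
      then have "cmod (?f t) \<le> exp (- (s * real n) * t\<^sup>2) * ((\<bar>t\<bar> + v * real k * \<bar>t\<bar>\<^sup>2) * (\<bar>t\<bar> + v * real m * \<bar>t\<bar>\<^sup>2))"
        unfolding norm_mult norm_cis mult_1_right
        using cmod_cf_defect_le[of k t] cmod_cf_defect_le[of m t] v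
        by (intro mult_mono) (auto simp: s_def v_def)
      then show "cmod (?f t) \<le> ?B t" by (simp add: algebra_simps numeral_2_eq_2 numeral_3_eq_3 eval_nat_numeral)
    qed (use freq_scale_pos in auto)
    also have "(\<integral>t. ?B t \<partial>lborel) = gauss_moment 2 / sqrt (s * real n) ^ Suc 2 + v * (real k + real m) * (gauss_moment 3 / sqrt (s * real n) ^ Suc 3)
       + v\<^sup>2 * (real k * real m) * (gauss_moment 4 / sqrt (s * real n) ^ Suc 4)"
      by (intro has_bochner_integral_integral_eq has_bochner_integral_add has_bochner_integral_mult_right has_integral_gauss sn)
    also have "\<dots> = A 2 / sqrt n ^ 3 + v * A 3 * ((real k + real m) / sqrt n ^ 4) + v\<^sup>2 * A 4 * (real k * real m / sqrt n ^ 5)"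
      by (simp add: A_def real_sqrt_mult power_mult_distrib eval_nat_numeral field_simps)
    also have "\<dots> \<le> C / sqrt n ^ 3 + C * ((real k + real m) / sqrt n ^ 4) + C * (real k * real m / sqrt n ^ 5)"
      using C by (intro add_mono mult_right_mono divide_right_mono) auto
    also have "\<dots> = C / sqrt n ^ 3 * ((1 + real k / sqrt n) * (1 + real m / sqrt n))"
    proof -
      have "sqrt n ^ 4 = sqrt n ^ 3 * sqrt n" "sqrt n ^ 5 = sqrt n ^ 3 * sqrt n * sqrt n"
        by (simp_all add: eval_nat_numeral)
      then show ?thesis using n0 by (simp only:) (simp add: field_simps)
    qed
    finally show ?thesis using freq_scale_pos by (simp add: mult_left_mono mult.assoc)
  qed
  then show ?thesis by blast
qed

section \<open>Limits of the law of the walk and of its differences\<close>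

lemma step_cf_power_limit:
  assumes "(\<lambda>n. real (N n) / real n) \<longlonglongrightarrow> \<alpha>"
  shows "(\<lambda>n. step_cf (x / sqrt (real n)) ^ N n) \<longlonglongrightarrow> complex_of_real (exp (- \<alpha> * offspring_var * x\<^sup>2 / 2))"
proof -
  have "(\<lambda>n. measure_pmf.expectation p (\<lambda>k. cis (x * (real k - 1) / sqrt (real n))) ^ N n)
     \<longlonglongrightarrow> complex_of_real (exp (- \<alpha> * measure_pmf.expectation p (\<lambda>k. (x * (real k - 1))\<^sup>2) / 2))"
    by (rule char_power_limit)
       (use integrable_step_sq integrable_step mean_step assms in \<open>simp_all add: power_mult_distrib del: integrable_diff\<close>)
  then show ?thesis by (simp add: step_cf_def power_mult_distrib mean_step_sq mult_ac)
qed

lemma step_cf_power_limit_minus: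
  "(\<lambda>n. step_cf (x / sqrt (real n)) ^ (n - j)) \<longlonglongrightarrow> complex_of_real (exp (- offspring_var * x\<^sup>2 / 2))"
proof -
  have "(\<lambda>n. 1 - real j / real n) \<longlonglongrightarrow> 1" by real_asymp
  then have "(\<lambda>n. real (n - j) / real n) \<longlonglongrightarrow> 1"
    by (rule Lim_transform_eventually)
       (auto intro!: eventually_sequentiallyI[of "Suc j"] simp: of_nat_diff diff_divide_distrib)
  from step_cf_power_limit[OF this] show ?thesis by simp
qed

lemma cis_scaled_limit: "(\<lambda>n. cis (x / sqrt (real n))) \<longlonglongrightarrow> 1"
proof -
  have "(\<lambda>n. x / sqrt (real n)) \<longlonglongrightarrow> 0" by real_asymp
  moreover have "continuous_on UNIV cis" by (intro continuous_intros)
  then have "isCont cis 0" by (simp add: continuous_on_eq_continuous_at)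
  ultimately have "(\<lambda>n. cis (x / sqrt (real n))) \<longlonglongrightarrow> cis 0"
    by (rule isCont_tendsto_compose[rotated])
  then show ?thesis by simp
qed

text \<open>To first order only the factor \<open>cis t\<close> counts; the \<open>k\<close>
  centered steps contribute a term of order \<open>t\<^sup>2\<close>. So the limit does not depend
  on \<open>k\<close>, and all tree sizes share the same second-order coefficient.\<close>

lemma cf_defect_limit: "(\<lambda>n. complex_of_real (sqrt (real n)) * cf_defect k (x / sqrt (real n))) \<longlonglongrightarrow> - \<i> * complex_of_real x"
proof -
  have "(\<lambda>n. complex_of_real (sqrt (real n)) * cf_defect k (x / sqrt (real n)) - (- \<i> * complex_of_real x)) \<longlonglongrightarrow> 0"
  proof (rule Lim_null_comparison)
    show "\<forall>\<^sub>F n in sequentially. norm (complex_of_real (sqrt (real n)) * cf_defect k (x / sqrt (real n)) - (- \<i> * complex_of_real x))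
       \<le> real k * (offspring_var / 2 * x\<^sup>2) / sqrt (real n) + x\<^sup>2 / 2 / sqrt (real n)"
      using eventually_gt_at_top[of 0]
    proof eventually_elim
      case (elim n)
      let ?r = "complex_of_real (sqrt (real n))" and ?t = "x / sqrt (real n)"
      have rt: "?r * complex_of_real ?t = complex_of_real x" using elim by (simp only: of_real_mult[symmetric]) simp
      have "?r * cf_defect k ?t - (- \<i> * complex_of_real x) = ?r * ((1 - step_cf ?t ^ k) * cis ?t) - ?r * (cis ?t - 1 - \<i> * complex_of_real ?t)"
        unfolding rt[symmetric] by (simp add: cf_defect_def algebra_simps)
      also have "norm \<dots> \<le> norm (?r * ((1 - step_cf ?t ^ k) * cis ?t)) + norm (?r * (cis ?t - 1 - \<i> * complex_of_real ?t))"
        by (rule norm_triangle_ineq4)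
      also have "norm (?r * ((1 - step_cf ?t ^ k) * cis ?t)) \<le> sqrt (real n) * (real k * (offspring_var / 2 * ?t\<^sup>2))"
        unfolding norm_mult norm_cis norm_of_real using cmod_1_minus_power_le[of ?t k] by (subst mult_1_right) (intro mult_mono, simp_all)
      also have "norm (?r * (cis ?t - 1 - \<i> * complex_of_real ?t)) \<le> sqrt (real n) * (?t\<^sup>2 / 2)"
        unfolding norm_mult norm_of_real using cmod_cis_approx1[of ?t] by (intro mult_mono) auto
      also have "sqrt (real n) * (real k * (offspring_var / 2 * ?t\<^sup>2)) + sqrt (real n) * (?t\<^sup>2 / 2)
         = real k * (offspring_var / 2 * x\<^sup>2) / sqrt (real n) + x\<^sup>2 / 2 / sqrt (real n)"
      proof -
        have "sqrt (real n) * ?t = x" using elim by simp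
        then have "sqrt (real n) * ?t\<^sup>2 = x * ?t" by (simp only: power2_eq_square mult.assoc[symmetric])
        then have "sqrt (real n) * ?t\<^sup>2 = x\<^sup>2 / sqrt (real n)" by (simp add: power2_eq_square)
        moreover have "sqrt (real n) * (real k * (offspring_var / 2 * ?t\<^sup>2)) + sqrt (real n) * (?t\<^sup>2 / 2)
           = real k * (offspring_var / 2 * (sqrt (real n) * ?t\<^sup>2)) + sqrt (real n) * ?t\<^sup>2 / 2" by simp
        ultimately show ?thesis by (simp only:) simp
      qed
      finally show ?case by simp
    qed
    show "(\<lambda>n. real k * (offspring_var / 2 * x\<^sup>2) / sqrt (real n) + x\<^sup>2 / 2 / sqrt (real n)) \<longlonglongrightarrow> 0"
      by real_asymp
  qed
  then show ?thesis by (simp only: LIM_zero_iff)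
qed

lemma cmod_scaled_defect_le:
  assumes "n > 0"
  shows "cmod (complex_of_real (sqrt (real n)) * cf_defect k (x / sqrt (real n))) \<le> \<bar>x\<bar> + offspring_var / 2 * real k * \<bar>x\<bar>\<^sup>2"
proof -
  have n: "sqrt (real n) \<ge> 1" using assms by simp
  have "cmod (complex_of_real (sqrt (real n)) * cf_defect k (x / sqrt (real n)))
     \<le> sqrt (real n) * (\<bar>x / sqrt (real n)\<bar> + offspring_var / 2 * real k * \<bar>x / sqrt (real n)\<bar>\<^sup>2)"
    unfolding norm_mult norm_of_real using cmod_cf_defect_le[of k "x / sqrt (real n)"] by (intro mult_mono) auto
  also have "\<dots> = \<bar>x\<bar> + offspring_var / 2 * real k * \<bar>x\<bar>\<^sup>2 / sqrt (real n)"
    using assms by (simp add: abs_divide power_divide field_simps)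
  also have "\<dots> \<le> \<bar>x\<bar> + offspring_var / 2 * real k * \<bar>x\<bar>\<^sup>2"
    using n offspring_var_pos mult_left_mono[OF n, of "offspring_var / 2 * real k * \<bar>x\<bar>\<^sup>2"]
    by (simp add: divide_le_eq)
  finally show ?thesis .
qed

definition gauss_const :: real where
  "gauss_const = (\<integral>x. exp (- offspring_var * x\<^sup>2 / 2) \<partial>lborel)"

lemma gauss_eq_normal_density:
  "exp (- offspring_var * x\<^sup>2 / 2) = sqrt (2 * pi / offspring_var) * normal_density 0 (1 / sqrt offspring_var) x"
  using offspring_var_pos by (simp add: normal_density_def power_divide real_sqrt_divide mult.commute)

lemma gauss_const_eq: "gauss_const = sqrt (2 * pi / offspring_var)"
  unfolding gauss_const_def gauss_eq_normal_density using offspring_var_pos by simp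

lemma gauss_const_pos: "0 < gauss_const"
  using offspring_var_pos by (simp add: gauss_const_eq)

lemma integral_gauss_first: "(\<integral>x. x * exp (- offspring_var * x\<^sup>2 / 2) \<partial>lborel) = 0"
proof -
  have "x * exp (- offspring_var * x\<^sup>2 / 2)
     = sqrt (2 * pi / offspring_var) * (normal_density 0 (1 / sqrt offspring_var) x * (x - 0) ^ (2 * 0 + 1))" for x
    unfolding gauss_eq_normal_density by simp
  then show ?thesis using integral_normal_moment_odd[of "1 / sqrt offspring_var" 0 0] offspring_var_pos
    by (simp only: integral_mult_right_zero) simp
qed

lemma integral_gauss_second: "(\<integral>x. x\<^sup>2 * exp (- offspring_var * x\<^sup>2 / 2) \<partial>lborel) = gauss_const / offspring_var"
proof -
  have "x\<^sup>2 * exp (- offspring_var * x\<^sup>2 / 2)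
     = sqrt (2 * pi / offspring_var) * (normal_density 0 (1 / sqrt offspring_var) x * (x - 0) ^ (2 * 1))" for x
    unfolding gauss_eq_normal_density by simp
  then show ?thesis using integral_normal_moment_even[of "1 / sqrt offspring_var" 0 1] offspring_var_pos
    by (simp only: integral_mult_right_zero) (simp add: gauss_const_eq power_divide)
qed

text \<open>Completing the square. The linear exponent \<open>b * x\<close> will come from the
  covariance of block sums with the walk, and the factor gained here lowers the variance.\<close>

lemma integral_gauss_shift:
  "(\<integral>x. exp (b * x) * exp (- offspring_var * x\<^sup>2 / 2) \<partial>lborel) = gauss_const * exp (b\<^sup>2 / (2 * offspring_var))"
proof -
  have "exp (b * x) * exp (- offspring_var * x\<^sup>2 / 2)
     = exp (b\<^sup>2 / (2 * offspring_var)) * (sqrt (2 * pi / offspring_var) * normal_density (b / offspring_var) (1 / sqrt offspring_var) x)" for x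
    using offspring_var_pos
    by (simp add: normal_density_def power_divide real_sqrt_divide flip: exp_add)
       (simp add: field_simps power2_eq_square)
  then show ?thesis using offspring_var_pos by (simp add: gauss_const_eq)
qed

text \<open>Its value is \<open>span / sqrt (2 * pi * offspring_var)\<close>, the constant of the
  local limit theorem on a lattice.\<close>

definition llt_const :: real where "llt_const = freq_scale * gauss_const"

lemma llt_const_pos: "0 < llt_const"
  using freq_scale_pos gauss_const_pos by (simp add: llt_const_def)

lemma scaled_fourier_limit:
  fixes G :: "nat \<Rightarrow> real \<Rightarrow> complex"
  assumes "\<And>n. G n \<in> borel_measurable borel" "g \<in> borel_measurable borel"
    and "\<And>x. (\<lambda>n. G n (x / sqrt (real n))) \<longlonglongrightarrow> g x"
    and "\<And>n x. n \<ge> b \<Longrightarrow> n > 0 \<Longrightarrow> \<bar>x / sqrt (real n)\<bar> \<le> pi / span \<Longrightarrow> norm (G n (x / sqrt (real n))) \<le> D x"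
    and "integrable lborel D" "\<And>x. 0 \<le> D x"
  shows "(\<lambda>n. complex_of_real (sqrt (real n)) * (complex_of_real freq_scale * (LINT t:freq_range|lborel. G n t)))
     \<longlonglongrightarrow> complex_of_real freq_scale * (\<integral>x. g x \<partial>lborel)"
  using tendsto_mult[OF tendsto_const[of "complex_of_real freq_scale"] scaled_dominated_convergence[OF pi_div_span_pos assms]]
  by (simp add: mult_ac)

lemma cmod_step_cf_scaled_le:
  assumes "n > 0" "\<bar>x / sqrt (real n)\<bar> \<le> pi / span" "real n \<le> a * real m" "a > 0"
  shows "cmod (step_cf (x / sqrt (real n)) ^ m) \<le> exp (- (decay / a) * x\<^sup>2)"
proof -
  have "cmod (step_cf (x / sqrt (real n)) ^ m) \<le> exp (- (decay * (real n / a)) * (x / sqrt (real n))\<^sup>2)"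
    using assms by (intro cmod_step_cf_power_le) (auto simp: field_simps)
  also have "- (decay * (real n / a)) * (x / sqrt (real n))\<^sup>2 = - (decay / a) * x\<^sup>2"
    using assms by (simp add: power_divide)
  finally show ?thesis .
qed

text \<open>The Fourier integral converges along all \<open>n\<close>, whereas
  \<open>walk_prob n (-1)\<close> is 0 off its residue class. Stated for the integral, the limit
  also shows which sizes are eventually admissible.\<close>

lemma walk_prob_limit_fourier:
  "(\<lambda>n. complex_of_real (sqrt (real n)) * (complex_of_real freq_scale * (LINT t:freq_range|lborel. step_cf t ^ n * cis (- t * of_int (-1)))))
     \<longlonglongrightarrow> complex_of_real llt_const"
proof -
  have "(\<lambda>n. complex_of_real (sqrt (real n)) * (complex_of_real freq_scale * (LINT t:freq_range|lborel. step_cf t ^ n * cis (- t * of_int (-1)))))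
     \<longlonglongrightarrow> complex_of_real freq_scale * (\<integral>x. complex_of_real (exp (- offspring_var * x\<^sup>2 / 2)) \<partial>lborel)"
  proof (rule scaled_fourier_limit[where b = 0 and D = "\<lambda>x. \<bar>x\<bar> ^ 0 * exp (- decay * x\<^sup>2)"])
    fix x
    show "(\<lambda>n. step_cf (x / sqrt (real n)) ^ n * cis (- (x / sqrt (real n)) * of_int (-1))) \<longlonglongrightarrow> complex_of_real (exp (- offspring_var * x\<^sup>2 / 2))"
      using tendsto_mult[OF step_cf_power_limit_minus[of x 0] cis_scaled_limit[of x]] by simp
  next
    fix n :: nat and x assume "n > 0" "\<bar>x / sqrt (real n)\<bar> \<le> pi / span"
    then show "norm (step_cf (x / sqrt (real n)) ^ n * cis (- (x / sqrt (real n)) * of_int (-1))) \<le> \<bar>x\<bar> ^ 0 * exp (- decay * x\<^sup>2)"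
      using cmod_step_cf_scaled_le[of n x 1 n] by (simp add: norm_mult)
  next
    show "integrable lborel (\<lambda>x. \<bar>x\<bar> ^ 0 * exp (- decay * x\<^sup>2))" by (rule integrable_gauss[OF decay_pos])
  qed auto
  then show ?thesis
    by (simp only: integral_complex_of_real gauss_const_def[symmetric] llt_const_def of_real_mult)
qed

lemma eventually_admissible:
  "eventually P (admissible_at_top p) \<longleftrightarrow> (\<forall>\<^sub>F n in sequentially. 0 < size_prob n \<longrightarrow> P n)"
  unfolding admissible_at_top_def admissible_sizes_eq eventually_inf_principal by simp

lemma tendsto_admissible:
  assumes "(J \<longlongrightarrow> L) sequentially" "\<forall>\<^sub>F n in sequentially. 0 < size_prob n \<longrightarrow> J n = g n"
  shows "(g \<longlongrightarrow> L) (admissible_at_top p)"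
proof -
  have "(J \<longlongrightarrow> L) (admissible_at_top p)"
    using assms(1) by (rule tendsto_mono[rotated]) (simp add: admissible_at_top_def)
  then show ?thesis
    by (rule Lim_transform_eventually) (use assms(2) in \<open>simp add: eventually_admissible\<close>)
qed

lemma tendsto_admissible_of_real:
  fixes g :: "nat \<Rightarrow> real"
  assumes "(J \<longlongrightarrow> complex_of_real L) sequentially" "\<forall>\<^sub>F n in sequentially. 0 < size_prob n \<longrightarrow> J n = complex_of_real (g n)"
  shows "(g \<longlongrightarrow> L) (admissible_at_top p)"
  using tendsto_admissible[OF assms] by (simp add: tendsto_of_real_iff)

lemma walk_prob_limit: "((\<lambda>n. sqrt (real n) * walk_prob n (-1)) \<longlongrightarrow> llt_const) (admissible_at_top p)"
proof (rule tendsto_admissible_of_real[OF walk_prob_limit_fourier])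
  show "\<forall>\<^sub>F n in sequentially. 0 < size_prob n \<longrightarrow>
     complex_of_real (sqrt (real n)) * (complex_of_real freq_scale * (LINT t:freq_range|lborel. step_cf t ^ n * cis (- t * of_int (-1))))
      = complex_of_real (sqrt (real n) * walk_prob n (-1))"
  proof (intro always_eventually allI impI)
    fix n assume "0 < size_prob n"
    then have "int span dvd -1 + int n" using span_dvd_of_size_prob[of n] by simp
    from walk_prob_fourier[OF this] show "complex_of_real (sqrt (real n)) * (complex_of_real freq_scale * (LINT t:freq_range|lborel. step_cf t ^ n * cis (- t * of_int (-1))))
      = complex_of_real (sqrt (real n) * walk_prob n (-1))" by simp
  qed
qed

text \<open>For large \<open>n\<close> congruent to 1 modulo \<open>span\<close> the Fourier
  integral is the probability and is close to a positive limit, so the admissible sizes are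
  unbounded. This lets inequalities pass to limits along them.\<close>

lemma admissible_at_top_neq_bot: "admissible_at_top p \<noteq> bot"
proof -
  have "\<forall>\<^sub>F n in sequentially. 0 < Re (complex_of_real (sqrt (real n)) * (complex_of_real freq_scale * (LINT t:freq_range|lborel. step_cf t ^ n * cis (- t * of_int (-1)))))"
    using tendsto_Re[OF walk_prob_limit_fourier] llt_const_pos by (auto intro: order_tendstoD)
  then obtain N where N: "\<And>n. n \<ge> N \<Longrightarrow> 0 < Re (complex_of_real (sqrt (real n)) * (complex_of_real freq_scale * (LINT t:freq_range|lborel. step_cf t ^ n * cis (- t * of_int (-1)))))"
    by (auto simp: eventually_sequentially)
  have pos: "0 < size_prob n" if n: "n \<ge> N" "n > 0" "int span dvd -1 + int n" for n
  proof -
    have "0 < sqrt (real n) * walk_prob n (-1)"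
      using N[OF n(1)] unfolding walk_prob_fourier[OF n(3), symmetric] by (simp flip: of_real_mult)
    then have "0 < walk_prob n (-1)" using n(2) by (simp add: zero_less_mult_iff)
    then show ?thesis using size_prob_eq_walk_prob[of n] n(2) by (metis zero_less_mult_pos of_nat_0_less_iff)
  qed
  show ?thesis
  proof
    assume "admissible_at_top p = bot"
    then have "eventually (\<lambda>_. False) (admissible_at_top p)" by simp
    then obtain M where M: "\<And>n. n \<ge> M \<Longrightarrow> \<not> 0 < size_prob n" by (auto simp: eventually_admissible eventually_sequentially)
    let ?n = "1 + span * (N + M)"
    have "1 * (N + M) \<le> span * (N + M)" using span_pos by (intro mult_right_mono) auto
    then have "N + M \<le> span * (N + M)" by simp
    then have "?n \<ge> N" by linarith
    then have "0 < size_prob ?n" by (rule pos) auto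
    moreover have "?n \<ge> M" using \<open>N + M \<le> span * (N + M)\<close> by linarith
    ultimately show False using M by blast
  qed
qed

text \<open>The rescaled integrand tends to an odd function, whose integral is 0. This improves the
  uniform order \<open>1 / n\<close> to \<open>o(1 / n)\<close>, which is what an error
  \<open>o(sqrt n)\<close> in the mean requires.\<close>

lemma walk_prob_diff_limit:
  assumes "0 < size_prob k"
  shows "((\<lambda>n. real n * (walk_prob (n - k) 0 - walk_prob n (-1))) \<longlongrightarrow> 0) (admissible_at_top p)"
proof -
  let ?G = "\<lambda>n t. complex_of_real (sqrt (real n)) * (step_cf t ^ (n - k) * cf_defect k t)"
  let ?g = "\<lambda>x. complex_of_real (exp (- offspring_var * x\<^sup>2 / 2)) * (- \<i> * complex_of_real x)"
  let ?v = "offspring_var / 2 * real k"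
  have d2: "decay / 2 > 0" using decay_pos by simp
  have "(\<lambda>n. complex_of_real (sqrt (real n)) * (complex_of_real freq_scale * (LINT t:freq_range|lborel. ?G n t)))
     \<longlonglongrightarrow> complex_of_real freq_scale * (\<integral>x. ?g x \<partial>lborel)"
  proof (rule scaled_fourier_limit[where b = "2 * k" and D = "\<lambda>x. \<bar>x\<bar> ^ 1 * exp (- (decay / 2) * x\<^sup>2) + ?v * (\<bar>x\<bar> ^ 2 * exp (- (decay / 2) * x\<^sup>2))"])
    fix x
    show "(\<lambda>n. ?G n (x / sqrt (real n))) \<longlonglongrightarrow> ?g x"
      using tendsto_mult[OF step_cf_power_limit_minus[of x k] cf_defect_limit[of k x]] by (simp add: mult_ac)
  next
    fix n x assume n: "2 * k \<le> n" "0 < n" "\<bar>x / sqrt (real n)\<bar> \<le> pi / span"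
    have "norm (?G n (x / sqrt (real n))) = norm (step_cf (x / sqrt (real n)) ^ (n - k)) * norm (complex_of_real (sqrt (real n)) * cf_defect k (x / sqrt (real n)))"
      by (simp add: norm_mult)
    also have "\<dots> \<le> exp (- (decay / 2) * x\<^sup>2) * (\<bar>x\<bar> + ?v * \<bar>x\<bar>\<^sup>2)"
      using n by (intro mult_mono cmod_step_cf_scaled_le cmod_scaled_defect_le) auto
    finally show "norm (?G n (x / sqrt (real n))) \<le> \<bar>x\<bar> ^ 1 * exp (- (decay / 2) * x\<^sup>2) + ?v * (\<bar>x\<bar> ^ 2 * exp (- (decay / 2) * x\<^sup>2))"
      by (simp add: algebra_simps)
  next
    show "integrable lborel (\<lambda>x. \<bar>x\<bar> ^ 1 * exp (- (decay / 2) * x\<^sup>2) + ?v * (\<bar>x\<bar> ^ 2 * exp (- (decay / 2) * x\<^sup>2)))"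
      by (intro Bochner_Integration.integrable_add integrable_mult_right integrable_gauss d2)
  qed (use offspring_var_pos in auto)
  also have "(\<integral>x. ?g x \<partial>lborel) = 0"
  proof -
    have "?g x = - \<i> * complex_of_real (x * exp (- offspring_var * x\<^sup>2 / 2))" for x by simp
    then have "(\<integral>x. ?g x \<partial>lborel) = - \<i> * (\<integral>x. complex_of_real (x * exp (- offspring_var * x\<^sup>2 / 2)) \<partial>lborel)"
      by (simp only: integral_mult_right_zero)
    then show ?thesis by (simp only: integral_complex_of_real integral_gauss_first) simp
  qed
  finally have *: "(\<lambda>n. complex_of_real (sqrt (real n)) * (complex_of_real freq_scale * (LINT t:freq_range|lborel. ?G n t))) \<longlonglongrightarrow> complex_of_real 0"
    by simp
  show ?thesis
  proof (rule tendsto_admissible_of_real[OF *])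
    show "\<forall>\<^sub>F n in sequentially. 0 < size_prob n \<longrightarrow>
       complex_of_real (sqrt (real n)) * (complex_of_real freq_scale * (LINT t:freq_range|lborel. ?G n t))
        = complex_of_real (real n * (walk_prob (n - k) 0 - walk_prob n (-1)))"
      using eventually_ge_at_top[of k]
    proof eventually_elim
      case (elim n)
      show ?case
      proof
        assume n: "0 < size_prob n"
        let ?r = "complex_of_real (sqrt (real n))"
        have r: "?r * ?r = complex_of_real (real n)" by (simp flip: of_real_mult)
        have w: "complex_of_real (walk_prob (n - k) 0 - walk_prob n (-1))
            = complex_of_real freq_scale * (LINT t:freq_range|lborel. step_cf t ^ (n - k) * cf_defect k t)"
          using span_dvd_of_size_prob[OF n] span_dvd_of_size_prob[OF assms] elim by (rule walk_prob_diff_fourier)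
        have "?r * (complex_of_real freq_scale * (LINT t:freq_range|lborel. ?G n t))
            = (?r * ?r) * (complex_of_real freq_scale * (LINT t:freq_range|lborel. step_cf t ^ (n - k) * cf_defect k t))"
          by (subst set_integral_mult_right) (simp only: mult_ac)
        then show "?r * (complex_of_real freq_scale * (LINT t:freq_range|lborel. ?G n t))
            = complex_of_real (real n * (walk_prob (n - k) 0 - walk_prob n (-1)))"
          by (simp only: r of_real_mult w)
      qed
    qed
  qed
qed

text \<open>The two defects contribute the square of \<open>- \<i> * x\<close>, and the second
  Gaussian moment supplies \<open>1 / offspring_var\<close>. Here
  \<open>- \<mu>\<^sup>2 / \<sigma>2\<close> enters the asymptotic variance.\<close>

lemma walk_prob_mixed_limit:
  assumes "0 < size_prob k" "0 < size_prob m"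
  shows "((\<lambda>n. sqrt (real n) ^ 3 * walk_prob_mixed n k m) \<longlongrightarrow> - llt_const / offspring_var) (admissible_at_top p)"
proof -
  let ?G = "\<lambda>n t. complex_of_real (real n) * (step_cf t ^ (n - k - m) * cis (-t) * (cf_defect k t * cf_defect m t))"
  let ?g = "\<lambda>x. complex_of_real (exp (- offspring_var * x\<^sup>2 / 2)) * 1 * ((- \<i> * complex_of_real x) * (- \<i> * complex_of_real x))"
  let ?v = "offspring_var / 2"
  let ?e = "\<lambda>x. exp (- (decay / 2) * x\<^sup>2)"
  have alg: "e * ((a + v * c * a\<^sup>2) * (a + v * d * a\<^sup>2)) = a ^ 2 * e + (v * (c + d)) * (a ^ 3 * e) + (v\<^sup>2 * c * d) * (a ^ 4 * e)"
    for e a v c d :: real by (simp add: algebra_simps eval_nat_numeral)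
  have d2: "decay / 2 > 0" using decay_pos by simp
  have "(\<lambda>n. complex_of_real (sqrt (real n)) * (complex_of_real freq_scale * (LINT t:freq_range|lborel. ?G n t)))
     \<longlonglongrightarrow> complex_of_real freq_scale * (\<integral>x. ?g x \<partial>lborel)"
  proof (rule scaled_fourier_limit[where b = "2 * (k + m)" and
      D = "\<lambda>x. \<bar>x\<bar> ^ 2 * ?e x + (?v * (real k + real m)) * (\<bar>x\<bar> ^ 3 * ?e x) + (?v\<^sup>2 * real k * real m) * (\<bar>x\<bar> ^ 4 * ?e x)"])
    fix x
    have "?G n (x / sqrt (real n)) = step_cf (x / sqrt (real n)) ^ (n - (k + m)) * cis (-x / sqrt (real n)) *
       ((complex_of_real (sqrt (real n)) * cf_defect k (x / sqrt (real n))) * (complex_of_real (sqrt (real n)) * cf_defect m (x / sqrt (real n))))" for n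
    proof -
      have "complex_of_real (real n) = complex_of_real (sqrt (real n)) * complex_of_real (sqrt (real n))" by (simp flip: of_real_mult)
      then show ?thesis by (simp only: diff_diff_left minus_divide_left mult_ac)
    qed
    then show "(\<lambda>n. ?G n (x / sqrt (real n))) \<longlonglongrightarrow> ?g x"
      by (simp only:) (intro tendsto_mult[OF tendsto_mult[OF step_cf_power_limit_minus[of x "k + m"] cis_scaled_limit[of "-x"]]
          tendsto_mult[OF cf_defect_limit[of k x] cf_defect_limit[of m x]]])
  next
    fix n x assume n: "2 * (k + m) \<le> n" "0 < n" "\<bar>x / sqrt (real n)\<bar> \<le> pi / span"
    have "complex_of_real (real n) = complex_of_real (sqrt (real n)) * complex_of_real (sqrt (real n))" by (simp flip: of_real_mult)
    then have "norm (?G n (x / sqrt (real n))) = norm (step_cf (x / sqrt (real n)) ^ (n - k - m)) *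
       (norm (complex_of_real (sqrt (real n)) * cf_defect k (x / sqrt (real n))) * norm (complex_of_real (sqrt (real n)) * cf_defect m (x / sqrt (real n))))"
      by (simp only: norm_mult norm_cis mult_1_right mult_ac)
    also have "\<dots> \<le> ?e x * ((\<bar>x\<bar> + ?v * real k * \<bar>x\<bar>\<^sup>2) * (\<bar>x\<bar> + ?v * real m * \<bar>x\<bar>\<^sup>2))"
      using n offspring_var_pos by (intro mult_mono cmod_step_cf_scaled_le cmod_scaled_defect_le) auto
    finally show "norm (?G n (x / sqrt (real n))) \<le> \<bar>x\<bar> ^ 2 * ?e x + (?v * (real k + real m)) * (\<bar>x\<bar> ^ 3 * ?e x) + (?v\<^sup>2 * real k * real m) * (\<bar>x\<bar> ^ 4 * ?e x)"
      unfolding alg .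
  next
    show "integrable lborel (\<lambda>x. \<bar>x\<bar> ^ 2 * ?e x + (?v * (real k + real m)) * (\<bar>x\<bar> ^ 3 * ?e x) + (?v\<^sup>2 * real k * real m) * (\<bar>x\<bar> ^ 4 * ?e x))"
      by (intro Bochner_Integration.integrable_add integrable_mult_right integrable_gauss d2)
  qed (use offspring_var_pos in auto)
  also have "(\<integral>x. ?g x \<partial>lborel) = complex_of_real (- gauss_const / offspring_var)"
  proof -
    have "?g x = complex_of_real (- (x\<^sup>2 * exp (- offspring_var * x\<^sup>2 / 2)))" for x
      by (simp add: power2_eq_square algebra_simps)
    then have "(\<integral>x. ?g x \<partial>lborel) = complex_of_real (\<integral>x. - (x\<^sup>2 * exp (- offspring_var * x\<^sup>2 / 2)) \<partial>lborel)"
      by (simp only: integral_complex_of_real)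
    then show ?thesis by (simp only: Bochner_Integration.integral_minus integral_gauss_second) simp
  qed
  also have "complex_of_real freq_scale * complex_of_real (- gauss_const / offspring_var) = complex_of_real (- llt_const / offspring_var)"
    by (simp add: llt_const_def)
  finally have *: "(\<lambda>n. complex_of_real (sqrt (real n)) * (complex_of_real freq_scale * (LINT t:freq_range|lborel. ?G n t)))
     \<longlonglongrightarrow> complex_of_real (- llt_const / offspring_var)" .
  show ?thesis
  proof (rule tendsto_admissible_of_real[OF *])
    show "\<forall>\<^sub>F n in sequentially. 0 < size_prob n \<longrightarrow>
       complex_of_real (sqrt (real n)) * (complex_of_real freq_scale * (LINT t:freq_range|lborel. ?G n t))
        = complex_of_real (sqrt (real n) ^ 3 * walk_prob_mixed n k m)"
      using eventually_ge_at_top[of "k + m"]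
    proof eventually_elim
      case (elim n)
      show ?case
      proof
        assume n: "0 < size_prob n"
        let ?r = "complex_of_real (sqrt (real n))"
        let ?I = "LINT t:freq_range|lborel. step_cf t ^ (n - k - m) * cis (-t) * (cf_defect k t * cf_defect m t)"
        have r: "?r * complex_of_real (real n) = complex_of_real (sqrt (real n) ^ 3)"
          by (simp only: of_real_mult[symmetric]) (simp add: eval_nat_numeral)
        have w: "complex_of_real (walk_prob_mixed n k m) = complex_of_real freq_scale * ?I"
          using span_dvd_of_size_prob[OF n] span_dvd_of_size_prob[OF assms(1)] span_dvd_of_size_prob[OF assms(2)] elim
          by (rule walk_prob_mixed_fourier)
        have "?r * (complex_of_real freq_scale * (LINT t:freq_range|lborel. ?G n t))
            = (?r * complex_of_real (real n)) * (complex_of_real freq_scale * ?I)"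
          by (subst set_integral_mult_right) (simp only: mult_ac)
        then show "?r * (complex_of_real freq_scale * (LINT t:freq_range|lborel. ?G n t))
            = complex_of_real (sqrt (real n) ^ 3 * walk_prob_mixed n k m)"
          by (simp only: r of_real_mult w)
      qed
    qed
  qed
qed

text \<open>The limit covers large sizes; the finitely many other admissible sizes have positive
  probability and are covered by a minimum.\<close>

lemma exists_walk_prob_lower: "\<exists>K>0. \<forall>n. 0 < size_prob n \<longrightarrow> 1 / (K * sqrt (real n)) \<le> walk_prob n (-1)"
proof -
  have "\<forall>\<^sub>F n in admissible_at_top p. llt_const / 2 < sqrt (real n) * walk_prob n (-1)"
    by (rule order_tendstoD(1)[OF walk_prob_limit]) (use llt_const_pos in simp)
  then obtain N where N: "\<And>n. n \<ge> N \<Longrightarrow> 0 < size_prob n \<Longrightarrow> llt_const / 2 < sqrt (real n) * walk_prob n (-1)"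
    by (auto simp: eventually_admissible eventually_sequentially)
  define S where "S = insert (llt_const / 2) ((\<lambda>n. sqrt (real n) * walk_prob n (-1)) ` {n. n < N \<and> 0 < size_prob n})"
  have S: "finite S" "S \<noteq> {}" by (auto simp: S_def)
  have pos: "0 < sqrt (real n) * walk_prob n (-1)" if "0 < size_prob n" for n
    using that size_prob_eq_walk_prob[of n] by (cases "n = 0") (auto simp flip: size_prob_eq_walk_prob)
  have "0 < Min S" using S pos llt_const_pos by (auto simp: Min_gr_iff S_def)
  moreover have "Min S \<le> sqrt (real n) * walk_prob n (-1)" if "0 < size_prob n" for n
  proof (cases "n < N")
    case True
    then show ?thesis using S that by (intro Min_le) (auto simp: S_def)
  next
    case False
    have "Min S \<le> llt_const / 2" using S by (intro Min_le) (auto simp: S_def)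
    then show ?thesis using N[of n] False that by simp
  qed
  ultimately show ?thesis
  proof (intro exI[of _ "1 / Min S"] conjI allI impI)
    fix n assume n: "0 < size_prob n"
    then have "0 < n" by (cases n) auto
    then show "1 / (1 / Min S * sqrt (real n)) \<le> walk_prob n (-1)"
      using \<open>0 < Min S\<close> \<open>\<And>n. 0 < size_prob n \<Longrightarrow> Min S \<le> _\<close>[OF n] by (simp add: field_simps)
  qed simp
qed

end

section \<open>Moments of additive functionals\<close>

lemma first_tree_take:
  assumes "prefix (degree_seq t) xs"
  shows "first_tree f (take j xs) = (if num_nodes t \<le> j then f t else 0)"
proof (cases "num_nodes t \<le> j")
  case True
  then have "prefix (degree_seq t) (take j xs)"
    using assms by (auto simp: prefix_def length_degree_seq)
  then show ?thesis using True by (simp add: first_tree_eq)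
next
  case False
  have "\<not> prefix (degree_seq u) (take j xs)" for u
  proof
    assume u: "prefix (degree_seq u) (take j xs)"
    then have "prefix (degree_seq u) xs" using take_is_prefix prefix_order.trans by blast
    then have "u = t" using assms prefix_degree_seq_unique by blast
    then show False using prefix_length_le[OF u] False by (simp add: length_degree_seq)
  qed
  then show ?thesis using False by (auto intro: first_tree_none)
qed

lemma tree_prefix_drop_degree_seq:
  assumes "i < num_nodes t"
  obtains s where "prefix (degree_seq s) (drop i (degree_seq t))"
proof -
  have "walk (take i (degree_seq t)) + walk (drop i (degree_seq t)) = -1"
    using walk_degree_seq[of t] by (metis append_take_drop_id walk_simps(3))
  then have "walk (drop i (degree_seq t)) < 0" using walk_take_degree_seq[OF assms] by simp
  then show ?thesis using tree_prefix_exists that by blast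
qed

lemma rotate_degree_seq_append:
  assumes "i < num_nodes t"
  shows "rotate i (degree_seq t @ zs) = drop i (degree_seq t) @ zs @ take i (degree_seq t)"
  using assms by (simp add: rotate_drop_take length_degree_seq)

text \<open>The indicator that position \<open>i\<close> lies inside the tree at the front. As a
  \<open>first_tree\<close> value it is 0 if no tree is complete.\<close>

abbreviation root_exceeds :: "nat \<Rightarrow> nat list \<Rightarrow> real" where
  "root_exceeds i \<equiv> first_tree (\<lambda>t. of_bool (i < num_nodes t))"

lemma sum_root_exceeds:
  assumes "length (degree_seq t @ zs) = n"
  shows "(\<Sum>i\<in>{0<..<n}. root_exceeds i (degree_seq t @ zs) * first_tree f (rotate i (degree_seq t @ zs)))
     = additive_functional f t - f t"
proof -
  let ?xs = "degree_seq t @ zs"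
  have le: "num_nodes t \<le> n" using assms by (simp flip: length_degree_seq)
  have ft: "first_tree f (rotate i ?xs) = first_tree f (drop i (degree_seq t))" if i: "i < num_nodes t" for i
  proof -
    obtain s where s: "prefix (degree_seq s) (drop i (degree_seq t))" using tree_prefix_drop_degree_seq[OF i] .
    then have "prefix (degree_seq s) (rotate i ?xs)" by (simp add: rotate_degree_seq_append[OF i] prefix_prefix)
    then show ?thesis using s by (simp add: first_tree_eq)
  qed
  have "(\<Sum>i\<in>{0<..<n}. root_exceeds i ?xs * first_tree f (rotate i ?xs))
     = (\<Sum>i\<in>{0<..<num_nodes t}. first_tree f (drop i (degree_seq t)))"
    by (rule sum.mono_neutral_cong_right) (use le in \<open>auto simp: ft\<close>)
  also have "\<dots> = (\<Sum>i<num_nodes t. first_tree f (drop i (degree_seq t))) - first_tree f (drop 0 (degree_seq t))"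
    using num_nodes_pos[of t] by (subst sum.remove[of "{..<num_nodes t}" 0]) (auto intro!: sum.cong)
  also have "\<dots> = additive_functional f t - f t"
    using window_sum_degree_seq[of f t] first_tree_append[of f t "[]"] by (simp add: window_sum_def length_degree_seq)
  finally show ?thesis .
qed

text \<open>Two windows are disjoint or nested; the last term accounts for a second window that wraps
  around the end of the word and hence contains the first one.\<close>

lemma first_tree_mult_rotate:
  assumes walk: "walk xs = -1" and j: "0 < j" "j < length xs"
  shows "first_tree f xs * first_tree f (rotate j xs) =
      root_exceeds j xs * (first_tree f xs * first_tree f (rotate j xs))
    + first_tree f (take j xs) * first_tree f (drop j xs)
    + root_exceeds (length xs - j) (rotate j xs)
        * (first_tree f (rotate j xs) * first_tree f (rotate (length xs - j) (rotate j xs)))"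
proof -
  let ?n = "length xs"
  obtain t where t: "prefix (degree_seq t) xs" using tree_prefix_exists[of xs] walk by auto
  obtain s where s: "prefix (degree_seq s) (rotate j xs)" using tree_prefix_exists[of "rotate j xs"] walk by auto
  have rotate_back: "rotate (?n - j) (rotate j xs) = xs"
    using j by (simp add: rotate_rotate)
  have drop: "drop j xs = take (?n - j) (rotate j xs)"
    using j by (simp add: rotate_drop_take)
  \<comment> \<open>A tree that starts inside the leading tree also ends inside it, so it cannot
    reach around the end of the word. At most one of the two nestings occurs.\<close>
  have excl: "\<not> (j < num_nodes t \<and> ?n - j < num_nodes s)"
  proof
    assume *: "j < num_nodes t \<and> ?n - j < num_nodes s"
    obtain zs where zs: "xs = degree_seq t @ zs" using t by (auto simp: prefix_def)
    obtain u where u: "prefix (degree_seq u) (drop j (degree_seq t))" using tree_prefix_drop_degree_seq * by blast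
    then have "prefix (degree_seq u) (rotate j xs)"
      using * unfolding zs by (simp add: rotate_degree_seq_append prefix_prefix)
    then have "u = s" using s prefix_degree_seq_unique by blast
    then have "num_nodes s \<le> num_nodes t - j" using prefix_length_le[OF u] by (simp add: length_degree_seq)
    moreover have "num_nodes t \<le> ?n" by (simp add: zs length_degree_seq)
    ultimately show False using * by arith
  qed
  show ?thesis
    unfolding rotate_back drop first_tree_take[OF t] first_tree_take[OF s] first_tree_eq[OF t] first_tree_eq[OF s]
    using excl by auto
qed

context critical_offspring
begin

lemma walk_prob_convolution:
  "word_mean m (\<lambda>xs. walk_prob n (i - walk xs)) = walk_prob (m + n) i"
proof -
  have "walk_prob (m + n) i = word_mean m (\<lambda>a. word_mean n (\<lambda>b. of_bool (walk (a @ b) = i)))"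
    unfolding walk_prob_def by (rule word_mean_append) simp
  also have "\<dots> = word_mean m (\<lambda>a. word_mean n (\<lambda>b. of_bool (walk b = i - walk a)))"
    by (intro expectation_pmf_cong arg_cong[of _ _ of_bool]) auto
  finally show ?thesis by (simp add: walk_prob_def)
qed

lemma integrable_walk_prob [simp]: "integrable (replicate_pmf m p) (\<lambda>xs. walk_prob n (g xs))"
  by (rule integrable_pmf_bounded[of _ _ 1]) (simp add: walk_prob_le_1)

lemma tree_sum_cmult: "tree_sum k (\<lambda>t. f t * c) = tree_sum k f * c"
  by (simp add: tree_sum_def sum_distrib_right mult.assoc)

lemma tree_sum_cmult_left: "tree_sum k (\<lambda>t. c * f t) = c * tree_sum k f"
  by (simp add: tree_sum_def sum_distrib_left mult_ac)

lemma tree_sum_add: "tree_sum k (\<lambda>t. f t + g t) = tree_sum k f + tree_sum k g"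
  by (simp add: tree_sum_def distrib_left sum.distrib)

text \<open>One tree leads the first \<open>j\<close> letters, the other leads the rest. Together
  they lower the walk by 2, so the remaining \<open>n - k - m\<close> letters have to sum to
  1.\<close>

lemma word_mean_disjoint_pair:
  assumes "j \<le> n"
  shows "word_mean n (\<lambda>xs. of_bool (walk xs = -1) * (first_tree f (take j xs) * first_tree f (drop j xs)))
     = (\<Sum>k\<le>j. \<Sum>m\<le>n - j. walk_prob (n - k - m) 1 * (tree_sum k f * tree_sum m f))"
proof -
  let ?r = "n - j"
  have n: "n = j + ?r" using assms by simp
  have "word_mean n (\<lambda>xs. of_bool (walk xs = -1) * (first_tree f (take j xs) * first_tree f (drop j xs)))
     = word_mean j (\<lambda>a. word_mean ?r (\<lambda>b. of_bool (walk (a @ b) = -1) * (first_tree f (take j (a @ b)) * first_tree f (drop j (a @ b)))))"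
    by (subst (1) n, rule word_mean_append) (rule integrable_word_walk)
  also have "\<dots> = word_mean j (\<lambda>a. first_tree f a * word_mean ?r (\<lambda>b. first_tree f b * of_bool (walk b = -1 - walk a)))"
  proof (rule expectation_pmf_cong)
    fix a assume "a \<in> set_pmf (replicate_pmf j p)"
    then have "length a = j" by (rule length_replicate_pmf)
    then have "of_bool (walk (a @ b) = -1) * (first_tree f (take j (a @ b)) * first_tree f (drop j (a @ b)))
       = first_tree f a * (first_tree f b * of_bool (walk b = -1 - walk a))" for b
      by (auto simp: of_bool_def)
    then show "word_mean ?r (\<lambda>b. of_bool (walk (a @ b) = -1) * (first_tree f (take j (a @ b)) * first_tree f (drop j (a @ b))))
       = first_tree f a * word_mean ?r (\<lambda>b. first_tree f b * of_bool (walk b = -1 - walk a))" by simp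
  qed
  also have "\<dots> = word_mean j (\<lambda>a. \<Sum>m\<le>?r. tree_sum m f * (first_tree f a * walk_prob (?r - m) (- walk a)))"
  proof (rule expectation_pmf_cong)
    fix a
    have "word_mean ?r (\<lambda>b. first_tree f b * of_bool (walk b = -1 - walk a)) = (\<Sum>m\<le>?r. tree_sum m f * walk_prob (?r - m) (- walk a))"
      by (subst word_mean_first_tree) (simp_all add: walk_degree_seq walk_prob_def tree_sum_cmult)
    then show "first_tree f a * word_mean ?r (\<lambda>b. first_tree f b * of_bool (walk b = -1 - walk a))
       = (\<Sum>m\<le>?r. tree_sum m f * (first_tree f a * walk_prob (?r - m) (- walk a)))"
      by (simp add: sum_distrib_left mult_ac)
  qed
  also have "\<dots> = (\<Sum>m\<le>?r. tree_sum m f * word_mean j (\<lambda>a. first_tree f a * walk_prob (?r - m) (- walk a)))"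
    by (subst Bochner_Integration.integral_sum) (auto intro!: integrable_mult_right integrable_first_tree)
  also have "\<dots> = (\<Sum>m\<le>?r. tree_sum m f * (\<Sum>k\<le>j. tree_sum k f * walk_prob (n - k - m) 1))"
  proof (intro sum.cong refl arg_cong2[of _ _ _ _ "(*)"])
    fix m assume m: "m \<in> {..?r}"
    have "word_mean j (\<lambda>a. first_tree f a * walk_prob (?r - m) (- walk a))
       = (\<Sum>k\<le>j. tree_sum k (\<lambda>t. f t * word_mean (j - k) (\<lambda>zs. walk_prob (?r - m) (1 - walk zs))))"
      by (subst word_mean_first_tree) (simp_all add: walk_degree_seq)
    also have "\<dots> = (\<Sum>k\<le>j. tree_sum k f * walk_prob (n - k - m) 1)"
      using m assms by (intro sum.cong refl) (simp add: walk_prob_convolution tree_sum_cmult)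
    finally show "word_mean j (\<lambda>a. first_tree f a * walk_prob (?r - m) (- walk a)) = (\<Sum>k\<le>j. tree_sum k f * walk_prob (n - k - m) 1)" .
  qed
  also have "\<dots> = (\<Sum>m\<le>?r. \<Sum>k\<le>j. walk_prob (n - k - m) 1 * (tree_sum k f * tree_sum m f))"
    by (simp add: sum_distrib_left mult_ac)
  finally show ?thesis by (subst sum.swap)
qed

text \<open>Summing over \<open>i\<close> before taking means collapses the inner factor, for each
  single word, to the contribution of the proper fringe subtrees of the leading tree.\<close>

lemma word_mean_nested_pairs:
  "(\<Sum>i\<in>{0<..<n}. word_mean n (\<lambda>xs. of_bool (walk xs = -1) * (root_exceeds i xs * (first_tree f xs * first_tree f (rotate i xs)))))
     = (\<Sum>k\<le>n. walk_prob (n - k) 0 * tree_sum k (\<lambda>t. f t * (additive_functional f t - f t)))"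
proof -
  let ?h = "\<lambda>xs. of_bool (walk xs = -1) * (\<Sum>i\<in>{0<..<n}. root_exceeds i xs * first_tree f (rotate i xs))"
  have "(\<Sum>i\<in>{0<..<n}. word_mean n (\<lambda>xs. of_bool (walk xs = -1) * (root_exceeds i xs * (first_tree f xs * first_tree f (rotate i xs)))))
     = word_mean n (\<lambda>xs. \<Sum>i\<in>{0<..<n}. of_bool (walk xs = -1) * (root_exceeds i xs * (first_tree f xs * first_tree f (rotate i xs))))"
    by (rule Bochner_Integration.integral_sum[symmetric]) (rule integrable_word_walk)
  also have "\<dots> = word_mean n (\<lambda>xs. first_tree f xs * ?h xs)"
    by (intro expectation_pmf_cong) (simp add: sum_distrib_left mult_ac)
  also have "\<dots> = (\<Sum>k\<le>n. tree_sum k (\<lambda>t. f t * word_mean (n - k) (\<lambda>zs. ?h (degree_seq t @ zs))))"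
    by (rule word_mean_first_tree) (rule integrable_word_walk)
  also have "\<dots> = (\<Sum>k\<le>n. tree_sum k (\<lambda>t. f t * (additive_functional f t - f t) * walk_prob (n - k) 0))"
  proof (intro sum.cong refl)
    fix k assume k: "k \<in> {..n}"
    have "word_mean (n - k) (\<lambda>zs. ?h (degree_seq t @ zs)) = (additive_functional f t - f t) * walk_prob (n - k) 0" if t: "t \<in> trees k" for t
    proof -
      have "word_mean (n - k) (\<lambda>zs. ?h (degree_seq t @ zs)) = word_mean (n - k) (\<lambda>zs. (additive_functional f t - f t) * of_bool (walk zs = 0))"
      proof (rule expectation_pmf_cong)
        fix zs assume "zs \<in> set_pmf (replicate_pmf (n - k) p)"
        then have "length (degree_seq t @ zs) = n" using t k by (simp add: length_replicate_pmf length_degree_seq trees_def)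
        then show "?h (degree_seq t @ zs) = (additive_functional f t - f t) * of_bool (walk zs = 0)"
          by (subst sum_root_exceeds) (auto simp: walk_degree_seq)
      qed
      then show ?thesis by (simp add: walk_prob_def)
    qed
    then show "tree_sum k (\<lambda>t. f t * word_mean (n - k) (\<lambda>zs. ?h (degree_seq t @ zs)))
       = tree_sum k (\<lambda>t. f t * (additive_functional f t - f t) * walk_prob (n - k) 0)"
      unfolding tree_sum_def by (intro sum.cong refl) simp
  qed
  finally show ?thesis unfolding tree_sum_cmult by (simp only: mult.commute)
qed

text \<open>For given sizes \<open>k\<close> and \<open>m\<close>, the admissible cuts are those
  with \<open>k \<le> j\<close> and \<open>j \<le> n - m\<close>, and there are
  \<open>n + 1 - k - m\<close> of them. Since \<open>c\<close> vanishes at size 0, the cuts at both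
  ends of the word do not interfere.\<close>

lemma sum_disjoint_positions:
  fixes c :: "nat \<Rightarrow> nat \<Rightarrow> real"
  assumes "\<And>m. c 0 m = 0" "\<And>k. c k 0 = 0"
  shows "(\<Sum>j\<in>{0<..<n}. \<Sum>k\<le>j. \<Sum>m\<le>n - j. c k m) = (\<Sum>k\<le>n. \<Sum>m\<le>n - k. real (n + 1 - k - m) * c k m)"
proof -
  have "(\<Sum>j\<in>{0<..<n}. \<Sum>k\<le>j. \<Sum>m\<le>n - j. c k m) = (\<Sum>j\<in>{0<..<n}. \<Sum>k\<le>n. \<Sum>m\<le>n. of_bool (k \<le> j \<and> m \<le> n - j) * c k m)"
  proof (rule sum.cong[OF refl])
    fix j assume j: "j \<in> {0<..<n}"
    have inner: "(\<Sum>m\<le>n. of_bool (k \<le> j \<and> m \<le> n - j) * c k m) = of_bool (k \<le> j) * (\<Sum>m\<le>n - j. c k m)" for k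
    proof -
      have "(\<Sum>m\<le>n - j. c k m) = (\<Sum>m\<le>n. of_bool (m \<le> n - j) * c k m)"
        by (rule sum.mono_neutral_cong_left) auto
      then show ?thesis by (auto simp: of_bool_def)
    qed
    show "(\<Sum>k\<le>j. \<Sum>m\<le>n - j. c k m) = (\<Sum>k\<le>n. \<Sum>m\<le>n. of_bool (k \<le> j \<and> m \<le> n - j) * c k m)"
      unfolding inner by (rule sum.mono_neutral_cong_left) (use j in auto)
  qed
  also have "\<dots> = (\<Sum>k\<le>n. \<Sum>j\<in>{0<..<n}. \<Sum>m\<le>n. of_bool (k \<le> j \<and> m \<le> n - j) * c k m)" by (rule sum.swap)
  also have "\<dots> = (\<Sum>k\<le>n. \<Sum>m\<le>n. \<Sum>j\<in>{0<..<n}. of_bool (k \<le> j \<and> m \<le> n - j) * c k m)"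
    by (intro sum.cong refl sum.swap)
  also have "\<dots> = (\<Sum>k\<le>n. \<Sum>m\<le>n. real (n + 1 - k - m) * c k m)"
  proof (intro sum.cong refl)
    fix k m
    show "(\<Sum>j\<in>{0<..<n}. of_bool (k \<le> j \<and> m \<le> n - j) * c k m) = real (n + 1 - k - m) * c k m"
    proof (cases "k = 0 \<or> m = 0")
      case False
      have "(\<Sum>j\<in>{0<..<n}. of_bool (k \<le> j \<and> m \<le> n - j) * c k m) = (\<Sum>j\<in>{k..<n + 1 - m}. c k m)"
        by (rule sum.mono_neutral_cong_right) (use False in auto)
      then show ?thesis by (simp add: algebra_simps)
    qed (auto simp: assms)
  qed
  also have "\<dots> = (\<Sum>k\<le>n. \<Sum>m\<le>n - k. real (n + 1 - k - m) * c k m)"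
    by (intro sum.cong refl sum.mono_neutral_cong_right) auto
  finally show ?thesis .
qed

text \<open>Rotation moves one of the two positions to the front and cancels the factor
  \<open>n\<close> of the cycle lemma. The second window then equals the first, is nested in it, is
  disjoint from it, or contains it. Rotating by \<open>j\<close> and replacing \<open>j\<close> by
  \<open>n - j\<close> identifies the last case with the nested one; the diagonal and the two nested
  sums combine to \<open>2 * additive_functional f t - f t\<close>.\<close>

theorem tree_sum_additive_functional_square:
  "tree_sum n (\<lambda>t. (additive_functional f t)\<^sup>2) =
      (\<Sum>k\<le>n. walk_prob (n - k) 0 * tree_sum k (\<lambda>t. f t * (2 * additive_functional f t - f t)))
    + (\<Sum>k\<le>n. \<Sum>m\<le>n - k. real (n + 1 - k - m) * (walk_prob (n - k - m) 1 * (tree_sum k f * tree_sum m f)))"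
proof (cases "n = 0")
  case True
  then show ?thesis by (simp add: tree_sum_def)
next
  case False
  let ?b = "\<lambda>xs. of_bool (walk xs = -1) :: real"
  let ?X = "\<lambda>j xs. first_tree f (rotate j xs)"
  let ?N = "\<lambda>i xs. root_exceeds i xs * (first_tree f xs * ?X i xs)"
  let ?D = "\<lambda>j xs. first_tree f (take j xs) * first_tree f (drop j xs)"
  let ?nested = "\<Sum>k\<le>n. walk_prob (n - k) 0 * tree_sum k (\<lambda>t. f t * (additive_functional f t - f t))"
  have rot: "word_mean n (\<lambda>xs. ?b xs * g (rotate j xs)) = word_mean n (\<lambda>xs. ?b xs * g xs)" for g :: "nat list \<Rightarrow> real" and j
    using word_mean_rotate[of n "\<lambda>xs. ?b xs * g xs" j] by simp
  have "real n * tree_sum n (\<lambda>t. (additive_functional f t)\<^sup>2) = word_mean n (\<lambda>xs. ?b xs * (cyclic_sum f xs)\<^sup>2)"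
    using tree_sum_eq_word_mean[of "\<lambda>xs. (cyclic_sum f xs)\<^sup>2" n] by (simp add: cyclic_sum_rotate cyclic_sum_degree_seq)
  also have "\<dots> = word_mean n (\<lambda>xs. \<Sum>j<n. ?b xs * (\<lambda>ys. first_tree f ys * cyclic_sum f ys) (rotate j xs))"
  proof (rule expectation_pmf_cong)
    fix xs assume "xs \<in> set_pmf (replicate_pmf n p)"
    then have "length xs = n" by (rule length_replicate_pmf)
    then have c: "cyclic_sum f xs = (\<Sum>j<n. ?X j xs)" by (simp add: cyclic_sum_def)
    have "(cyclic_sum f xs)\<^sup>2 = (\<Sum>j<n. ?X j xs) * cyclic_sum f xs" by (simp only: c power2_eq_square)
    then show "?b xs * (cyclic_sum f xs)\<^sup>2 = (\<Sum>j<n. ?b xs * (\<lambda>ys. first_tree f ys * cyclic_sum f ys) (rotate j xs))"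
      by (simp add: cyclic_sum_rotate sum_distrib_right sum_distrib_left)
  qed
  also have "\<dots> = (\<Sum>j<n. word_mean n (\<lambda>xs. ?b xs * (\<lambda>ys. first_tree f ys * cyclic_sum f ys) (rotate j xs)))"
    by (rule Bochner_Integration.integral_sum) (rule integrable_word_walk)
  also have "\<dots> = real n * word_mean n (\<lambda>xs. ?b xs * (first_tree f xs * cyclic_sum f xs))"
    by (simp add: rot[of "\<lambda>ys. first_tree f ys * cyclic_sum f ys"])
  finally have "tree_sum n (\<lambda>t. (additive_functional f t)\<^sup>2) = word_mean n (\<lambda>xs. ?b xs * (first_tree f xs * cyclic_sum f xs))"
    using False by simp
  also have "\<dots> = word_mean n (\<lambda>xs. ?b xs * (first_tree f xs)\<^sup>2
      + (\<Sum>j\<in>{0<..<n}. ?b xs * ?N j xs + ?b xs * ?D j xs + ?b xs * ?N (n - j) (rotate j xs)))"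
  proof (rule expectation_pmf_cong)
    fix xs assume "xs \<in> set_pmf (replicate_pmf n p)"
    then have len: "length xs = n" by (rule length_replicate_pmf)
    show "?b xs * (first_tree f xs * cyclic_sum f xs) = ?b xs * (first_tree f xs)\<^sup>2
      + (\<Sum>j\<in>{0<..<n}. ?b xs * ?N j xs + ?b xs * ?D j xs + ?b xs * ?N (n - j) (rotate j xs))"
    proof (cases "walk xs = -1")
      case True
      have "first_tree f xs * cyclic_sum f xs = (\<Sum>j<n. first_tree f xs * ?X j xs)"
        by (simp add: cyclic_sum_def len sum_distrib_left)
      also have "\<dots> = first_tree f xs * ?X 0 xs + (\<Sum>j\<in>{0<..<n}. first_tree f xs * ?X j xs)"
        using False by (subst sum.remove[of "{..<n}" 0]) (auto intro!: sum.cong)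
      also have "(\<Sum>j\<in>{0<..<n}. first_tree f xs * ?X j xs) = (\<Sum>j\<in>{0<..<n}. ?N j xs + ?D j xs + ?N (n - j) (rotate j xs))"
        using first_tree_mult_rotate[OF True] len by (intro sum.cong refl) auto
      finally show ?thesis using True by (simp add: power2_eq_square)
    qed simp
  qed
  also have "\<dots> = word_mean n (\<lambda>xs. ?b xs * (first_tree f xs)\<^sup>2)
      + (\<Sum>j\<in>{0<..<n}. word_mean n (\<lambda>xs. ?b xs * ?N j xs) + word_mean n (\<lambda>xs. ?b xs * ?D j xs)
            + word_mean n (\<lambda>xs. ?b xs * ?N (n - j) (rotate j xs)))"
    using integrable_word_walk[of n "-1"]
    by (subst Bochner_Integration.integral_add Bochner_Integration.integral_sum;
        (intro integrable_word_walk Bochner_Integration.integrable_add Bochner_Integration.integrable_sum)?)+ simp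
  also have "(\<Sum>j\<in>{0<..<n}. word_mean n (\<lambda>xs. ?b xs * ?N j xs) + word_mean n (\<lambda>xs. ?b xs * ?D j xs)
            + word_mean n (\<lambda>xs. ?b xs * ?N (n - j) (rotate j xs)))
     = ?nested + (\<Sum>j\<in>{0<..<n}. word_mean n (\<lambda>xs. ?b xs * ?D j xs)) + ?nested"
  proof -
    have "(\<Sum>j\<in>{0<..<n}. word_mean n (\<lambda>xs. ?b xs * ?N (n - j) xs)) = (\<Sum>j\<in>{0<..<n}. word_mean n (\<lambda>xs. ?b xs * ?N j xs))"
      by (rule sum.reindex_bij_witness[of _ "\<lambda>j. n - j" "\<lambda>j. n - j"]) auto
    moreover have "word_mean n (\<lambda>xs. ?b xs * ?N (n - j) (rotate j xs)) = word_mean n (\<lambda>xs. ?b xs * ?N (n - j) xs)" for j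
      by (rule rot)
    ultimately show ?thesis by (simp only: sum.distrib word_mean_nested_pairs)
  qed
  also have "(\<Sum>j\<in>{0<..<n}. word_mean n (\<lambda>xs. ?b xs * ?D j xs))
     = (\<Sum>j\<in>{0<..<n}. \<Sum>k\<le>j. \<Sum>m\<le>n - j. walk_prob (n - k - m) 1 * (tree_sum k f * tree_sum m f))"
    by (intro sum.cong refl word_mean_disjoint_pair) auto
  also have "\<dots> = (\<Sum>k\<le>n. \<Sum>m\<le>n - k. real (n + 1 - k - m) * (walk_prob (n - k - m) 1 * (tree_sum k f * tree_sum m f)))"
    by (rule sum_disjoint_positions) (simp_all add: tree_sum_def)
  also have "word_mean n (\<lambda>xs. ?b xs * (first_tree f xs)\<^sup>2) = (\<Sum>k\<le>n. walk_prob (n - k) 0 * tree_sum k (\<lambda>t. f t * f t))"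
  proof -
    have int: "integrable (replicate_pmf n p) (\<lambda>xs. ?b xs * first_tree f xs)" by (rule integrable_word_walk)
    have "word_mean n (\<lambda>xs. ?b xs * (first_tree f xs)\<^sup>2) = word_mean n (\<lambda>xs. first_tree f xs * (?b xs * first_tree f xs))"
      by (simp add: power2_eq_square mult_ac)
    also have "\<dots> = (\<Sum>k\<le>n. tree_sum k (\<lambda>t. f t * (f t * walk_prob (n - k) 0)))"
      unfolding word_mean_first_tree[OF int] by (simp add: walk_degree_seq walk_prob_def mult.commute)
    also have "\<dots> = (\<Sum>k\<le>n. walk_prob (n - k) 0 * tree_sum k (\<lambda>t. f t * f t))"
      by (simp only: mult.assoc[symmetric] tree_sum_cmult) (simp only: mult.commute)
    finally show ?thesis .
  qed
  finally have "tree_sum n (\<lambda>t. (additive_functional f t)\<^sup>2) =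
      ((\<Sum>k\<le>n. walk_prob (n - k) 0 * tree_sum k (\<lambda>t. f t * f t)) + ?nested + ?nested)
    + (\<Sum>k\<le>n. \<Sum>m\<le>n - k. real (n + 1 - k - m) * (walk_prob (n - k - m) 1 * (tree_sum k f * tree_sum m f)))" by simp
  also have "(\<Sum>k\<le>n. walk_prob (n - k) 0 * tree_sum k (\<lambda>t. f t * f t)) + ?nested + ?nested
     = (\<Sum>k\<le>n. walk_prob (n - k) 0 * tree_sum k (\<lambda>t. f t * (2 * additive_functional f t - f t)))"
    unfolding sum.distrib[symmetric] distrib_left[symmetric] tree_sum_add[symmetric]
    by (simp add: algebra_simps)
  finally show ?thesis .
qed

end

text \<open>A single constant \<open>K \<ge> 1\<close> replaces those of the separate estimates, so
  that products of bounds are powers of \<open>K\<close> and smaller powers may be raised to larger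
  ones.\<close>

locale walk_bounds = critical_offspring +
  fixes K :: real
  assumes K_ge_1: "1 \<le> K"
    and walk_prob_upper: "walk_prob n i \<le> K / sqrt (real n + 1)"
    and walk_prob_lower: "0 < size_prob n \<Longrightarrow> 1 / (K * sqrt (real n)) \<le> walk_prob n (-1)"
    and walk_prob_diff_bound: "0 < size_prob n \<Longrightarrow> 0 < size_prob k \<Longrightarrow> 2 * k \<le> n \<Longrightarrow>
      \<bar>walk_prob (n - k) 0 - walk_prob n (-1)\<bar> \<le> K / real n * (1 + real k / sqrt (real n))"
    and walk_prob_mixed_bound: "0 < size_prob n \<Longrightarrow> 0 < size_prob k \<Longrightarrow> 0 < size_prob m \<Longrightarrow>
      4 * k \<le> n \<Longrightarrow> 4 * m \<le> n \<Longrightarrow>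
      \<bar>walk_prob_mixed n k m\<bar> \<le> K / sqrt (real n) ^ 3 * ((1 + real k / sqrt (real n)) * (1 + real m / sqrt (real n)))"

context critical_offspring
begin

lemma exists_walk_bounds: "\<exists>K. walk_bounds p K"
proof -
  obtain A where A: "\<And>n i. walk_prob n i \<le> A / sqrt (real n + 1)" using exists_walk_prob_upper by blast
  obtain B where B: "B > 0" "\<And>n. 0 < size_prob n \<Longrightarrow> 1 / (B * sqrt (real n)) \<le> walk_prob n (-1)"
    using exists_walk_prob_lower by blast
  obtain C where C: "\<And>n k. 0 < size_prob n \<Longrightarrow> 0 < size_prob k \<Longrightarrow> 2 * k \<le> n \<Longrightarrow>
     \<bar>walk_prob (n - k) 0 - walk_prob n (-1)\<bar> \<le> C / real n * (1 + real k / sqrt n)"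
    using exists_walk_prob_diff_bound by blast
  obtain D where D: "\<And>n k m. 0 < size_prob n \<Longrightarrow> 0 < size_prob k \<Longrightarrow> 0 < size_prob m \<Longrightarrow> 4 * k \<le> n \<Longrightarrow> 4 * m \<le> n \<Longrightarrow>
     \<bar>walk_prob_mixed n k m\<bar> \<le> D / sqrt n ^ 3 * ((1 + real k / sqrt n) * (1 + real m / sqrt n))"
    using exists_walk_prob_mixed_bound by blast
  define K where "K = Max {1, A, B, C, D}"
  have K: "1 \<le> K" "A \<le> K" "B \<le> K" "C \<le> K" "D \<le> K" by (auto simp: K_def)
  have "walk_bounds p K"
  proof
    show "walk_prob n i \<le> K / sqrt (real n + 1)" for n i
      using A[of n i] K by (elim order.trans) (intro divide_right_mono, auto)
    show "1 / (K * sqrt (real n)) \<le> walk_prob n (-1)" if "0 < size_prob n" for n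
    proof -
      have "n > 0" using that by (cases n) auto
      then have "1 / (K * sqrt (real n)) \<le> 1 / (B * sqrt (real n))"
        using B(1) K by (intro divide_left_mono mult_right_mono) auto
      then show ?thesis using B(2)[OF that] by linarith
    qed
    show "\<bar>walk_prob (n - k) 0 - walk_prob n (-1)\<bar> \<le> K / real n * (1 + real k / sqrt (real n))"
      if "0 < size_prob n" "0 < size_prob k" "2 * k \<le> n" for n k
      using C[OF that] K by (elim order.trans) (intro mult_right_mono divide_right_mono, auto)
    show "\<bar>walk_prob_mixed n k m\<bar> \<le> K / sqrt (real n) ^ 3 * ((1 + real k / sqrt (real n)) * (1 + real m / sqrt (real n)))"
      if "0 < size_prob n" "0 < size_prob k" "0 < size_prob m" "4 * k \<le> n" "4 * m \<le> n" for n k m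
      using D[OF that] K by (elim order.trans) (intro mult_right_mono divide_right_mono, auto)
  qed (rule K)
  then show ?thesis by blast
qed

text \<open>The conditional moments vanish at inadmissible sizes because of the division by 0, so their
  limits along admissible sizes to 0 are limits of full sequences.\<close>

definition cond_mean :: "nat \<Rightarrow> (plane_tree \<Rightarrow> real) \<Rightarrow> real" where
  "cond_mean n h = tree_sum n h / size_prob n"

text \<open>The conditional \<open>L\<^sup>2\<close> norm, written with square roots of the weights
  inside \<open>L2_set\<close> so that the triangle and Cauchy-Schwarz inequalities apply
  directly.\<close>

definition cond_norm :: "nat \<Rightarrow> (plane_tree \<Rightarrow> real) \<Rightarrow> real" where
  "cond_norm n h = L2_set (\<lambda>t. sqrt (tree_weight p t / size_prob n) * h t) (trees n)"

definition cond_sd :: "nat \<Rightarrow> (plane_tree \<Rightarrow> real) \<Rightarrow> real" where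
  "cond_sd n h = cond_norm n (\<lambda>t. h t - cond_mean n h)"

lemma tree_weight_eq_0: "size_prob n = 0 \<Longrightarrow> t \<in> trees n \<Longrightarrow> tree_weight p t = 0"
  unfolding size_prob_def tree_sum_def by (simp add: sum_nonneg_eq_0_iff)

lemma tree_sum_eq_0: "size_prob n = 0 \<Longrightarrow> tree_sum n h = 0"
  unfolding tree_sum_def by (intro sum.neutral) (auto simp: tree_weight_eq_0)

lemma tree_sum_eq_cond_mean: "tree_sum n h = size_prob n * cond_mean n h"
  by (cases "size_prob n = 0") (auto simp: cond_mean_def tree_sum_eq_0)

lemma cond_norm_nonneg [simp]: "0 \<le> cond_norm n h"
  by (simp add: cond_norm_def)

lemma cond_sd_nonneg [simp]: "0 \<le> cond_sd n h"
  by (simp add: cond_sd_def)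

lemma cond_norm_eq_0: "size_prob n = 0 \<Longrightarrow> cond_norm n h = 0"
  by (simp add: cond_norm_def L2_set_def)

lemma cond_norm_square: "(cond_norm n h)\<^sup>2 = cond_mean n (\<lambda>t. (h t)\<^sup>2)"
  by (simp add: cond_norm_def L2_set_def cond_mean_def tree_sum_def power_mult_distrib sum_nonneg sum_divide_distrib)

lemma cond_norm_eq: "cond_norm n h = sqrt (cond_mean n (\<lambda>t. (h t)\<^sup>2))"
  by (simp flip: cond_norm_square)

lemma cond_norm_triangle: "cond_norm n (\<lambda>t. f t + g t) \<le> cond_norm n f + cond_norm n g"
  unfolding cond_norm_def distrib_left by (rule L2_set_triangle_ineq)

lemma cond_norm_cmult: "cond_norm n (\<lambda>t. c * f t) = \<bar>c\<bar> * cond_norm n f"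
proof -
  have "(cond_norm n (\<lambda>t. c * f t))\<^sup>2 = (\<bar>c\<bar> * cond_norm n f)\<^sup>2"
    unfolding cond_norm_square power_mult_distrib
    by (simp add: cond_mean_def tree_sum_def sum_distrib_left sum_divide_distrib mult_ac)
  then show ?thesis by (simp add: power2_eq_iff_nonneg)
qed

lemma cond_norm_const_le: "cond_norm n (\<lambda>_. c) \<le> \<bar>c\<bar>"
proof -
  have "(cond_norm n (\<lambda>_. c))\<^sup>2 \<le> \<bar>c\<bar>\<^sup>2"
    unfolding cond_norm_square by (simp add: cond_mean_def tree_sum_def size_prob_def flip: sum_distrib_right)
  then show ?thesis by (rule power2_le_imp_le) simp
qed

lemma cond_norm_mono: "(\<And>t. t \<in> trees n \<Longrightarrow> \<bar>f t\<bar> \<le> \<bar>g t\<bar>) \<Longrightarrow> cond_norm n f \<le> cond_norm n g"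
  unfolding cond_norm_def L2_set_def
  by (intro real_sqrt_le_mono sum_mono) (auto simp: power_mult_distrib abs_le_square_iff intro!: divide_right_mono mult_left_mono)

lemma abs_tree_sum_mult_le: "\<bar>tree_sum n (\<lambda>t. f t * h t)\<bar> \<le> size_prob n * (cond_norm n f * cond_norm n h)"
proof (cases "size_prob n = 0")
  case False
  then have pos: "0 < size_prob n" using size_prob_nonneg[of n] by linarith
  let ?s = "\<lambda>t. sqrt (tree_weight p t / size_prob n)"
  have sq: "?s t * ?s t = tree_weight p t / size_prob n" for t using pos by simp
  have "tree_sum n (\<lambda>t. f t * h t) = size_prob n * (\<Sum>t\<in>trees n. (?s t * ?s t) * (f t * h t))"
    unfolding sq tree_sum_def sum_distrib_left using pos by (intro sum.cong) auto
  also have "\<dots> = size_prob n * (\<Sum>t\<in>trees n. (?s t * f t) * (?s t * h t))"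
    by (simp only: mult_ac)
  finally have eq: "tree_sum n (\<lambda>t. f t * h t) = size_prob n * (\<Sum>t\<in>trees n. (?s t * f t) * (?s t * h t))" .
  have "\<bar>\<Sum>t\<in>trees n. (?s t * f t) * (?s t * h t)\<bar> \<le> (\<Sum>t\<in>trees n. \<bar>?s t * f t\<bar> * \<bar>?s t * h t\<bar>)"
    unfolding abs_mult[symmetric] by (rule sum_abs)
  also have "\<dots> \<le> cond_norm n f * cond_norm n h"
    unfolding cond_norm_def by (rule L2_set_mult_ineq)
  finally show ?thesis unfolding eq abs_mult using pos by (simp add: mult_left_mono)
qed (simp add: tree_sum_eq_0)

lemma abs_tree_sum_le: "\<bar>tree_sum n f\<bar> \<le> size_prob n * cond_norm n f"
proof -
  have "\<bar>tree_sum n (\<lambda>t. f t * 1)\<bar> \<le> size_prob n * (cond_norm n f * cond_norm n (\<lambda>_. 1))" by (rule abs_tree_sum_mult_le)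
  also have "\<dots> \<le> size_prob n * (cond_norm n f * 1)"
    using cond_norm_const_le[of n 1] by (intro mult_left_mono) auto
  finally show ?thesis by simp
qed

lemma abs_cond_mean_le: "\<bar>cond_mean n f\<bar> \<le> cond_norm n f"
proof (cases "size_prob n = 0")
  case False
  then have "0 < size_prob n" using size_prob_nonneg[of n] by linarith
  then show ?thesis using abs_tree_sum_le[of n f] by (simp add: cond_mean_def abs_divide divide_le_eq mult.commute)
qed (simp add: cond_mean_def tree_sum_eq_0)

lemma cond_mean_add: "cond_mean n (\<lambda>t. f t + g t) = cond_mean n f + cond_mean n g"
  by (simp add: cond_mean_def tree_sum_add add_divide_distrib)

lemma cond_mean_cmult: "cond_mean n (\<lambda>t. c * f t) = c * cond_mean n f"
  by (simp add: cond_mean_def tree_sum_def sum_distrib_left mult_ac)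

lemma cond_mean_const: "0 < size_prob n \<Longrightarrow> cond_mean n (\<lambda>_. c) = c"
  by (simp add: cond_mean_def tree_sum_def size_prob_def flip: sum_distrib_right)

lemma cond_sd_square:
  assumes "0 < size_prob n"
  shows "(cond_sd n f)\<^sup>2 = cond_mean n (\<lambda>t. (f t)\<^sup>2) - (cond_mean n f)\<^sup>2"
proof -
  have "(f t - cond_mean n f)\<^sup>2 = (f t)\<^sup>2 + ((-2 * cond_mean n f) * f t + (cond_mean n f)\<^sup>2)" for t
    by (simp add: power2_eq_square algebra_simps)
  then have "(cond_sd n f)\<^sup>2 = cond_mean n (\<lambda>t. (f t)\<^sup>2) + ((-2 * cond_mean n f) * cond_mean n f + (cond_mean n f)\<^sup>2)"
    unfolding cond_sd_def cond_norm_square by (simp only: cond_mean_add cond_mean_cmult cond_mean_const[OF assms])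
  then show ?thesis by (simp add: power2_eq_square)
qed

lemma cond_sd_le_norm: "cond_sd n f \<le> cond_norm n f"
proof (cases "size_prob n = 0")
  case False
  then have "0 < size_prob n" using size_prob_nonneg[of n] by linarith
  then have "(cond_sd n f)\<^sup>2 \<le> (cond_norm n f)\<^sup>2" by (simp add: cond_sd_square cond_norm_square)
  then show ?thesis by (rule power2_le_imp_le) simp
qed (simp add: cond_sd_def cond_norm_eq_0)

lemma cond_sd_triangle: "cond_sd n (\<lambda>t. f t + g t) \<le> cond_sd n f + cond_sd n g"
  using cond_norm_triangle[of n "\<lambda>t. f t - cond_mean n f" "\<lambda>t. g t - cond_mean n g"]
  unfolding cond_sd_def cond_mean_add by (simp add: algebra_simps)

lemma cond_norm_shift_le: "cond_norm n (\<lambda>t. f t - c) \<le> cond_sd n f + \<bar>cond_mean n f - c\<bar>"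
proof -
  have "cond_norm n (\<lambda>t. (f t - cond_mean n f) + (cond_mean n f - c)) \<le> cond_sd n f + cond_norm n (\<lambda>_. cond_mean n f - c)"
    unfolding cond_sd_def by (rule cond_norm_triangle)
  then show ?thesis using cond_norm_const_le[of n "cond_mean n f - c"] by simp
qed

lemma additive_functional_add: "additive_functional (\<lambda>t. f t + g t) t = additive_functional f t + additive_functional g t"
  by (simp add: additive_functional_def sum.distrib)

lemma sum_size_prob_le_1: "(\<Sum>k\<le>n. size_prob k) \<le> 1"
proof -
  have "(\<lambda>n. tree_sum n (\<lambda>_. 1)) sums integral\<^sup>L gw (\<lambda>_. 1)" by (rule sums_expectation_gw) simp
  then have s: "size_prob sums 1" by (simp add: size_prob_def[abs_def])
  then have "(\<Sum>k\<in>{..n}. size_prob k) \<le> suminf size_prob" by (intro sum_le_suminf) (auto simp: sums_iff)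
  then show ?thesis using s by (simp add: sums_iff)
qed

end

lemma sum_inverse_sqrt_le: "(\<Sum>j\<le>n. 1 / sqrt (real j + 1)) \<le> 2 * sqrt (real n + 1)"
proof (induction n)
  case (Suc n)
  have "1 / sqrt (real n + 2) \<le> 2 * (sqrt (real n + 2) - sqrt (real n + 1))"
  proof -
    let ?a = "sqrt (real n + 2)" and ?b = "sqrt (real n + 1)"
    have ab: "?b \<le> ?a" "?a > 0" by auto
    have "1 = (?a - ?b) * (?a + ?b)" by (simp add: algebra_simps)
    also have "\<dots> \<le> (?a - ?b) * (2 * ?a)" using ab by (intro mult_left_mono) auto
    finally have "1 / ?a \<le> ((?a - ?b) * (2 * ?a)) / ?a" using ab(2) by (intro divide_right_mono) auto
    also have "\<dots> = 2 * (?a - ?b)" using ab(2) by simp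
    finally show ?thesis .
  qed
  then show ?case using Suc by (simp add: add.commute)
qed simp

context walk_bounds
begin

lemma K_pos: "0 < K" using K_ge_1 by simp

lemma walk_prob_upper': "n > 0 \<Longrightarrow> walk_prob n i \<le> K / sqrt (real n)"
  using walk_prob_upper[of n i] K_pos by (elim order.trans) (intro divide_left_mono, auto)

lemma sum_walk_prob_le:
  assumes "n > 0" shows "(\<Sum>j\<le>n. walk_prob j i) \<le> 4 * K * sqrt (real n)"
proof -
  have "(\<Sum>j\<le>n. walk_prob j i) \<le> (\<Sum>j\<le>n. K * (1 / sqrt (real j + 1)))"
    using walk_prob_upper by (intro sum_mono) simp
  also have "\<dots> \<le> K * (2 * sqrt (real n + 1))"
    unfolding sum_distrib_left[symmetric] using sum_inverse_sqrt_le[of n] K_pos by (intro mult_left_mono) auto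
  also have "\<dots> \<le> K * (2 * (2 * sqrt (real n)))"
  proof -
    have "sqrt (real n + 1) \<le> sqrt (4 * real n)" using assms by (intro real_sqrt_le_mono) simp
    then show ?thesis using K_pos by (intro mult_left_mono) (auto simp: real_sqrt_mult)
  qed
  finally show ?thesis by simp
qed

text \<open>The Otter-Dwass factor \<open>k\<close> turns the order \<open>1 / sqrt k\<close> of the
  walk law into the order \<open>1 / (k * sqrt k)\<close>.\<close>

lemma size_prob_upper:
  assumes "k > 0" shows "size_prob k \<le> K / (real k * sqrt (real k))"
proof -
  have "real k * size_prob k \<le> K / sqrt (real k)"
    using walk_prob_upper'[OF assms, of "-1"] by (simp add: size_prob_eq_walk_prob)
  then show ?thesis using assms by (simp add: field_simps)
qed

lemma inverse_size_prob_le: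
  assumes "0 < size_prob n" shows "1 / size_prob n \<le> K * real n * sqrt (real n)"
proof -
  have n: "n > 0" using assms by (cases n) auto
  have "1 \<le> K * sqrt (real n) * (real n * size_prob n)"
    using walk_prob_lower[OF assms] n K_pos by (simp add: size_prob_eq_walk_prob divide_le_eq mult_ac)
  then show ?thesis using assms by (simp add: divide_le_eq mult_ac)
qed

lemma sum_size_prob_first_moment:
  assumes "n > 0" shows "(\<Sum>k\<le>n. real k * size_prob k) \<le> 4 * K * sqrt (real n)"
  using sum_walk_prob_le[OF assms, of "-1"] by (simp add: size_prob_eq_walk_prob)

text \<open>Because \<open>real n * size_prob n\<close> is \<open>walk_prob n (-1)\<close>,
  subtracting the centering replaces each coefficient by a first difference. For
  \<open>2 * k \<le> n\<close> the difference bound is summed against \<open>size_prob k\<close> and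
  \<open>real k * size_prob k\<close>. For larger \<open>k\<close> the rarity of such trees is
  summed against the walk probabilities, whose sum is only of order \<open>sqrt n\<close>.\<close>

lemma cond_mean_additive_functional_bound:
  assumes n: "0 < size_prob n" and A: "\<And>k. k \<le> n \<Longrightarrow> \<bar>cond_mean k f\<bar> \<le> A"
  shows "\<bar>cond_mean n (additive_functional f) - real n * cut_mean f n\<bar> \<le> 24 * K ^ 3 * sqrt (real n) * A"
proof -
  have n0: "n > 0" using n by (cases n) auto
  have A0: "0 \<le> A" using A[of 0] by simp
  let ?Q = "walk_prob n (-1)"
  let ?r = "sqrt (real n)"
  have r: "?r > 0" "?r * ?r = real n" using n0 by auto
  define D where "D k = \<bar>walk_prob (n - k) 0 - ?Q\<bar> * size_prob k" for k
  have u: "\<bar>tree_sum k f\<bar> \<le> size_prob k * A" if "k \<le> n" for k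
    unfolding tree_sum_eq_cond_mean abs_mult using A[OF that] by (simp add: mult_left_mono)
  have nQ: "real n * cut_mean f n = (\<Sum>k\<le>n. ?Q * tree_sum k f) / size_prob n"
    using n by (simp add: size_prob_eq_walk_prob[symmetric] cut_mean_def sum_distrib_left[symmetric])
  have "cond_mean n (additive_functional f) - real n * cut_mean f n
     = (\<Sum>k\<le>n. (walk_prob (n - k) 0 - ?Q) * tree_sum k f) / size_prob n"
    unfolding nQ cond_mean_def tree_sum_additive_functional
    by (simp add: left_diff_distrib sum_subtractf diff_divide_distrib)
  then have "\<bar>cond_mean n (additive_functional f) - real n * cut_mean f n\<bar>
     = \<bar>\<Sum>k\<le>n. (walk_prob (n - k) 0 - ?Q) * tree_sum k f\<bar> * (1 / size_prob n)"
    using n by (simp add: abs_divide)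
  also have "\<dots> \<le> ((\<Sum>k\<le>n. D k) * A) * (K * real n * ?r)"
  proof (rule mult_mono)
    have "\<bar>\<Sum>k\<le>n. (walk_prob (n - k) 0 - ?Q) * tree_sum k f\<bar> \<le> (\<Sum>k\<le>n. \<bar>(walk_prob (n - k) 0 - ?Q) * tree_sum k f\<bar>)" by (rule sum_abs)
    also have "\<dots> \<le> (\<Sum>k\<le>n. D k * A)"
    proof (rule sum_mono)
      fix k assume "k \<in> {..n}"
      then show "\<bar>(walk_prob (n - k) 0 - ?Q) * tree_sum k f\<bar> \<le> D k * A"
        unfolding abs_mult D_def mult.assoc using u[of k] by (intro mult_left_mono) auto
    qed
    finally show "\<bar>\<Sum>k\<le>n. (walk_prob (n - k) 0 - ?Q) * tree_sum k f\<bar> \<le> (\<Sum>k\<le>n. D k) * A"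
      by (simp add: sum_distrib_right)
    show "0 \<le> (\<Sum>k\<le>n. D k) * A" using A0 by (intro mult_nonneg_nonneg sum_nonneg) (auto simp: D_def)
  qed (use inverse_size_prob_le[OF n] n in auto)
  also have "(\<Sum>k\<le>n. D k) \<le> 24 * K\<^sup>2 / real n"
  proof -
    have small: "D k \<le> K / real n * size_prob k + K / (real n * ?r) * (real k * size_prob k)" if "2 * k \<le> n" for k
    proof (cases "size_prob k = 0")
      case False
      then have "0 < size_prob k" using size_prob_nonneg[of k] by linarith
      have "D k \<le> K / real n * (1 + real k / ?r) * size_prob k"
        unfolding D_def using walk_prob_diff_bound[OF n \<open>0 < size_prob k\<close> that] by (rule mult_right_mono) simp
      also have "\<dots> = K / real n * size_prob k + K / (real n * ?r) * (real k * size_prob k)"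
        by (simp add: distrib_left distrib_right)
      finally show ?thesis .
    qed (simp add: D_def)
    \<comment> \<open>The constant 3 comes from \<open>k > n / 2\<close> together with
      \<open>sqrt (1 / 2) \<ge> 2 / 3\<close>, weakened in the proof to
      \<open>sqrt (4 / 9)\<close>.\<close>
    have big: "D k \<le> 3 * K / (real n * ?r) * (walk_prob (n - k) 0 + ?Q)" if "k \<le> n" "n < 2 * k" for k
    proof -
      have "size_prob k \<le> K / (real k * sqrt (real k))" using that by (intro size_prob_upper) auto
      also have "\<dots> \<le> K / ((real n / 2) * (?r * (2 / 3)))"
      proof (intro divide_left_mono mult_mono)
        have "sqrt (4/9) = (2/3 :: real)" by (rule real_sqrt_unique) (auto simp: power2_eq_square)
        then have "?r * (2 / 3) = sqrt (real n * (4/9))" by (simp only: real_sqrt_mult)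
        moreover have "sqrt (real n * (4/9)) \<le> sqrt (real k)" using that by (intro real_sqrt_le_mono) simp
        ultimately show "?r * (2 / 3) \<le> sqrt (real k)" by (simp only:)
      qed (use that n0 r K_pos in auto)
      also have "\<dots> = 3 * K / (real n * ?r)" by simp
      finally have s: "size_prob k \<le> 3 * K / (real n * ?r)" .
      have "D k \<le> (walk_prob (n - k) 0 + ?Q) * size_prob k"
        unfolding D_def by (intro mult_right_mono) (auto simp: abs_le_iff intro: add_increasing)
      also have "\<dots> \<le> (walk_prob (n - k) 0 + ?Q) * (3 * K / (real n * ?r))"
        by (intro mult_left_mono s add_nonneg_nonneg) auto
      finally show ?thesis by (simp add: mult.commute)
    qed
    have "(\<Sum>k\<le>n. D k) \<le> (\<Sum>k\<le>n. K / real n * size_prob k + K / (real n * ?r) * (real k * size_prob k)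
         + 3 * K / (real n * ?r) * (walk_prob (n - k) 0 + ?Q))"
    proof (rule sum_mono)
      fix k assume k: "k \<in> {..n}"
      have "0 \<le> K / real n * size_prob k + K / (real n * ?r) * (real k * size_prob k)" "0 \<le> 3 * K / (real n * ?r) * (walk_prob (n - k) 0 + ?Q)"
        using K_pos by (auto intro!: add_nonneg_nonneg mult_nonneg_nonneg)
      then show "D k \<le> K / real n * size_prob k + K / (real n * ?r) * (real k * size_prob k)
         + 3 * K / (real n * ?r) * (walk_prob (n - k) 0 + ?Q)"
        using small[of k] big[of k] k by (cases "2 * k \<le> n") auto
    qed
    also have "\<dots> = K / real n * (\<Sum>k\<le>n. size_prob k) + K / (real n * ?r) * (\<Sum>k\<le>n. real k * size_prob k)
         + 3 * K / (real n * ?r) * ((\<Sum>k\<le>n. walk_prob (n - k) 0) + (real n + 1) * ?Q)"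
      by (simp only: sum.distrib sum_distrib_left[symmetric]) simp
    also have "\<dots> \<le> K / real n * 1 + K / (real n * ?r) * (4 * K * ?r) + 3 * K / (real n * ?r) * (4 * K * ?r + 2 * K * ?r)"
    proof (intro add_mono mult_left_mono)
      have "(\<Sum>k\<le>n. walk_prob (n - k) 0) = (\<Sum>k\<le>n. walk_prob k 0)"
        by (rule sum.reindex_bij_witness[of _ "\<lambda>k. n - k" "\<lambda>k. n - k"]) auto
      then show "(\<Sum>k\<le>n. walk_prob (n - k) 0) \<le> 4 * K * ?r" using sum_walk_prob_le[OF n0] by simp
      have "(real n + 1) * ?Q \<le> (2 * real n) * (K / ?r)"
        using n0 by (intro mult_mono walk_prob_upper') auto
      also have "\<dots> = 2 * K * (real n / ?r)" by simp
      also have "real n / ?r = ?r" using n0 by (simp add: real_div_sqrt)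
      finally show "(real n + 1) * ?Q \<le> 2 * K * ?r" .
    qed (use K_pos sum_size_prob_le_1 sum_size_prob_first_moment[OF n0] in auto)
    also have "\<dots> = K / real n + 4 * K\<^sup>2 / real n + 18 * K\<^sup>2 / real n"
      using r by (simp add: power2_eq_square)
    also have "\<dots> \<le> K\<^sup>2 / real n + 4 * K\<^sup>2 / real n + 18 * K\<^sup>2 / real n"
      using K_ge_1 by (intro add_mono order.refl) (simp add: divide_right_mono power2_eq_square)
    also have "\<dots> = 23 * K\<^sup>2 / real n" by (simp add: add_divide_distrib[symmetric])
    also have "\<dots> \<le> 24 * K\<^sup>2 / real n" by (intro divide_right_mono) auto
    finally show ?thesis .
  qed
  also have "24 * K\<^sup>2 / real n * A * (K * real n * ?r) = 24 * K ^ 3 * ?r * A"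
    using n0 by (simp add: power2_eq_square power3_eq_cube)
  finally show ?thesis using A0 K_pos by (simp add: mult_right_mono)
qed

end

lemma double_sum_le:
  fixes c :: "nat \<Rightarrow> nat \<Rightarrow> real"
  assumes "\<And>k m. k \<le> n \<Longrightarrow> m \<le> n \<Longrightarrow> c k m \<le> H * (x k * y m)"
  shows "(\<Sum>k\<le>n. \<Sum>m\<le>n. c k m) \<le> H * ((\<Sum>k\<le>n. x k) * (\<Sum>m\<le>n. y m))"
proof -
  have "(\<Sum>k\<le>n. \<Sum>m\<le>n. c k m) \<le> (\<Sum>k\<le>n. \<Sum>m\<le>n. H * (x k * y m))"
    by (intro sum_mono assms) auto
  also have "\<dots> = H * ((\<Sum>k\<le>n. x k) * (\<Sum>m\<le>n. y m))"
    by (subst sum_product) (simp only: sum_distrib_left)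
  finally show ?thesis .
qed

text \<open>It frees a quantity that occurs on both sides of an estimate. The constant 72 is 64 + 8,
  chosen with \<open>72 * 8 \<ge> 544\<close>.\<close>

lemma quadratic_bound:
  fixes D y :: real
  assumes "D\<^sup>2 \<le> 64 * y * D + 544 * y\<^sup>2" "0 \<le> y"
  shows "D \<le> 72 * y"
proof (rule ccontr)
  assume "\<not> ?thesis"
  then have "(72 * y) * (8 * y) < D * (D - 64 * y)"
    using assms(2) by (intro mult_strict_mono') auto
  then show False using assms(1) mult_nonneg_nonneg[OF assms(2,2)] by (simp add: power2_eq_square algebra_simps)
qed

context walk_bounds
begin

lemma cond_norm_two_minus_le: "cond_norm k (\<lambda>t. 2 * g t - f t) \<le> 2 * cond_norm k g + cond_norm k f"
  using cond_norm_triangle[of k "\<lambda>t. 2 * g t" "\<lambda>t. (-1) * f t"] unfolding cond_norm_cmult by simp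

text \<open>Trees with more than \<open>N / 4\<close> nodes are so rare that the second moment
  itself is small, without subtracting the squared mean. The nested sum involves the norms of the
  additive functional at smaller sizes, so the maximum of these norms is bounded by a quadratic
  inequality in itself.\<close>

lemma cond_norm_large_part:
  assumes N: "N > 0" and supp: "\<And>t. 4 * num_nodes t \<le> N \<Longrightarrow> f t = 0" and B: "\<And>k. k \<le> N \<Longrightarrow> cond_norm k f \<le> B"
  shows "cond_norm N (additive_functional f) \<le> 72 * K ^ 3 * sqrt (real N) * B"
proof -
  let ?F = "additive_functional f"
  let ?r = "sqrt (real N)"
  have r: "?r \<ge> 1" "?r * ?r = real N" using N by auto
  have B0: "0 \<le> B" using B[of 0] cond_norm_nonneg[of 0 f] by linarith
  define D where "D = Max ((\<lambda>k. cond_norm k ?F) ` {..N})"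
  have D: "cond_norm k ?F \<le> D" if "k \<le> N" for k unfolding D_def using that by (intro Max_ge) auto
  have D0: "0 \<le> D" using D[of 0] cond_norm_nonneg[of 0 ?F] by linarith
  \<comment> \<open>For \<open>4 * k > N\<close> one has
    \<open>k * sqrt k \<ge> N * sqrt N / 8\<close>, whence the factor 8 in this common bound of the
    unnormalised norms.\<close>
  define c where "c = 8 * K / (real N * ?r) * B"
  have c0: "0 \<le> c" using K_pos B0 by (simp add: c_def)
  have pa: "size_prob k * cond_norm k f \<le> c" if k: "k \<le> N" for k
  proof (cases "4 * k \<le> N")
    case True
    then have "cond_norm k f \<le> cond_norm k (\<lambda>_. 0)" by (intro cond_norm_mono) (auto simp: trees_def supp)
    then have "cond_norm k f \<le> 0" using cond_norm_const_le[of k 0] by simp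
    then show ?thesis using c0 by (simp add: mult_nonneg_nonpos order.trans[OF _ c0])
  next
    case False
    then have "size_prob k \<le> K / (real k * sqrt (real k))" by (intro size_prob_upper) auto
    also have "\<dots> \<le> K / ((real N / 4) * (?r / 2))"
    proof (intro divide_left_mono mult_mono)
      have "sqrt (real N / 4) \<le> sqrt (real k)" using False by (intro real_sqrt_le_mono) simp
      then show "?r / 2 \<le> sqrt (real k)" by (simp add: real_sqrt_divide)
    qed (use False N K_pos in auto)
    also have "\<dots> = 8 * K / (real N * ?r)" by simp
    finally show ?thesis unfolding c_def using B[OF k] by (intro mult_mono) (use K_pos in auto)
  qed
  have bound: "(cond_norm n ?F)\<^sup>2 \<le> 64 * K ^ 3 * ?r * B * D + 544 * K ^ 4 * real N * B\<^sup>2" if n: "n \<le> N" for n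
  proof (cases "size_prob n = 0")
    case True
    then show ?thesis using K_pos B0 D0 by (simp add: cond_norm_eq_0)
  next
    case False
    then have pos: "0 < size_prob n" using size_prob_nonneg[of n] by linarith
    then have n0: "n > 0" by (cases n) auto
    have nested: "(\<Sum>k\<le>n. walk_prob (n - k) 0 * tree_sum k (\<lambda>t. f t * (2 * ?F t - f t))) \<le> 4 * K * ?r * (c * (2 * D + B))"
    proof -
      have "(\<Sum>k\<le>n. walk_prob (n - k) 0 * tree_sum k (\<lambda>t. f t * (2 * ?F t - f t))) \<le> (\<Sum>k\<le>n. walk_prob (n - k) 0 * (c * (2 * D + B)))"
      proof (rule sum_mono)
        fix k assume k: "k \<in> {..n}"
        have "tree_sum k (\<lambda>t. f t * (2 * ?F t - f t)) \<le> (size_prob k * cond_norm k f) * cond_norm k (\<lambda>t. 2 * ?F t - f t)"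
          using abs_tree_sum_mult_le[of k f "\<lambda>t. 2 * ?F t - f t"] by (simp add: mult.assoc)
        also have "\<dots> \<le> c * (2 * D + B)"
        proof (intro mult_mono)
          show "cond_norm k (\<lambda>t. 2 * ?F t - f t) \<le> 2 * D + B"
            using cond_norm_two_minus_le[of k ?F f] D[of k] B[of k] k n by force
        qed (use pa[of k] k n c0 in auto)
        finally show "walk_prob (n - k) 0 * tree_sum k (\<lambda>t. f t * (2 * ?F t - f t)) \<le> walk_prob (n - k) 0 * (c * (2 * D + B))"
          by (rule mult_left_mono) simp
      qed
      also have "\<dots> = (\<Sum>k\<le>n. walk_prob k 0) * (c * (2 * D + B))"
        unfolding sum_distrib_right by (rule sum.reindex_bij_witness[of _ "\<lambda>k. n - k" "\<lambda>k. n - k"]) auto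
      also have "\<dots> \<le> (4 * K * sqrt (real n)) * (c * (2 * D + B))"
        using sum_walk_prob_le[OF n0, of 0] c0 D0 B0 by (intro mult_right_mono) auto
      also have "\<dots> \<le> (4 * K * ?r) * (c * (2 * D + B))"
        using n c0 D0 B0 K_pos by (intro mult_right_mono mult_left_mono) auto
      finally show ?thesis .
    qed
    have disjoint: "(\<Sum>k\<le>n. \<Sum>m\<le>n - k. real (n + 1 - k - m) * (walk_prob (n - k - m) 1 * (tree_sum k f * tree_sum m f)))
        \<le> (2 * real N) * ((2 * real N) * (2 * K * ?r * (c * c)))"
    proof -
      have "(\<Sum>k\<le>n. \<Sum>m\<le>n - k. real (n + 1 - k - m) * (walk_prob (n - k - m) 1 * (tree_sum k f * tree_sum m f)))
         \<le> (\<Sum>k\<le>n. \<Sum>m\<le>n - k. 2 * K * ?r * (c * c))"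
      proof (intro sum_mono)
        fix k m assume k: "k \<in> {..n}" and m: "m \<in> {..n - k}"
        let ?j = "n - k - m"
        have "real (n + 1 - k - m) * walk_prob ?j 1 \<le> (real ?j + 1) * (K / sqrt (real ?j + 1))"
          using k m by (intro mult_mono walk_prob_upper) auto
        also have "\<dots> = K * ((real ?j + 1) / sqrt (real ?j + 1))" by (simp only: times_divide_eq_right mult.commute)
        also have "\<dots> = K * sqrt (real ?j + 1)" by (subst real_div_sqrt) auto
        also have "\<dots> \<le> K * sqrt (4 * real N)" using K_pos n N k m by (intro mult_left_mono real_sqrt_le_mono) auto
        finally have w: "real (n + 1 - k - m) * walk_prob ?j 1 \<le> 2 * K * ?r" by (simp add: real_sqrt_mult)
        have u: "\<bar>tree_sum k f\<bar> \<le> c" "\<bar>tree_sum m f\<bar> \<le> c"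
          using order.trans[OF abs_tree_sum_le[of k f] pa[of k]] order.trans[OF abs_tree_sum_le[of m f] pa[of m]] k m n by auto
        have "tree_sum k f * tree_sum m f \<le> \<bar>tree_sum k f\<bar> * \<bar>tree_sum m f\<bar>" unfolding abs_mult[symmetric] by simp
        also have "\<dots> \<le> c * c" using u c0 by (intro mult_mono) auto
        finally have "tree_sum k f * tree_sum m f \<le> c * c" .
        then have "(real (n + 1 - k - m) * walk_prob ?j 1) * (tree_sum k f * tree_sum m f)
            \<le> (real (n + 1 - k - m) * walk_prob ?j 1) * (c * c)" by (intro mult_left_mono) auto
        also have "\<dots> \<le> 2 * K * ?r * (c * c)" using w c0 by (intro mult_right_mono) auto
        finally show "real (n + 1 - k - m) * (walk_prob ?j 1 * (tree_sum k f * tree_sum m f)) \<le> 2 * K * ?r * (c * c)"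
          by (simp add: mult.assoc)
      qed
      also have "\<dots> \<le> (\<Sum>k\<le>n. (2 * real N) * (2 * K * ?r * (c * c)))"
      proof (rule sum_mono)
        fix k
        have "real (n - k + 1) * (2 * K * ?r * (c * c)) \<le> (2 * real N) * (2 * K * ?r * (c * c))"
          using n N K_pos c0 by (intro mult_right_mono) auto
        then show "(\<Sum>m\<le>n - k. 2 * K * ?r * (c * c)) \<le> (2 * real N) * (2 * K * ?r * (c * c))" by simp
      qed
      also have "\<dots> = real (n + 1) * ((2 * real N) * (2 * K * ?r * (c * c)))" by simp
      also have "\<dots> \<le> (2 * real N) * ((2 * real N) * (2 * K * ?r * (c * c)))"
        using n N K_pos c0 by (intro mult_right_mono) auto
      finally show ?thesis .
    qed
    have "(cond_norm n ?F)\<^sup>2 = tree_sum n (\<lambda>t. (?F t)\<^sup>2) * (1 / size_prob n)"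
      unfolding cond_norm_square cond_mean_def by simp
    also have "\<dots> \<le> (4 * K * ?r * (c * (2 * D + B)) + (2 * real N) * ((2 * real N) * (2 * K * ?r * (c * c)))) * (K * real N * ?r)"
    proof (rule mult_mono)
      show "tree_sum n (\<lambda>t. (?F t)\<^sup>2) \<le> 4 * K * ?r * (c * (2 * D + B)) + (2 * real N) * ((2 * real N) * (2 * K * ?r * (c * c)))"
        unfolding tree_sum_additive_functional_square using nested disjoint by (rule add_mono)
      have "1 / size_prob n \<le> K * real n * sqrt (real n)" by (rule inverse_size_prob_le[OF pos])
      also have "\<dots> \<le> K * real N * ?r" using n K_pos by (intro mult_mono) auto
      finally show "1 / size_prob n \<le> K * real N * ?r" .
    qed (use pos K_pos c0 D0 B0 in auto)
    also have "\<dots> = 64 * K ^ 3 * ?r * B * D + (32 * K ^ 3 * ?r * B\<^sup>2 + 512 * K ^ 4 * real N * B\<^sup>2)"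
    proof -
      have cN: "c * (real N * ?r) = 8 * K * B" using N by (simp add: c_def)
      have "(4 * K * ?r * (c * (2 * D + B)) + (2 * real N) * ((2 * real N) * (2 * K * ?r * (c * c)))) * (K * real N * ?r)
        = 4 * K\<^sup>2 * ?r * (2 * D + B) * (c * (real N * ?r)) + 8 * K\<^sup>2 * real N * (c * (real N * ?r)) * (c * (real N * ?r))"
        by (simp add: power2_eq_square algebra_simps)
      also have "\<dots> = 64 * K ^ 3 * ?r * B * D + (32 * K ^ 3 * ?r * B\<^sup>2 + 512 * K ^ 4 * real N * B\<^sup>2)"
        unfolding cN by (simp add: power2_eq_square eval_nat_numeral algebra_simps)
      finally show ?thesis .
    qed
    also have "32 * K ^ 3 * ?r * B\<^sup>2 \<le> 32 * K ^ 4 * real N * B\<^sup>2"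
    proof (intro mult_right_mono mult_mono)
      show "K ^ 3 \<le> K ^ 4" using K_ge_1 by (intro power_increasing) auto
      show "?r \<le> real N" using r mult_left_mono[of 1 ?r ?r] by simp
    qed (use K_pos in auto)
    finally show ?thesis by (simp add: algebra_simps)
  qed
  let ?y = "K ^ 3 * ?r * B"
  have y0: "0 \<le> ?y" using K_pos B0 by simp
  have "D \<in> (\<lambda>k. cond_norm k ?F) ` {..N}" unfolding D_def by (intro Max_in) auto
  then have "D\<^sup>2 \<le> 64 * K ^ 3 * ?r * B * D + 544 * K ^ 4 * real N * B\<^sup>2" using bound by auto
  also have "544 * K ^ 4 * real N * B\<^sup>2 \<le> 544 * K ^ 6 * real N * B\<^sup>2"
    using K_ge_1 by (intro mult_right_mono mult_left_mono power_increasing) auto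
  also have "64 * K ^ 3 * ?r * B * D + 544 * K ^ 6 * real N * B\<^sup>2 = 64 * ?y * D + 544 * ?y\<^sup>2"
    by (simp add: power_mult_distrib)
  finally have quad: "D\<^sup>2 \<le> 64 * ?y * D + 544 * ?y\<^sup>2" by simp
  from quadratic_bound[OF quad y0] have "D \<le> 72 * ?y" .
  then show ?thesis using D[of N] by (simp add: mult.assoc)
qed

lemma weight_le: "k > 0 \<Longrightarrow> k \<le> n \<Longrightarrow> 1 + real k / sqrt (real n) \<le> 2 * sqrt (real k)"
proof -
  assume k: "k > 0" "k \<le> n"
  have "real k / sqrt (real n) \<le> real k / sqrt (real k)" using k by (intro divide_left_mono) auto
  also have "\<dots> = sqrt (real k)" by (simp add: real_div_sqrt)
  moreover have "1 \<le> sqrt (real k)" using k by simp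
  ultimately show ?thesis by linarith
qed

text \<open>With \<open>Q = walk_prob n (-1)\<close>, the first expression is
  \<open>Q * walk_prob_mixed n k m\<close> minus the product of the two first differences. Both
  parts have order \<open>1 / n\<^sup>2\<close>, although each of the two products subtracted on the
  left has order \<open>1 / n\<close>.\<close>

lemma walk_prob_mixed_estimates:
  assumes n: "0 < size_prob n" and k: "0 < size_prob k" "4 * k \<le> n" and m: "0 < size_prob m" "4 * m \<le> n"
  shows "\<bar>walk_prob (n - k - m) 1 * walk_prob n (-1) - walk_prob (n - k) 0 * walk_prob (n - m) 0\<bar>
      \<le> 2 * K\<^sup>2 / (real n)\<^sup>2 * ((1 + real k / sqrt (real n)) * (1 + real m / sqrt (real n)))"
    and "\<bar>walk_prob (n - k) 0 - walk_prob (n - k - m) 1\<bar> \<le> 3 * K / real n * (1 + real m / sqrt (real n))"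
proof -
  let ?s = "sqrt (real n)"
  let ?w = "\<lambda>k. 1 + real k / ?s"
  let ?Q = "walk_prob n (-1)"
  have n0: "n > 0" using n by (cases n) auto
  have s: "?s \<ge> 1" "?s * ?s = real n" using n0 by auto
  have w: "0 \<le> ?w k" for k by simp
  have D: "\<bar>walk_prob_mixed n k m\<bar> \<le> K / ?s ^ 3 * (?w k * ?w m)"
    using walk_prob_mixed_bound[OF n k(1) m(1) k(2) m(2)] .
  have dk: "\<bar>walk_prob (n - k) 0 - ?Q\<bar> \<le> K / real n * ?w k" using k by (intro walk_prob_diff_bound n) auto
  have dm: "\<bar>walk_prob (n - m) 0 - ?Q\<bar> \<le> K / real n * ?w m" using m by (intro walk_prob_diff_bound n) auto
  have Q: "0 \<le> ?Q" "?Q \<le> K / ?s" using walk_prob_upper'[OF n0, of "-1"] by auto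
  have "walk_prob (n - k - m) 1 * ?Q - walk_prob (n - k) 0 * walk_prob (n - m) 0
     = ?Q * walk_prob_mixed n k m - (walk_prob (n - k) 0 - ?Q) * (walk_prob (n - m) 0 - ?Q)"
    by (simp add: walk_prob_mixed_def algebra_simps)
  then have "\<bar>walk_prob (n - k - m) 1 * ?Q - walk_prob (n - k) 0 * walk_prob (n - m) 0\<bar>
     \<le> \<bar>?Q\<bar> * \<bar>walk_prob_mixed n k m\<bar> + \<bar>walk_prob (n - k) 0 - ?Q\<bar> * \<bar>walk_prob (n - m) 0 - ?Q\<bar>"
    unfolding abs_mult[symmetric] by linarith
  also have "\<dots> \<le> K / ?s * (K / ?s ^ 3 * (?w k * ?w m)) + (K / real n * ?w k) * (K / real n * ?w m)"
    using Q D dk dm K_pos by (intro add_mono mult_mono) auto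
  also have "\<dots> = 2 * K\<^sup>2 / (real n)\<^sup>2 * (?w k * ?w m)"
  proof -
    have "K / ?s * (K / ?s ^ 3 * (?w k * ?w m)) = K * K / ((?s * ?s) * (?s * ?s)) * (?w k * ?w m)"
    proof -
      have "K / a * (K / a ^ 3 * x) = K * K / ((a * a) * (a * a)) * x" for a x :: real
        by (simp add: power3_eq_cube)
      then show ?thesis .
    qed
    moreover have "(K / real n * ?w k) * (K / real n * ?w m) = K * K / (real n * real n) * (?w k * ?w m)" by simp
    ultimately show ?thesis unfolding s(2) power2_eq_square by (simp only: distrib_right[symmetric]) simp
  qed
  finally show "\<bar>walk_prob (n - k - m) 1 * ?Q - walk_prob (n - k) 0 * walk_prob (n - m) 0\<bar> \<le> 2 * K\<^sup>2 / (real n)\<^sup>2 * (?w k * ?w m)" .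
  have "K / ?s ^ 3 * (?w k * ?w m) \<le> K / ?s ^ 3 * ((2 * ?s) * ?w m)"
  proof (intro mult_left_mono mult_right_mono)
    have "real k / ?s \<le> real n / ?s" using k by (intro divide_right_mono) auto
    then have "real k / ?s \<le> ?s" by (simp add: real_div_sqrt)
    then show "?w k \<le> 2 * ?s" using s(1) by linarith
  qed (use K_pos in auto)
  also have "\<dots> = 2 * K / real n * ?w m" using s by (simp add: eval_nat_numeral)
  finally have "\<bar>walk_prob_mixed n k m\<bar> \<le> 2 * K / real n * ?w m" using D by linarith
  moreover have "walk_prob (n - k) 0 - walk_prob (n - k - m) 1 = - walk_prob_mixed n k m - (walk_prob (n - m) 0 - ?Q)"
    by (simp add: walk_prob_mixed_def)
  moreover have "3 * K / real n * ?w m = 2 * K / real n * ?w m + K / real n * ?w m"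
    by (simp only: distrib_right[symmetric] add_divide_distrib[symmetric]) simp
  ultimately show "\<bar>walk_prob (n - k) 0 - walk_prob (n - k - m) 1\<bar> \<le> 3 * K / real n * ?w m"
    using dm by linarith
qed

lemma cond_norm_eq_0_if: "(\<And>t. num_nodes t = k \<Longrightarrow> f t = 0) \<Longrightarrow> cond_norm k f = 0"
proof -
  assume "\<And>t. num_nodes t = k \<Longrightarrow> f t = 0"
  then have "cond_norm k f \<le> cond_norm k (\<lambda>_. 0)" by (intro cond_norm_mono) (auto simp: trees_def)
  then show ?thesis using cond_norm_const_le[of k 0] cond_norm_nonneg[of k f] by linarith
qed

text \<open>Since \<open>sqrt k * size_prob k\<close> is at most \<open>K / k\<close>, the weight
  \<open>sqrt k\<close> is exactly what the series of \<open>cond_norm k f / k\<close> controls; the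
  other weights are compared with it. This is how the summability hypothesis enters the variance
  bound.\<close>

lemma tree_weight_sums:
  assumes S: "(\<Sum>k\<le>n. cond_norm k f / real k) \<le> B"
  shows "(\<Sum>k\<le>n. sqrt (real k) * (size_prob k * cond_norm k f)) \<le> K * B"
    and "(\<Sum>k\<le>n. size_prob k * cond_norm k f) \<le> K * B"
    and "(\<Sum>k\<le>n. real k * (size_prob k * cond_norm k f)) \<le> sqrt (real n) * (K * B)"
proof -
  have 1: "sqrt (real k) * (size_prob k * cond_norm k f) \<le> K * (cond_norm k f / real k)" for k
  proof (cases "k = 0")
    case False
    have "sqrt (real k) * size_prob k \<le> sqrt (real k) * (K / (real k * sqrt (real k)))"
      using False by (intro mult_left_mono size_prob_upper) auto
    also have "\<dots> = K / real k" using False by simp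
    finally have "sqrt (real k) * size_prob k * cond_norm k f \<le> K / real k * cond_norm k f" by (intro mult_right_mono) auto
    then show ?thesis by (simp add: mult.assoc)
  qed simp
  have "(\<Sum>k\<le>n. sqrt (real k) * (size_prob k * cond_norm k f)) \<le> (\<Sum>k\<le>n. K * (cond_norm k f / real k))"
    by (intro sum_mono 1)
  also have "\<dots> \<le> K * B" unfolding sum_distrib_left[symmetric] using S K_pos by (intro mult_left_mono) auto
  finally show S1: "(\<Sum>k\<le>n. sqrt (real k) * (size_prob k * cond_norm k f)) \<le> K * B" .
  have "(\<Sum>k\<le>n. size_prob k * cond_norm k f) \<le> (\<Sum>k\<le>n. sqrt (real k) * (size_prob k * cond_norm k f))"
  proof (rule sum_mono)
    fix k
    show "size_prob k * cond_norm k f \<le> sqrt (real k) * (size_prob k * cond_norm k f)"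
      using mult_right_mono[of 1 "sqrt (real k)" "size_prob k * cond_norm k f"] by (cases "k = 0") auto
  qed
  then show "(\<Sum>k\<le>n. size_prob k * cond_norm k f) \<le> K * B" using S1 by linarith
  have "(\<Sum>k\<le>n. real k * (size_prob k * cond_norm k f)) \<le> (\<Sum>k\<le>n. sqrt (real n) * (sqrt (real k) * (size_prob k * cond_norm k f)))"
  proof (rule sum_mono)
    fix k assume "k \<in> {..n}"
    then have "sqrt (real k) * sqrt (real k) \<le> sqrt (real n) * sqrt (real k)" by (intro mult_right_mono) auto
    then have "real k \<le> sqrt (real n) * sqrt (real k)" by simp
    then have "real k * (size_prob k * cond_norm k f) \<le> sqrt (real n) * sqrt (real k) * (size_prob k * cond_norm k f)"
      by (intro mult_right_mono) auto
    then show "real k * (size_prob k * cond_norm k f) \<le> sqrt (real n) * (sqrt (real k) * (size_prob k * cond_norm k f))"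
      by (simp add: mult.assoc)
  qed
  also have "\<dots> \<le> sqrt (real n) * (K * B)" unfolding sum_distrib_left[symmetric] using S1 by (intro mult_left_mono) auto
  finally show "(\<Sum>k\<le>n. real k * (size_prob k * cond_norm k f)) \<le> sqrt (real n) * (K * B)" .
qed

text \<open>Write \<open>i\<close> for the inverse size probability and
  \<open>Q = walk_prob n (-1)\<close>, so that \<open>i * Q = n\<close>. The coefficient of a
  disjoint pair is \<open>i * (n + 1 - k - m) * r = i\<^sup>2 * r * Q + i * r - i * (k + m) *
  r\<close>. Its first part meets the squared mean (\<open>T1\<close>) and the second is small
  (\<open>T2\<close>). In the nested sum the additive functional is centered at
  \<open>k * \<mu>\<close>; the centered part is \<open>T3\<close>, where the bound
  \<open>IH\<close> for smaller sizes is used, and the centering itself meets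
  \<open>- i * (k + m) * r\<close> (\<open>T4\<close>).\<close>

lemma cond_sd_small_part:
  assumes n: "0 < size_prob n" and supp: "\<And>t. n < 4 * num_nodes t \<Longrightarrow> f t = 0"
    and B: "\<And>k. k \<le> n \<Longrightarrow> cond_norm k f \<le> B" and S: "(\<Sum>k\<le>n. cond_norm k f / real k) \<le> B"
    and C: "0 \<le> C" and IH: "\<And>k. 4 * k \<le> n \<Longrightarrow> cond_sd k (additive_functional f) \<le> C * sqrt (real k) * B"
  shows "(cond_sd n (additive_functional f))\<^sup>2 \<le> (122 * K ^ 6 + 4 * K ^ 3 * C) * real n * B\<^sup>2"
proof -
  let ?F = "additive_functional f"
  let ?s = "sqrt (real n)"
  let ?Q = "walk_prob n (-1)"
  define i where "i = 1 / size_prob n"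
  define q where "q k = walk_prob (n - k) 0" for k
  define r where "r k m = walk_prob (n - k - m) 1" for k m
  define u where "u k = tree_sum k f" for k
  define pa where "pa k = size_prob k * cond_norm k f" for k
  define w where "w k = 1 + real k / ?s" for k
  define \<mu> where "\<mu> = (\<Sum>m\<le>n. u m)"
  define J where "J k = tree_sum k (\<lambda>t. f t * (?F t - real k * \<mu>))" for k
  have n0: "n > 0" using n by (cases n) auto
  have s: "?s \<ge> 1" "?s > 0" "?s * ?s = real n" using n0 by auto
  have B0: "0 \<le> B" using B[of 0] cond_norm_nonneg[of 0 f] by linarith
  have KB: "0 \<le> K * B" using K_pos B0 by simp
  have i: "0 < i" "i \<le> K * real n * ?s" "i * ?Q = real n"
    using n inverse_size_prob_le[OF n] by (auto simp: i_def size_prob_eq_walk_prob[symmetric])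
  have i2: "i\<^sup>2 \<le> K\<^sup>2 * real n ^ 3"
  proof -
    have "i\<^sup>2 \<le> (K * real n * ?s)\<^sup>2" using i by (intro power_mono) auto
    also have "\<dots> = K\<^sup>2 * (real n)\<^sup>2 * (?s * ?s)" by (simp only: power2_eq_square mult_ac)
    also have "\<dots> = K\<^sup>2 * real n ^ 3" unfolding s(3) by (simp add: power2_eq_square power3_eq_cube)
    finally show ?thesis .
  qed
  have pa0: "0 \<le> pa k" for k by (simp add: pa_def)
  have pa_zero: "pa k = 0" if "size_prob k = 0 \<or> n < 4 * k" for k
    using that cond_norm_eq_0_if[of k f] supp by (auto simp: pa_def)
  have u_le: "\<bar>u k\<bar> \<le> pa k" for k unfolding u_def pa_def by (rule abs_tree_sum_le)
  have uu: "\<bar>u k * u m\<bar> \<le> pa k * pa m" for k m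
    unfolding abs_mult using u_le pa0 by (intro mult_mono) auto
  have s1: "(\<Sum>k\<le>n. sqrt (real k) * pa k) \<le> K * B" and s0: "(\<Sum>k\<le>n. pa k) \<le> K * B"
    and s2: "(\<Sum>k\<le>n. real k * pa k) \<le> ?s * (K * B)"
    unfolding pa_def using tree_weight_sums[OF S] by auto
  have sw: "(\<Sum>k\<le>n. w k * pa k) \<le> 2 * (K * B)"
  proof -
    have "(\<Sum>k\<le>n. w k * pa k) \<le> (\<Sum>k\<le>n. 2 * (sqrt (real k) * pa k))"
    proof (rule sum_mono)
      fix k assume "k \<in> {..n}"
      then have "w k * pa k \<le> 2 * sqrt (real k) * pa k"
        using weight_le[of k n] pa0 pa_zero[of 0] unfolding w_def by (cases "k = 0") (auto intro!: mult_right_mono)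
      then show "w k * pa k \<le> 2 * (sqrt (real k) * pa k)" by (simp only: mult.assoc)
    qed
    then show ?thesis using s1 by (simp add: sum_distrib_left[symmetric])
  qed
  have w0: "0 \<le> w k" for k by (simp add: w_def)
  have swn: "0 \<le> (\<Sum>k\<le>n. w k * pa k)" using w0 pa0 by (intro sum_nonneg mult_nonneg_nonneg)
  have s0n: "0 \<le> (\<Sum>k\<le>n. pa k)" using pa0 by (intro sum_nonneg)
  have s2n: "0 \<le> (\<Sum>k\<le>n. real k * pa k)" using pa0 by (intro sum_nonneg mult_nonneg_nonneg) auto
  have rq: "q k \<le> 2 * K / ?s" "r k m \<le> 2 * K / ?s" if "4 * k \<le> n" "4 * m \<le> n" for k m
  proof -
    have "walk_prob j i \<le> 2 * K / ?s" if j: "n \<le> 4 * j" for j i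
    proof -
      have j0: "j > 0" using j n0 by simp
      have "?s / 2 = sqrt (real n / 4)" by (simp add: real_sqrt_divide)
      also have "\<dots> \<le> sqrt (real j)" using j by (intro real_sqrt_le_mono) simp
      finally have "K / sqrt (real j) \<le> K / (?s / 2)" using K_pos s j0 by (intro divide_left_mono) auto
      then show ?thesis using walk_prob_upper'[OF j0, of i] by (simp add: mult.commute)
    qed
    then show "q k \<le> 2 * K / ?s" "r k m \<le> 2 * K / ?s" unfolding q_def r_def using that by auto
  qed
  have est: "\<bar>r k m * ?Q - q k * q m\<bar> \<le> 2 * K\<^sup>2 / (real n)\<^sup>2 * (w k * w m)" "\<bar>q k - r k m\<bar> \<le> 3 * K / real n * w m"
    if "0 < size_prob k" "4 * k \<le> n" "0 < size_prob m" "4 * m \<le> n" for k m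
    unfolding r_def q_def w_def using walk_prob_mixed_estimates[OF n that] by auto
  \<comment> \<open>Pairs with an inadmissible size or a size above \<open>n / 4\<close> carry
    weight 0, so every coefficient has to be estimated only where the Fourier bounds apply.\<close>
  have cases: "(c * (u k * u m) \<le> h * (x * y)) "
    if "0 < size_prob k \<Longrightarrow> 4 * k \<le> n \<Longrightarrow> 0 < size_prob m \<Longrightarrow> 4 * m \<le> n \<Longrightarrow> \<bar>c\<bar> * (pa k * pa m) \<le> h * (x * y)"
      "0 \<le> h" "0 \<le> x" "0 \<le> y" for k m c h x y
  proof (cases "0 < size_prob k \<and> 4 * k \<le> n \<and> 0 < size_prob m \<and> 4 * m \<le> n")
    case True
    have "c * (u k * u m) \<le> \<bar>c\<bar> * \<bar>u k * u m\<bar>" unfolding abs_mult[symmetric] by simp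
    also have "\<dots> \<le> \<bar>c\<bar> * (pa k * pa m)" using uu by (intro mult_left_mono) auto
    also have "\<dots> \<le> h * (x * y)" using that(1) True by blast
    finally show ?thesis .
  next
    case False
    then have "pa k = 0 \<or> pa m = 0" using pa_zero size_prob_nonneg[of k] size_prob_nonneg[of m] by force
    then have "u k * u m = 0" using uu[of k m] by auto
    then have "c * (u k * u m) = 0" by simp
    moreover have "0 \<le> h * (x * y)" using that(2-4) by simp
    ultimately show ?thesis by linarith
  qed
  have T1: "(\<Sum>k\<le>n. \<Sum>m\<le>n. i\<^sup>2 * (r k m * ?Q - q k * q m) * (u k * u m)) \<le> 8 * K ^ 6 * real n * B\<^sup>2"
  proof -
    have "(\<Sum>k\<le>n. \<Sum>m\<le>n. i\<^sup>2 * (r k m * ?Q - q k * q m) * (u k * u m))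
       \<le> (2 * K ^ 4 * real n) * ((\<Sum>k\<le>n. w k * pa k) * (\<Sum>m\<le>n. w m * pa m))"
    proof (rule double_sum_le, rule cases)
      fix k m assume km: "0 < size_prob k" "4 * k \<le> n" "0 < size_prob m" "4 * m \<le> n"
      have "\<bar>i\<^sup>2 * (r k m * ?Q - q k * q m)\<bar> \<le> (K\<^sup>2 * real n ^ 3) * (2 * K\<^sup>2 / (real n)\<^sup>2 * (w k * w m))"
        unfolding abs_mult using i2 est(1)[OF km] by (intro mult_mono) auto
      also have "\<dots> = 2 * K ^ 4 * real n * (w k * w m)"
        using n0 by (simp add: power2_eq_square power3_eq_cube eval_nat_numeral)
      finally have "\<bar>i\<^sup>2 * (r k m * ?Q - q k * q m)\<bar> * (pa k * pa m) \<le> 2 * K ^ 4 * real n * (w k * w m) * (pa k * pa m)"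
        using pa0 by (intro mult_right_mono) auto
      then show "\<bar>i\<^sup>2 * (r k m * ?Q - q k * q m)\<bar> * (pa k * pa m) \<le> (2 * K ^ 4 * real n) * ((w k * pa k) * (w m * pa m))"
        by (simp only: mult_ac)
    qed (use K_pos w0 pa0 in auto)
    also have "\<dots> \<le> (2 * K ^ 4 * real n) * ((2 * (K * B)) * (2 * (K * B)))"
      using sw swn KB K_pos by (intro mult_left_mono mult_mono) auto
    also have "\<dots> = 8 * K ^ 6 * real n * B\<^sup>2" by (simp add: power2_eq_square eval_nat_numeral)
    finally show ?thesis .
  qed
  have T2: "(\<Sum>k\<le>n. \<Sum>m\<le>n. i * r k m * (u k * u m)) \<le> 2 * K ^ 4 * real n * B\<^sup>2"
  proof -
    have "(\<Sum>k\<le>n. \<Sum>m\<le>n. i * r k m * (u k * u m)) \<le> (2 * K\<^sup>2 * real n) * ((\<Sum>k\<le>n. pa k) * (\<Sum>m\<le>n. pa m))"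
    proof (rule double_sum_le, rule cases)
      fix k m assume km: "0 < size_prob k" "4 * k \<le> n" "0 < size_prob m" "4 * m \<le> n"
      have "\<bar>i * r k m\<bar> = i * r k m" using i by (simp add: r_def)
      also have "\<dots> \<le> (K * real n * ?s) * (2 * K / ?s)"
        using i rq(2)[OF km(2,4)] K_pos by (intro mult_mono) (auto simp: r_def)
      also have "\<dots> = 2 * K\<^sup>2 * real n" using s by (simp add: power2_eq_square)
      finally show "\<bar>i * r k m\<bar> * (pa k * pa m) \<le> (2 * K\<^sup>2 * real n) * (pa k * pa m)"
        using pa0 by (intro mult_right_mono) auto
    qed (use pa0 in auto)
    also have "\<dots> \<le> (2 * K\<^sup>2 * real n) * ((K * B) * (K * B))"
      using s0 s0n KB by (intro mult_left_mono mult_mono) auto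
    finally show ?thesis by (simp add: power2_eq_square eval_nat_numeral algebra_simps)
  qed
  have T4: "(\<Sum>k\<le>n. \<Sum>m\<le>n. (2 * i * real k * (q k - r k m)) * (u k * u m)) \<le> 12 * K ^ 4 * real n * B\<^sup>2"
  proof -
    have "(\<Sum>k\<le>n. \<Sum>m\<le>n. (2 * i * real k * (q k - r k m)) * (u k * u m)) \<le> (6 * K\<^sup>2 * ?s) * ((\<Sum>k\<le>n. real k * pa k) * (\<Sum>m\<le>n. w m * pa m))"
    proof (rule double_sum_le, rule cases)
      fix k m assume km: "0 < size_prob k" "4 * k \<le> n" "0 < size_prob m" "4 * m \<le> n"
      have "\<bar>2 * i * real k * (q k - r k m)\<bar> \<le> (2 * (K * real n * ?s) * real k) * (3 * K / real n * w m)"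
        unfolding abs_mult using i est(2)[OF km] K_pos by (intro mult_mono) auto
      also have "\<dots> = 6 * K\<^sup>2 * ?s * (real k * w m)" using n0 by (simp add: power2_eq_square)
      finally have "\<bar>2 * i * real k * (q k - r k m)\<bar> * (pa k * pa m) \<le> 6 * K\<^sup>2 * ?s * (real k * w m) * (pa k * pa m)"
        using pa0 by (intro mult_right_mono) auto
      then show "\<bar>2 * i * real k * (q k - r k m)\<bar> * (pa k * pa m) \<le> (6 * K\<^sup>2 * ?s) * ((real k * pa k) * (w m * pa m))"
        by (simp only: mult_ac)
    qed (use K_pos w0 pa0 in auto)
    also have "\<dots> \<le> (6 * K\<^sup>2 * ?s) * ((?s * (K * B)) * (2 * (K * B)))"
      using sw swn s2 s2n KB K_pos by (intro mult_left_mono mult_mono) auto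
    also have "\<dots> = 12 * K ^ 4 * (?s * ?s) * B\<^sup>2" by (simp add: power2_eq_square eval_nat_numeral)
    finally show ?thesis unfolding s(3) .
  qed
  \<comment> \<open>The deviation comes from \<open>IH\<close> and the bias from the mean bound with
    its 24. Moving the centering from \<open>cut_mean f k\<close> to \<open>\<mu>\<close> costs
    \<open>k\<close> times the mass of sizes above \<open>k\<close>, which the weight
    \<open>sqrt m\<close> bounds by \<open>sqrt k * K * B\<close>. This gives 24 + 1 = 25.\<close>
  have shift: "cond_norm k (\<lambda>t. ?F t - real k * \<mu>) \<le> (C + 25 * K ^ 3) * B * sqrt (real k)"
    if k: "0 < size_prob k" "4 * k \<le> n" for k
  proof -
    have k0: "k > 0" using k by (cases k) auto
    have "cond_norm k (\<lambda>t. ?F t - real k * \<mu>) \<le> cond_sd k ?F + \<bar>cond_mean k ?F - real k * \<mu>\<bar>" by (rule cond_norm_shift_le)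
    also have "cond_sd k ?F \<le> C * sqrt (real k) * B" by (rule IH) (rule k)
    also have "\<bar>cond_mean k ?F - real k * \<mu>\<bar> \<le> \<bar>cond_mean k ?F - real k * cut_mean f k\<bar> + real k * \<bar>\<mu> - cut_mean f k\<bar>"
    proof -
      have "cond_mean k ?F - real k * \<mu> = (cond_mean k ?F - real k * cut_mean f k) - real k * (\<mu> - cut_mean f k)"
        by (simp add: algebra_simps)
      then show ?thesis using abs_triangle_ineq4[of "cond_mean k ?F - real k * cut_mean f k" "real k * (\<mu> - cut_mean f k)"]
        by (simp add: abs_mult)
    qed
    also have "\<bar>cond_mean k ?F - real k * cut_mean f k\<bar> \<le> 24 * K ^ 3 * sqrt (real k) * B"
    proof (rule cond_mean_additive_functional_bound[OF k(1)])
      show "\<bar>cond_mean j f\<bar> \<le> B" if "j \<le> k" for j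
        using that k(2) by (intro order.trans[OF abs_cond_mean_le B]) simp
    qed
    also have "real k * \<bar>\<mu> - cut_mean f k\<bar> \<le> sqrt (real k) * (K * B)"
    proof -
      have "\<mu> - cut_mean f k = (\<Sum>m\<in>{k<..n}. u m)"
      proof -
        have "{..n} = {..k} \<union> {k<..n}" using k by auto
        then have "\<mu> = sum u ({..k} \<union> {k<..n})" by (simp only: \<mu>_def)
        also have "\<dots> = (\<Sum>m\<le>k. u m) + (\<Sum>m\<in>{k<..n}. u m)" by (rule sum.union_disjoint) auto
        finally have "\<mu> = (\<Sum>m\<le>k. u m) + (\<Sum>m\<in>{k<..n}. u m)" .
        then show ?thesis by (simp add: cut_mean_def u_def)
      qed
      then have "real k * \<bar>\<mu> - cut_mean f k\<bar> \<le> real k * (\<Sum>m\<in>{k<..n}. pa m)"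
        using u_le by (intro mult_left_mono) (auto intro!: order.trans[OF sum_abs] sum_mono)
      also have "\<dots> = sqrt (real k) * (\<Sum>m\<in>{k<..n}. sqrt (real k) * pa m)"
        by (simp flip: sum_distrib_left mult.assoc)
      also have "\<dots> \<le> sqrt (real k) * (\<Sum>m\<in>{k<..n}. sqrt (real m) * pa m)"
        using pa0 by (intro mult_left_mono sum_mono mult_right_mono) auto
      also have "\<dots> \<le> sqrt (real k) * (\<Sum>m\<le>n. sqrt (real m) * pa m)"
        using pa0 by (intro mult_left_mono sum_mono2) auto
      also have "\<dots> \<le> sqrt (real k) * (K * B)" using s1 by (intro mult_left_mono) auto
      finally show ?thesis .
    qed
    also have "sqrt (real k) * (K * B) \<le> sqrt (real k) * (K ^ 3 * B)"
      using K_ge_1 B0 self_le_power[of K 3] by (intro mult_left_mono mult_right_mono) auto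
    finally show ?thesis by (simp add: algebra_simps)
  qed
  have T3: "(\<Sum>k\<le>n. 2 * i * q k * J k) \<le> (4 * K ^ 3 * C + 100 * K ^ 6) * real n * B\<^sup>2"
  proof -
    have "(\<Sum>k\<le>n. 2 * i * q k * J k) \<le> (\<Sum>k\<le>n. (4 * K\<^sup>2 * real n * ((C + 25 * K ^ 3) * B)) * (sqrt (real k) * pa k))"
    proof (rule sum_mono)
      fix k assume "k \<in> {..n}"
      have J: "\<bar>J k\<bar> \<le> pa k * cond_norm k (\<lambda>t. ?F t - real k * \<mu>)"
        unfolding J_def pa_def using abs_tree_sum_mult_le[of k f "\<lambda>t. ?F t - real k * \<mu>"] by (simp add: mult.assoc)
      show "2 * i * q k * J k \<le> (4 * K\<^sup>2 * real n * ((C + 25 * K ^ 3) * B)) * (sqrt (real k) * pa k)"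
      proof (cases "0 < size_prob k \<and> 4 * k \<le> n")
        case True
        have "2 * i * q k * J k \<le> (2 * i * q k) * \<bar>J k\<bar>" using i by (intro mult_left_mono) (auto simp: q_def)
        also have "\<dots> \<le> (2 * (K * real n * ?s) * (2 * K / ?s)) * (pa k * ((C + 25 * K ^ 3) * B * sqrt (real k)))"
          using i rq(1)[of k k] True K_pos s shift[of k] pa0[of k]
          by (intro mult_mono order.trans[OF J] mult_left_mono) (auto simp: q_def)
        also have "\<dots> = (4 * K\<^sup>2 * real n * ((C + 25 * K ^ 3) * B)) * (sqrt (real k) * pa k)"
          using s by (simp add: power2_eq_square)
        finally show ?thesis .
      next
        case False
        then have "pa k = 0" using pa_zero[of k] size_prob_nonneg[of k] by force
        then show ?thesis using J by simp
      qed
    qed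
    also have "\<dots> \<le> (4 * K\<^sup>2 * real n * ((C + 25 * K ^ 3) * B)) * (K * B)"
      unfolding sum_distrib_left[symmetric] using s1 C B0 K_pos by (intro mult_left_mono) auto
    also have "\<dots> = (4 * K ^ 3 * C + 100 * K ^ 6) * real n * B\<^sup>2"
      by (simp add: power2_eq_square eval_nat_numeral algebra_simps)
    finally show ?thesis .
  qed
  have Fsq: "cond_mean n (\<lambda>t. (?F t)\<^sup>2) = (\<Sum>k\<le>n. i * q k * tree_sum k (\<lambda>t. f t * (2 * ?F t - f t)))
      + (\<Sum>k\<le>n. \<Sum>m\<le>n. i * (real n + 1 - real k - real m) * r k m * (u k * u m))"
  proof -
    have "(\<Sum>k\<le>n. \<Sum>m\<le>n - k. real (n + 1 - k - m) * (walk_prob (n - k - m) 1 * (tree_sum k f * tree_sum m f)))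
       = (\<Sum>k\<le>n. \<Sum>m\<le>n. (real n + 1 - real k - real m) * r k m * (u k * u m))"
    proof (rule sum.cong[OF refl])
      fix k assume k: "k \<in> {..n}"
      have z: "u j = 0" if "n < 4 * j" for j using u_le[of j] pa_zero[of j] that by simp
      show "(\<Sum>m\<le>n - k. real (n + 1 - k - m) * (walk_prob (n - k - m) 1 * (tree_sum k f * tree_sum m f)))
         = (\<Sum>m\<le>n. (real n + 1 - real k - real m) * r k m * (u k * u m))"
      proof (rule sum.mono_neutral_cong_left)
        show "\<forall>m\<in>{..n} - {..n - k}. (real n + 1 - real k - real m) * r k m * (u k * u m) = 0"
        proof
          fix m assume "m \<in> {..n} - {..n - k}"
          then have "n < 4 * k \<or> n < 4 * m" using k by auto
          then show "(real n + 1 - real k - real m) * r k m * (u k * u m) = 0" using z by auto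
        qed
      next
        fix m assume "m \<in> {..n - k}"
        then have "real (n + 1 - k - m) = real n + 1 - real k - real m" using k by (simp add: of_nat_diff)
        then show "real (n + 1 - k - m) * (walk_prob (n - k - m) 1 * (tree_sum k f * tree_sum m f))
           = (real n + 1 - real k - real m) * r k m * (u k * u m)" by (simp add: r_def u_def)
      qed auto
    qed
    then show ?thesis
      unfolding cond_mean_def tree_sum_additive_functional_square
      by (simp add: i_def q_def sum_divide_distrib add_divide_distrib mult_ac)
  qed
  have mean: "cond_mean n ?F = i * (\<Sum>k\<le>n. q k * u k)"
    unfolding cond_mean_def tree_sum_additive_functional by (simp add: i_def q_def u_def)
  have "(cond_sd n ?F)\<^sup>2 = (\<Sum>k\<le>n. i * q k * tree_sum k (\<lambda>t. f t * (2 * ?F t - f t)))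
      + (\<Sum>k\<le>n. \<Sum>m\<le>n. i * (real n + 1 - real k - real m) * r k m * (u k * u m))
      - (\<Sum>k\<le>n. \<Sum>m\<le>n. i\<^sup>2 * (q k * q m) * (u k * u m))"
  proof -
    have "(i * (\<Sum>k\<le>n. q k * u k))\<^sup>2 = (\<Sum>k\<le>n. \<Sum>m\<le>n. i\<^sup>2 * (q k * q m) * (u k * u m))"
    proof -
      have "(\<Sum>k\<le>n. q k * u k)\<^sup>2 = (\<Sum>k\<le>n. \<Sum>m\<le>n. (q k * u k) * (q m * u m))"
        unfolding power2_eq_square by (rule sum_product)
      then show ?thesis unfolding power_mult_distrib by (simp only: sum_distrib_left mult_ac)
    qed
    then show ?thesis unfolding cond_sd_square[OF n] Fsq mean by simp
  qed
  also have "(\<Sum>k\<le>n. i * q k * tree_sum k (\<lambda>t. f t * (2 * ?F t - f t)))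
      \<le> (\<Sum>k\<le>n. 2 * i * q k * J k) + (\<Sum>k\<le>n. \<Sum>m\<le>n. 2 * i * real k * q k * (u k * u m))"
  proof -
    have "i * q k * tree_sum k (\<lambda>t. f t * (2 * ?F t - f t)) \<le> 2 * i * q k * J k + (\<Sum>m\<le>n. 2 * i * real k * q k * (u k * u m))" for k
    proof -
      \<comment> \<open>The summand \<open>- (f t)\<^sup>2\<close> is discarded, which is allowed in
        an upper bound.\<close>
      have "tree_sum k (\<lambda>t. f t * (2 * ?F t - f t)) \<le> tree_sum k (\<lambda>t. 2 * (f t * (?F t - real k * \<mu>)) + f t * (2 * real k * \<mu>))"
        unfolding tree_sum_def by (intro sum_mono mult_left_mono) (auto simp: algebra_simps)
      also have "\<dots> = 2 * J k + u k * (2 * real k * \<mu>)"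
        by (simp only: tree_sum_add tree_sum_cmult tree_sum_cmult_left J_def u_def)
      finally have "i * q k * tree_sum k (\<lambda>t. f t * (2 * ?F t - f t)) \<le> i * q k * (2 * J k + u k * (2 * real k * \<mu>))"
        using i by (intro mult_left_mono) (auto simp: q_def)
      also have "\<dots> = 2 * i * q k * J k + (\<Sum>m\<le>n. 2 * i * real k * q k * (u k * u m))"
        by (simp add: \<mu>_def distrib_left sum_distrib_left mult_ac)
      finally show ?thesis .
    qed
    then have "(\<Sum>k\<le>n. i * q k * tree_sum k (\<lambda>t. f t * (2 * ?F t - f t)))
       \<le> (\<Sum>k\<le>n. 2 * i * q k * J k + (\<Sum>m\<le>n. 2 * i * real k * q k * (u k * u m)))" by (rule sum_mono)
    then show ?thesis by (simp only: sum.distrib)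
  qed
  also have "(\<Sum>k\<le>n. \<Sum>m\<le>n. i * (real n + 1 - real k - real m) * r k m * (u k * u m))
     = (\<Sum>k\<le>n. \<Sum>m\<le>n. i\<^sup>2 * (r k m * ?Q) * (u k * u m)) + (\<Sum>k\<le>n. \<Sum>m\<le>n. i * r k m * (u k * u m))
       - (\<Sum>k\<le>n. \<Sum>m\<le>n. 2 * i * real k * r k m * (u k * u m))"
  proof -
    \<comment> \<open>Exchanging the roles of \<open>k\<close> and \<open>m\<close> merges the two
      size corrections into \<open>2 * i * real k\<close>, the shape of the term produced by the
      centering.\<close>
    have sym: "(\<Sum>k\<le>n. \<Sum>m\<le>n. i * real m * r k m * (u k * u m)) = (\<Sum>k\<le>n. \<Sum>m\<le>n. i * real k * r k m * (u k * u m))"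
    proof (subst sum.swap, intro sum.cong refl)
      fix k m
      have "r m k = r k m" by (simp add: r_def add.commute)
      then show "i * real k * r m k * (u m * u k) = i * real k * r k m * (u k * u m)" by (simp only: mult_ac)
    qed
    have "i * (real n + 1 - real k - real m) * r k m * (u k * u m) = i\<^sup>2 * (r k m * ?Q) * (u k * u m) + i * r k m * (u k * u m)
        - (i * real k * r k m * (u k * u m) + i * real m * r k m * (u k * u m))" for k m
      unfolding i(3)[symmetric] by (simp add: power2_eq_square algebra_simps)
    then have "(\<Sum>k\<le>n. \<Sum>m\<le>n. i * (real n + 1 - real k - real m) * r k m * (u k * u m))
      = (\<Sum>k\<le>n. \<Sum>m\<le>n. i\<^sup>2 * (r k m * ?Q) * (u k * u m)) + (\<Sum>k\<le>n. \<Sum>m\<le>n. i * r k m * (u k * u m))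
        - ((\<Sum>k\<le>n. \<Sum>m\<le>n. i * real k * r k m * (u k * u m)) + (\<Sum>k\<le>n. \<Sum>m\<le>n. i * real m * r k m * (u k * u m)))"
      by (simp only: sum.distrib sum_subtractf)
    moreover have "(\<Sum>k\<le>n. \<Sum>m\<le>n. 2 * i * real k * r k m * (u k * u m)) = 2 * (\<Sum>k\<le>n. \<Sum>m\<le>n. i * real k * r k m * (u k * u m))"
      by (simp add: sum_distrib_left mult_ac)
    ultimately show ?thesis unfolding sym by linarith
  qed
  finally have "(cond_sd n ?F)\<^sup>2 \<le> (\<Sum>k\<le>n. 2 * i * q k * J k)
      + ((\<Sum>k\<le>n. \<Sum>m\<le>n. i\<^sup>2 * (r k m * ?Q) * (u k * u m)) - (\<Sum>k\<le>n. \<Sum>m\<le>n. i\<^sup>2 * (q k * q m) * (u k * u m)))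
      + (\<Sum>k\<le>n. \<Sum>m\<le>n. i * r k m * (u k * u m))
      + ((\<Sum>k\<le>n. \<Sum>m\<le>n. 2 * i * real k * q k * (u k * u m)) - (\<Sum>k\<le>n. \<Sum>m\<le>n. 2 * i * real k * r k m * (u k * u m)))"
    by linarith
  also have "\<dots> = (\<Sum>k\<le>n. 2 * i * q k * J k)
      + (\<Sum>k\<le>n. \<Sum>m\<le>n. i\<^sup>2 * (r k m * ?Q - q k * q m) * (u k * u m))
      + (\<Sum>k\<le>n. \<Sum>m\<le>n. i * r k m * (u k * u m))
      + (\<Sum>k\<le>n. \<Sum>m\<le>n. (2 * i * real k * (q k - r k m)) * (u k * u m))"
    by (simp only: sum_subtractf[symmetric] left_diff_distrib right_diff_distrib)
  also have "\<dots> \<le> (4 * K ^ 3 * C + 100 * K ^ 6) * real n * B\<^sup>2 + 8 * K ^ 6 * real n * B\<^sup>2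
      + 2 * K ^ 4 * real n * B\<^sup>2 + 12 * K ^ 4 * real n * B\<^sup>2"
    by (intro add_mono T1 T2 T3 T4)
  also have "\<dots> \<le> (4 * K ^ 3 * C + 100 * K ^ 6) * real n * B\<^sup>2 + 8 * K ^ 6 * real n * B\<^sup>2
      + 2 * K ^ 6 * real n * B\<^sup>2 + 12 * K ^ 6 * real n * B\<^sup>2"
    using K_ge_1 by (intro add_mono mult_right_mono mult_left_mono power_increasing) auto
  also have "\<dots> = (122 * K ^ 6 + 4 * K ^ 3 * C) * real n * B\<^sup>2" by (simp add: algebra_simps)
  finally show ?thesis .
qed

text \<open>Strong induction on \<open>n\<close>, splitting \<open>f\<close> at size
  \<open>n / 4\<close>. The small part inherits both hypotheses with the same \<open>B\<close>. The
  constant 100 reproduces itself: under the root it yields 122 + 4 * 100 = 522, which is at most the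
  square of 23, and 23 + 72 for the two parts is still below 100.\<close>

theorem cond_sd_additive_functional_le:
  assumes "\<And>k. k \<le> n \<Longrightarrow> cond_norm k f \<le> B" "(\<Sum>k\<le>n. cond_norm k f / real k) \<le> B"
  shows "cond_sd n (additive_functional f) \<le> 100 * K ^ 3 * sqrt (real n) * B"
  using assms
proof (induction n arbitrary: f rule: less_induct)
  case (less n)
  note B = less.prems(1) and S = less.prems(2)
  have B0: "0 \<le> B" using B[of 0] cond_norm_nonneg[of 0 f] by linarith
  show ?case
  proof (cases "size_prob n = 0")
    case True
    then show ?thesis using B0 K_pos by (simp add: cond_sd_def cond_norm_eq_0)
  next
    case False
    then have n: "0 < size_prob n" using size_prob_nonneg[of n] by linarith
    then have n0: "n > 0" by (cases n) auto
    define g h where "g t = (if 4 * num_nodes t \<le> n then f t else 0)" and "h t = (if 4 * num_nodes t \<le> n then 0 else f t)" for t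
    have le: "cond_norm k g \<le> cond_norm k f" "cond_norm k h \<le> cond_norm k f" for k
      by (intro cond_norm_mono; simp add: g_def h_def)+
    have gS: "(\<Sum>k\<le>m. cond_norm k g / real k) \<le> B" if "m \<le> n" for m
    proof -
      have "(\<Sum>k\<le>m. cond_norm k g / real k) \<le> (\<Sum>k\<le>m. cond_norm k f / real k)"
        using le by (intro sum_mono divide_right_mono) auto
      also have "\<dots> \<le> (\<Sum>k\<le>n. cond_norm k f / real k)" using that by (intro sum_mono2) auto
      finally show ?thesis using S by linarith
    qed
    have gB: "cond_norm k g \<le> B" "cond_norm k h \<le> B" if "k \<le> n" for k using le[of k] B[OF that] by linarith+
    have "(cond_sd n (additive_functional g))\<^sup>2 \<le> (122 * K ^ 6 + 4 * K ^ 3 * (100 * K ^ 3)) * real n * B\<^sup>2"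
    proof (rule cond_sd_small_part[OF n])
      show "cond_sd k (additive_functional g) \<le> 100 * K ^ 3 * sqrt (real k) * B" if "4 * k \<le> n" for k
        using that n0 by (intro less.IH gB gS) auto
    qed (use gB gS K_pos in \<open>auto simp: g_def\<close>)
    also have "\<dots> = 522 * (K ^ 6 * real n * B\<^sup>2)" by (simp add: algebra_simps flip: power_add)
    also have "\<dots> \<le> 529 * (K ^ 6 * real n * B\<^sup>2)" by (intro mult_right_mono) (use K_pos in auto)
    also have "\<dots> = (23 * K ^ 3 * sqrt (real n) * B)\<^sup>2" by (simp add: power_mult_distrib)
    finally have 1: "cond_sd n (additive_functional g) \<le> 23 * K ^ 3 * sqrt (real n) * B"
      by (rule power2_le_imp_le) (use K_pos B0 in auto)
    have 2: "cond_sd n (additive_functional h) \<le> 72 * K ^ 3 * sqrt (real n) * B"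
      by (rule order.trans[OF cond_sd_le_norm cond_norm_large_part[OF n0]]) (use gB in \<open>auto simp: h_def\<close>)
    have "f = (\<lambda>t. g t + h t)" by (auto simp: g_def h_def)
    then have "additive_functional f = (\<lambda>t. additive_functional g t + additive_functional h t)"
      by (simp add: additive_functional_add[abs_def])
    then have "cond_sd n (additive_functional f) \<le> 23 * K ^ 3 * sqrt (real n) * B + 72 * K ^ 3 * sqrt (real n) * B"
      using cond_sd_triangle[of n "additive_functional g" "additive_functional h"] 1 2 by (simp only:)
    also have "\<dots> \<le> 100 * K ^ 3 * sqrt (real n) * B"
      using mult_nonneg_nonneg[of "K ^ 3 * sqrt (real n)" B] K_pos B0 by simp
    finally show ?thesis .
  qed
qed

end

section \<open>Limits of means and variances\<close>

definition trunc :: "nat \<Rightarrow> (plane_tree \<Rightarrow> real) \<Rightarrow> plane_tree \<Rightarrow> real" where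
  "trunc M f t = (if num_nodes t \<le> M then f t else 0)"

definition tail :: "nat \<Rightarrow> (plane_tree \<Rightarrow> real) \<Rightarrow> plane_tree \<Rightarrow> real" where
  "tail M f t = (if num_nodes t \<le> M then 0 else f t)"

lemma trunc_add_tail: "f = (\<lambda>t. trunc M f t + tail M f t)"
  by (auto simp: trunc_def tail_def)

lemma additive_functional_trunc_add_tail:
  "additive_functional f t = additive_functional (trunc M f) t + additive_functional (tail M f) t"
  by (subst trunc_add_tail[of f M]) (simp add: additive_functional_def sum.distrib)

lemma num_nodes_child_less: "u \<in> set ts \<Longrightarrow> num_nodes u < num_nodes (Node ts)"
  using length_degree_seq[of "Node ts"] member_le_sum_list[of "num_nodes u" "map num_nodes ts"]
  by (simp add: length_concat comp_def length_degree_seq)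

lemma additive_functional_cong:
  "(\<And>s. num_nodes s \<le> num_nodes t \<Longrightarrow> f s = g s) \<Longrightarrow> additive_functional f t = additive_functional g t"
proof (induction t)
  case (Node ts)
  have "additive_functional f u = additive_functional g u" if "u \<in> set ts" for u
    using num_nodes_child_less[OF that] Node.prems by (intro Node.IH that) auto
  then have "map (additive_functional f) ts = map (additive_functional g) ts" by simp
  then show ?case using Node.prems[of "Node ts"] by (simp add: additive_functional_Node del: map_eq_conv)
qed

lemma sum_power_three_halves_le:
  assumes "n > 0" "n \<le> m"
  shows "(\<Sum>k\<in>{n<..m}. 1 / (real k * sqrt (real k))) \<le> 2 * (1 / sqrt (real n) - 1 / sqrt (real m))"
  using assms(2)
proof (induction m rule: dec_induct)
  case (step m)
  define a b where "a = sqrt (real m)" and "b = sqrt (real m + 1)"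
  have m: "m > 0" using step assms by simp
  have ab: "0 < a" "a \<le> b" "0 < b" "b * b = real m + 1" "a * a = real m" using m by (auto simp: a_def b_def)
  have "1 = (b - a) * (b + a)" using ab(4,5) by (simp add: algebra_simps)
  also have "\<dots> \<le> (b - a) * (2 * b)" using ab(1-3) by (intro mult_left_mono) auto
  finally have 1: "1 \<le> 2 * b * (b - a)" by (simp only: mult_ac)
  have "1 / ((real m + 1) * b) = 1 / (b * b * b)" by (simp only: ab(4))
  also have "\<dots> \<le> (2 * b * (b - a)) / (b * b * b)" using 1 ab(3) by (intro divide_right_mono) auto
  also have "\<dots> = 2 * (b - a) / (b * b)" using ab(3) by simp
  also have "\<dots> \<le> 2 * (b - a) / (a * b)" using ab(1-3) by (intro divide_left_mono mult_right_mono) auto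
  also have "\<dots> = 2 * (1 / a - 1 / b)" using ab(1,3) by (simp add: field_simps)
  finally have "1 / ((real m + 1) * sqrt (real m + 1)) \<le> 2 * (1 / sqrt (real m) - 1 / sqrt (real m + 1))"
    unfolding a_def b_def .
  moreover have "{n<..Suc m} = insert (Suc m) {n<..m}" using step by auto
  ultimately show ?case using step.IH by (simp add: add.commute)
qed simp

context critical_offspring
begin

lemma tree_sum_trunc: "tree_sum k (trunc M f) = (if k \<le> M then tree_sum k f else 0)"
  unfolding tree_sum_def by (auto simp: trunc_def trees_def intro!: sum.cong)

lemma tree_sum_tail: "tree_sum k (tail M f) = (if k \<le> M then 0 else tree_sum k f)"
  unfolding tree_sum_def by (auto simp: tail_def trees_def intro!: sum.cong)

lemma cond_mean_tail: "cond_mean k (tail M f) = (if k \<le> M then 0 else cond_mean k f)"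
  by (simp add: cond_mean_def tree_sum_tail)

lemma cond_norm_tail: "cond_norm k (tail M f) = (if k \<le> M then 0 else cond_norm k f)"
  unfolding cond_norm_def L2_set_def
  by (auto simp: tail_def trees_def intro!: sum.cong arg_cong[of _ _ sqrt])

lemma integrable_trunc: "integrable gw (trunc M f)"
proof (rule integrable_finite_support)
  show "finite (\<Union>k\<le>M. trees k)" by simp
qed (auto simp: trunc_def trees_def)

lemma integrable_tail: "integrable gw f \<Longrightarrow> integrable gw (tail M f)"
  by (rule Bochner_Integration.integrable_bound) (auto simp: tail_def)

lemma expectation_finite_support:
  assumes "\<And>t. M < num_nodes t \<Longrightarrow> h t = 0"
  shows "measure_pmf.expectation gw h = (\<Sum>k\<le>M. tree_sum k h)"
proof -
  have h: "integrable gw h"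
  proof (rule integrable_finite_support)
    show "finite (\<Union>k\<le>M. trees k)" by simp
    show "h x = 0" if "x \<notin> (\<Union>k\<le>M. trees k)" for x using that assms[of x] by (auto simp: trees_def)
  qed
  have "(\<lambda>k. tree_sum k h) sums (\<Sum>k\<le>M. tree_sum k h)"
    by (rule sums_finite) (use assms in \<open>auto simp: tree_sum_def trees_def\<close>)
  then show ?thesis using sums_expectation_gw[OF h] sums_unique2 by blast
qed

lemma expectation_trunc: "measure_pmf.expectation gw (trunc M f) = cut_mean f M"
proof -
  have "measure_pmf.expectation gw (trunc M f) = (\<Sum>k\<le>M. tree_sum k (trunc M f))"
    by (rule expectation_finite_support) (simp add: trunc_def)
  also have "\<dots> = cut_mean f M" unfolding cut_mean_def by (intro sum.cong refl) (simp add: tree_sum_trunc)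
  finally show ?thesis .
qed

lemma expectation_trunc_tail:
  assumes "integrable gw f"
  shows "measure_pmf.expectation gw f = measure_pmf.expectation gw (trunc M f) + measure_pmf.expectation gw (tail M f)"
  by (subst trunc_add_tail[of f M]) (rule Bochner_Integration.integral_add[OF integrable_trunc integrable_tail[OF assms]])

lemma cut_mean_tendsto: "integrable gw f \<Longrightarrow> cut_mean f \<longlonglongrightarrow> measure_pmf.expectation gw f"
  using sums_expectation_gw[of f] unfolding sums_def_le cut_mean_def[abs_def] .

text \<open>The \<open>\<gamma>2\<close> of the theorem, with the variance of \<open>f\<close>
  expanded into the mean of the square minus the square of the mean.\<close>

definition asymptotic_var :: "(plane_tree \<Rightarrow> real) \<Rightarrow> real" where
  "asymptotic_var f = 2 * measure_pmf.expectation gw (\<lambda>t. f t * (additive_functional f t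
      - real (num_nodes t) * measure_pmf.expectation gw f))
    - measure_pmf.expectation gw (\<lambda>t. (f t)\<^sup>2) + (measure_pmf.expectation gw f)\<^sup>2
    - (measure_pmf.expectation gw f)\<^sup>2 / offspring_var"

lemma tree_sum_num_nodes: "tree_sum k (\<lambda>t. f t * (g t - real (num_nodes t) * c)) = tree_sum k (\<lambda>t. f t * g t) - real k * c * tree_sum k f"
  unfolding tree_sum_def sum_distrib_left sum_subtractf[symmetric]
  by (intro sum.cong) (auto simp: trees_def algebra_simps)

lemma asymptotic_var_finite_support:
  fixes f
  assumes supp: "\<And>t. M < num_nodes t \<Longrightarrow> f t = 0"
  defines "\<mu> \<equiv> measure_pmf.expectation gw f"
  shows "asymptotic_var f = 2 * (\<Sum>k\<le>M. tree_sum k (\<lambda>t. f t * additive_functional f t) - real k * \<mu> * tree_sum k f)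
    - (\<Sum>k\<le>M. tree_sum k (\<lambda>t. (f t)\<^sup>2)) + \<mu>\<^sup>2 - \<mu>\<^sup>2 / offspring_var"
  unfolding asymptotic_var_def \<mu>_def[symmetric]
  by (subst (1 2) expectation_finite_support[of M]) (auto simp: supp tree_sum_num_nodes)

lemma tendsto_admissible_0:
  fixes g :: "nat \<Rightarrow> real"
  assumes "(g \<longlongrightarrow> 0) (admissible_at_top p)" "\<And>n. size_prob n = 0 \<Longrightarrow> g n = 0"
  shows "g \<longlonglongrightarrow> 0"
proof (rule tendstoI)
  fix e :: real assume "e > 0"
  then have "\<forall>\<^sub>F n in admissible_at_top p. dist (g n) 0 < e" using assms(1) by (rule tendstoD[rotated])
  then show "\<forall>\<^sub>F n in sequentially. dist (g n) 0 < e"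
    unfolding eventually_admissible
  proof eventually_elim
    case (elim n)
    then show ?case using assms(2)[of n] size_prob_nonneg[of n] \<open>e > 0\<close> by (cases "size_prob n = 0") auto
  qed
qed

lemma walk_prob_ratio_limits:
  assumes k: "0 < size_prob k"
  shows "((\<lambda>n. walk_prob (n - k) 0 / walk_prob n (-1)) \<longlongrightarrow> 1) (admissible_at_top p)"
    and "((\<lambda>n. sqrt (real n) * ((walk_prob (n - k) 0 - walk_prob n (-1)) / walk_prob n (-1))) \<longlongrightarrow> 0) (admissible_at_top p)"
proof -
  let ?F = "admissible_at_top p"
  let ?Q = "\<lambda>n. walk_prob n (-1)"
  have ev: "\<forall>\<^sub>F n in ?F. n > 0 \<and> ?Q n > 0"
    unfolding eventually_admissible using eventually_gt_at_top[of 0]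
    by eventually_elim (auto simp flip: size_prob_eq_walk_prob)
  have "((\<lambda>n. real n * (walk_prob (n - k) 0 - ?Q n) / (sqrt (real n) * ?Q n)) \<longlongrightarrow> 0 / llt_const) ?F"
    using llt_const_pos by (intro tendsto_divide walk_prob_diff_limit k walk_prob_limit) auto
  then have "((\<lambda>n. sqrt (real n) * ((walk_prob (n - k) 0 - ?Q n) / ?Q n)) \<longlongrightarrow> 0 / llt_const) ?F"
  proof (rule Lim_transform_eventually)
    show "\<forall>\<^sub>F n in ?F. real n * (walk_prob (n - k) 0 - ?Q n) / (sqrt (real n) * ?Q n) = sqrt (real n) * ((walk_prob (n - k) 0 - ?Q n) / ?Q n)"
      using ev
    proof eventually_elim
      case (elim n)
      have "real n * x / (sqrt (real n) * y) = (real n / sqrt (real n)) * (x / y)" for x y by simp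
      then show ?case using elim by (simp only: real_div_sqrt)
    qed
  qed
  then show 2: "((\<lambda>n. sqrt (real n) * ((walk_prob (n - k) 0 - ?Q n) / ?Q n)) \<longlongrightarrow> 0) ?F" by simp
  have "((\<lambda>n. 1 / sqrt (real n)) \<longlongrightarrow> 0) ?F"
    by (rule tendsto_mono[of _ sequentially]) (simp add: admissible_at_top_def, real_asymp)
  from tendsto_add[OF tendsto_mult[OF this 2] tendsto_const[of 1]]
  have "((\<lambda>n. 1 / sqrt (real n) * (sqrt (real n) * ((walk_prob (n - k) 0 - ?Q n) / ?Q n)) + 1) \<longlongrightarrow> 1) ?F" by simp
  then show "((\<lambda>n. walk_prob (n - k) 0 / ?Q n) \<longlongrightarrow> 1) ?F"
    by (rule Lim_transform_eventually) (use ev in \<open>auto elim!: eventually_mono simp: diff_divide_distrib\<close>)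
qed

text \<open>The numerator is again split into the mixed difference and a product of first
  differences. After scaling by \<open>n\<close> the mixed difference tends to
  \<open>- 1 / offspring_var\<close> while the product tends to 0.\<close>

lemma walk_prob_mixed_ratio_limits:
  assumes k: "0 < size_prob k" and m: "0 < size_prob m"
  shows "((\<lambda>n. real n * (walk_prob (n - k - m) 1 * walk_prob n (-1) - walk_prob (n - k) 0 * walk_prob (n - m) 0) / (walk_prob n (-1))\<^sup>2)
       \<longlongrightarrow> - 1 / offspring_var) (admissible_at_top p)"
    and "((\<lambda>n. walk_prob (n - k - m) 1 / walk_prob n (-1)) \<longlongrightarrow> 1) (admissible_at_top p)"
proof -
  let ?F = "admissible_at_top p"
  let ?Q = "\<lambda>n. walk_prob n (-1)"
  let ?q = "\<lambda>k n. walk_prob (n - k) 0"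
  let ?D = "\<lambda>n. walk_prob_mixed n k m"
  have ev: "\<forall>\<^sub>F n in ?F. n > 0 \<and> ?Q n > 0"
    unfolding eventually_admissible using eventually_gt_at_top[of 0]
    by eventually_elim (auto simp flip: size_prob_eq_walk_prob)
  have "((\<lambda>n. sqrt (real n) ^ 3 * ?D n / (sqrt (real n) * ?Q n)) \<longlongrightarrow> (- llt_const / offspring_var) / llt_const) ?F"
    using llt_const_pos by (intro tendsto_divide walk_prob_mixed_limit k m walk_prob_limit) auto
  then have D: "((\<lambda>n. real n * (?D n / ?Q n)) \<longlongrightarrow> - 1 / offspring_var) ?F"
  proof (rule Lim_transform_eventually[THEN tendsto_eq_rhs])
    show "\<forall>\<^sub>F n in ?F. sqrt (real n) ^ 3 * ?D n / (sqrt (real n) * ?Q n) = real n * (?D n / ?Q n)"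
      using ev by eventually_elim (simp add: power3_eq_cube)
  qed (use llt_const_pos in simp)
  have "((\<lambda>n. real n * (?D n / ?Q n) - (sqrt (real n) * ((?q k n - ?Q n) / ?Q n)) * (sqrt (real n) * ((?q m n - ?Q n) / ?Q n)))
      \<longlongrightarrow> - 1 / offspring_var - 0 * 0) ?F"
    by (intro tendsto_diff tendsto_mult D walk_prob_ratio_limits k m)
  then show "((\<lambda>n. real n * (walk_prob (n - k - m) 1 * ?Q n - ?q k n * ?q m n) / (?Q n)\<^sup>2) \<longlongrightarrow> - 1 / offspring_var) ?F"
  proof (rule Lim_transform_eventually[THEN tendsto_eq_rhs])
    show "\<forall>\<^sub>F n in ?F. real n * (?D n / ?Q n) - (sqrt (real n) * ((?q k n - ?Q n) / ?Q n)) * (sqrt (real n) * ((?q m n - ?Q n) / ?Q n))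
       = real n * (walk_prob (n - k - m) 1 * ?Q n - ?q k n * ?q m n) / (?Q n)\<^sup>2"
      using ev
    proof eventually_elim
      case (elim n)
      have "(sqrt (real n) * a) * (sqrt (real n) * b) = (sqrt (real n) * sqrt (real n)) * (a * b)" for a b :: real by (simp only: mult_ac)
      then have *: "(sqrt (real n) * a) * (sqrt (real n) * b) = real n * (a * b)" for a b by simp
      have Q: "?Q n \<noteq> 0" using elim by simp
      show ?case unfolding * walk_prob_mixed_def using Q by (simp add: field_simps power2_eq_square)
    qed
  qed simp
  have "((\<lambda>n. 1 / real n) \<longlongrightarrow> 0) ?F"
    by (rule tendsto_mono[of _ sequentially]) (simp add: admissible_at_top_def, real_asymp)
  from tendsto_mult[OF this D]
  have "((\<lambda>n. 1 / real n * (real n * (?D n / ?Q n)) + ?q k n / ?Q n + ?q m n / ?Q n - 1) \<longlongrightarrow> 0 * (- 1 / offspring_var) + 1 + 1 - 1) ?F"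
    by (intro tendsto_diff tendsto_add walk_prob_ratio_limits k m tendsto_const)
  then show "((\<lambda>n. walk_prob (n - k - m) 1 / ?Q n) \<longlongrightarrow> 1) ?F"
  proof (rule Lim_transform_eventually[THEN tendsto_eq_rhs])
    show "\<forall>\<^sub>F n in ?F. 1 / real n * (real n * (?D n / ?Q n)) + ?q k n / ?Q n + ?q m n / ?Q n - 1 = walk_prob (n - k - m) 1 / ?Q n"
      using ev by eventually_elim (simp add: walk_prob_mixed_def field_simps)
  qed simp
qed

lemma finite_support_mean_limit:
  assumes supp: "\<And>t. M < num_nodes t \<Longrightarrow> f t = 0"
  shows "((\<lambda>n. (cond_mean n (additive_functional f) - real n * measure_pmf.expectation gw f) / sqrt (real n)) \<longlongrightarrow> 0) (admissible_at_top p)"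
proof -
  let ?Q = "\<lambda>n. walk_prob n (-1)"
  have u0: "tree_sum k f = 0" if "M < k" for k using that supp by (auto simp: tree_sum_def trees_def)
  have "((\<lambda>n. \<Sum>k\<le>M. sqrt (real n) * ((walk_prob (n - k) 0 - ?Q n) / ?Q n) * tree_sum k f) \<longlongrightarrow> (\<Sum>k\<le>M. 0 * tree_sum k f)) (admissible_at_top p)"
  proof (intro tendsto_sum)
    fix k
    show "((\<lambda>n. sqrt (real n) * ((walk_prob (n - k) 0 - ?Q n) / ?Q n) * tree_sum k f) \<longlongrightarrow> 0 * tree_sum k f) (admissible_at_top p)"
    proof (cases "size_prob k = 0")
      case False
      then have "0 < size_prob k" using size_prob_nonneg[of k] by linarith
      then show ?thesis by (intro tendsto_mult walk_prob_ratio_limits tendsto_const)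
    qed (simp add: tree_sum_eq_0)
  qed
  then have "((\<lambda>n. \<Sum>k\<le>M. sqrt (real n) * ((walk_prob (n - k) 0 - ?Q n) / ?Q n) * tree_sum k f) \<longlongrightarrow> 0) (admissible_at_top p)" by simp
  then show ?thesis
  proof (rule Lim_transform_eventually)
    show "\<forall>\<^sub>F n in admissible_at_top p. (\<Sum>k\<le>M. sqrt (real n) * ((walk_prob (n - k) 0 - ?Q n) / ?Q n) * tree_sum k f)
        = (cond_mean n (additive_functional f) - real n * measure_pmf.expectation gw f) / sqrt (real n)"
      unfolding eventually_admissible using eventually_ge_at_top[of "Suc M"]
    proof eventually_elim
      case (elim n)
      show ?case
      proof
        assume n: "0 < size_prob n"
        have Q: "?Q n = real n * size_prob n" by (simp add: size_prob_eq_walk_prob)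
        have "(\<Sum>k\<le>n. walk_prob (n - k) 0 * tree_sum k f) = (\<Sum>k\<le>M. walk_prob (n - k) 0 * tree_sum k f)"
          by (rule sum.mono_neutral_right) (use elim u0 in auto)
        then have "cond_mean n (additive_functional f) = (\<Sum>k\<le>M. walk_prob (n - k) 0 * tree_sum k f) * (real n / ?Q n)"
          unfolding cond_mean_def tree_sum_additive_functional Q using elim by simp
        moreover have "measure_pmf.expectation gw f = (\<Sum>k\<le>M. tree_sum k f)" by (rule expectation_finite_support) (rule supp)
        ultimately have "(cond_mean n (additive_functional f) - real n * measure_pmf.expectation gw f) / sqrt (real n)
          = (\<Sum>k\<le>M. (walk_prob (n - k) 0 * tree_sum k f * (real n / ?Q n) - real n * tree_sum k f) / sqrt (real n))"
          by (simp only: sum_distrib_left sum_distrib_right sum_subtractf[symmetric] sum_divide_distrib)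
        also have "\<dots> = (\<Sum>k\<le>M. sqrt (real n) * ((walk_prob (n - k) 0 - ?Q n) / ?Q n) * tree_sum k f)"
        proof (intro sum.cong refl)
          fix k
          have "(x * u * (real n / y) - real n * u) / sqrt (real n) = (real n / sqrt (real n)) * ((x - y) / y) * u" if "y \<noteq> 0" for x y u :: real
            using that by (simp add: field_simps)
          moreover have "?Q n \<noteq> 0" using n elim by (simp add: Q)
          ultimately show "(walk_prob (n - k) 0 * tree_sum k f * (real n / ?Q n) - real n * tree_sum k f) / sqrt (real n)
            = sqrt (real n) * ((walk_prob (n - k) 0 - ?Q n) / ?Q n) * tree_sum k f" by (simp only: real_div_sqrt of_nat_0_le_iff)
        qed
        finally show "(\<Sum>k\<le>M. sqrt (real n) * ((walk_prob (n - k) 0 - ?Q n) / ?Q n) * tree_sum k f)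
          = (cond_mean n (additive_functional f) - real n * measure_pmf.expectation gw f) / sqrt (real n)" by simp
      qed
    qed
  qed
qed

text \<open>All sums stop at \<open>M\<close>, and \<open>2 * M \<le> n\<close> makes every
  truncated subtraction exact. Dividing by \<open>n\<close> isolates finitely many ratios with known
  limits.\<close>

lemma finite_support_var_eq:
  assumes supp: "\<And>t. M < num_nodes t \<Longrightarrow> f t = 0" and n: "0 < size_prob n" "2 * M \<le> n"
  shows "(cond_sd n (additive_functional f))\<^sup>2 / real n =
      (\<Sum>k\<le>M. walk_prob (n - k) 0 / walk_prob n (-1) * tree_sum k (\<lambda>t. f t * (2 * additive_functional f t - f t)))
    + (\<Sum>k\<le>M. \<Sum>m\<le>M. (real n * (walk_prob (n - k - m) 1 * walk_prob n (-1) - walk_prob (n - k) 0 * walk_prob (n - m) 0) / (walk_prob n (-1))\<^sup>2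
        + (1 - real k - real m) * (walk_prob (n - k - m) 1 / walk_prob n (-1))) * (tree_sum k f * tree_sum m f))"
proof -
  let ?F = "additive_functional f"
  let ?Q = "walk_prob n (-1)"
  define q where "q k = walk_prob (n - k) 0" for k
  define r where "r k m = walk_prob (n - k - m) 1" for k m
  define u where "u k = tree_sum k f" for k
  have n0: "n > 0" using n by (cases n) auto
  have Q: "?Q = real n * size_prob n" "?Q > 0" "?Q \<noteq> 0" using n n0 by (auto simp: size_prob_eq_walk_prob[symmetric])
  have z: "tree_sum k (\<lambda>t. f t * h t) = 0" if "M < k" for k h using that supp by (auto simp: tree_sum_def trees_def)
  have u0: "u k = 0" if "M < k" for k using z[OF that, of "\<lambda>_. 1"] by (simp add: u_def)
  have inv: "x / size_prob n = x * (real n / ?Q)" for x using Q n0 by (simp add: Q(1))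
  have A: "(\<Sum>k\<le>n. walk_prob (n - k) 0 * tree_sum k (\<lambda>t. f t * (2 * ?F t - f t)))
     = (\<Sum>k\<le>M. q k * tree_sum k (\<lambda>t. f t * (2 * ?F t - f t)))"
    unfolding q_def by (rule sum.mono_neutral_right) (use n(2) z in auto)
  have B: "(\<Sum>k\<le>n. \<Sum>m\<le>n - k. real (n + 1 - k - m) * (walk_prob (n - k - m) 1 * (tree_sum k f * tree_sum m f)))
     = (\<Sum>k\<le>M. \<Sum>m\<le>M. (real n + 1 - real k - real m) * (r k m * (u k * u m)))"
  proof (rule sum.mono_neutral_cong_right)
    fix k assume k: "k \<in> {..M}"
    show "(\<Sum>m\<le>n - k. real (n + 1 - k - m) * (walk_prob (n - k - m) 1 * (tree_sum k f * tree_sum m f)))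
       = (\<Sum>m\<le>M. (real n + 1 - real k - real m) * (r k m * (u k * u m)))"
    proof (rule sum.mono_neutral_cong_right)
      show "{..M} \<subseteq> {..n - k}" using k n(2) by auto
      show "\<forall>i\<in>{..n - k} - {..M}. real (n + 1 - k - i) * (walk_prob (n - k - i) 1 * (tree_sum k f * tree_sum i f)) = 0"
        using u0 by (simp add: u_def)
      fix m assume m: "m \<in> {..M}"
      then have "real (n + 1 - k - m) = real n + 1 - real k - real m" using k n(2) by (simp add: of_nat_diff)
      then show "real (n + 1 - k - m) * (walk_prob (n - k - m) 1 * (tree_sum k f * tree_sum m f)) = (real n + 1 - real k - real m) * (r k m * (u k * u m))"
        by (simp add: r_def u_def)
    qed simp
  qed (use n(2) u0 in \<open>auto simp: u_def\<close>)
  have C: "(\<Sum>k\<le>n. walk_prob (n - k) 0 * tree_sum k f) = (\<Sum>k\<le>M. q k * u k)"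
    unfolding q_def u_def by (rule sum.mono_neutral_right) (use n(2) u0 in \<open>auto simp: u_def\<close>)
  have sq: "(\<Sum>k\<le>M. q k * u k)\<^sup>2 = (\<Sum>k\<le>M. \<Sum>m\<le>M. (q k * q m) * (u k * u m))"
    unfolding power2_eq_square sum_product by (intro sum.cong refl) (simp only: mult_ac)
  have "(cond_sd n ?F)\<^sup>2 = ((\<Sum>k\<le>M. q k * tree_sum k (\<lambda>t. f t * (2 * ?F t - f t)))
      + (\<Sum>k\<le>M. \<Sum>m\<le>M. (real n + 1 - real k - real m) * (r k m * (u k * u m)))) * (real n / ?Q)
      - (\<Sum>k\<le>M. \<Sum>m\<le>M. (q k * q m) * (u k * u m)) * (real n / ?Q)\<^sup>2"
    unfolding cond_sd_square[OF n(1)] cond_mean_def tree_sum_additive_functional_square tree_sum_additive_functional A B C inv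
    by (simp only: power_mult_distrib sq)
  then have "(cond_sd n ?F)\<^sup>2 / real n = (\<Sum>k\<le>M. q k * tree_sum k (\<lambda>t. f t * (2 * ?F t - f t))) * (1 / ?Q)
      + ((\<Sum>k\<le>M. \<Sum>m\<le>M. (real n + 1 - real k - real m) * (r k m * (u k * u m))) * (1 / ?Q)
      - (\<Sum>k\<le>M. \<Sum>m\<le>M. (q k * q m) * (u k * u m)) * (real n / ?Q\<^sup>2))"
  proof -
    have "((x + y) * (real n / ?Q) - z * (real n / ?Q)\<^sup>2) / real n = x * (1 / ?Q) + (y * (1 / ?Q) - z * (real n / ?Q\<^sup>2))" for x y z :: real
      using n0 Q(3) by (simp add: field_simps power2_eq_square)
    then show ?thesis using \<open>(cond_sd n ?F)\<^sup>2 = _\<close> by (simp only:)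
  qed
  also have "(\<Sum>k\<le>M. \<Sum>m\<le>M. (real n + 1 - real k - real m) * (r k m * (u k * u m))) * (1 / ?Q)
      - (\<Sum>k\<le>M. \<Sum>m\<le>M. (q k * q m) * (u k * u m)) * (real n / ?Q\<^sup>2)
     = (\<Sum>k\<le>M. \<Sum>m\<le>M. (real n * (r k m * ?Q - q k * q m) / ?Q\<^sup>2 + (1 - real k - real m) * (r k m / ?Q)) * (u k * u m))"
    unfolding sum_distrib_right sum_subtractf[symmetric]
    by (intro sum.cong refl) (use Q(3) in \<open>simp add: field_simps power2_eq_square\<close>)
  finally show ?thesis unfolding sum_distrib_right q_def r_def u_def by (simp add: mult_ac)
qed

text \<open>The limiting coefficient of a pair is \<open>1 - k - m - 1 / offspring_var\<close>.
  Summed against the masses of the sizes, \<open>- k - m\<close> gives the centering of the additive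
  functional by \<open>num_nodes t * \<mu>\<close>, and 1 gives the square from the variance of
  \<open>f\<close>.\<close>

theorem finite_support_var_limit:
  assumes supp: "\<And>t. M < num_nodes t \<Longrightarrow> f t = 0"
  shows "((\<lambda>n. (cond_sd n (additive_functional f))\<^sup>2 / real n) \<longlongrightarrow> asymptotic_var f) (admissible_at_top p)"
proof -
  let ?F = "additive_functional f"
  let ?Q = "\<lambda>n. walk_prob n (-1)"
  let ?\<mu> = "measure_pmf.expectation gw f"
  have pos: "size_prob k = 0 \<or> 0 < size_prob k" for k using size_prob_nonneg[of k] by linarith
  have lim: "((\<lambda>n. (\<Sum>k\<le>M. walk_prob (n - k) 0 / ?Q n * tree_sum k (\<lambda>t. f t * (2 * ?F t - f t)))
    + (\<Sum>k\<le>M. \<Sum>m\<le>M. (real n * (walk_prob (n - k - m) 1 * ?Q n - walk_prob (n - k) 0 * walk_prob (n - m) 0) / (?Q n)\<^sup>2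
        + (1 - real k - real m) * (walk_prob (n - k - m) 1 / ?Q n)) * (tree_sum k f * tree_sum m f)))
    \<longlongrightarrow> (\<Sum>k\<le>M. 1 * tree_sum k (\<lambda>t. f t * (2 * ?F t - f t)))
      + (\<Sum>k\<le>M. \<Sum>m\<le>M. (- 1 / offspring_var + (1 - real k - real m) * 1) * (tree_sum k f * tree_sum m f))) (admissible_at_top p)"
  proof (intro tendsto_add tendsto_sum)
    fix k
    show "((\<lambda>n. walk_prob (n - k) 0 / ?Q n * tree_sum k (\<lambda>t. f t * (2 * ?F t - f t))) \<longlongrightarrow> 1 * tree_sum k (\<lambda>t. f t * (2 * ?F t - f t))) (admissible_at_top p)"
    proof (cases "size_prob k = 0")
      case False
      then show ?thesis using pos[of k] by (intro tendsto_mult walk_prob_ratio_limits tendsto_const) auto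
    qed (simp add: tree_sum_eq_0)
    fix m
    show "((\<lambda>n. (real n * (walk_prob (n - k - m) 1 * ?Q n - walk_prob (n - k) 0 * walk_prob (n - m) 0) / (?Q n)\<^sup>2
        + (1 - real k - real m) * (walk_prob (n - k - m) 1 / ?Q n)) * (tree_sum k f * tree_sum m f))
       \<longlongrightarrow> (- 1 / offspring_var + (1 - real k - real m) * 1) * (tree_sum k f * tree_sum m f)) (admissible_at_top p)"
    proof (cases "size_prob k = 0 \<or> size_prob m = 0")
      case False
      then show ?thesis using pos[of k] pos[of m]
        by (intro tendsto_mult tendsto_add tendsto_const walk_prob_mixed_ratio_limits) auto
    qed (auto simp: tree_sum_eq_0)
  qed
  have "(\<Sum>k\<le>M. 1 * tree_sum k (\<lambda>t. f t * (2 * ?F t - f t)))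
      + (\<Sum>k\<le>M. \<Sum>m\<le>M. (- 1 / offspring_var + (1 - real k - real m) * 1) * (tree_sum k f * tree_sum m f)) = asymptotic_var f"
  proof -
    have mu: "?\<mu> = (\<Sum>k\<le>M. tree_sum k f)" by (rule expectation_finite_support) (rule supp)
    have "(\<Sum>k\<le>M. \<Sum>m\<le>M. (- 1 / offspring_var + (1 - real k - real m) * 1) * (tree_sum k f * tree_sum m f))
      = (1 - 1 / offspring_var) * (\<Sum>k\<le>M. \<Sum>m\<le>M. tree_sum k f * tree_sum m f)
        - (\<Sum>k\<le>M. \<Sum>m\<le>M. (real k * tree_sum k f) * tree_sum m f) - (\<Sum>k\<le>M. \<Sum>m\<le>M. tree_sum k f * (real m * tree_sum m f))"
      unfolding sum_distrib_left sum_subtractf[symmetric]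
      by (intro sum.cong refl) (simp add: algebra_simps)
    also have "\<dots> = (1 - 1 / offspring_var) * ?\<mu>\<^sup>2 - 2 * (\<Sum>k\<le>M. real k * tree_sum k f) * ?\<mu>"
      unfolding sum_product[symmetric] mu[symmetric] by (simp add: power2_eq_square mult_ac)
    also have "2 * (\<Sum>k\<le>M. real k * tree_sum k f) * ?\<mu> = 2 * (\<Sum>k\<le>M. real k * ?\<mu> * tree_sum k f)"
      by (simp add: sum_distrib_left sum_distrib_right mult_ac)
    finally have 1: "(\<Sum>k\<le>M. \<Sum>m\<le>M. (- 1 / offspring_var + (1 - real k - real m) * 1) * (tree_sum k f * tree_sum m f))
      = (1 - 1 / offspring_var) * ?\<mu>\<^sup>2 - 2 * (\<Sum>k\<le>M. real k * ?\<mu> * tree_sum k f)" .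
    have "tree_sum k (\<lambda>t. f t * (2 * ?F t - f t)) = 2 * tree_sum k (\<lambda>t. f t * ?F t) - tree_sum k (\<lambda>t. (f t)\<^sup>2)" for k
      unfolding tree_sum_def sum_distrib_left sum_subtractf[symmetric]
      by (intro sum.cong refl) (simp add: algebra_simps power2_eq_square)
    then have 2: "(\<Sum>k\<le>M. 1 * tree_sum k (\<lambda>t. f t * (2 * ?F t - f t)))
       = 2 * (\<Sum>k\<le>M. tree_sum k (\<lambda>t. f t * ?F t)) - (\<Sum>k\<le>M. tree_sum k (\<lambda>t. (f t)\<^sup>2))"
      by (simp add: sum_subtractf sum_distrib_left)
    show ?thesis unfolding 1 2
      by (subst asymptotic_var_finite_support[of M]) (simp_all add: supp sum_subtractf algebra_simps)
  qed
  then have lim': "((\<lambda>n. (\<Sum>k\<le>M. walk_prob (n - k) 0 / ?Q n * tree_sum k (\<lambda>t. f t * (2 * ?F t - f t)))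
    + (\<Sum>k\<le>M. \<Sum>m\<le>M. (real n * (walk_prob (n - k - m) 1 * ?Q n - walk_prob (n - k) 0 * walk_prob (n - m) 0) / (?Q n)\<^sup>2
        + (1 - real k - real m) * (walk_prob (n - k - m) 1 / ?Q n)) * (tree_sum k f * tree_sum m f)))
    \<longlongrightarrow> asymptotic_var f) (admissible_at_top p)" using lim by (simp only:)
  show ?thesis
  proof (rule Lim_transform_eventually[OF lim'])
    show "\<forall>\<^sub>F n in admissible_at_top p. (\<Sum>k\<le>M. walk_prob (n - k) 0 / ?Q n * tree_sum k (\<lambda>t. f t * (2 * ?F t - f t)))
    + (\<Sum>k\<le>M. \<Sum>m\<le>M. (real n * (walk_prob (n - k - m) 1 * ?Q n - walk_prob (n - k) 0 * walk_prob (n - m) 0) / (?Q n)\<^sup>2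
        + (1 - real k - real m) * (walk_prob (n - k - m) 1 / ?Q n)) * (tree_sum k f * tree_sum m f))
      = (cond_sd n ?F)\<^sup>2 / real n"
      unfolding eventually_admissible using eventually_ge_at_top[of "2 * M"]
      by eventually_elim (simp add: finite_support_var_eq[of M f, OF supp])
  qed
qed

end

context walk_bounds
begin

text \<open>The size probabilities of order \<open>1 / (k * sqrt k)\<close> have tails of order
  \<open>1 / sqrt n\<close>.\<close>

lemma expectation_minus_cut_mean_bound:
  assumes f: "integrable gw f" and A: "\<And>k. \<bar>cond_mean k f\<bar> \<le> A" and n: "n > 0"
  shows "\<bar>measure_pmf.expectation gw f - cut_mean f n\<bar> \<le> 2 * K * A / sqrt (real n)"
proof (rule LIMSEQ_le_const2)
  have A0: "0 \<le> A" using A[of 0] by simp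
  show "(\<lambda>m. \<bar>cut_mean f m - cut_mean f n\<bar>) \<longlonglongrightarrow> \<bar>measure_pmf.expectation gw f - cut_mean f n\<bar>"
    by (intro tendsto_intros cut_mean_tendsto f)
  have "\<bar>cut_mean f m - cut_mean f n\<bar> \<le> 2 * K * A / sqrt (real n)" if m: "n \<le> m" for m
  proof -
    have "{..m} = {..n} \<union> {n<..m}" using m by auto
    then have "cut_mean f m = sum (\<lambda>k. tree_sum k f) ({..n} \<union> {n<..m})" by (simp only: cut_mean_def)
    also have "\<dots> = cut_mean f n + (\<Sum>k\<in>{n<..m}. tree_sum k f)" unfolding cut_mean_def by (rule sum.union_disjoint) auto
    finally have "\<bar>cut_mean f m - cut_mean f n\<bar> \<le> (\<Sum>k\<in>{n<..m}. \<bar>tree_sum k f\<bar>)" by simp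
    also have "\<dots> \<le> (\<Sum>k\<in>{n<..m}. K * A * (1 / (real k * sqrt (real k))))"
    proof (rule sum_mono)
      fix k assume "k \<in> {n<..m}"
      then have "size_prob k * \<bar>cond_mean k f\<bar> \<le> K / (real k * sqrt (real k)) * A"
        using A A0 K_pos by (intro mult_mono size_prob_upper) auto
      then show "\<bar>tree_sum k f\<bar> \<le> K * A * (1 / (real k * sqrt (real k)))"
        by (simp add: tree_sum_eq_cond_mean abs_mult)
    qed
    also have "\<dots> \<le> K * A * (2 * (1 / sqrt (real n) - 1 / sqrt (real m)))"
      unfolding sum_distrib_left[symmetric] using K_pos A0 by (intro mult_left_mono sum_power_three_halves_le n m) auto
    also have "\<dots> \<le> K * A * (2 * (1 / sqrt (real n)))"
      using K_pos A0 by (intro mult_left_mono) auto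
    finally show ?thesis by (simp add: mult_ac)
  qed
  then show "\<exists>N. \<forall>m\<ge>N. \<bar>cut_mean f m - cut_mean f n\<bar> \<le> 2 * K * A / sqrt (real n)" by blast
qed

lemma cond_mean_additive_functional_bound':
  assumes f: "integrable gw f" and A: "\<And>k. \<bar>cond_mean k f\<bar> \<le> A" and n: "0 < size_prob n"
  shows "\<bar>cond_mean n (additive_functional f) - real n * measure_pmf.expectation gw f\<bar> \<le> 26 * K ^ 3 * sqrt (real n) * A"
proof -
  have n0: "n > 0" using n by (cases n) auto
  have A0: "0 \<le> A" using A[of 0] by simp
  let ?E = "measure_pmf.expectation gw f"
  have "\<bar>real n * cut_mean f n - real n * ?E\<bar> = real n * \<bar>?E - cut_mean f n\<bar>"
    by (simp add: abs_minus_commute abs_mult flip: right_diff_distrib)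
  also have "\<dots> \<le> real n * (2 * K * A / sqrt (real n))"
    by (intro mult_left_mono expectation_minus_cut_mean_bound f A n0) simp
  also have "\<dots> = 2 * (K * (real n / sqrt (real n)) * A)" by simp
  also have "\<dots> = 2 * (K * sqrt (real n) * A)" by (simp add: real_div_sqrt)
  also have "\<dots> \<le> 2 * (K ^ 3 * sqrt (real n) * A)"
    using K_ge_1 A0 self_le_power[of K 3] by (intro mult_left_mono mult_right_mono) auto
  finally have "\<bar>real n * cut_mean f n - real n * ?E\<bar> \<le> 2 * (K ^ 3 * sqrt (real n) * A)" .
  moreover have "\<bar>cond_mean n (additive_functional f) - real n * cut_mean f n\<bar> \<le> 24 * (K ^ 3 * sqrt (real n) * A)"
    using cond_mean_additive_functional_bound[OF n A] by (simp add: mult.assoc)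
  moreover have "26 * K ^ 3 * sqrt (real n) * A = 26 * (K ^ 3 * sqrt (real n) * A)" by simp
  ultimately show ?thesis by linarith
qed

text \<open>The uniform error bound is linear in the supremum of the conditional means, and this
  supremum is small for the part of \<open>f\<close> on large trees. The truncated part is covered
  by the finite-support limit.\<close>

theorem mean_asymptotics:
  assumes f: "integrable gw f" and lim: "((\<lambda>n. cond_mean n f) \<longlongrightarrow> 0) (admissible_at_top p)"
  shows "((\<lambda>n. (cond_mean n (additive_functional f) - real n * measure_pmf.expectation gw f) / sqrt (real n)) \<longlongrightarrow> 0) (admissible_at_top p)"
proof (rule tendstoI)
  fix e :: real assume e: "e > 0"
  \<comment> \<open>The value 52 is twice the 26 of the uniform bound, so that the tail contributes
    at most \<open>e / 2\<close>.\<close>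
  define A where "A = e / (52 * K ^ 3)"
  have A0: "A > 0" using e K_pos by (simp add: A_def)
  have "(\<lambda>n. cond_mean n f) \<longlonglongrightarrow> 0"
    using lim by (rule tendsto_admissible_0) (simp add: cond_mean_def tree_sum_eq_0)
  from tendstoD[OF this A0] obtain M where M: "\<And>k. k \<ge> M \<Longrightarrow> \<bar>cond_mean k f\<bar> < A"
    by (auto simp: eventually_sequentially)
  let ?R = "\<lambda>f n. (cond_mean n (additive_functional f) - real n * measure_pmf.expectation gw f) / sqrt (real n)"
  have split: "?R f n = ?R (trunc M f) n + ?R (tail M f) n" for n
  proof -
    have "cond_mean n (additive_functional f) = cond_mean n (additive_functional (trunc M f)) + cond_mean n (additive_functional (tail M f))"
      unfolding cond_mean_add[symmetric] additive_functional_trunc_add_tail[symmetric] ..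
    then show ?thesis unfolding expectation_trunc_tail[OF f, of M] by (simp add: add_divide_distrib[symmetric] algebra_simps)
  qed
  have "((\<lambda>n. ?R (trunc M f) n) \<longlongrightarrow> 0) (admissible_at_top p)"
    by (rule finite_support_mean_limit[of M]) (simp add: trunc_def)
  then have "\<forall>\<^sub>F n in admissible_at_top p. dist (?R (trunc M f) n) 0 < e / 2" using e by (intro tendstoD) auto
  moreover have "\<forall>\<^sub>F n in admissible_at_top p. \<bar>?R (tail M f) n\<bar> \<le> e / 2"
    unfolding eventually_admissible
  proof (intro always_eventually allI impI)
    fix n assume n: "0 < size_prob n"
    then have n0: "n > 0" by (cases n) auto
    have "\<bar>cond_mean n (additive_functional (tail M f)) - real n * measure_pmf.expectation gw (tail M f)\<bar> \<le> 26 * K ^ 3 * sqrt (real n) * A"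
      by (rule cond_mean_additive_functional_bound'[OF integrable_tail[OF f] _ n])
         (use M A0 in \<open>auto simp: cond_mean_tail less_imp_le\<close>)
    also have "\<dots> = e / 2 * sqrt (real n)" using K_pos by (simp add: A_def field_simps)
    finally show "\<bar>?R (tail M f) n\<bar> \<le> e / 2" using n0 by (simp add: abs_divide divide_le_eq)
  qed
  ultimately show "\<forall>\<^sub>F n in admissible_at_top p. dist (?R f n) 0 < e"
    unfolding split dist_real_def diff_0_right
  proof eventually_elim
    case (elim n)
    have "\<bar>a + b\<bar> < e" if "\<bar>a\<bar> < e / 2" "\<bar>b\<bar> \<le> e / 2" for a b :: real using that by linarith
    then show ?case using elim .
  qed
qed

end

locale small_functional = walk_bounds +
  fixes f :: "plane_tree \<Rightarrow> real"
  assumes integrable_f: "integrable gw f"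
    and cond_norm_limit: "(\<lambda>k. cond_norm k f) \<longlonglongrightarrow> 0"
    and summable_cond_norm: "summable (\<lambda>k. cond_norm k f / real k)"
begin

abbreviation \<mu> :: real where "\<mu> \<equiv> measure_pmf.expectation gw f"

lemma exists_bound: "\<exists>B. (\<forall>k. cond_norm k f \<le> B) \<and> (\<forall>n. (\<Sum>k\<le>n. cond_norm k f / real k) \<le> B)"
proof -
  obtain A where A: "\<And>k. norm (cond_norm k f) \<le> A"
    using convergent_imp_Bseq[of "\<lambda>k. cond_norm k f"] cond_norm_limit by (auto simp: convergent_def Bseq_def)
  have "(\<Sum>k\<le>n. cond_norm k f / real k) \<le> (\<Sum>k. cond_norm k f / real k)" for n
    by (rule sum_le_suminf[OF summable_cond_norm]) auto
  then show ?thesis using A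
    by (intro exI[of _ "max A (\<Sum>k. cond_norm k f / real k)"]) (auto simp: le_max_iff_disj)
qed

text \<open>Truncation at a large \<open>M\<close> makes both hypotheses of the deviation bound hold
  with a small constant: the norms beyond \<open>M\<close> are small, and so is the remainder of the
  series.\<close>

lemma tail_sd_small:
  assumes e: "e > 0"
  shows "\<forall>\<^sub>F M in sequentially. \<forall>n. cond_sd n (additive_functional (tail M f)) \<le> e * sqrt (real n)"
proof -
  define B where "B = e / (100 * K ^ 3)"
  have B0: "B > 0" using e K_pos by (simp add: B_def)
  from tendstoD[OF cond_norm_limit B0] have 1: "\<forall>\<^sub>F M in sequentially. \<forall>k\<ge>M. cond_norm k f < B"
    by (auto simp: eventually_sequentially intro: le_trans)
  have 2: "\<forall>\<^sub>F M in sequentially. \<forall>n. norm (sum (\<lambda>k. cond_norm k f / real k) {M..<n}) < B"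
    using summable_cond_norm B0 unfolding summable_Cauchy eventually_sequentially by blast
  \<comment> \<open>The tail functional vanishes at size \<open>M\<close> itself, so its series
    starts at \<open>Suc M\<close>.\<close>
  then have 2: "\<forall>\<^sub>F M in sequentially. \<forall>n. norm (sum (\<lambda>k. cond_norm k f / real k) {Suc M..<n}) < B"
    by (rule eventually_sequentially_Suc[THEN iffD2])
  from 1 2 show ?thesis
  proof eventually_elim
    case (elim M)
    show ?case
    proof
      fix n
      have "cond_sd n (additive_functional (tail M f)) \<le> 100 * K ^ 3 * sqrt (real n) * B"
      proof (rule cond_sd_additive_functional_le)
        show "cond_norm k (tail M f) \<le> B" for k
          using elim(1) B0 by (auto simp: cond_norm_tail less_imp_le)
        have "(\<Sum>k\<le>n. cond_norm k (tail M f) / real k) = (\<Sum>k\<in>{Suc M..<Suc n}. cond_norm k f / real k)"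
          by (rule sum.mono_neutral_cong_right) (auto simp: cond_norm_tail)
        then show "(\<Sum>k\<le>n. cond_norm k (tail M f) / real k) \<le> B" using elim(2) by (smt (verit) real_norm_def)
      qed
      then show "cond_sd n (additive_functional (tail M f)) \<le> e * sqrt (real n)" using K_pos by (simp add: B_def mult.commute)
    qed
  qed
qed

lemma integrable_square: "integrable gw (\<lambda>t. (f t)\<^sup>2)"
proof -
  obtain B where B: "\<And>k. cond_norm k f \<le> B" using exists_bound by blast
  show ?thesis unfolding integrable_gw_iff
  proof (rule summable_comparison_test')
  have "(\<lambda>n. tree_sum n (\<lambda>_. 1)) sums integral\<^sup>L gw (\<lambda>_. 1)" by (rule sums_expectation_gw) simp
  then have "summable size_prob" by (simp add: size_prob_def[abs_def] sums_iff)
  then show "summable (\<lambda>k. size_prob k * B\<^sup>2)" by (rule summable_mult2)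
  fix k
  have "tree_sum k (\<lambda>t. \<bar>(f t)\<^sup>2\<bar>) = size_prob k * (cond_norm k f)\<^sup>2"
    unfolding cond_norm_square by (simp flip: tree_sum_eq_cond_mean)
  also have "\<dots> \<le> size_prob k * B\<^sup>2" using B by (intro mult_left_mono power_mono) auto
  finally show "norm (tree_sum k (\<lambda>t. \<bar>(f t)\<^sup>2\<bar>)) \<le> size_prob k * B\<^sup>2"
    using tree_sum_nonneg[of k "\<lambda>t. \<bar>(f t)\<^sup>2\<bar>"] by simp
  qed
qed

text \<open>After centering, the additive functional has norm of order \<open>sqrt k\<close> on
  trees of size \<open>k\<close>, with 126 = 100 + 26 from deviation and bias. Against
  \<open>size_prob k\<close> this leaves terms of order \<open>cond_norm k f / k\<close>, which are
  summable by assumption; the uncentered size \<open>k\<close> would only leave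
  \<open>cond_norm k f / sqrt k\<close>.\<close>

lemma integrable_centered: "integrable gw (\<lambda>t. f t * (additive_functional f t - real (num_nodes t) * \<mu>))"
proof -
  obtain B where B: "\<And>k. cond_norm k f \<le> B" "\<And>n. (\<Sum>k\<le>n. cond_norm k f / real k) \<le> B" using exists_bound by blast
  have B0: "0 \<le> B" using B(1)[of 0] cond_norm_nonneg[of 0 f] by linarith
  let ?C = "K * (126 * K ^ 3 * B)"
  show ?thesis unfolding integrable_gw_iff
  proof (rule summable_comparison_test')
  show "summable (\<lambda>k. ?C * (cond_norm k f / real k))" by (intro summable_mult summable_cond_norm)
  fix k
  let ?g = "\<lambda>t. additive_functional f t - real k * \<mu>"
  have "tree_sum k (\<lambda>t. \<bar>f t * (additive_functional f t - real (num_nodes t) * \<mu>)\<bar>) = tree_sum k (\<lambda>t. \<bar>f t\<bar> * \<bar>?g t\<bar>)"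
    unfolding tree_sum_def by (intro sum.cong refl) (auto simp: trees_def abs_mult)
  also have "\<dots> \<le> size_prob k * (cond_norm k (\<lambda>t. \<bar>f t\<bar>) * cond_norm k (\<lambda>t. \<bar>?g t\<bar>))"
    using abs_tree_sum_mult_le[of k "\<lambda>t. \<bar>f t\<bar>" "\<lambda>t. \<bar>?g t\<bar>"] by linarith
  also have "\<dots> \<le> ?C * (cond_norm k f / real k)"
  proof (cases "size_prob k = 0")
    case True
    then show ?thesis using K_pos B0 by simp
  next
    case False
    then have k: "0 < size_prob k" using size_prob_nonneg[of k] by linarith
    then have k0: "k > 0" by (cases k) auto
    have "cond_norm k (\<lambda>t. \<bar>?g t\<bar>) \<le> cond_norm k ?g" by (rule cond_norm_mono) simp
    also have "\<dots> \<le> cond_sd k (additive_functional f) + \<bar>cond_mean k (additive_functional f) - real k * \<mu>\<bar>"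
      by (rule cond_norm_shift_le)
    also have "\<dots> \<le> 100 * K ^ 3 * sqrt (real k) * B + 26 * K ^ 3 * sqrt (real k) * B"
      by (intro add_mono cond_sd_additive_functional_le cond_mean_additive_functional_bound' integrable_f k B order.trans[OF abs_cond_mean_le])
    finally have g: "cond_norm k (\<lambda>t. \<bar>?g t\<bar>) \<le> 126 * K ^ 3 * sqrt (real k) * B" by (simp add: mult_ac)
    have f: "cond_norm k (\<lambda>t. \<bar>f t\<bar>) \<le> cond_norm k f" by (rule cond_norm_mono) simp
    have "size_prob k * (cond_norm k (\<lambda>t. \<bar>f t\<bar>) * cond_norm k (\<lambda>t. \<bar>?g t\<bar>))
       \<le> K / (real k * sqrt (real k)) * (cond_norm k f * (126 * K ^ 3 * sqrt (real k) * B))"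
      using f g K_pos k0 by (intro mult_mono size_prob_upper) auto
    also have "\<dots> = ?C * (cond_norm k f / real k)" using k0 by (simp add: field_simps)
    finally show ?thesis .
  qed
  finally show "norm (tree_sum k (\<lambda>t. \<bar>f t * (additive_functional f t - real (num_nodes t) * \<mu>)\<bar>)) \<le> ?C * (cond_norm k f / real k)"
    using tree_sum_nonneg[of k "\<lambda>t. \<bar>f t * (additive_functional f t - real (num_nodes t) * \<mu>)\<bar>"] by simp
  qed
qed

text \<open>Truncation changes \<open>f\<close> only beyond size \<open>M\<close>, but it also
  changes the mean used for centering. The resulting error is a product of a factor
  \<open>o(1 / sqrt M)\<close> and one of order \<open>sqrt M\<close>.\<close>

lemma asymptotic_var_trunc_limit: "(\<lambda>M. asymptotic_var (trunc M f)) \<longlonglongrightarrow> asymptotic_var f"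
proof -
  let ?h = "\<lambda>t. f t * (additive_functional f t - real (num_nodes t) * \<mu>)"
  obtain B where B: "\<And>k. cond_norm k f \<le> B" using exists_bound by blast
  have B0: "0 \<le> B" using B[of 0] cond_norm_nonneg[of 0 f] by linarith
  \<comment> \<open>The error of centering with the truncated mean. Its first factor is small
    relative to \<open>1 / sqrt M\<close> because the conditional means tend to 0.\<close>
  define R where "R M = (\<mu> - cut_mean f M) * (\<Sum>k\<le>M. real k * tree_sum k f)" for M
  have R: "R \<longlonglongrightarrow> 0"
  proof (rule tendstoI)
    fix e :: real assume e: "e > 0"
    define A where "A = e / (8 * K\<^sup>2 * (B + 1) + 1)"
    have pos: "8 * K\<^sup>2 * (B + 1) + 1 > 0" using B0 by (intro add_nonneg_pos mult_nonneg_nonneg) auto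
    have A: "A > 0" using e pos by (simp add: A_def)
    from tendstoD[OF cond_norm_limit A] obtain M0 where M0: "\<And>k. k \<ge> M0 \<Longrightarrow> cond_norm k f < A"
      by (auto simp: eventually_sequentially)
    show "\<forall>\<^sub>F M in sequentially. dist (R M) 0 < e"
    proof (rule eventually_sequentiallyI)
      fix M assume M: "Suc M0 \<le> M"
      then have M1: "M > 0" by simp
      have "\<mu> - cut_mean f M = measure_pmf.expectation gw (tail M f) - cut_mean (tail M f) M"
        using expectation_trunc_tail[OF integrable_f, of M] by (simp add: expectation_trunc cut_mean_def tree_sum_tail)
      also have "\<bar>\<dots>\<bar> \<le> 2 * K * A / sqrt (real M)"
      proof (rule expectation_minus_cut_mean_bound[OF integrable_tail[OF integrable_f] _ M1])
        fix k show "\<bar>cond_mean k (tail M f)\<bar> \<le> A"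
          using M0[of k] M A abs_cond_mean_le[of k f] by (auto simp: cond_mean_tail)
      qed
      finally have 1: "\<bar>\<mu> - cut_mean f M\<bar> \<le> 2 * K * A / sqrt (real M)" .
      have "\<bar>\<Sum>k\<le>M. real k * tree_sum k f\<bar> \<le> (\<Sum>k\<le>M. B * (real k * size_prob k))"
      proof (rule order.trans[OF sum_abs sum_mono])
        fix k
        have "\<bar>tree_sum k f\<bar> \<le> size_prob k * B"
          by (rule order.trans[OF abs_tree_sum_le]) (intro mult_left_mono B, simp)
        then have "real k * \<bar>tree_sum k f\<bar> \<le> real k * (size_prob k * B)" by (rule mult_left_mono) simp
        then show "\<bar>real k * tree_sum k f\<bar> \<le> B * (real k * size_prob k)"
          unfolding abs_mult by (simp add: mult_ac)
      qed
      also have "\<dots> \<le> B * (4 * K * sqrt (real M))"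
        unfolding sum_distrib_left[symmetric] by (intro mult_left_mono sum_size_prob_first_moment M1 B0)
      finally have 2: "\<bar>\<Sum>k\<le>M. real k * tree_sum k f\<bar> \<le> B * (4 * K * sqrt (real M))" .
      have "\<bar>R M\<bar> \<le> (2 * K * A / sqrt (real M)) * (B * (4 * K * sqrt (real M)))"
        unfolding R_def abs_mult using 1 2 A K_pos by (intro mult_mono) auto
      also have "\<dots> = A * (8 * K\<^sup>2 * B)" using M1 by (simp add: power2_eq_square)
      also have "\<dots> < A * (8 * K\<^sup>2 * (B + 1) + 1)" using A by (intro mult_strict_left_mono) (auto simp: algebra_simps intro!: add_pos_nonneg)
      also have "\<dots> = e" using pos by (simp add: A_def)
      finally show "dist (R M) 0 < e" by simp
    qed
  qed
  have eq: "asymptotic_var (trunc M f) = 2 * ((\<Sum>k\<le>M. tree_sum k ?h) + R M) - (\<Sum>k\<le>M. tree_sum k (\<lambda>t. (f t)\<^sup>2))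
      + (cut_mean f M)\<^sup>2 - (cut_mean f M)\<^sup>2 / offspring_var" for M
  proof -
    have "asymptotic_var (trunc M f) = 2 * (\<Sum>k\<le>M. tree_sum k (\<lambda>t. trunc M f t * additive_functional (trunc M f) t) - real k * cut_mean f M * tree_sum k (trunc M f))
      - (\<Sum>k\<le>M. tree_sum k (\<lambda>t. (trunc M f t)\<^sup>2)) + (cut_mean f M)\<^sup>2 - (cut_mean f M)\<^sup>2 / offspring_var"
      using asymptotic_var_finite_support[of M "trunc M f"] by (simp add: expectation_trunc trunc_def)
    also have "(\<Sum>k\<le>M. tree_sum k (\<lambda>t. trunc M f t * additive_functional (trunc M f) t) - real k * cut_mean f M * tree_sum k (trunc M f))
      = (\<Sum>k\<le>M. tree_sum k ?h + (\<mu> - cut_mean f M) * (real k * tree_sum k f))"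
    proof (intro sum.cong refl)
      fix k assume k: "k \<in> {..M}"
      have "additive_functional (trunc M f) t = additive_functional f t" if "num_nodes t \<le> M" for t
        using that by (intro additive_functional_cong) (auto simp: trunc_def)
      then have "tree_sum k (\<lambda>t. trunc M f t * additive_functional (trunc M f) t) = tree_sum k (\<lambda>t. f t * additive_functional f t)"
        unfolding tree_sum_def using k by (intro sum.cong refl) (auto simp: trees_def trunc_def)
      then show "tree_sum k (\<lambda>t. trunc M f t * additive_functional (trunc M f) t) - real k * cut_mean f M * tree_sum k (trunc M f)
        = tree_sum k ?h + (\<mu> - cut_mean f M) * (real k * tree_sum k f)"
        using k unfolding tree_sum_num_nodes tree_sum_trunc by (simp add: algebra_simps)
    qed
    also have "\<dots> = (\<Sum>k\<le>M. tree_sum k ?h) + R M" by (simp add: R_def sum.distrib sum_distrib_left)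
    also have "(\<Sum>k\<le>M. tree_sum k (\<lambda>t. (trunc M f t)\<^sup>2)) = (\<Sum>k\<le>M. tree_sum k (\<lambda>t. (f t)\<^sup>2))"
      unfolding tree_sum_def by (intro sum.cong refl) (auto simp: trees_def trunc_def)
    finally show ?thesis .
  qed
  have "(\<lambda>M. 2 * ((\<Sum>k\<le>M. tree_sum k ?h) + R M) - (\<Sum>k\<le>M. tree_sum k (\<lambda>t. (f t)\<^sup>2))
      + (cut_mean f M)\<^sup>2 - (cut_mean f M)\<^sup>2 / offspring_var) \<longlonglongrightarrow>
      2 * (measure_pmf.expectation gw ?h + 0) - measure_pmf.expectation gw (\<lambda>t. (f t)\<^sup>2) + \<mu>\<^sup>2 - \<mu>\<^sup>2 / offspring_var"
    using sums_expectation_gw[OF integrable_centered] sums_expectation_gw[OF integrable_square] offspring_var_pos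
    by (intro tendsto_intros R cut_mean_tendsto integrable_f) (auto simp: sums_def_le)
  then show ?thesis unfolding eq unfolding asymptotic_var_def by simp
qed

end

section \<open>Asymptotic normality for functionals vanishing on large trees\<close>

definition block_sum :: "(nat list \<Rightarrow> 'b::comm_monoid_add) \<Rightarrow> nat \<Rightarrow> nat \<Rightarrow> nat list \<Rightarrow> 'b" where
  "block_sum h l N xs = (\<Sum>i<N. h (take l (drop (i * l) xs)))"

lemma block_sum_0 [simp]: "block_sum h l 0 xs = 0"
  by (simp add: block_sum_def)

lemma block_sum_Suc: "block_sum h l (Suc N) xs = h (take l xs) + block_sum h l N (drop l xs)"
  by (simp add: block_sum_def sum.lessThan_Suc_shift add.commute del: sum.lessThan_Suc)

lemma block_sum_take: "N * l \<le> m \<Longrightarrow> block_sum h l N (take m xs) = block_sum h l N xs"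
proof -
  assume m: "N * l \<le> m"
  have "take l (drop (i * l) (take m xs)) = take l (drop (i * l) xs)" if "i < N" for i
  proof -
    have "Suc i * l \<le> N * l" using that by (intro mult_right_mono) auto
    then have "l \<le> m - i * l" using m by simp
    then show ?thesis by (simp add: drop_take min_def)
  qed
  then show ?thesis by (simp add: block_sum_def)
qed

lemma block_sum_walk: "length xs = N * l \<Longrightarrow> block_sum walk l N xs = walk xs"
proof (induction N arbitrary: xs)
  case (Suc N)
  have "walk (take l xs) + walk (drop l xs) = walk xs" by (metis append_take_drop_id walk_simps(3))
  then show ?case using Suc by (simp add: block_sum_Suc)
qed simp

definition straddle_sum :: "(plane_tree \<Rightarrow> real) \<Rightarrow> nat list \<Rightarrow> nat list \<Rightarrow> real" where
  "straddle_sum f a b = window_sum f (a @ b) - window_sum f a - window_sum f b"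

lemma straddle_sum_eq: "straddle_sum f a b = (\<Sum>i<length a. first_tree f (drop i a @ b) - first_tree f (drop i a))"
proof -
  have "window_sum f (a @ b) = (\<Sum>i<length a. first_tree f (drop i a @ b)) + window_sum f b"
    by (induction a) (auto simp: window_sum_Cons sum.lessThan_Suc_shift simp del: sum.lessThan_Suc)
  then show ?thesis by (simp add: straddle_sum_def sum_subtractf) (simp add: window_sum_def)
qed

locale finite_support =
  fixes f :: "plane_tree \<Rightarrow> real" and M :: nat and \<beta> :: real
  assumes support: "M < num_nodes t \<Longrightarrow> f t = 0"
    and abs_le: "\<bar>f t\<bar> \<le> \<beta>"
begin

lemma \<beta>_nonneg: "0 \<le> \<beta>" using abs_le[of undefined] by linarith

lemma abs_first_tree_le_\<beta>: "\<bar>first_tree f xs\<bar> \<le> \<beta>"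
  using abs_le \<beta>_nonneg by (simp add: first_tree_def)

text \<open>If the tree at the front ends only inside \<open>b\<close>, it has more than
  \<open>M\<close> nodes and \<open>f\<close> vanishes on it, in agreement with the default 0 read
  from \<open>a\<close> alone. Thus \<open>f\<close> looks at most \<open>M\<close> letters
  ahead.\<close>

lemma first_tree_append_eq:
  assumes "M \<le> length a"
  shows "first_tree f (a @ b) = first_tree f a"
proof (cases "\<exists>t. prefix (degree_seq t) (a @ b)")
  case True
  then obtain t where t: "prefix (degree_seq t) (a @ b)" by blast
  have "a = take (length a) (a @ b)" by simp
  then have "first_tree f a = (if num_nodes t \<le> length a then f t else 0)"
    using first_tree_take[OF t, of f "length a"] by simp
  then show ?thesis using first_tree_eq[OF t, of f] support[of t] assms by simp
next
  case False
  then have "\<nexists>t. prefix (degree_seq t) a" using prefix_prefix by blast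
  then show ?thesis using False by (simp add: first_tree_none)
qed

lemma abs_sum_boundary_le:
  "\<bar>\<Sum>i<length a. first_tree f (drop i a @ z i) - first_tree f (drop i a)\<bar> \<le> 2 * real M * \<beta>"
proof -
  have "(\<Sum>i<length a. first_tree f (drop i a @ z i) - first_tree f (drop i a))
     = (\<Sum>i\<in>{length a - M..<length a}. first_tree f (drop i a @ z i) - first_tree f (drop i a))"
    by (rule sum.mono_neutral_right) (auto simp: first_tree_append_eq)
  also have "\<bar>\<dots>\<bar> \<le> (\<Sum>i\<in>{length a - M..<length a}. 2 * \<beta>)"
  proof (rule order.trans[OF sum_abs sum_mono])
    fix i
    show "\<bar>first_tree f (drop i a @ z i) - first_tree f (drop i a)\<bar> \<le> 2 * \<beta>"
      using abs_first_tree_le_\<beta>[of "drop i a @ z i"] abs_first_tree_le_\<beta>[of "drop i a"] by linarith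
  qed
  also have "\<dots> \<le> 2 * real M * \<beta>" using \<beta>_nonneg by (simp add: mult_right_mono)
  finally show ?thesis .
qed

lemma abs_straddle_sum_le: "\<bar>straddle_sum f a b\<bar> \<le> 2 * real M * \<beta>"
  unfolding straddle_sum_eq by (rule abs_sum_boundary_le)

lemma abs_cyclic_minus_window_sum_le: "\<bar>cyclic_sum f xs - window_sum f xs\<bar> \<le> 2 * real M * \<beta>"
proof -
  have "cyclic_sum f xs - window_sum f xs = (\<Sum>i<length xs. first_tree f (drop i xs @ take i xs) - first_tree f (drop i xs))"
    unfolding cyclic_sum_def window_sum_def sum_subtractf[symmetric]
    by (intro sum.cong refl) (simp add: rotate_drop_take)
  then show ?thesis using abs_sum_boundary_le[of xs "\<lambda>i. take i xs"] by simp
qed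

lemma straddle_sum_local:
  assumes L: "M \<le> L" "L \<le> length a" "L \<le> length b"
  shows "straddle_sum f a b = straddle_sum f (drop (length a - L) a) (take L b)"
proof -
  let ?k = "length a - L"
  have "straddle_sum f a b = (\<Sum>i\<in>{?k..<length a}. first_tree f (drop i a @ b) - first_tree f (drop i a))"
    unfolding straddle_sum_eq by (rule sum.mono_neutral_right) (use L in \<open>auto simp: first_tree_append_eq\<close>)
  also have "\<dots> = (\<Sum>i<L. first_tree f (drop (i + ?k) a @ b) - first_tree f (drop (i + ?k) a))"
    by (rule sum.reindex_bij_witness[of _ "\<lambda>i. i + ?k" "\<lambda>i. i - ?k"]) (use L in auto)
  also have "\<dots> = straddle_sum f (drop ?k a) (take L b)"
    unfolding straddle_sum_eq
  proof (intro sum.cong)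
    fix i
    have "first_tree f (drop (i + ?k) a @ b) = first_tree f ((drop (i + ?k) a @ take L b) @ drop L b)" by simp
    also have "\<dots> = first_tree f (drop (i + ?k) a @ take L b)"
      using L by (intro first_tree_append_eq) simp
    finally show "first_tree f (drop (i + ?k) a @ b) - first_tree f (drop (i + ?k) a)
        = first_tree f (drop i (drop ?k a) @ take L b) - first_tree f (drop i (drop ?k a))" by simp
  qed (use L in auto)
  finally show ?thesis .
qed

text \<open>A seam between blocks involves only \<open>L\<close> letters on either side, that is,
  one block of length \<open>2 * L\<close> of the grid shifted by \<open>L\<close>. The seam terms
  are therefore functions of disjoint stretches and independent of each other, so their centered sum
  grows only like the square root of their number.\<close>

lemma window_sum_blocks:
  assumes L: "M \<le> L" and len: "length xs = Suc N * (2 * L)"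
  shows "window_sum f xs = block_sum (window_sum f) (2 * L) (Suc N) xs
    + block_sum (\<lambda>y. straddle_sum f (take L y) (drop L y)) (2 * L) N (drop L xs)"
  using len
proof (induction N arbitrary: xs)
  case (Suc N)
  let ?l = "2 * L"
  let ?g = "\<lambda>y. straddle_sum f (take L y) (drop L y)"
  define a ys where "a = take ?l xs" and "ys = drop ?l xs"
  have xs: "xs = a @ ys" and la: "length a = ?l" and ly: "length ys = Suc N * ?l"
    using Suc.prems by (auto simp: a_def ys_def)
  have "window_sum f xs = window_sum f a + window_sum f ys + straddle_sum f a ys" by (simp add: xs straddle_sum_def)
  also have "straddle_sum f a ys = straddle_sum f (drop (length a - L) a) (take L ys)"
    using L la ly by (intro straddle_sum_local) auto
  also have "\<dots> = ?g (take ?l (drop L xs))" using la ly by (simp add: xs)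
  also have "window_sum f ys = block_sum (window_sum f) ?l (Suc N) ys + block_sum ?g ?l N (drop L ys)"
    by (rule Suc.IH) (rule ly)
  finally have "window_sum f xs = (window_sum f a + block_sum (window_sum f) ?l (Suc N) ys)
      + (?g (take ?l (drop L xs)) + block_sum ?g ?l N (drop L ys))" by simp
  moreover have "drop L ys = drop ?l (drop L xs)" by (simp add: ys_def add.commute)
  ultimately show ?case
    by (simp only: block_sum_Suc[of _ _ "Suc N" xs] block_sum_Suc[of _ _ N "drop L xs"] a_def ys_def)
qed (simp add: block_sum_Suc)

end

lemma borel_measurable_pair_pmf:
  fixes G :: "real \<Rightarrow> 'a::countable \<Rightarrow> complex"
  assumes "\<And>x. (\<lambda>t. G t x) \<in> borel_measurable borel"
  shows "case_prod G \<in> borel_measurable (borel \<Otimes>\<^sub>M measure_pmf P)"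
proof -
  have "case_prod G \<in> borel_measurable (borel \<Otimes>\<^sub>M count_space UNIV)"
    using assms by (subst measurable_pair_swap_iff) (rule measurable_pair_measure_countable1, auto)
  then show ?thesis by (simp cong: measurable_cong_sets sets_pair_measure_cong)
qed

lemma borel_measurable_expectation_pmf:
  fixes G :: "real \<Rightarrow> 'a::countable \<Rightarrow> complex"
  assumes "\<And>x. (\<lambda>t. G t x) \<in> borel_measurable borel"
  shows "(\<lambda>t. measure_pmf.expectation P (G t)) \<in> borel_measurable borel"
  using borel_measurable_pair_pmf[OF assms] by (rule measure_pmf.borel_measurable_lebesgue_integral)

context critical_offspring
begin

lemma word_mean_cis_block_sum:
  fixes h :: "nat list \<Rightarrow> real"
  shows "word_mean (N * l) (\<lambda>xs. cis (block_sum h l N xs)) = word_mean l (\<lambda>xs. cis (h xs)) ^ N"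
proof (induction N)
  case (Suc N)
  have "word_mean (l + N * l) (\<lambda>xs. cis (block_sum h l (Suc N) xs))
     = word_mean (l + N * l) (\<lambda>xs. (\<lambda>a. cis (h a)) (take l xs) * (\<lambda>b. cis (block_sum h l N b)) (drop l xs))"
    by (simp add: block_sum_Suc cis_mult)
  also have "\<dots> = word_mean l (\<lambda>xs. cis (h xs)) * word_mean (N * l) (\<lambda>xs. cis (block_sum h l N xs))"
    by (rule word_mean_mult_bounded) auto
  finally show ?case using Suc by simp
qed simp

lemma integrable_word_bounded:
  fixes g :: "nat list \<Rightarrow> real"
  assumes "\<And>xs. \<bar>g xs\<bar> \<le> b" shows "integrable (replicate_pmf n p) g"
  by (rule integrable_pmf_bounded[of _ _ b]) (simp add: assms)

lemma word_mean_block_sum: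
  fixes h :: "nat list \<Rightarrow> real"
  assumes h: "integrable (replicate_pmf l p) h"
  shows "integrable (replicate_pmf (N * l) p) (block_sum h l N) \<and> word_mean (N * l) (block_sum h l N) = real N * word_mean l h"
proof (induction N)
  case (Suc N)
  have eq: "block_sum h l (Suc N) = (\<lambda>xs. h (take l xs) * 1 + 1 * block_sum h l N (drop l xs))"
    by (simp add: block_sum_Suc fun_eq_iff)
  have 1: "integrable (replicate_pmf (l + N * l) p) (\<lambda>xs. h (take l xs) * 1)"
    "integrable (replicate_pmf (l + N * l) p) (\<lambda>xs. 1 * block_sum h l N (drop l xs))"
    using integrable_word_take_drop[OF h, of "N * l" "\<lambda>_. 1"] integrable_word_take_drop[of l "\<lambda>_. 1" "N * l" "block_sum h l N"] Suc
    by auto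
  have 2: "word_mean (l + N * l) (\<lambda>xs. h (take l xs) * 1) = word_mean l h"
    "word_mean (l + N * l) (\<lambda>xs. 1 * block_sum h l N (drop l xs)) = real N * word_mean l h"
    using word_mean_take_drop[OF h, of "N * l" "\<lambda>_. 1"] word_mean_take_drop[of l "\<lambda>_. 1" "N * l" "block_sum h l N"] Suc
    by auto
  show ?case unfolding eq mult_Suc using 1 2
    by (simp only: Bochner_Integration.integral_add Bochner_Integration.integrable_add) (simp add: algebra_simps)
qed (simp add: block_sum_def[abs_def])

lemma word_mean_block_sum_square:
  fixes h :: "nat list \<Rightarrow> real"
  assumes h: "integrable (replicate_pmf l p) h" "integrable (replicate_pmf l p) (\<lambda>xs. (h xs)\<^sup>2)" and mean: "word_mean l h = 0"
  shows "integrable (replicate_pmf (N * l) p) (\<lambda>xs. (block_sum h l N xs)\<^sup>2)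
     \<and> word_mean (N * l) (\<lambda>xs. (block_sum h l N xs)\<^sup>2) = real N * word_mean l (\<lambda>xs. (h xs)\<^sup>2)"
proof (induction N)
  case (Suc N)
  let ?B = "block_sum h l N"
  let ?B2 = "\<lambda>xs. (?B xs)\<^sup>2" and ?h2 = "\<lambda>xs. (h xs)\<^sup>2" and ?one = "\<lambda>_ :: nat list. 1 :: real"
  have eq: "(block_sum h l (Suc N) xs)\<^sup>2 = (?h2 (take l xs) * ?one (drop l xs) + ?one (take l xs) * ?B2 (drop l xs))
      + 2 * (h (take l xs) * ?B (drop l xs))" for xs
    by (simp add: block_sum_Suc power2_sum)
  have B: "integrable (replicate_pmf (N * l) p) ?B" using word_mean_block_sum[OF h(1)] by blast
  have B2: "integrable (replicate_pmf (N * l) p) ?B2" "word_mean (N * l) ?B2 = real N * word_mean l ?h2" using Suc by auto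
  have one: "integrable (replicate_pmf n p) ?one" for n by simp
  note i1 = integrable_word_take_drop[OF h(2) one, of "N * l"] and i2 = integrable_word_take_drop[OF one B2(1), of l]
    and i3 = integrable_word_take_drop[OF h(1) B]
  note m1 = word_mean_take_drop[OF h(2) one, of "N * l"] and m2 = word_mean_take_drop[OF one B2(1), of l]
    and m3 = word_mean_take_drop[OF h(1) B]
  have "integrable (replicate_pmf (l + N * l) p) (\<lambda>xs. (?h2 (take l xs) * ?one (drop l xs) + ?one (take l xs) * ?B2 (drop l xs))
      + 2 * (h (take l xs) * ?B (drop l xs)))"
    by (intro Bochner_Integration.integrable_add integrable_mult_right i1 i2 i3)
  moreover have "word_mean (l + N * l) (\<lambda>xs. (?h2 (take l xs) * ?one (drop l xs) + ?one (take l xs) * ?B2 (drop l xs))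
      + 2 * (h (take l xs) * ?B (drop l xs))) = real (Suc N) * word_mean l ?h2"
    using i1 i2 i3 m1 m2 m3 B2(2) mean
    by (simp only: Bochner_Integration.integral_add Bochner_Integration.integrable_add integrable_mult_right integral_mult_right_zero)
       (simp add: algebra_simps)
  ultimately show ?case unfolding eq mult_Suc by blast
qed simp

text \<open>The letters that \<open>g\<close> does not see have to bring the walk to a prescribed
  endpoint, and whatever that endpoint is, the probability is at most \<open>c\<close>. Moments
  under conditioning are thereby bounded by unconditioned ones.\<close>

lemma word_mean_walk_take_le:
  fixes g :: "nat list \<Rightarrow> real"
  assumes g: "\<And>xs. 0 \<le> g xs" "integrable (replicate_pmf m p) g" and c: "\<And>i. walk_prob n i \<le> c"
  shows "word_mean (m + n) (\<lambda>xs. of_bool (walk xs = -1) * g (take m xs)) \<le> c * word_mean m g"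
proof -
  have "word_mean (m + n) (\<lambda>xs. of_bool (walk xs = -1) * g (take m xs))
     = word_mean m (\<lambda>a. word_mean n (\<lambda>b. of_bool (walk (a @ b) = -1) * g (take m (a @ b))))"
    by (rule word_mean_append) (rule integrable_word_walk)
  also have "\<dots> = word_mean m (\<lambda>a. g a * walk_prob n (-1 - walk a))"
  proof (rule expectation_pmf_cong)
    fix a assume "a \<in> set_pmf (replicate_pmf m p)"
    then have "length a = m" by (rule length_replicate_pmf)
    then have "of_bool (walk (a @ b) = -1) * g (take m (a @ b)) = g a * of_bool (walk b = -1 - walk a)" for b
      by (auto simp: of_bool_def)
    then show "word_mean n (\<lambda>b. of_bool (walk (a @ b) = -1) * g (take m (a @ b))) = g a * walk_prob n (-1 - walk a)"
      by (simp add: walk_prob_def)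
  qed
  also have "\<dots> \<le> word_mean m (\<lambda>a. g a * c)"
  proof (rule integral_mono)
    show "integrable (replicate_pmf m p) (\<lambda>a. g a * walk_prob n (- 1 - walk a))"
      by (rule Bochner_Integration.integrable_bound[OF g(2)]) (auto simp: abs_mult walk_prob_le_1 mult_left_le)
  qed (use g c in \<open>auto intro!: mult_left_mono\<close>)
  finally show ?thesis by (simp add: mult.commute)
qed

text \<open>A rotation preserves the word law and the endpoint and moves the last \<open>n\<close>
  letters to the front.\<close>

lemma word_mean_walk_drop_le:
  fixes g :: "nat list \<Rightarrow> real"
  assumes g: "\<And>xs. 0 \<le> g xs" "integrable (replicate_pmf n p) g" and c: "\<And>i. walk_prob m i \<le> c"
  shows "word_mean (m + n) (\<lambda>xs. of_bool (walk xs = -1) * g (drop m xs)) \<le> c * word_mean n g"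
proof -
  have "word_mean (m + n) (\<lambda>xs. of_bool (walk xs = -1) * g (drop m xs))
     = word_mean (m + n) (\<lambda>xs. (\<lambda>ys. of_bool (walk ys = -1) * g (take n ys)) (rotate m xs))"
  proof (rule expectation_pmf_cong)
    fix xs assume "xs \<in> set_pmf (replicate_pmf (m + n) p)"
    then have len: "length xs = m + n" by (rule length_replicate_pmf)
    have "take n (rotate m xs) = drop m xs"
      by (cases "n = 0") (use len in \<open>auto simp: rotate_drop_take\<close>)
    then show "of_bool (walk xs = -1) * g (drop m xs) = (\<lambda>ys. of_bool (walk ys = -1) * g (take n ys)) (rotate m xs)" by simp
  qed
  also have "\<dots> = word_mean (n + m) (\<lambda>ys. of_bool (walk ys = -1) * g (take n ys))"
    by (subst word_mean_rotate) (simp add: add.commute)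
  also have "\<dots> \<le> c * word_mean n g" by (rule word_mean_walk_take_le[OF g c])
  finally show ?thesis .
qed

end

lemma nat_div_limit:
  assumes x: "(\<lambda>n. real (x n) / real n) \<longlonglongrightarrow> c" and l: "l > 0"
  shows "(\<lambda>n. real (x n div l) / real n) \<longlonglongrightarrow> c / real l"
proof -
  have "(\<lambda>n. real (x n div l) / real n - real (x n) / real n / real l) \<longlonglongrightarrow> 0"
  proof (rule Lim_null_comparison)
    show "\<forall>\<^sub>F n in sequentially. norm (real (x n div l) / real n - real (x n) / real n / real l) \<le> 1 / real n"
      using eventually_gt_at_top[of 0]
    proof eventually_elim
      case (elim n)
      define y where "y = real (x n mod l) / real l"
      have y: "0 \<le> y" "y \<le> 1" using l by (auto simp: y_def divide_le_eq less_imp_le)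
      have "real (x n) = real (x n div l) * real l + real (x n mod l)"
        by (metis div_mult_mod_eq of_nat_add of_nat_mult)
      then have "real (x n) / real l = real (x n div l) + y" using l by (simp add: add_divide_distrib y_def)
      moreover have "real (x n div l) / real n - real (x n) / real n / real l = (real (x n div l) - real (x n) / real l) / real n"
        by (simp add: diff_divide_distrib mult.commute)
      ultimately have "real (x n div l) / real n - real (x n) / real n / real l = - y / real n" by simp
      then show ?case using y elim by (simp add: divide_right_mono)
    qed
    show "(\<lambda>n. 1 / real n) \<longlonglongrightarrow> 0" by real_asymp
  qed
  from tendsto_add[OF this tendsto_divide[OF x tendsto_const[of "real l"]]] show ?thesis using l by simp
qed

context critical_offspring
begin

definition cond_char :: "nat \<Rightarrow> (plane_tree \<Rightarrow> real) \<Rightarrow> complex" where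
  "cond_char n h = (\<Sum>t\<in>trees n. complex_of_real (tree_weight p t) * cis (h t)) / complex_of_real (size_prob n)"

lemma cmod_cond_char_diff_le:
  assumes "0 < size_prob n"
  shows "cmod (cond_char n g - cond_char n h) \<le> cond_mean n (\<lambda>t. \<bar>g t - h t\<bar>)"
proof -
  have "cond_char n g - cond_char n h = (\<Sum>t\<in>trees n. complex_of_real (tree_weight p t) * (cis (g t) - cis (h t))) / complex_of_real (size_prob n)"
    by (simp add: cond_char_def right_diff_distrib sum_subtractf diff_divide_distrib)
  also have "cmod \<dots> \<le> (\<Sum>t\<in>trees n. tree_weight p t * \<bar>g t - h t\<bar>) / size_prob n"
    unfolding norm_divide norm_of_real using assms
    by (auto intro!: divide_right_mono order.trans[OF norm_sum] sum_mono mult_left_mono cmod_cis_diff_le simp: norm_mult)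
  finally show ?thesis by (simp add: cond_mean_def tree_sum_def)
qed

lemma cond_char_eq_word_mean:
  assumes rot: "\<And>j xs. h (rotate j xs) = h xs"
  shows "complex_of_real (real n * size_prob n) * cond_char n (\<lambda>t. h (degree_seq t)) = word_mean n (\<lambda>xs. of_bool (walk xs = -1) * cis (h xs))"
proof (cases "size_prob n = 0")
  case True
  have "word_mean n (\<lambda>xs. of_bool (walk xs = -1) :: real) = 0"
    using size_prob_eq_walk_prob[of n] True by (simp add: walk_prob_def)
  then have "AE xs in replicate_pmf n p. of_bool (walk xs = -1) = (0 :: real)"
    by (subst (asm) integral_nonneg_eq_0_iff_AE) auto
  then have "word_mean n (\<lambda>xs. of_bool (walk xs = -1) * cis (h xs)) = 0"
    by (intro integral_eq_zero_AE) (auto elim!: eventually_mono)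
  then show ?thesis using True by simp
next
  case False
  let ?z = "\<lambda>xs. of_bool (walk xs = -1) * cis (h xs) :: complex"
  have int: "integrable (replicate_pmf n p) ?z" by (rule integrable_pmf_bounded[of _ _ 1]) (simp add: norm_mult)
  have re: "Re (?z xs) = of_bool (walk xs = -1) * cos (h xs)" "Im (?z xs) = of_bool (walk xs = -1) * sin (h xs)" for xs by auto
  have "Re (word_mean n ?z) = real n * tree_sum n (\<lambda>t. cos (h (degree_seq t)))"
    using tree_sum_eq_word_mean[of "\<lambda>xs. cos (h xs)" n] integral_Re[OF int] by (simp only: re rot)
  moreover have "Im (word_mean n ?z) = real n * tree_sum n (\<lambda>t. sin (h (degree_seq t)))"
    using tree_sum_eq_word_mean[of "\<lambda>xs. sin (h xs)" n] integral_Im[OF int] by (simp only: re rot)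
  moreover have "complex_of_real (real n * size_prob n) * cond_char n (\<lambda>t. h (degree_seq t))
      = complex_of_real (real n) * (\<Sum>t\<in>trees n. complex_of_real (tree_weight p t) * cis (h (degree_seq t)))"
    using False by (simp add: cond_char_def)
  ultimately show ?thesis
    by (simp add: complex_eq_iff tree_sum_def)
qed

end

section \<open>Conditioned block sums and their Gaussian limit\<close>

locale bounded_functional = walk_bounds + finite_support
begin

abbreviation \<mu> :: real where "\<mu> \<equiv> measure_pmf.expectation gw f"
abbreviation win_mean :: "nat \<Rightarrow> real" where "win_mean \<equiv> window_mean f"

lemma cut_mean_eq: "M \<le> N \<Longrightarrow> cut_mean f N = \<mu>"
proof -
  assume N: "M \<le> N"
  have "\<mu> = (\<Sum>k\<le>N. tree_sum k f)" by (rule expectation_finite_support) (use N support in auto)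
  then show ?thesis by (simp add: cut_mean_def)
qed

lemma window_mean_diff: "M \<le> j \<Longrightarrow> win_mean (j + i) - win_mean j = real i * \<mu>"
  by (induction i) (auto simp: window_mean_Suc cut_mean_eq algebra_simps)

lemma exists_window_mean_bound: "\<exists>c. \<forall>j. \<bar>win_mean j - real j * \<mu>\<bar> \<le> c"
proof -
  define c where "c = Max ((\<lambda>j. \<bar>win_mean j - real j * \<mu>\<bar>) ` {..M})"
  have c: "\<bar>win_mean j - real j * \<mu>\<bar> \<le> c" if "j \<le> M" for j unfolding c_def using that by (intro Max_ge) auto
  have "\<bar>win_mean j - real j * \<mu>\<bar> \<le> c" for j
  proof (cases "j \<le> M")
    case False
    then have "win_mean j - real j * \<mu> = win_mean M - real M * \<mu>"
      using window_mean_diff[of M "j - M"] by (simp add: of_nat_diff algebra_simps)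
    then show ?thesis using c[of M] by simp
  qed (rule c)
  then show ?thesis by blast
qed

text \<open>The variance per letter of the window sum of an unconditioned word. The added
  \<open>\<mu>\<^sup>2 / offspring_var\<close> is the part explained by linear regression on the
  walk: the covariance per letter is \<open>- \<mu>\<close> up to boundary terms, the step variance
  is \<open>offspring_var\<close>.\<close>

definition window_rate :: real where "window_rate = asymptotic_var f + \<mu>\<^sup>2 / offspring_var"

text \<open>Beyond \<open>2 * M\<close> letters the leading tree that matters and the means
  subtracted for it are unaffected by the end of the word, so each new letter adds the same
  amount.\<close>

lemma window_var_increment:
  assumes "2 * M \<le> N"
  shows "window_var f (Suc N) = window_var f N + window_rate"
proof -
  have z: "tree_sum k (\<lambda>t. f t * h t) = 0" if "M < k" for k h using that support by (auto simp: tree_sum_def trees_def)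
  have "(\<Sum>k\<le>Suc N. tree_sum k (\<lambda>t. f t * (2 * additive_functional f t - f t - 2 * (win_mean (Suc N) - win_mean (Suc N - k)))))
      = (\<Sum>k\<le>M. tree_sum k (\<lambda>t. f t * (2 * additive_functional f t - f t - 2 * (win_mean (Suc N) - win_mean (Suc N - k)))))"
    by (rule sum.mono_neutral_right) (use assms z in auto)
  also have "\<dots> = (\<Sum>k\<le>M. 2 * (tree_sum k (\<lambda>t. f t * additive_functional f t) - real k * \<mu> * tree_sum k f) - tree_sum k (\<lambda>t. (f t)\<^sup>2))"
  proof (intro sum.cong refl)
    fix k assume k: "k \<in> {..M}"
    have d: "win_mean (Suc N) - win_mean (Suc N - k) = real k * \<mu>"
      using window_mean_diff[of "Suc N - k" k] k assms by auto
    show "tree_sum k (\<lambda>t. f t * (2 * additive_functional f t - f t - 2 * (win_mean (Suc N) - win_mean (Suc N - k))))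
      = 2 * (tree_sum k (\<lambda>t. f t * additive_functional f t) - real k * \<mu> * tree_sum k f) - tree_sum k (\<lambda>t. (f t)\<^sup>2)"
      unfolding d tree_sum_def sum_distrib_left sum_subtractf[symmetric]
      by (intro sum.cong refl) (simp add: algebra_simps power2_eq_square)
  qed
  also have "\<dots> = window_rate - \<mu>\<^sup>2"
    unfolding window_rate_def
    by (subst asymptotic_var_finite_support[of M]) (simp_all add: support sum_subtractf sum_distrib_left)
  finally show ?thesis using assms by (simp add: window_var_Suc cut_mean_eq)
qed

lemma window_var_eventually: "window_var f (2 * M + j) = window_var f (2 * M) + real j * window_rate"
  by (induction j) (auto simp: window_var_increment algebra_simps)

lemma exists_window_var_bound: "\<exists>c\<ge>0. \<forall>j. window_var f j \<le> c * (real j + 1)"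
proof -
  define c where "c = Max ((\<lambda>j. window_var f j) ` {..2 * M}) + \<bar>window_rate\<bar>"
  have c: "window_var f j \<le> c - \<bar>window_rate\<bar>" if "j \<le> 2 * M" for j
  proof -
    have "window_var f j \<le> Max ((\<lambda>j. window_var f j) ` {..2 * M})" using that by (intro Max_ge) auto
    then show ?thesis by (simp add: c_def)
  qed
  have c0: "0 \<le> c" using c[of 0] by simp
  have "window_var f j \<le> c * (real j + 1)" for j
  proof (cases "j \<le> 2 * M")
    case True
    then have "window_var f j \<le> c" using c[OF True] by simp
    also have "\<dots> \<le> c * (real j + 1)" using c0 by (simp add: mult_left_le distrib_left)
    finally show ?thesis .
  next
    case False
    then have "window_var f j = window_var f (2 * M) + real (j - 2 * M) * window_rate"
      using window_var_eventually[of "j - 2 * M"] by simp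
    also have "\<dots> \<le> (c - \<bar>window_rate\<bar>) + real j * \<bar>window_rate\<bar>"
    proof (intro add_mono c)
      have "real (j - 2 * M) * window_rate \<le> real (j - 2 * M) * \<bar>window_rate\<bar>" by (intro mult_left_mono) auto
      also have "\<dots> \<le> real j * \<bar>window_rate\<bar>" by (intro mult_right_mono) auto
      finally show "real (j - 2 * M) * window_rate \<le> real j * \<bar>window_rate\<bar>" .
    qed simp
    also have "\<dots> \<le> c + real j * c"
    proof -
      have "\<bar>window_rate\<bar> \<le> c" using c[of 0] by simp
      then show ?thesis by (intro add_mono mult_left_mono) auto
    qed
    finally show ?thesis by (simp add: algebra_simps)
  qed
  then show ?thesis using c0 by blast
qed

definition centered_window :: "nat \<Rightarrow> nat list \<Rightarrow> real" where
  "centered_window l xs = window_sum f xs - win_mean l"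

lemma integrable_centered_window: "integrable (replicate_pmf l p) (centered_window l)"
  and integrable_centered_window_square: "integrable (replicate_pmf l p) (\<lambda>xs. (centered_window l xs)\<^sup>2)"
  and mean_centered_window: "word_mean l (centered_window l) = 0"
  and var_centered_window: "word_mean l (\<lambda>xs. (centered_window l xs)\<^sup>2) = window_var f l"
proof -
  note w = integrable_window_sum[of l f] integrable_window_sum_power[of l f 2]
  show "integrable (replicate_pmf l p) (centered_window l)" "word_mean l (centered_window l) = 0"
    "word_mean l (\<lambda>xs. (centered_window l xs)\<^sup>2) = window_var f l"
    using w by (simp_all add: centered_window_def[abs_def] window_mean_def window_var_def)
  show "integrable (replicate_pmf l p) (\<lambda>xs. (centered_window l xs)\<^sup>2)"
    using w by (simp add: centered_window_def power2_diff)
qed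

lemma centered_window_walk_moments:
  "integrable (replicate_pmf l p) (\<lambda>xs. (s * centered_window l xs + x * real_of_int (walk xs))\<^sup>2)"
  "word_mean l (\<lambda>xs. s * centered_window l xs + x * real_of_int (walk xs)) = 0"
  "word_mean l (\<lambda>xs. (s * centered_window l xs + x * real_of_int (walk xs))\<^sup>2)
     = s\<^sup>2 * window_var f l - 2 * s * x * win_mean l + x\<^sup>2 * (real l * offspring_var)"
proof -
  have cw: "integrable (replicate_pmf l p) (\<lambda>xs. centered_window l xs * real_of_int (walk xs))"
    "word_mean l (\<lambda>xs. centered_window l xs * real_of_int (walk xs)) = - win_mean l"
    using integrable_window_sum_walk[of l f] integrable_walk[of l] word_mean_window_sum_walk[of l f] word_mean_walk[of l]
    by (simp_all add: centered_window_def left_diff_distrib)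
  have eq: "(s * centered_window l xs + x * real_of_int (walk xs))\<^sup>2
     = s\<^sup>2 * (centered_window l xs)\<^sup>2 + ((2 * s * x) * (centered_window l xs * real_of_int (walk xs)) + x\<^sup>2 * (real_of_int (walk xs))\<^sup>2)" for xs
    by (simp add: power2_sum power_mult_distrib algebra_simps)
  note i = integrable_centered_window_square[of l] cw(1) integrable_walk_sq[of l]
  show "integrable (replicate_pmf l p) (\<lambda>xs. (s * centered_window l xs + x * real_of_int (walk xs))\<^sup>2)"
    unfolding eq by (intro Bochner_Integration.integrable_add integrable_mult_right i)
  show "word_mean l (\<lambda>xs. s * centered_window l xs + x * real_of_int (walk xs)) = 0"
    using integrable_centered_window[of l] integrable_walk[of l] mean_centered_window[of l] word_mean_walk[of l] by simp
  have "word_mean l (\<lambda>xs. s\<^sup>2 * (centered_window l xs)\<^sup>2 + ((2 * s * x) * (centered_window l xs * real_of_int (walk xs)) + x\<^sup>2 * (real_of_int (walk xs))\<^sup>2))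
     = s\<^sup>2 * window_var f l + ((2 * s * x) * (- win_mean l) + x\<^sup>2 * (real l * offspring_var))"
    using i by (simp only: Bochner_Integration.integral_add Bochner_Integration.integrable_add integrable_mult_right
        integral_mult_right_zero var_centered_window cw(2) word_mean_walk_sq)
  then show "word_mean l (\<lambda>xs. (s * centered_window l xs + x * real_of_int (walk xs))\<^sup>2)
     = s\<^sup>2 * window_var f l - 2 * s * x * win_mean l + x\<^sup>2 * (real l * offspring_var)"
    unfolding eq by simp
qed

definition block_char :: "nat \<Rightarrow> real \<Rightarrow> real \<Rightarrow> complex" where
  "block_char l \<theta> t = word_mean l (\<lambda>xs. cis (\<theta> * centered_window l xs + t * real_of_int (walk xs)))"

text \<open>Under the Fourier integral the endpoint condition becomes a factor \<open>cis\<close>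
  per letter. The blocks are then independent with the joint characteristic function of block sum
  and walk, the uncovered letters contribute powers of \<open>step_cf\<close>, and the last
  \<open>cis t\<close> stems from the endpoint \<open>-1\<close>.\<close>

lemma block_sum_fourier:
  assumes n: "int span dvd int n - 1" "N * l \<le> n"
  shows "word_mean n (\<lambda>xs. of_bool (walk xs = -1) * cis (\<theta> * block_sum (centered_window l) l N xs))
     = complex_of_real freq_scale * (LINT t:freq_range|lborel. block_char l \<theta> t ^ N * step_cf t ^ (n - N * l) * cis t)"
proof -
  let ?m = "N * l"
  let ?h = "\<lambda>xs. cis (\<theta> * block_sum (centered_window l) l N xs)"
  have dvd: "int span dvd -1 + int n" using n(1) by simp
  have "word_mean n (\<lambda>xs. of_bool (walk xs = -1) * ?h xs)
     = complex_of_real freq_scale * (LINT t:freq_range|lborel. word_mean n (\<lambda>xs. ?h xs * cis (t * of_int (walk xs - (-1)))))"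
    by (rule fourier_inversion) (use dvd in auto)
  also have "(\<lambda>t. word_mean n (\<lambda>xs. ?h xs * cis (t * of_int (walk xs - (-1))))) = (\<lambda>t. block_char l \<theta> t ^ N * step_cf t ^ (n - ?m) * cis t)"
  proof
    fix t :: real
    let ?g = "\<lambda>xs. \<theta> * centered_window l xs + t * real_of_int (walk xs)"
    let ?w = "\<lambda>xs. cis (t * real_of_int (walk xs))"
    have "word_mean n (\<lambda>xs. ?h xs * cis (t * of_int (walk xs - (-1))))
       = word_mean (?m + (n - ?m)) (\<lambda>xs. (\<lambda>a. cis (block_sum ?g l N a)) (take ?m xs) * ?w (drop ?m xs) * cis t)"
      using n(2)
    proof (simp only: le_add_diff_inverse, intro expectation_pmf_cong)
      fix xs assume "xs \<in> set_pmf (replicate_pmf n p)"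
      then have len: "length xs = n" by (rule length_replicate_pmf)
      let ?a = "take ?m xs"
      have "length ?a = N * l" using len n(2) by simp
      then have "walk ?a = block_sum walk l N ?a" by (rule block_sum_walk[symmetric])
      then have "block_sum ?g l N ?a = \<theta> * block_sum (centered_window l) l N xs + t * real_of_int (walk ?a)"
      proof -
        have "block_sum ?g l N ?a = \<theta> * block_sum (centered_window l) l N ?a + t * real_of_int (block_sum walk l N ?a)"
          by (simp add: block_sum_def sum.distrib sum_distrib_left)
        then show ?thesis using \<open>walk ?a = _\<close> block_sum_take[of N l ?m "centered_window l" xs] by simp
      qed
      moreover have "real_of_int (walk xs) = real_of_int (walk ?a) + real_of_int (walk (drop ?m xs))"
        by (metis append_take_drop_id of_int_add walk_simps(3))
      ultimately show "?h xs * cis (t * of_int (walk xs - (-1))) = cis (block_sum ?g l N ?a) * ?w (drop ?m xs) * cis t"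
        by (simp add: cis_mult algebra_simps)
    qed
    also have "\<dots> = word_mean (?m + (n - ?m)) (\<lambda>xs. (\<lambda>a. cis (block_sum ?g l N a)) (take ?m xs) * ?w (drop ?m xs)) * cis t"
      by (rule integral_mult_left_zero)
    also have "word_mean (?m + (n - ?m)) (\<lambda>xs. (\<lambda>a. cis (block_sum ?g l N a)) (take ?m xs) * ?w (drop ?m xs))
       = word_mean ?m (\<lambda>a. cis (block_sum ?g l N a)) * word_mean (n - ?m) ?w"
      by (rule word_mean_mult_bounded) auto
    also have "\<dots> = block_char l \<theta> t ^ N * step_cf t ^ (n - ?m)"
      unfolding word_mean_cis_walk word_mean_cis_block_sum block_char_def ..
    finally show "word_mean n (\<lambda>xs. ?h xs * cis (t * of_int (walk xs - (-1)))) = block_char l \<theta> t ^ N * step_cf t ^ (n - ?m) * cis t" .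
  qed
  finally show ?thesis .
qed

lemma cmod_block_char_le_1: "cmod (block_char l \<theta> t) \<le> 1"
proof -
  have "cmod (block_char l \<theta> t) \<le> word_mean l (\<lambda>xs. cmod (cis (\<theta> * centered_window l xs + t * real_of_int (walk xs))))"
    unfolding block_char_def by (rule integral_norm_bound)
  then show ?thesis by simp
qed

lemma measurable_block_char: "block_char l \<theta> \<in> borel_measurable borel"
  unfolding block_char_def[abs_def] by (rule borel_measurable_expectation_pmf) measurable

text \<open>Nothing beyond modulus 1 is used about \<open>block_char\<close> in the domination, so a
  fraction \<open>1 / a\<close> of uncovered letters must dominate alone. In the limit the
  covariance with the walk leaves a linear exponent in \<open>x\<close>, and completing the square
  yields the subtracted \<open>(\<alpha> * win_mean l)\<^sup>2 / offspring_var\<close>.\<close>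

lemma block_fourier_limit:
  assumes l: "l > 0" and N: "(\<lambda>n. real (N n) / real n) \<longlonglongrightarrow> \<alpha>" "\<And>n. N n * l \<le> n"
    and a: "a > 0" "\<And>n. n \<ge> b \<Longrightarrow> real n \<le> a * real (n - N n * l)"
  shows "(\<lambda>n. complex_of_real (sqrt (real n)) * (complex_of_real freq_scale *
      (LINT t:freq_range|lborel. block_char l (s / sqrt (real n)) t ^ N n * step_cf t ^ (n - N n * l) * cis t)))
     \<longlonglongrightarrow> complex_of_real (llt_const * exp (- s\<^sup>2 / 2 * (\<alpha> * window_var f l - (\<alpha> * win_mean l)\<^sup>2 / offspring_var)))"
proof -
  let ?V = "window_var f l" and ?e = "win_mean l"
  let ?c = "exp (- \<alpha> * s\<^sup>2 * ?V / 2)"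
  let ?g = "\<lambda>x. ?c * (exp ((\<alpha> * s * ?e) * x) * exp (- offspring_var * x\<^sup>2 / 2))"
  have Nl: "(\<lambda>n. real (n - N n * l) / real n) \<longlonglongrightarrow> 1 - \<alpha> * real l"
  proof -
    have "(\<lambda>n. 1 - real (N n) / real n * real l) \<longlonglongrightarrow> 1 - \<alpha> * real l" by (intro tendsto_intros N)
    then show ?thesis
      by (rule Lim_transform_eventually)
         (use N(2) in \<open>auto intro!: eventually_sequentiallyI[of 1] simp: of_nat_diff diff_divide_distrib\<close>)
  qed
  have "(\<lambda>n. complex_of_real (sqrt (real n)) * (complex_of_real freq_scale *
      (LINT t:freq_range|lborel. block_char l (s / sqrt (real n)) t ^ N n * step_cf t ^ (n - N n * l) * cis t)))
     \<longlonglongrightarrow> complex_of_real freq_scale * (\<integral>x. complex_of_real (?g x) \<partial>lborel)"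
  proof (rule scaled_fourier_limit[where b = b and D = "\<lambda>x. \<bar>x\<bar> ^ 0 * exp (- (decay / a) * x\<^sup>2)"])
    show "(\<lambda>t. block_char l (s / sqrt (real n)) t ^ N n * step_cf t ^ (n - N n * l) * cis t) \<in> borel_measurable borel" for n
      using measurable_block_char by measurable
    fix x
    note mom = centered_window_walk_moments[of l s x]
    have "block_char l (s / sqrt (real n)) (x / sqrt (real n)) = word_mean l (\<lambda>xs. cis ((s * centered_window l xs + x * real_of_int (walk xs)) / sqrt (real n)))" for n
      by (simp add: block_char_def add_divide_distrib)
    then have "(\<lambda>n. block_char l (s / sqrt (real n)) (x / sqrt (real n)) ^ N n)
        \<longlonglongrightarrow> complex_of_real (exp (- \<alpha> * (s\<^sup>2 * ?V - 2 * s * x * ?e + x\<^sup>2 * (real l * offspring_var)) / 2))"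
      using char_power_limit[OF mom(1,2) N(1)] unfolding mom(3) by simp
    then have "(\<lambda>n. block_char l (s / sqrt (real n)) (x / sqrt (real n)) ^ N n * step_cf (x / sqrt (real n)) ^ (n - N n * l) * cis (x / sqrt (real n)))
       \<longlonglongrightarrow> complex_of_real (exp (- \<alpha> * (s\<^sup>2 * ?V - 2 * s * x * ?e + x\<^sup>2 * (real l * offspring_var)) / 2))
          * complex_of_real (exp (- (1 - \<alpha> * real l) * offspring_var * x\<^sup>2 / 2)) * 1"
      by (intro tendsto_mult step_cf_power_limit Nl cis_scaled_limit)
    moreover have "exp (- \<alpha> * (s\<^sup>2 * ?V - 2 * s * x * ?e + x\<^sup>2 * (real l * offspring_var)) / 2) * exp (- (1 - \<alpha> * real l) * offspring_var * x\<^sup>2 / 2) = ?g x"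
      unfolding exp_add[symmetric] by (simp add: field_simps)
    ultimately show "(\<lambda>n. block_char l (s / sqrt (real n)) (x / sqrt (real n)) ^ N n * step_cf (x / sqrt (real n)) ^ (n - N n * l) * cis (x / sqrt (real n)))
       \<longlonglongrightarrow> complex_of_real (?g x)" by (simp only: of_real_mult[symmetric] mult_1_right)
  next
    fix n x assume n: "b \<le> n" "0 < n" "\<bar>x / sqrt (real n)\<bar> \<le> pi / span"
    have "norm (block_char l (s / sqrt (real n)) (x / sqrt (real n)) ^ N n * step_cf (x / sqrt (real n)) ^ (n - N n * l) * cis (x / sqrt (real n)))
       \<le> 1 * exp (- (decay / a) * x\<^sup>2)"
      unfolding norm_mult norm_cis mult_1_right
      by (intro mult_mono cmod_step_cf_scaled_le a n) (auto simp: norm_power power_le_one cmod_block_char_le_1)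
    then show "norm (block_char l (s / sqrt (real n)) (x / sqrt (real n)) ^ N n * step_cf (x / sqrt (real n)) ^ (n - N n * l) * cis (x / sqrt (real n)))
       \<le> \<bar>x\<bar> ^ 0 * exp (- (decay / a) * x\<^sup>2)" by simp
  next
    show "integrable lborel (\<lambda>x. \<bar>x\<bar> ^ 0 * exp (- (decay / a) * x\<^sup>2))"
      using decay_pos a by (intro integrable_gauss) simp
  qed auto
  moreover have B: "(\<integral>x. complex_of_real (?g x) \<partial>lborel) = complex_of_real (?c * (gauss_const * exp ((\<alpha> * s * ?e)\<^sup>2 / (2 * offspring_var))))"
    by (simp only: integral_complex_of_real integral_mult_right_zero integral_gauss_shift)
  have C: "?c * (gauss_const * exp ((\<alpha> * s * ?e)\<^sup>2 / (2 * offspring_var)))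
     = gauss_const * exp (- s\<^sup>2 / 2 * (\<alpha> * ?V - (\<alpha> * ?e)\<^sup>2 / offspring_var))"
    using offspring_var_pos
    by (simp only: mult.left_commute[of ?c] exp_add[symmetric]) (simp add: field_simps power_mult_distrib)
  have "complex_of_real freq_scale * (\<integral>x. complex_of_real (?g x) \<partial>lborel)
     = complex_of_real (llt_const * exp (- s\<^sup>2 / 2 * (\<alpha> * ?V - (\<alpha> * ?e)\<^sup>2 / offspring_var)))"
    unfolding B C llt_const_def by (simp only: of_real_mult mult.assoc)
  ultimately show ?thesis by (simp only:)
qed

lemma word_mean_shifted_blocks:
  fixes g :: "real \<Rightarrow> real"
  shows "word_mean (Suc N * (2 * L)) (\<lambda>xs. g (block_sum h (2 * L) N (drop L xs)))
     = word_mean (N * (2 * L)) (\<lambda>xs. g (block_sum h (2 * L) N xs))"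
proof -
  let ?l = "2 * L"
  have m: "Suc N * ?l = L + (N * ?l + L)" by simp
  have "word_mean (L + (N * ?l + L)) (\<lambda>xs. (\<lambda>ys. g (block_sum h ?l N ys)) (drop L xs)) = word_mean (N * ?l + L) (\<lambda>ys. g (block_sum h ?l N ys))"
    by (rule word_mean_drop)
  also have "\<dots> = word_mean (N * ?l + L) (\<lambda>ys. (\<lambda>zs. g (block_sum h ?l N zs)) (take (N * ?l) ys))"
    by (simp only: block_sum_take order.refl)
  also have "\<dots> = word_mean (N * ?l) (\<lambda>zs. g (block_sum h ?l N zs))"
    by (rule word_mean_take)
  finally show ?thesis unfolding m .
qed

lemma abs_block_sum_le:
  fixes h :: "nat list \<Rightarrow> real"
  assumes "\<And>y. \<bar>h y\<bar> \<le> b"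
  shows "\<bar>block_sum h l N xs\<bar> \<le> real N * b"
  unfolding block_sum_def using sum_mono[of "{..<N}" "\<lambda>i. \<bar>h (take l (drop (i * l) xs))\<bar>" "\<lambda>_. b"] assms
  by (intro order.trans[OF sum_abs]) auto

text \<open>Three kinds of error occur. The wrap-around, the seam before the uncovered part and the
  biases of two means are bounded by a constant. The centered seams \<open>R\<close> depend on the
  first \<open>m\<close> letters only, and the fluctuation \<open>D\<close> of the uncovered part on
  the other letters only, so for each of them conditioning costs a factor from the law of the
  complementary stretch.\<close>

lemma conditional_block_error:
  assumes L: "M \<le> L" and n: "Suc N * (2 * L) \<le> n"
    and c1: "\<And>j. \<bar>win_mean j - real j * \<mu>\<bar> \<le> c1" and c2: "0 \<le> c2" "\<And>j. window_var f j \<le> c2 * (real j + 1)"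
  defines "l \<equiv> 2 * L" and "m \<equiv> Suc N * (2 * L)"
  shows "word_mean n (\<lambda>xs. of_bool (walk xs = -1) * \<bar>cyclic_sum f xs - real n * \<mu> - block_sum (centered_window l) l (Suc N) xs\<bar>)
     \<le> (4 * real M * \<beta> + 2 * c1) * walk_prob n (-1)
       + K / sqrt (real (n - m) + 1) * (sqrt (real (Suc N)) * (4 * real M * \<beta>))
       + K / sqrt (real m + 1) * sqrt (c2 * (real (n - m) + 1))"
proof -
  define \<rho> where "\<rho> y = straddle_sum f (take L y) (drop L y)" for y
  define \<rho>m where "\<rho>m = word_mean l \<rho>"
  define \<rho>1 where "\<rho>1 y = \<rho> y - \<rho>m" for y
  define R where "R a = block_sum \<rho>1 l N (drop L a)" for a
  define D where "D b = window_sum f b - win_mean (n - m)" for b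
  let ?Q = "walk_prob n (-1)"
  let ?b = "\<lambda>xs. of_bool (walk xs = -1) :: real"
  let ?C = "4 * real M * \<beta> + 2 * c1"
  have mn: "m + (n - m) = n" using n by (simp add: m_def)
  have \<rho>_le: "\<bar>\<rho> y\<bar> \<le> 2 * real M * \<beta>" for y unfolding \<rho>_def by (rule abs_straddle_sum_le)
  have int_\<rho>: "integrable (replicate_pmf k p) \<rho>" for k by (rule integrable_word_bounded) (rule \<rho>_le)
  have "\<bar>\<rho>m\<bar> \<le> 2 * real M * \<beta>"
  proof -
    have "norm \<rho>m \<le> word_mean l (\<lambda>_. 2 * real M * \<beta>)" unfolding \<rho>m_def by (rule norm_expectation_le) (auto simp: \<rho>_le)
    then show ?thesis by simp
  qed
  then have \<rho>1_le: "\<bar>\<rho>1 y\<bar> \<le> 4 * real M * \<beta>" for y using \<rho>_le[of y] unfolding \<rho>1_def by linarith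
  have int_\<rho>1: "integrable (replicate_pmf k p) \<rho>1" "integrable (replicate_pmf k p) (\<lambda>y. (\<rho>1 y)\<^sup>2)" for k
  proof -
    show "integrable (replicate_pmf k p) \<rho>1" by (rule integrable_word_bounded) (rule \<rho>1_le)
    show "integrable (replicate_pmf k p) (\<lambda>y. (\<rho>1 y)\<^sup>2)"
      by (rule integrable_word_bounded[of _ "(4 * real M * \<beta>)\<^sup>2"]) (use \<rho>1_le in \<open>auto simp: abs_le_square_iff[symmetric] intro: order.trans[OF _ abs_ge_self]\<close>)
  qed
  have mean_\<rho>1: "word_mean l \<rho>1 = 0" using int_\<rho> by (simp add: \<rho>1_def[abs_def] \<rho>m_def)
  have split: "window_sum f a = block_sum (window_sum f) l (Suc N) a + block_sum \<rho> l N (drop L a)" if "length a = m" for a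
    using window_sum_blocks[OF L, of a N] that unfolding \<rho>_def[abs_def] l_def m_def by simp
  \<comment> \<open>The block decomposition holds exactly for means as well. Centering blocks and
    seams separately therefore leaves no drift proportional to the number of blocks.\<close>
  have means: "win_mean m = real (Suc N) * win_mean l + real N * \<rho>m"
  proof -
    note W = word_mean_block_sum[OF integrable_window_sum[of l f], of "Suc N"] and P = word_mean_block_sum[OF int_\<rho>[of l], of N]
    have i: "integrable (replicate_pmf m p) (\<lambda>xs. block_sum \<rho> l N (drop L xs))"
      by (rule integrable_word_bounded) (rule abs_block_sum_le, rule \<rho>_le)
    have "win_mean m = word_mean m (\<lambda>xs. block_sum (window_sum f) l (Suc N) xs + block_sum \<rho> l N (drop L xs))"
      unfolding window_mean_def by (intro expectation_pmf_cong split) (rule length_replicate_pmf)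
    also have "\<dots> = word_mean m (block_sum (window_sum f) l (Suc N)) + word_mean m (\<lambda>xs. block_sum \<rho> l N (drop L xs))"
      using W i by (intro Bochner_Integration.integral_add) (auto simp: m_def l_def)
    also have "word_mean m (\<lambda>xs. block_sum \<rho> l N (drop L xs)) = word_mean (N * l) (block_sum \<rho> l N)"
      using word_mean_shifted_blocks[of N L "\<lambda>x. x" \<rho>] by (simp only: m_def l_def)
    also have "\<dots> = real N * \<rho>m" using P by (simp add: \<rho>m_def)
    also have "word_mean m (block_sum (window_sum f) l (Suc N)) = real (Suc N) * win_mean l"
      using W unfolding m_def l_def window_mean_def by blast
    finally show ?thesis .
  qed
  have pathwise: "\<bar>cyclic_sum f xs - real n * \<mu> - block_sum (centered_window l) l (Suc N) xs\<bar> \<le> ?C + (\<bar>R (take m xs)\<bar> + \<bar>D (drop m xs)\<bar>)"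
    if len: "length xs = n" for xs
  proof -
    let ?a = "take m xs" and ?d = "drop m xs"
    have la: "length ?a = m" using len mn by simp
    have "window_sum f xs = window_sum f ?a + window_sum f ?d + straddle_sum f ?a ?d" by (simp add: straddle_sum_def)
    moreover have "block_sum (window_sum f) l (Suc N) ?a = block_sum (centered_window l) l (Suc N) xs + real (Suc N) * win_mean l"
    proof -
      have "block_sum (window_sum f) l (Suc N) ?a = block_sum (centered_window l) l (Suc N) ?a + real (Suc N) * win_mean l"
        unfolding block_sum_def centered_window_def sum_subtractf by simp
      then show ?thesis using block_sum_take[of "Suc N" l m "centered_window l" xs] by (simp add: m_def l_def)
    qed
    moreover have "block_sum \<rho> l N (drop L ?a) = R ?a + real N * \<rho>m"
      unfolding R_def block_sum_def \<rho>1_def sum_subtractf by simp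
    moreover have "\<bar>win_mean m + win_mean (n - m) - real n * \<mu>\<bar> \<le> 2 * c1"
    proof -
      have "real n = real m + real (n - m)" using mn by linarith
      then have "real n * \<mu> = real m * \<mu> + real (n - m) * \<mu>" by (simp only: distrib_right)
      then show ?thesis using c1[of m] c1[of "n - m"] by linarith
    qed
    moreover have "\<bar>cyclic_sum f xs - window_sum f xs\<bar> \<le> 2 * real M * \<beta>" by (rule abs_cyclic_minus_window_sum_le)
    moreover have "\<bar>straddle_sum f ?a ?d\<bar> \<le> 2 * real M * \<beta>" by (rule abs_straddle_sum_le)
    ultimately show ?thesis using split[OF la] means D_def[of ?d] by linarith
  qed
  have int_R: "integrable (replicate_pmf k p) (\<lambda>a. \<bar>R a\<bar>)" for k
    using abs_block_sum_le[of \<rho>1, OF \<rho>1_le] by (intro integrable_word_bounded[of _ "real N * (4 * real M * \<beta>)"]) (simp add: R_def)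
  have ER: "word_mean m (\<lambda>a. \<bar>R a\<bar>) \<le> sqrt (real (Suc N)) * (4 * real M * \<beta>)"
  proof -
    note P = word_mean_block_sum_square[OF int_\<rho>1[of l] mean_\<rho>1, of N]
    have "word_mean m (\<lambda>a. \<bar>R a\<bar>) = word_mean (N * l) (\<lambda>xs. \<bar>block_sum \<rho>1 l N xs\<bar>)"
      using word_mean_shifted_blocks[of N L "\<lambda>x. \<bar>x\<bar>" \<rho>1] by (simp only: m_def l_def R_def)
    also have "\<dots> \<le> sqrt (word_mean (N * l) (\<lambda>xs. (block_sum \<rho>1 l N xs)\<^sup>2))"
      by (rule expectation_abs_le_sqrt) (use P in blast)
    also have "\<dots> = sqrt (real N * word_mean l (\<lambda>y. (\<rho>1 y)\<^sup>2))" using P by simp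
    also have "\<dots> \<le> sqrt (real (Suc N) * (4 * real M * \<beta>)\<^sup>2)"
    proof (intro real_sqrt_le_mono mult_mono)
      have "word_mean l (\<lambda>y. (\<rho>1 y)\<^sup>2) \<le> word_mean l (\<lambda>_. (4 * real M * \<beta>)\<^sup>2)"
      proof (rule integral_mono)
        fix y
        have "(\<bar>\<rho>1 y\<bar>)\<^sup>2 \<le> (4 * real M * \<beta>)\<^sup>2" by (rule power_mono[OF \<rho>1_le]) simp
        then show "(\<rho>1 y)\<^sup>2 \<le> (4 * real M * \<beta>)\<^sup>2" by simp
      qed (use int_\<rho>1 in auto)
      then show "word_mean l (\<lambda>y. (\<rho>1 y)\<^sup>2) \<le> (4 * real M * \<beta>)\<^sup>2" by simp
    qed (auto intro!: integral_nonneg_AE)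
    also have "\<dots> = sqrt (real (Suc N)) * (4 * real M * \<beta>)" using \<beta>_nonneg by (simp add: real_sqrt_mult)
    finally show ?thesis .
  qed
  have int_D: "integrable (replicate_pmf (n - m) p) (\<lambda>b. \<bar>D b\<bar>)"
    using integrable_window_sum[of "n - m" f] by (simp add: D_def)
  have ED: "word_mean (n - m) (\<lambda>b. \<bar>D b\<bar>) \<le> sqrt (c2 * (real (n - m) + 1))"
  proof -
    have "word_mean (n - m) (\<lambda>b. \<bar>D b\<bar>) \<le> sqrt (word_mean (n - m) (\<lambda>b. (D b)\<^sup>2))"
      by (rule expectation_abs_le_sqrt) (use integrable_centered_window_square[of "n - m"] in \<open>simp add: centered_window_def D_def\<close>)
    also have "word_mean (n - m) (\<lambda>b. (D b)\<^sup>2) = window_var f (n - m)" by (simp add: D_def window_var_def)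
    also have "sqrt \<dots> \<le> sqrt (c2 * (real (n - m) + 1))" by (intro real_sqrt_le_mono c2)
    finally show ?thesis .
  qed
  have "word_mean n (\<lambda>xs. ?b xs * \<bar>cyclic_sum f xs - real n * \<mu> - block_sum (centered_window l) l (Suc N) xs\<bar>)
     \<le> word_mean n (\<lambda>xs. ?b xs * (?C + (\<bar>R (take m xs)\<bar> + \<bar>D (drop m xs)\<bar>)))"
  proof (rule integral_mono_AE)
    show "AE xs in measure_pmf (replicate_pmf n p). ?b xs * \<bar>cyclic_sum f xs - real n * \<mu> - block_sum (centered_window l) l (Suc N) xs\<bar>
       \<le> ?b xs * (?C + (\<bar>R (take m xs)\<bar> + \<bar>D (drop m xs)\<bar>))"
      by (rule AE_pmfI) (intro mult_left_mono pathwise length_replicate_pmf, auto)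
  qed (intro integrable_word_walk)+
  also have "\<dots> = word_mean n (\<lambda>xs. ?b xs * ?C + (?b xs * \<bar>R (take m xs)\<bar> + ?b xs * \<bar>D (drop m xs)\<bar>))"
    by (simp only: distrib_left)
  also have "\<dots> = word_mean n (\<lambda>xs. ?b xs * ?C) + (word_mean n (\<lambda>xs. ?b xs * \<bar>R (take m xs)\<bar>) + word_mean n (\<lambda>xs. ?b xs * \<bar>D (drop m xs)\<bar>))"
    by (subst Bochner_Integration.integral_add Bochner_Integration.integral_add;
        (intro Bochner_Integration.integrable_add integrable_word_walk)?)+ simp
  also have "word_mean n (\<lambda>xs. ?b xs * ?C) = ?C * ?Q" by (simp add: walk_prob_def mult.commute)
  also have "word_mean n (\<lambda>xs. ?b xs * \<bar>R (take m xs)\<bar>) \<le> K / sqrt (real (n - m) + 1) * (sqrt (real (Suc N)) * (4 * real M * \<beta>))"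
  proof -
    have "word_mean (m + (n - m)) (\<lambda>xs. ?b xs * \<bar>R (take m xs)\<bar>) \<le> K / sqrt (real (n - m) + 1) * word_mean m (\<lambda>a. \<bar>R a\<bar>)"
      by (rule word_mean_walk_take_le[where g = "\<lambda>a. \<bar>R a\<bar>", OF _ int_R walk_prob_upper]) simp
    also have "\<dots> \<le> K / sqrt (real (n - m) + 1) * (sqrt (real (Suc N)) * (4 * real M * \<beta>))"
      using K_pos by (intro mult_left_mono ER) auto
    finally show ?thesis unfolding mn .
  qed
  also have "word_mean n (\<lambda>xs. ?b xs * \<bar>D (drop m xs)\<bar>) \<le> K / sqrt (real m + 1) * sqrt (c2 * (real (n - m) + 1))"
  proof -
    have "word_mean (m + (n - m)) (\<lambda>xs. ?b xs * \<bar>D (drop m xs)\<bar>) \<le> K / sqrt (real m + 1) * word_mean (n - m) (\<lambda>b. \<bar>D b\<bar>)"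
      by (rule word_mean_walk_drop_le[where g = "\<lambda>b. \<bar>D b\<bar>", OF _ int_D walk_prob_upper]) simp
    also have "\<dots> \<le> K / sqrt (real m + 1) * sqrt (c2 * (real (n - m) + 1))"
      using K_pos by (intro mult_left_mono ED) auto
    finally show ?thesis unfolding mn .
  qed
  finally show ?thesis by (simp add: add.assoc)
qed

text \<open>About \<open>n / r\<close> letters are left uncovered, and blocks have length
  \<open>2 * r\<^sup>2\<close>. The seam error is governed by the square root of the ratio of the
  number of blocks, at most \<open>n / r\<^sup>2\<close>, to the uncovered length, the error of the
  uncovered part by the root of its proportion of the word; both are of order
  \<open>1 / sqrt r\<close>. A block length that is large compared with \<open>r\<close> is needed
  because conditioning on the few uncovered letters magnifies the seams.\<close>

lemma cond_char_block_error:
  assumes r: "4 \<le> r" "M \<le> r" and n: "4 * r * (2 * r\<^sup>2 + 1) \<le> n" "0 < size_prob n"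
    and c1: "\<And>j. \<bar>win_mean j - real j * \<mu>\<bar> \<le> c1" and c2: "0 \<le> c2" "\<And>j. window_var f j \<le> c2 * (real j + 1)"
  defines "l \<equiv> 2 * r\<^sup>2" and "N \<equiv> (n - n div r) div (2 * r\<^sup>2)"
  shows "cmod (cond_char n (\<lambda>t. s / sqrt (real n) * (additive_functional f t - real n * \<mu>))
      - word_mean n (\<lambda>xs. of_bool (walk xs = -1) * cis (s / sqrt (real n) * block_sum (centered_window l) l N xs)) / complex_of_real (walk_prob n (-1)))
    \<le> \<bar>s\<bar> * ((4 * real M * \<beta> + 2 * c1) / sqrt (real n) + (4 * real M * \<beta> * K\<^sup>2 + 2 * K\<^sup>2 * sqrt c2) / sqrt (real r))"
proof -
  define m where "m = N * l"
  let ?Q = "walk_prob n (-1)"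
  let ?th = "s / sqrt (real n)"
  let ?B = "block_sum (centered_window l) l N"
  let ?C = "4 * real M * \<beta> + 2 * c1"
  have r0: "r > 0" using r by simp
  have l0: "l > 0" using r0 by (simp add: l_def)
  have n0: "n > 0" using n(2) by (cases n) auto
  have Q: "?Q = real n * size_prob n" "?Q > 0" using n(2) n0 by (auto simp: size_prob_eq_walk_prob[symmetric])
  have iQ: "1 / ?Q \<le> K * sqrt (real n)"
    using walk_prob_lower[OF n(2)] Q(2) n0 K_pos by (simp add: field_simps)
  have lr: "real l = 2 * (real r)\<^sup>2" by (simp add: l_def)
  \<comment> \<open>By the threshold on \<open>n\<close>, the rounding loss of at most one block
    stays below a quarter of the \<open>n / r\<close> letters meant to be uncovered.\<close>
  have nl: "4 * real r * (real l + 1) \<le> real n"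
  proof -
    have "real (4 * r * (2 * r\<^sup>2 + 1)) \<le> real n" using n(1) by (simp only: of_nat_le_iff)
    moreover have "real (4 * r * (2 * r\<^sup>2 + 1)) = 4 * real r * (real l + 1)" unfolding lr by (simp add: algebra_simps)
    ultimately show ?thesis by linarith
  qed
  have nr: "real n = real (n div r) * real r + real (n mod r)" by (metis div_mult_mod_eq of_nat_add of_nat_mult)
  have dl: "real (n div r) \<le> real n / real r" using nr r0 by (simp add: pos_le_divide_eq)
  have du: "real n / real r \<le> real (n div r) + 1"
  proof -
    have "real (n mod r) \<le> real r" using r0 by simp
    then show ?thesis using nr r0 by (simp add: pos_divide_le_eq algebra_simps)
  qed
  have m_le: "m \<le> n - n div r" unfolding m_def N_def l_def by (rule div_times_less_eq_dividend)
  have m_ge: "n - n div r < m + l"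
    using l0 mod_less_divisor[of l "n - n div r"] div_mult_mod_eq[of "n - n div r" l] unfolding m_def N_def l_def by linarith
  have div_le: "n div r \<le> n" by simp
  have mn: "m \<le> n" using m_le by simp
  have nm1: "real n / real r \<le> real (n - m) + 1"
  proof -
    have "n div r \<le> n - m" using m_le div_le by linarith
    then show ?thesis using du by linarith
  qed
  have lb: "real l + 1 \<le> real n / (4 * real r)" using nl r0 by (simp add: pos_le_divide_eq mult.commute)
  have nm2: "real (n - m) + 1 \<le> 5 * (real n / (4 * real r))"
  proof -
    have "real (n - m) \<le> real (n div r) + real l" using m_ge mn div_le by linarith
    moreover have "real n / real r = 4 * (real n / (4 * real r))" by simp
    ultimately show ?thesis using dl lb by linarith
  qed
  have m2: "real n / 2 \<le> real m + 1"
  proof -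
    have "real n / (4 * real r) \<le> real n / (4 * 4)" using r by (intro divide_left_mono mult_left_mono) auto
    moreover have "real m = real n - real (n - m)" using mn by (simp add: of_nat_diff)
    ultimately show ?thesis using nm2 n0 by linarith
  qed
  have N0: "N > 0"
  proof (rule ccontr)
    assume "\<not> N > 0"
    then have "m = 0" by (simp add: m_def)
    then have "real n / 2 \<le> 1" using m2 by simp
    moreover have "4 * real r * (real l + 1) \<ge> 4 * 4 * 1" using r by (intro mult_mono) auto
    ultimately show False using nl by linarith
  qed
  then obtain N' where N': "N = Suc N'" by (cases N) auto
  have NL: "M \<le> r\<^sup>2" using r(2) by (metis power2_nat_le_eq_le power2_nat_le_imp_le le_trans le_square power2_eq_square)
  have "Suc N' * (2 * r\<^sup>2) \<le> n" using mn by (simp only: m_def l_def N')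
  from conditional_block_error[OF NL this c1 c2]
  have err: "word_mean n (\<lambda>xs. of_bool (walk xs = -1) * \<bar>cyclic_sum f xs - real n * \<mu> - ?B xs\<bar>)
     \<le> ?C * ?Q + K / sqrt (real (n - m) + 1) * (sqrt (real N) * (4 * real M * \<beta>)) + K / sqrt (real m + 1) * sqrt (c2 * (real (n - m) + 1))"
    by (simp only: N' l_def m_def)
  have e1: "K / sqrt (real (n - m) + 1) * (sqrt (real N) * (4 * real M * \<beta>)) \<le> K * (4 * real M * \<beta>) / sqrt (real r)"
  proof -
    have "real N * real l \<le> real n" using mn by (simp add: m_def flip: of_nat_mult)
    then have "real N \<le> real n / real l" using l0 by (simp add: pos_le_divide_eq)
    also have "\<dots> \<le> real n / (real r * real r)" using r0 unfolding lr power2_eq_square by (intro divide_left_mono) auto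
    finally have "real N * real r \<le> real n / real r" using r0 by (simp add: field_simps)
    then have "sqrt (real N * real r) \<le> sqrt (real (n - m) + 1)" using nm1 by (intro real_sqrt_le_mono) linarith
    then have "sqrt (real N) * sqrt (real r) \<le> sqrt (real (n - m) + 1)" by (simp only: real_sqrt_mult)
    then have "sqrt (real N) / sqrt (real (n - m) + 1) \<le> 1 / sqrt (real r)" using r0 by (simp add: field_simps)
    then have "K * (4 * real M * \<beta>) * (sqrt (real N) / sqrt (real (n - m) + 1)) \<le> K * (4 * real M * \<beta>) * (1 / sqrt (real r))"
      using K_pos \<beta>_nonneg by (intro mult_left_mono) auto
    then show ?thesis by (simp add: mult_ac)
  qed
  have e2: "K / sqrt (real m + 1) * sqrt (c2 * (real (n - m) + 1)) \<le> K * (2 * sqrt c2) / sqrt (real r)"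
  proof -
    have "(real (n - m) + 1) * real r \<le> 5 * (real n / (4 * real r)) * real r" using nm2 by (intro mult_right_mono) auto
    also have "\<dots> = 5 * real n / 4" using r0 by simp
    also have "\<dots> \<le> 2 * real n" by simp
    also have "\<dots> = 4 * (real n / 2)" by simp
    also have "\<dots> \<le> 4 * (real m + 1)" by (intro mult_left_mono m2) simp
    finally have "sqrt ((real (n - m) + 1) * real r) \<le> sqrt (4 * (real m + 1))" by (rule real_sqrt_le_mono)
    then have "sqrt (real (n - m) + 1) * sqrt (real r) \<le> 2 * sqrt (real m + 1)" by (simp only: real_sqrt_mult real_sqrt_four)
    then have "sqrt (real (n - m) + 1) / sqrt (real m + 1) \<le> 2 / sqrt (real r)" using r0 by (simp add: field_simps)
    then have "K * sqrt c2 * (sqrt (real (n - m) + 1) / sqrt (real m + 1)) \<le> K * sqrt c2 * (2 / sqrt (real r))"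
      using K_pos c2(1) by (intro mult_left_mono) auto
    then show ?thesis by (simp add: real_sqrt_mult mult_ac)
  qed
  have "complex_of_real (real n * size_prob n) * cond_char n (\<lambda>t. ?th * (cyclic_sum f (degree_seq t) - real n * \<mu>))
     = word_mean n (\<lambda>xs. of_bool (walk xs = -1) * cis (?th * (cyclic_sum f xs - real n * \<mu>)))"
    by (rule cond_char_eq_word_mean[of "\<lambda>xs. ?th * (cyclic_sum f xs - real n * \<mu>)"]) (simp add: cyclic_sum_rotate)
  then have "cond_char n (\<lambda>t. ?th * (additive_functional f t - real n * \<mu>))
     = word_mean n (\<lambda>xs. of_bool (walk xs = -1) * cis (?th * (cyclic_sum f xs - real n * \<mu>))) / complex_of_real ?Q"
    unfolding cyclic_sum_degree_seq Q(1)[symmetric] using Q(2) by (simp add: field_simps)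
  then have "cmod (cond_char n (\<lambda>t. ?th * (additive_functional f t - real n * \<mu>))
      - word_mean n (\<lambda>xs. of_bool (walk xs = -1) * cis (?th * ?B xs)) / complex_of_real ?Q)
    = cmod (word_mean n (\<lambda>xs. of_bool (walk xs = -1) * cis (?th * (cyclic_sum f xs - real n * \<mu>)) - of_bool (walk xs = -1) * cis (?th * ?B xs))) / ?Q"
    using Q(2)
    by (subst Bochner_Integration.integral_diff) (auto simp: diff_divide_distrib[symmetric] norm_divide norm_mult intro!: integrable_pmf_bounded[of _ _ 1])
  also have "\<dots> \<le> word_mean n (\<lambda>xs. \<bar>?th\<bar> * (of_bool (walk xs = -1) * \<bar>cyclic_sum f xs - real n * \<mu> - ?B xs\<bar>)) / ?Q"
  proof (intro divide_right_mono norm_expectation_le)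
    show "integrable (replicate_pmf n p) (\<lambda>xs. \<bar>?th\<bar> * (of_bool (walk xs = -1) * \<bar>cyclic_sum f xs - real n * \<mu> - ?B xs\<bar>))"
      by (intro integrable_mult_right integrable_word_walk)
    fix xs
    have "cmod (cis (?th * (cyclic_sum f xs - real n * \<mu>)) - cis (?th * ?B xs)) \<le> \<bar>?th * (cyclic_sum f xs - real n * \<mu>) - ?th * ?B xs\<bar>"
      by (rule cmod_cis_diff_le)
    also have "\<dots> = \<bar>?th\<bar> * \<bar>cyclic_sum f xs - real n * \<mu> - ?B xs\<bar>"
      by (simp only: right_diff_distrib[symmetric] abs_mult)
    finally show "cmod (of_bool (walk xs = -1) * cis (?th * (cyclic_sum f xs - real n * \<mu>)) - of_bool (walk xs = -1) * cis (?th * ?B xs))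
       \<le> \<bar>?th\<bar> * (of_bool (walk xs = -1) * \<bar>cyclic_sum f xs - real n * \<mu> - ?B xs\<bar>)"
      by (cases "walk xs = -1") simp_all
  qed (use Q(2) in simp)
  also have "\<dots> = \<bar>?th\<bar> * (word_mean n (\<lambda>xs. of_bool (walk xs = -1) * \<bar>cyclic_sum f xs - real n * \<mu> - ?B xs\<bar>) * (1 / ?Q))"
    by simp
  also have "\<dots> \<le> \<bar>?th\<bar> * (?C + (K * (4 * real M * \<beta>) / sqrt (real r) + K * (2 * sqrt c2) / sqrt (real r)) * (K * sqrt (real n)))"
  proof (intro mult_left_mono)
    let ?X = "K * (4 * real M * \<beta>) / sqrt (real r) + K * (2 * sqrt c2) / sqrt (real r)"
    have X0: "0 \<le> ?X" using K_pos \<beta>_nonneg c2(1) by simp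
    have "word_mean n (\<lambda>xs. of_bool (walk xs = -1) * \<bar>cyclic_sum f xs - real n * \<mu> - ?B xs\<bar>) \<le> ?C * ?Q + ?X"
      using err e1 e2 by linarith
    then have "word_mean n (\<lambda>xs. of_bool (walk xs = -1) * \<bar>cyclic_sum f xs - real n * \<mu> - ?B xs\<bar>) * (1 / ?Q) \<le> (?C * ?Q + ?X) * (1 / ?Q)"
      using Q(2) by (intro mult_right_mono) auto
    also have "\<dots> = ?C + ?X * (1 / ?Q)"
    proof -
      have c: "(c * q + x) * (1 / q) = c + x * (1 / q)" if "q \<noteq> 0" for c q x :: real using that by (simp add: field_simps)
      show ?thesis by (rule c) (use Q(2) in simp)
    qed
    also have "\<dots> \<le> ?C + ?X * (K * sqrt (real n))" using iQ X0 by (intro add_left_mono mult_left_mono) auto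
    finally show "word_mean n (\<lambda>xs. of_bool (walk xs = -1) * \<bar>cyclic_sum f xs - real n * \<mu> - ?B xs\<bar>) * (1 / ?Q) \<le> ?C + ?X * (K * sqrt (real n))" .
  qed simp
  also have "\<dots> = \<bar>s\<bar> * (?C / sqrt (real n) + (4 * real M * \<beta> * K\<^sup>2 + 2 * K\<^sup>2 * sqrt c2) / sqrt (real r))"
  proof -
    have fac: "y / q * (c + x * (K * q)) = y * (c / q + x * K)" if "q \<noteq> 0" for q c x y :: real using that by (simp add: field_simps)
    have "\<bar>?th\<bar> = \<bar>s\<bar> / sqrt (real n)" by (simp add: abs_divide)
    then have "\<bar>?th\<bar> * (?C + (K * (4 * real M * \<beta>) / sqrt (real r) + K * (2 * sqrt c2) / sqrt (real r)) * (K * sqrt (real n)))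
      = \<bar>s\<bar> * (?C / sqrt (real n) + (K * (4 * real M * \<beta>) / sqrt (real r) + K * (2 * sqrt c2) / sqrt (real r)) * K)"
      by (simp only:) (rule fac, use n0 in simp)
    also have "(K * (4 * real M * \<beta>) / sqrt (real r) + K * (2 * sqrt c2) / sqrt (real r)) * K = (4 * real M * \<beta> * K\<^sup>2 + 2 * K\<^sup>2 * sqrt c2) / sqrt (real r)"
      by (simp add: power2_eq_square add_divide_distrib algebra_simps)
    finally show ?thesis .
  qed
  finally show ?thesis .
qed

lemma diff_div_limit:
  assumes "r > 0"
  shows "(\<lambda>n. real (n - n div r) / real n) \<longlonglongrightarrow> 1 - 1 / real r"
proof -
  have one: "(\<lambda>n. real n / real n) \<longlonglongrightarrow> 1"
    by (rule Lim_transform_eventually[OF tendsto_const]) (use eventually_gt_at_top[of "0::nat"] in eventually_elim, simp)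
  have "(\<lambda>n. real n / real n - real (n div r) / real n) \<longlonglongrightarrow> 1 - 1 / real r"
    by (intro tendsto_diff one nat_div_limit assms)
  then show ?thesis by (simp add: of_nat_diff diff_divide_distrib)
qed

text \<open>The asymptotic variance of the part of the walk covered by blocks of length \<open>2 * r\<^sup>2\<close>,
  which leave about \<open>n / r\<close> of the \<open>n\<close> steps free.\<close>

definition block_rate :: "nat \<Rightarrow> real" where
  "block_rate r = (let \<alpha> = (1 - 1 / real r) / real (2 * r\<^sup>2) in
     \<alpha> * window_var f (2 * r\<^sup>2) - (\<alpha> * win_mean (2 * r\<^sup>2))\<^sup>2 / offspring_var)"

text \<open>Per covered letter the block variance tends to \<open>window_rate\<close> and the block
  mean to \<open>\<mu>\<close>, while the covered proportion tends to 1. The regression term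
  subtracted in \<open>block_rate\<close> then removes precisely what \<open>window_rate\<close> has
  in excess.\<close>

lemma block_rate_limit: "block_rate \<longlonglongrightarrow> asymptotic_var f"
proof -
  let ?\<alpha> = "\<lambda>r. (1 - 1 / real r) / real (2 * r\<^sup>2)"
  obtain c where c: "\<And>j. \<bar>win_mean j - real j * \<mu>\<bar> \<le> c" using exists_window_mean_bound by blast
  have \<alpha>: "?\<alpha> \<longlonglongrightarrow> 0" "(\<lambda>r. ?\<alpha> r * real (2 * r\<^sup>2)) \<longlonglongrightarrow> 1"
    by (simp_all only: of_nat_mult of_nat_power of_nat_numeral) real_asymp+
  have "(\<lambda>r. ?\<alpha> r * window_var f (2 * r\<^sup>2)) \<longlonglongrightarrow> window_rate"
  proof (rule Lim_transform_eventually)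
    show "(\<lambda>r. ?\<alpha> r * (window_var f (2 * M) - 2 * real M * window_rate) + ?\<alpha> r * real (2 * r\<^sup>2) * window_rate) \<longlonglongrightarrow> window_rate"
      using tendsto_add[OF tendsto_mult_right[OF \<alpha>(1), of "window_var f (2 * M) - 2 * real M * window_rate"] tendsto_mult_right[OF \<alpha>(2), of window_rate]]
      by (simp only: mult_zero_left mult_1_left add_0_left)
    show "\<forall>\<^sub>F r in sequentially. ?\<alpha> r * (window_var f (2 * M) - 2 * real M * window_rate) + ?\<alpha> r * real (2 * r\<^sup>2) * window_rate = ?\<alpha> r * window_var f (2 * r\<^sup>2)"
      using eventually_ge_at_top[of M]
    proof eventually_elim
      case (elim r)
      then have "2 * M \<le> 2 * r\<^sup>2" by (metis le_trans mult_le_mono2 le_square power2_eq_square)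
      then have "window_var f (2 * r\<^sup>2) = window_var f (2 * M) - 2 * real M * window_rate + real (2 * r\<^sup>2) * window_rate"
        using window_var_eventually[of "2 * r\<^sup>2 - 2 * M"] by (simp add: of_nat_diff left_diff_distrib)
      then show ?case by (simp only: distrib_left mult.assoc)
    qed
  qed
  moreover have "(\<lambda>r. ?\<alpha> r * win_mean (2 * r\<^sup>2)) \<longlonglongrightarrow> \<mu>"
  proof -
    have "(\<lambda>r. ?\<alpha> r * (win_mean (2 * r\<^sup>2) - real (2 * r\<^sup>2) * \<mu>)) \<longlonglongrightarrow> 0"
    proof (rule Lim_null_comparison)
      show "\<forall>\<^sub>F r in sequentially. norm (?\<alpha> r * (win_mean (2 * r\<^sup>2) - real (2 * r\<^sup>2) * \<mu>)) \<le> \<bar>?\<alpha> r\<bar> * c"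
        by (intro always_eventually allI) (simp only: real_norm_def abs_mult, intro mult_left_mono c, simp)
      show "(\<lambda>r. \<bar>?\<alpha> r\<bar> * c) \<longlonglongrightarrow> 0"
        using tendsto_mult_right[OF tendsto_rabs[OF \<alpha>(1)], of c] by simp
    qed
    moreover have "(\<lambda>r. ?\<alpha> r * (real (2 * r\<^sup>2) * \<mu>)) \<longlonglongrightarrow> \<mu>"
      using tendsto_mult_right[OF \<alpha>(2), of \<mu>] by (simp only: mult.assoc mult_1_left)
    ultimately have "(\<lambda>r. ?\<alpha> r * (win_mean (2 * r\<^sup>2) - real (2 * r\<^sup>2) * \<mu>) + ?\<alpha> r * (real (2 * r\<^sup>2) * \<mu>)) \<longlonglongrightarrow> 0 + \<mu>"
      by (rule tendsto_add)
    then show ?thesis by (simp only: distrib_left[symmetric] diff_add_cancel add_0_left)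
  qed
  ultimately have "(\<lambda>r. ?\<alpha> r * window_var f (2 * r\<^sup>2) - (?\<alpha> r * win_mean (2 * r\<^sup>2))\<^sup>2 / offspring_var) \<longlonglongrightarrow> window_rate - \<mu>\<^sup>2 / offspring_var"
    using offspring_var_pos by (intro tendsto_intros) auto
  then show ?thesis by (simp add: block_rate_def[abs_def] Let_def window_rate_def)
qed

text \<open>A quotient of two local limits: the numerator is the Fourier integral with the block
  factor, the denominator the probability of the endpoint, and the factor \<open>llt_const\<close>
  cancels.\<close>

lemma conditioned_block_clt:
  assumes r: "2 \<le> r"
  defines "l \<equiv> 2 * r\<^sup>2" and "N \<equiv> (\<lambda>n. (n - n div r) div (2 * r\<^sup>2))"
  shows "((\<lambda>n. word_mean n (\<lambda>xs. of_bool (walk xs = -1) * cis (s / sqrt (real n) * block_sum (centered_window l) l (N n) xs)) / complex_of_real (walk_prob n (-1)))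
    \<longlongrightarrow> complex_of_real (exp (- s\<^sup>2 / 2 * block_rate r))) (admissible_at_top p)"
proof -
  let ?W = "\<lambda>n. word_mean n (\<lambda>xs. of_bool (walk xs = -1) * cis (s / sqrt (real n) * block_sum (centered_window l) l (N n) xs))"
  let ?J = "\<lambda>n. complex_of_real (sqrt (real n)) * (complex_of_real freq_scale *
      (LINT t:freq_range|lborel. block_char l (s / sqrt (real n)) t ^ N n * step_cf t ^ (n - N n * l) * cis t))"
  have r0: "r > 0" and l0: "l > 0" using r by (auto simp: l_def)
  have Nl: "N n * l \<le> n - n div r" for n unfolding N_def l_def by (rule div_times_less_eq_dividend)
  have Nl': "N n * l \<le> n" for n using Nl[of n] by linarith
  have Nlim: "(\<lambda>n. real (N n) / real n) \<longlonglongrightarrow> (1 - 1 / real r) / real (2 * r\<^sup>2)"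
    unfolding N_def by (rule nat_div_limit[OF diff_div_limit[OF r0]]) (use l0 l_def in simp)
  \<comment> \<open>At least \<open>n div r\<close> letters stay uncovered, and
    \<open>n div r \<ge> n / (2 * r)\<close> once \<open>n \<ge> 2 * r\<close>; this provides the
    constant \<open>2 * r\<close> for the domination.\<close>
  have gap: "real n \<le> (2 * real r) * real (n - N n * l)" if n: "n \<ge> 2 * r" for n
  proof -
    have "n div r \<le> n - N n * l" using Nl[of n] Nl'[of n] div_le_dividend[of n r] by linarith
    then have "2 * r * (n div r) \<le> 2 * r * (n - N n * l)" by (rule mult_le_mono2)
    moreover have "n \<le> 2 * r * (n div r)"
    proof -
      have "n = r * (n div r) + n mod r" by simp
      moreover have "n mod r < r" using r0 by simp
      moreover have "r * 1 \<le> r * (n div r)" using n r0 div_le_mono[of r n r] by (intro mult_le_mono2) simp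
      ultimately show ?thesis by linarith
    qed
    ultimately have "n \<le> 2 * r * (n - N n * l)" by (rule order.trans[rotated])
    then have "real n \<le> real (2 * r * (n - N n * l))" by (simp only: of_nat_le_iff)
    then show ?thesis by (simp only: of_nat_mult of_nat_numeral)
  qed
  have "?J \<longlonglongrightarrow> complex_of_real (llt_const * exp (- s\<^sup>2 / 2 * block_rate r))"
    using block_fourier_limit[OF l0 Nlim Nl' _ gap, where s = s] r0 unfolding block_rate_def Let_def l_def by simp
  then have J: "((\<lambda>n. complex_of_real (sqrt (real n)) * ?W n) \<longlongrightarrow> complex_of_real (llt_const * exp (- s\<^sup>2 / 2 * block_rate r))) (admissible_at_top p)"
  proof (rule tendsto_admissible)
    show "\<forall>\<^sub>F n in sequentially. 0 < size_prob n \<longrightarrow> ?J n = complex_of_real (sqrt (real n)) * ?W n"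
    proof (intro always_eventually allI impI)
      fix n assume "0 < size_prob n"
      from block_sum_fourier[OF span_dvd_of_size_prob[OF this] Nl', of "s / sqrt (real n)"] show "?J n = complex_of_real (sqrt (real n)) * ?W n" by (simp only:)
    qed
  qed
  have Q: "((\<lambda>n. complex_of_real (sqrt (real n) * walk_prob n (-1))) \<longlongrightarrow> complex_of_real llt_const) (admissible_at_top p)"
    by (intro tendsto_of_real walk_prob_limit)
  have "((\<lambda>n. complex_of_real (sqrt (real n)) * ?W n / complex_of_real (sqrt (real n) * walk_prob n (-1)))
      \<longlongrightarrow> complex_of_real (llt_const * exp (- s\<^sup>2 / 2 * block_rate r)) / complex_of_real llt_const) (admissible_at_top p)"
    using llt_const_pos by (intro tendsto_divide J Q) simp
  then show ?thesis
  proof (rule Lim_transform_eventually[THEN tendsto_eq_rhs])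
    show "\<forall>\<^sub>F n in admissible_at_top p. complex_of_real (sqrt (real n)) * ?W n / complex_of_real (sqrt (real n) * walk_prob n (-1)) = ?W n / complex_of_real (walk_prob n (-1))"
      unfolding eventually_admissible using eventually_gt_at_top[of 0] by eventually_elim simp
  qed (use llt_const_pos in simp)
qed

text \<open>The order of limits matters: the block error is of order \<open>1 / sqrt r\<close>
  uniformly in large \<open>n\<close>, so \<open>r\<close> is fixed first and \<open>n\<close> tends
  to infinity afterwards.\<close>

lemma finite_support_clt:
  "((\<lambda>n. cond_char n (\<lambda>t. s / sqrt (real n) * (additive_functional f t - real n * \<mu>)))
     \<longlongrightarrow> complex_of_real (exp (- s\<^sup>2 / 2 * asymptotic_var f))) (admissible_at_top p)"
proof (rule tendstoI)
  fix e :: real assume e: "e > 0"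
  obtain c1 where c1: "\<And>j. \<bar>win_mean j - real j * \<mu>\<bar> \<le> c1" using exists_window_mean_bound by blast
  obtain c2 where c2: "0 \<le> c2" "\<And>j. window_var f j \<le> c2 * (real j + 1)" using exists_window_var_bound by blast
  let ?A = "complex_of_real (exp (- s\<^sup>2 / 2 * asymptotic_var f))"
  let ?G = "\<lambda>r. complex_of_real (exp (- s\<^sup>2 / 2 * block_rate r))"
  define C0 where "C0 = 4 * real M * \<beta> + 2 * c1"
  define C1 where "C1 = 4 * real M * \<beta> * K\<^sup>2 + 2 * K\<^sup>2 * sqrt c2"
  have "?G \<longlonglongrightarrow> ?A" by (intro tendsto_intros block_rate_limit)
  then have "\<forall>\<^sub>F r in sequentially. dist (?G r) ?A < e / 4" using e by (intro tendstoD) auto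
  moreover have "\<forall>\<^sub>F r in sequentially. \<bar>s\<bar> * (C1 / sqrt (real r)) < e / 4"
  proof -
    have "(\<lambda>r. \<bar>s\<bar> * (C1 / sqrt (real r))) \<longlonglongrightarrow> 0" by real_asymp
    then show ?thesis using e by (intro order_tendstoD) auto
  qed
  ultimately have "\<forall>\<^sub>F r in sequentially. dist (?G r) ?A < e / 4 \<and> \<bar>s\<bar> * (C1 / sqrt (real r)) < e / 4 \<and> max M 4 \<le> r"
    using eventually_ge_at_top[of "max M 4"] by eventually_elim simp
  then obtain r where r: "dist (?G r) ?A < e / 4" "\<bar>s\<bar> * (C1 / sqrt (real r)) < e / 4" "M \<le> r" "4 \<le> r"
    by (auto simp: eventually_sequentially)
  let ?B = "\<lambda>n. word_mean n (\<lambda>xs. of_bool (walk xs = -1) * cis (s / sqrt (real n) * block_sum (centered_window (2 * r\<^sup>2)) (2 * r\<^sup>2) ((n - n div r) div (2 * r\<^sup>2)) xs)) / complex_of_real (walk_prob n (-1))"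
  let ?c = "\<lambda>n. cond_char n (\<lambda>t. s / sqrt (real n) * (additive_functional f t - real n * \<mu>))"
  have B: "\<forall>\<^sub>F n in admissible_at_top p. dist (?B n) (?G r) < e / 4"
    using conditioned_block_clt[of r s] r(4) e by (intro tendstoD) auto
  have small: "\<forall>\<^sub>F n in sequentially. \<bar>s\<bar> * (C0 / sqrt (real n)) < e / 4"
  proof -
    have "(\<lambda>n. \<bar>s\<bar> * (C0 / sqrt (real n))) \<longlonglongrightarrow> 0" by real_asymp
    then show ?thesis using e by (intro order_tendstoD) auto
  qed
  have "\<forall>\<^sub>F n in sequentially. 0 < size_prob n \<longrightarrow> dist (?c n) ?A < e"
    using B[unfolded eventually_admissible] small eventually_ge_at_top[of "4 * r * (2 * r\<^sup>2 + 1)"]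
  proof eventually_elim
    case (elim n)
    show ?case
    proof
      assume n: "0 < size_prob n"
      have "dist (?c n) (?B n) \<le> \<bar>s\<bar> * (C0 / sqrt (real n) + C1 / sqrt (real r))"
        unfolding dist_norm C0_def C1_def by (rule cond_char_block_error[OF r(4,3) elim(3) n c1 c2])
      then have "dist (?c n) (?B n) < e / 2" using elim(2) r(2) unfolding distrib_left by linarith
      moreover have "dist (?B n) (?G r) < e / 4" using elim(1) n by blast
      ultimately show "dist (?c n) ?A < e"
        using r(1) dist_triangle[of "?c n" ?A "?B n"] dist_triangle[of "?B n" ?A "?G r"] by linarith
    qed
  qed
  then show "\<forall>\<^sub>F n in admissible_at_top p. dist (?c n) ?A < e" unfolding eventually_admissible .
qed

end

section \<open>Asymptotic normality in general\<close>

context critical_offspring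
begin

lemma exists_finite_support_trunc: "\<exists>\<beta>. finite_support (trunc M f) M \<beta>"
proof -
  let ?S = "\<Union>k\<le>M. trees k"
  have "\<bar>trunc M f t\<bar> \<le> (\<Sum>t\<in>?S. \<bar>f t\<bar>)" for t
  proof (cases "num_nodes t \<le> M")
    case True
    then have "t \<in> ?S" by (simp add: trees_def)
    then have "\<bar>f t\<bar> \<le> (\<Sum>t\<in>?S. \<bar>f t\<bar>)" by (intro member_le_sum) auto
    then show ?thesis using True by (simp add: trunc_def)
  qed (simp add: trunc_def sum_nonneg)
  then have "finite_support (trunc M f) M (\<Sum>t\<in>?S. \<bar>f t\<bar>)"
    by unfold_locales (auto simp: trunc_def)
  then show ?thesis by blast
qed

lemma cond_sd_uminus: "cond_sd n (\<lambda>t. - g t) = cond_sd n g"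
proof -
  have "cond_norm n (\<lambda>t. -1 * (g t - cond_mean n g)) = cond_norm n (\<lambda>t. g t - cond_mean n g)"
    by (subst cond_norm_cmult) simp
  moreover have "cond_mean n (\<lambda>t. - g t) = - cond_mean n g"
    using cond_mean_cmult[of n "-1" g] by simp
  ultimately show ?thesis by (simp add: cond_sd_def algebra_simps)
qed

lemma char_conditioned:
  assumes n: "0 < size_prob n"
  shows "char (distr (conditioned_galton_watson p n) borel X) s = cond_char n (\<lambda>t. s * X t)"
proof -
  let ?q = "cond_pmf gw (trees n)"
  note q = conditioned_eq_cond_pmf[OF n]
  have "char (distr (conditioned_galton_watson p n) borel X) s = (\<integral>t. cis (s * X t) \<partial>?q)"
    unfolding char_def q(1) by (subst integral_distr) (auto simp: cis_conv_exp)
  also have "\<dots> = (\<Sum>t\<in>trees n. pmf ?q t *\<^sub>R cis (s * X t))"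
    by (rule integral_measure_pmf) (use q(2) in auto)
  also have "\<dots> = (\<Sum>t\<in>trees n. complex_of_real (tree_weight p t / size_prob n) * cis (s * X t))"
    by (intro sum.cong refl) (simp only: q(3) scaleR_conv_of_real)
  also have "\<dots> = cond_char n (\<lambda>t. s * X t)"
    by (simp add: cond_char_def sum_divide_distrib)
  finally show ?thesis .
qed

lemma mean_conditioned: "0 < size_prob n \<Longrightarrow> integral\<^sup>L (conditioned_galton_watson p n) h = cond_mean n h"
  by (simp add: expectation_conditioned cond_mean_def)

lemma variance_conditioned:
  assumes "0 < size_prob n"
  shows "prob_space.variance (conditioned_galton_watson p n) h = (cond_sd n h)\<^sup>2"
  unfolding cond_sd_def cond_norm_square mean_conditioned[OF assms] ..

end

context small_functional
begin

text \<open>The deviation of the tail is small uniformly in \<open>n\<close>. Its mean is handled by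
  the mean asymptotics for the tail functional, which give \<open>o(sqrt n)\<close> around the
  centering for each fixed \<open>M\<close>.\<close>

lemma finite_support_approximation:
  assumes e: "e > 0"
  shows "\<forall>\<^sub>F M in sequentially. \<forall>\<^sub>F n in admissible_at_top p. cond_sd n (additive_functional (tail M f)) \<le> e * sqrt (real n) \<and>
    cond_norm n (\<lambda>t. additive_functional (tail M f) t - real n * measure_pmf.expectation gw (tail M f)) \<le> 2 * e * sqrt (real n)"
  using tail_sd_small[OF e]
proof eventually_elim
  case (elim M)
  let ?T = "additive_functional (tail M f)" and ?\<mu>T = "measure_pmf.expectation gw (tail M f)"
  have "(\<lambda>k. cond_norm k (tail M f)) \<longlonglongrightarrow> 0"
    by (rule Lim_null_comparison[OF _ cond_norm_limit]) (simp add: cond_norm_tail)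
  then have "(\<lambda>k. cond_mean k (tail M f)) \<longlonglongrightarrow> 0"
    by (rule Lim_null_comparison[rotated]) (simp add: abs_cond_mean_le)
  then have "((\<lambda>k. cond_mean k (tail M f)) \<longlongrightarrow> 0) (admissible_at_top p)"
    by (rule tendsto_admissible) simp
  from mean_asymptotics[OF integrable_tail[OF integrable_f] this]
  have "\<forall>\<^sub>F n in admissible_at_top p. \<bar>(cond_mean n ?T - real n * ?\<mu>T) / sqrt (real n)\<bar> < e"
    using e unfolding tendsto_iff by (simp add: dist_norm)
  then have "\<forall>\<^sub>F n in sequentially. 0 < size_prob n \<longrightarrow> cond_sd n ?T \<le> e * sqrt (real n) \<and>
     cond_norm n (\<lambda>t. ?T t - real n * ?\<mu>T) \<le> 2 * e * sqrt (real n)"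
    unfolding eventually_admissible using eventually_gt_at_top[of 0]
  proof eventually_elim
    case (elim n)
    show ?case
    proof
      assume "0 < size_prob n"
      then have "\<bar>cond_mean n ?T - real n * ?\<mu>T\<bar> \<le> e * sqrt (real n)"
        using elim by (simp add: abs_divide pos_divide_less_eq)
      then show "cond_sd n ?T \<le> e * sqrt (real n) \<and> cond_norm n (\<lambda>t. ?T t - real n * ?\<mu>T) \<le> 2 * e * sqrt (real n)"
        using \<open>\<forall>n. cond_sd n ?T \<le> e * sqrt (real n)\<close>[rule_format, of n] cond_norm_shift_le[of n ?T "real n * ?\<mu>T"] by linarith
    qed
  qed
  then show ?case unfolding eventually_admissible .
qed

lemma cond_char_limit:
  "((\<lambda>n. cond_char n (\<lambda>t. s / sqrt (real n) * (additive_functional f t - real n * \<mu>)))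
     \<longlongrightarrow> complex_of_real (exp (- s\<^sup>2 / 2 * asymptotic_var f))) (admissible_at_top p)"
proof (rule tendstoI)
  fix e :: real assume e: "e > 0"
  let ?A = "complex_of_real (exp (- s\<^sup>2 / 2 * asymptotic_var f))"
  let ?G = "\<lambda>M. complex_of_real (exp (- s\<^sup>2 / 2 * asymptotic_var (trunc M f)))"
  \<comment> \<open>Chosen so that \<open>\<bar>s\<bar> * (2 * d) \<le> e / 4\<close>; the summand 1
    avoids a division by 0 at \<open>s = 0\<close>.\<close>
  define d where "d = e / (8 * (\<bar>s\<bar> + 1))"
  have d: "d > 0" "\<bar>s\<bar> * (2 * d) \<le> e / 4" using e by (auto simp: d_def field_simps)
  have "?G \<longlonglongrightarrow> ?A" by (intro tendsto_intros asymptotic_var_trunc_limit)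
  then have "\<forall>\<^sub>F M in sequentially. dist (?G M) ?A < e / 4" using e by (intro tendstoD) auto
  with finite_support_approximation[OF d(1)]
  have "\<forall>\<^sub>F M in sequentially. dist (?G M) ?A < e / 4 \<and> (\<forall>\<^sub>F n in admissible_at_top p.
     cond_norm n (\<lambda>t. additive_functional (tail M f) t - real n * measure_pmf.expectation gw (tail M f)) \<le> 2 * d * sqrt (real n))"
    by eventually_elim (auto elim: eventually_mono)
  then obtain M where M: "dist (?G M) ?A < e / 4" "\<forall>\<^sub>F n in admissible_at_top p.
     cond_norm n (\<lambda>t. additive_functional (tail M f) t - real n * measure_pmf.expectation gw (tail M f)) \<le> 2 * d * sqrt (real n)"
    by (auto simp: eventually_sequentially)
  let ?\<mu>M = "measure_pmf.expectation gw (trunc M f)" and ?\<mu>T = "measure_pmf.expectation gw (tail M f)"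
  obtain \<beta> where "finite_support (trunc M f) M \<beta>" using exists_finite_support_trunc by blast
  then interpret T: bounded_functional p K "trunc M f" M \<beta>
    by (intro bounded_functional.intro walk_bounds_axioms)
  let ?c = "\<lambda>n. cond_char n (\<lambda>t. s / sqrt (real n) * (additive_functional f t - real n * \<mu>))"
  let ?B = "\<lambda>n. cond_char n (\<lambda>t. s / sqrt (real n) * (additive_functional (trunc M f) t - real n * ?\<mu>M))"
  have "\<forall>\<^sub>F n in admissible_at_top p. dist (?B n) (?G M) < e / 4"
    using e by (intro tendstoD[OF T.finite_support_clt]) simp
  with M(2) have "\<forall>\<^sub>F n in sequentially. 0 < size_prob n \<longrightarrow> dist (?c n) ?A < e"
    unfolding eventually_admissible using eventually_gt_at_top[of 0]
  proof eventually_elim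
    case (elim n)
    show ?case
    proof
      assume n: "0 < size_prob n"
      let ?g = "\<lambda>t. additive_functional (tail M f) t - real n * ?\<mu>T"
      have diff: "s / sqrt (real n) * (additive_functional f t - real n * \<mu>)
          - s / sqrt (real n) * (additive_functional (trunc M f) t - real n * ?\<mu>M) = s / sqrt (real n) * ?g t" for t
        unfolding additive_functional_trunc_add_tail[of f t M] expectation_trunc_tail[OF integrable_f, of M]
        by (simp add: algebra_simps diff_divide_distrib add_divide_distrib)
      have "dist (?c n) (?B n) \<le> cond_mean n (\<lambda>t. \<bar>s / sqrt (real n) * ?g t\<bar>)"
        unfolding dist_norm by (rule order.trans[OF cmod_cond_char_diff_le[OF n]]) (simp only: diff order.refl)
      also have "\<dots> \<le> cond_norm n (\<lambda>t. \<bar>s / sqrt (real n) * ?g t\<bar>)"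
        using abs_cond_mean_le abs_ge_self by (rule order.trans[rotated])
      also have "\<dots> \<le> cond_norm n (\<lambda>t. s / sqrt (real n) * ?g t)"
        by (rule cond_norm_mono) simp
      also have "\<dots> = \<bar>s\<bar> / sqrt (real n) * cond_norm n ?g"
        unfolding cond_norm_cmult by (simp add: abs_divide)
      also have "\<dots> \<le> \<bar>s\<bar> / sqrt (real n) * (2 * d * sqrt (real n))"
        using elim n by (intro mult_left_mono) auto
      also have "\<dots> = \<bar>s\<bar> * (2 * d)" using elim by simp
      finally have "dist (?c n) (?B n) \<le> e / 4" using d(2) by linarith
      moreover have "dist (?B n) (?G M) < e / 4" using elim n by blast
      ultimately show "dist (?c n) ?A < e"
        using M(1) e dist_triangle[of "?c n" ?A "?B n"] dist_triangle[of "?B n" ?A "?G M"] by linarith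
    qed
  qed
  then show "\<forall>\<^sub>F n in admissible_at_top p. dist (?c n) ?A < e" unfolding eventually_admissible .
qed

text \<open>For truncated functionals the value is a limit of variances along a nontrivial filter;
  the truncation is then removed.\<close>

lemma asymptotic_var_nonneg: "0 \<le> asymptotic_var f"
proof -
  have "0 \<le> asymptotic_var (trunc M f)" for M
  proof (rule tendsto_lowerbound[OF finite_support_var_limit[of M] _ admissible_at_top_neq_bot])
    show "\<forall>\<^sub>F n in admissible_at_top p. 0 \<le> (cond_sd n (additive_functional (trunc M f)))\<^sup>2 / real n" by simp
  qed (simp add: trunc_def)
  then show ?thesis using asymptotic_var_trunc_limit by (intro LIMSEQ_le_const) auto
qed

text \<open>The limit is taken for standard deviations, because these obey the triangle inequality
  and so change by at most the deviation of the tail when \<open>f\<close> is truncated. Squaring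
  comes last.\<close>

lemma variance_limit: "((\<lambda>n. (cond_sd n (additive_functional f))\<^sup>2 / real n) \<longlongrightarrow> asymptotic_var f) (admissible_at_top p)"
proof -
  let ?v = "\<lambda>n. cond_sd n (additive_functional f) / sqrt (real n)"
  let ?u = "\<lambda>M n. cond_sd n (additive_functional (trunc M f)) / sqrt (real n)"
  have "(?v \<longlongrightarrow> sqrt (asymptotic_var f)) (admissible_at_top p)"
  proof (rule tendstoI)
    fix e :: real assume e: "e > 0"
    have "(\<lambda>M. sqrt (asymptotic_var (trunc M f))) \<longlonglongrightarrow> sqrt (asymptotic_var f)"
      by (intro tendsto_real_sqrt asymptotic_var_trunc_limit)
    then have "\<forall>\<^sub>F M in sequentially. dist (sqrt (asymptotic_var (trunc M f))) (sqrt (asymptotic_var f)) < e / 3"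
      using e by (intro tendstoD) auto
    with finite_support_approximation[of "e / 3"] e
    have "\<forall>\<^sub>F M in sequentially. dist (sqrt (asymptotic_var (trunc M f))) (sqrt (asymptotic_var f)) < e / 3 \<and>
        (\<forall>\<^sub>F n in admissible_at_top p. cond_sd n (additive_functional (tail M f)) \<le> e / 3 * sqrt (real n))"
      by (auto elim: eventually_elim2 eventually_mono)
    then obtain M where M: "dist (sqrt (asymptotic_var (trunc M f))) (sqrt (asymptotic_var f)) < e / 3"
        "\<forall>\<^sub>F n in admissible_at_top p. cond_sd n (additive_functional (tail M f)) \<le> e / 3 * sqrt (real n)"
      by (auto simp: eventually_sequentially)
    have "((\<lambda>n. sqrt ((cond_sd n (additive_functional (trunc M f)))\<^sup>2 / real n)) \<longlongrightarrow> sqrt (asymptotic_var (trunc M f))) (admissible_at_top p)"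
      by (intro tendsto_real_sqrt finite_support_var_limit[of M]) (simp add: trunc_def)
    then have "(?u M \<longlongrightarrow> sqrt (asymptotic_var (trunc M f))) (admissible_at_top p)" by (simp add: real_sqrt_divide)
    then have "\<forall>\<^sub>F n in admissible_at_top p. dist (?u M n) (sqrt (asymptotic_var (trunc M f))) < e / 3"
      using e by (intro tendstoD) auto
    with M(2) have "\<forall>\<^sub>F n in sequentially. 0 < size_prob n \<longrightarrow> dist (?v n) (sqrt (asymptotic_var f)) < e"
      unfolding eventually_admissible using eventually_gt_at_top[of 0]
    proof eventually_elim
      case (elim n)
      show ?case
      proof
        assume n: "0 < size_prob n"
        let ?F = "additive_functional f" and ?S = "additive_functional (trunc M f)" and ?T = "additive_functional (tail M f)"
        have F: "?F = (\<lambda>t. ?S t + ?T t)" and S: "?S = (\<lambda>t. ?F t + - ?T t)"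
          by (auto simp: additive_functional_trunc_add_tail[of f _ M])
        have "cond_sd n ?F \<le> cond_sd n ?S + cond_sd n ?T"
          by (subst F) (rule cond_sd_triangle)
        moreover have "cond_sd n ?S \<le> cond_sd n ?F + cond_sd n ?T"
          by (subst S) (rule order.trans[OF cond_sd_triangle], simp add: cond_sd_uminus)
        moreover have "cond_sd n ?T \<le> e / 3 * sqrt (real n)" using elim n by blast
        ultimately have "\<bar>cond_sd n ?F - cond_sd n ?S\<bar> \<le> e / 3 * sqrt (real n)" by linarith
        then have "\<bar>cond_sd n ?F - cond_sd n ?S\<bar> / sqrt (real n) \<le> e / 3" using elim by (simp add: pos_divide_le_eq)
        then have "dist (?v n) (?u M n) \<le> e / 3" by (simp add: dist_real_def abs_divide flip: diff_divide_distrib)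
        moreover have "dist (?u M n) (sqrt (asymptotic_var (trunc M f))) < e / 3" using elim n by blast
        ultimately show "dist (?v n) (sqrt (asymptotic_var f)) < e"
          using M(1) dist_triangle[of "?v n" "sqrt (asymptotic_var f)" "?u M n"]
            dist_triangle[of "?u M n" "sqrt (asymptotic_var f)" "sqrt (asymptotic_var (trunc M f))"] by linarith
      qed
    qed
    then show "\<forall>\<^sub>F n in admissible_at_top p. dist (?v n) (sqrt (asymptotic_var f)) < e" unfolding eventually_admissible .
  qed
  then have "((\<lambda>n. (?v n)\<^sup>2) \<longlongrightarrow> (sqrt (asymptotic_var f))\<^sup>2) (admissible_at_top p)" by (rule tendsto_power)
  then show ?thesis using asymptotic_var_nonneg by (simp add: power_divide)
qed

end

lemma real_distribution_normal_distribution: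
  assumes "0 \<le> v" shows "real_distribution (normal_distribution m v)"
proof (cases "v = 0")
  case True
  then show ?thesis
    by (auto simp: normal_distribution_def real_distribution_def real_distribution_axioms_def intro!: prob_space_return)
next
  case False
  then show ?thesis using assms prob_space_normal_density[of "sqrt v" m]
    by (auto simp: normal_distribution_def real_distribution_def real_distribution_axioms_def)
qed

lemma char_normal_distribution:
  assumes "0 \<le> v" shows "char (normal_distribution 0 v) s = complex_of_real (exp (- s\<^sup>2 / 2 * v))"
proof (cases "v = 0")
  case True
  then show ?thesis by (simp add: normal_distribution_def char_def integral_return)
next
  case False
  then have v: "0 < sqrt v" using assms by simp
  interpret N: real_distribution std_normal_distribution by (rule real_dist_normal_dist)
  have "distributed std_normal_distribution lborel (\<lambda>x. x) std_normal_density"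
    by (auto simp: distributed_def distr_id2)
  from N.normal_density_affine[OF this _ , of "sqrt v" 0] v
  have "distributed std_normal_distribution lborel (\<lambda>x. sqrt v * x) (normal_density 0 (sqrt v))" by simp
  then have "distr std_normal_distribution lborel (\<lambda>x. sqrt v * x) = normal_distribution 0 v"
    using v by (simp add: distributed_def normal_distribution_def)
  then have "char (normal_distribution 0 v) s = (CLINT y|distr std_normal_distribution lborel (\<lambda>x. sqrt v * x). iexp (s * y))"
    by (simp add: char_def)
  also have "\<dots> = char std_normal_distribution (s * sqrt v)"
    unfolding char_def by (subst integral_distr) (auto simp: mult.assoc)
  also have "\<dots> = complex_of_real (exp (- (s * sqrt v)\<^sup>2 / 2))" by (simp add: char_std_normal_distribution)
  also have "- (s * sqrt v)\<^sup>2 / 2 = - s\<^sup>2 / 2 * v" using assms by (simp add: power_mult_distrib)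
  finally show ?thesis .
qed

lemma (in critical_offspring) converges_in_distribution_charI:
  assumes N: "real_distribution N"
    and char: "\<And>s. ((\<lambda>n. cond_char n (\<lambda>t. s * X n t)) \<longlongrightarrow> char N s) (admissible_at_top p)"
  shows "converges_in_distribution (\<lambda>n. distr (conditioned_galton_watson p n) borel (X n)) N (admissible_at_top p)"
proof -
  let ?L = "\<lambda>n. distr (conditioned_galton_watson p n) borel (X n)"
  \<comment> \<open>Levy's continuity theorem concerns full sequences of distributions; inadmissible
    indices are filled with the limit law itself.\<close>
  define M where "M n = (if 0 < size_prob n then ?L n else N)" for n
  have "real_distribution (M n)" for n
  proof (cases "0 < size_prob n")
    case True
    have "prob_space (distr (measure_pmf (cond_pmf gw (trees n))) borel (X n))"
      by (rule measure_pmf.prob_space_distr) simp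
    then show ?thesis using True
      by (auto simp: M_def conditioned_eq_cond_pmf(1) real_distribution_def real_distribution_axioms_def)
  qed (simp add: M_def N)
  moreover have "(\<lambda>n. char (M n) s) \<longlonglongrightarrow> char N s" for s
  proof (rule tendstoI)
    fix e :: real assume "e > 0"
    with char[of s] have "\<forall>\<^sub>F n in sequentially. 0 < size_prob n \<longrightarrow> dist (cond_char n (\<lambda>t. s * X n t)) (char N s) < e"
      unfolding tendsto_iff eventually_admissible by blast
    then show "\<forall>\<^sub>F n in sequentially. dist (char (M n) s) (char N s) < e"
      using \<open>e > 0\<close> by (auto simp: M_def char_conditioned elim: eventually_mono)
  qed
  ultimately have W: "weak_conv_m M N" using N by (intro levy_continuity)
  show ?thesis unfolding converges_in_distribution_def
  proof (intro allI impI)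
    fix x assume "isCont (cdf N) x"
    then have "(\<lambda>n. cdf (M n) x) \<longlonglongrightarrow> cdf N x" using W by (auto simp: weak_conv_m_def weak_conv_def)
    then show "((\<lambda>n. cdf (?L n) x) \<longlongrightarrow> cdf N x) (admissible_at_top p)"
      by (rule tendsto_admissible) (simp add: M_def)
  qed
qed

text \<open>Finiteness of \<open>\<gamma>2\<close> is expressed by integrability of the functions
  behind it, since a real-valued integral has a value in any case.\<close>

theorem theorem1p5:
  fixes p :: "nat pmf" and f :: "plane_tree \<Rightarrow> real" and \<sigma>2 \<mu> \<gamma>2 :: real
  assumes mean_offspring: "measure_pmf.expectation p real = 1"
    and finite_variance: "integrable (measure_pmf p) (\<lambda>k. (real k)\<^sup>2)"
    and sigma2_eq: "\<sigma>2 = measure_pmf.variance p real"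
    and sigma2_pos: "0 < \<sigma>2"
    and f_integrable: "integrable (galton_watson p) f"
    and mu_eq: "\<mu> = prob_space.expectation (galton_watson p) f"
    and gamma2_eq: "\<gamma>2 =
        2 * prob_space.expectation (galton_watson p)
              (\<lambda>t. f t * (additive_functional f t - real (num_nodes t) * \<mu>))
        - prob_space.variance (galton_watson p) f - \<mu>\<^sup>2 / \<sigma>2"
  shows
    "(((\<lambda>n. prob_space.expectation (conditioned_galton_watson p n) f) \<longlongrightarrow> 0)
          (admissible_at_top p)
      \<longrightarrow>
      (\<lambda>n. prob_space.expectation (conditioned_galton_watson p n) (additive_functional f)
             - real n * \<mu>)
        \<in> o[admissible_at_top p](\<lambda>n. sqrt (real n)))
    \<and>
    (((\<lambda>n. prob_space.expectation (conditioned_galton_watson p n) (\<lambda>t. (f t)\<^sup>2)) \<longlongrightarrow> 0)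
          (admissible_at_top p)
      \<and> (\<lambda>n. sqrt (prob_space.expectation (conditioned_galton_watson p n) (\<lambda>t. (f t)\<^sup>2))
                / real n)
          summable_on admissible_sizes p
      \<longrightarrow>
      integrable (galton_watson p)
        (\<lambda>t. f t * (additive_functional f t - real (num_nodes t) * \<mu>))
      \<and> integrable (galton_watson p) (\<lambda>t. (f t)\<^sup>2)
      \<and> 0 \<le> \<gamma>2
      \<and> (\<lambda>n. prob_space.variance (conditioned_galton_watson p n) (additive_functional f)
               - real n * \<gamma>2)
          \<in> o[admissible_at_top p](\<lambda>n. real n)
      \<and> converges_in_distribution
          (\<lambda>n. distr (conditioned_galton_watson p n) borel
                 (\<lambda>t. (additive_functional f t - real n * \<mu>) / sqrt (real n)))
          (normal_distribution 0 \<gamma>2)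
          (admissible_at_top p))"
proof -
  interpret critical_offspring p
    using mean_offspring finite_variance sigma2_pos unfolding sigma2_eq by unfold_locales
  obtain K where "walk_bounds p K" using exists_walk_bounds by blast
  then interpret walk_bounds p K .
  let ?F = "additive_functional f" and ?A = "admissible_at_top p"
  have \<mu>: "\<mu> = measure_pmf.expectation gw f" using mu_eq by (simp add: galton_watson_eq_gw)
  have \<sigma>2: "\<sigma>2 = offspring_var" using sigma2_eq by (simp add: offspring_var_def)
  have f: "integrable gw f" using f_integrable by (simp add: galton_watson_eq_gw)
  have ev: "\<forall>\<^sub>F n in ?A. 0 < n \<and> 0 < size_prob n"
    unfolding eventually_admissible using eventually_gt_at_top[of 0] by eventually_elim simp
  have to_cond: "((\<lambda>n. prob_space.expectation (conditioned_galton_watson p n) h) \<longlongrightarrow> 0) ?A \<longleftrightarrow> ((\<lambda>n. cond_mean n h) \<longlongrightarrow> 0) ?A" for h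
    by (intro filterlim_cong refl eventually_mono[OF ev]) (simp add: mean_conditioned)
  show ?thesis
  proof (intro conjI impI)
    assume "((\<lambda>n. prob_space.expectation (conditioned_galton_watson p n) f) \<longlongrightarrow> 0) ?A"
    then have "((\<lambda>n. (cond_mean n ?F - real n * \<mu>) / sqrt (real n)) \<longlongrightarrow> 0) ?A"
      unfolding to_cond \<mu> by (rule mean_asymptotics[OF f])
    then have "((\<lambda>n. (prob_space.expectation (conditioned_galton_watson p n) ?F - real n * \<mu>) / sqrt (real n)) \<longlongrightarrow> 0) ?A"
      by (rule Lim_transform_eventually) (use ev in eventually_elim, simp add: mean_conditioned)
    then show "(\<lambda>n. prob_space.expectation (conditioned_galton_watson p n) ?F - real n * \<mu>) \<in> o[?A](\<lambda>n. sqrt (real n))"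
      by (rule smalloI_tendsto) (use ev in eventually_elim, simp)
  next
    assume H: "((\<lambda>n. prob_space.expectation (conditioned_galton_watson p n) (\<lambda>t. (f t)\<^sup>2)) \<longlongrightarrow> 0) ?A
      \<and> (\<lambda>n. sqrt (prob_space.expectation (conditioned_galton_watson p n) (\<lambda>t. (f t)\<^sup>2)) / real n) summable_on admissible_sizes p"
    have "((\<lambda>n. cond_norm n f) \<longlongrightarrow> sqrt 0) ?A"
      unfolding cond_norm_eq by (intro tendsto_real_sqrt) (use H in \<open>simp only: to_cond\<close>)
    then have lim: "(\<lambda>n. cond_norm n f) \<longlonglongrightarrow> 0"
      by (intro tendsto_admissible_0) (simp_all add: cond_norm_eq_0)
    \<comment> \<open>At inadmissible sizes \<open>cond_norm\<close> is 0 by default, so the sum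
      over admissible sizes is an ordinary series over all \<open>n\<close>.\<close>
    have "(\<lambda>n. cond_norm n f / real n) summable_on UNIV \<longleftrightarrow>
        (\<lambda>n. sqrt (prob_space.expectation (conditioned_galton_watson p n) (\<lambda>t. (f t)\<^sup>2)) / real n) summable_on admissible_sizes p"
    proof (rule summable_on_cong_neutral)
      fix n assume "n \<in> UNIV - admissible_sizes p"
      then have "size_prob n = 0" using size_prob_nonneg[of n] by (auto simp: admissible_sizes_eq)
      then show "cond_norm n f / real n = 0" by (simp add: cond_norm_eq_0)
    qed (auto simp: admissible_sizes_eq mean_conditioned cond_norm_eq)
    then have "summable (\<lambda>n. cond_norm n f / real n)"
      using H by (intro summable_on_imp_summable) blast
    with lim f interpret small_functional p K f by unfold_locales
    have "prob_space.variance (galton_watson p) f = measure_pmf.expectation gw (\<lambda>t. (f t)\<^sup>2) - \<mu>\<^sup>2"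
      unfolding galton_watson_eq_gw \<mu> by (rule measure_pmf.variance_eq[OF f integrable_square])
    then have \<gamma>2: "\<gamma>2 = asymptotic_var f"
      unfolding gamma2_eq \<mu> \<sigma>2 by (simp add: asymptotic_var_def galton_watson_eq_gw)
    show "integrable (galton_watson p) (\<lambda>t. f t * (?F t - real (num_nodes t) * \<mu>))"
      using integrable_centered by (simp add: galton_watson_eq_gw \<mu>)
    show "integrable (galton_watson p) (\<lambda>t. (f t)\<^sup>2)"
      using integrable_square by (simp add: galton_watson_eq_gw)
    show "0 \<le> \<gamma>2" using asymptotic_var_nonneg by (simp add: \<gamma>2)
    have "((\<lambda>n. (cond_sd n ?F)\<^sup>2 / real n - \<gamma>2) \<longlongrightarrow> 0) ?A"
      using variance_limit unfolding \<gamma>2 by (rule LIM_zero)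
    then have "((\<lambda>n. (prob_space.variance (conditioned_galton_watson p n) ?F - real n * \<gamma>2) / real n) \<longlongrightarrow> 0) ?A"
      by (rule Lim_transform_eventually) (use ev in eventually_elim, simp add: variance_conditioned diff_divide_distrib)
    then show "(\<lambda>n. prob_space.variance (conditioned_galton_watson p n) ?F - real n * \<gamma>2) \<in> o[?A](\<lambda>n. real n)"
      by (rule smalloI_tendsto) (use ev in eventually_elim, simp)
    show "converges_in_distribution
          (\<lambda>n. distr (conditioned_galton_watson p n) borel (\<lambda>t. (?F t - real n * \<mu>) / sqrt (real n)))
          (normal_distribution 0 \<gamma>2) ?A"
    proof (rule converges_in_distribution_charI)
      show "real_distribution (normal_distribution 0 \<gamma>2)"
        by (rule real_distribution_normal_distribution) (simp add: \<gamma>2 asymptotic_var_nonneg)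
      show "((\<lambda>n. cond_char n (\<lambda>t. s * ((?F t - real n * \<mu>) / sqrt (real n)))) \<longlongrightarrow> char (normal_distribution 0 \<gamma>2) s) ?A" for s
        using cond_char_limit[of s] by (simp add: char_normal_distribution \<gamma>2 asymptotic_var_nonneg \<mu>)
    qed
  qed
qed

end
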